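(* Let $g\geq 1$, $n\geq 2$, and let $a=(a_1,\ldots,a_n)$ be nonzero integers with $a_1+\cdots+a_n=0$; put $d=\sum_{i:a_i>0}a_i$ and suppose $d\geq 2$. Let $\mathrm{DR}_{g,a}\subseteq M_{g,n}^{trop}$ be the set of stable marked tropical curves $(\Gamma,p_1,\ldots,p_n)$ for which there exist a tropical modification $\Gamma'$ of $\Gamma$, a tropical curve $\Delta$ of genus $0$ with exactly two legs labelled $0$ and $\infty$, and a finite effective harmonic morphism $\tau:\Gamma'\to\Delta$ such that for every $i$, $\tau$ maps the leg $p_i$ to $0$ with degree $a_i$ if $a_i>0$, and to $\infty$ with degree $-a_i$ if $a_i<0$. Let $\mathrm{PD}_{g,a}\subseteq M_{g,n}^{trop}$ be the set of $(\Gamma,p_1,\ldots,p_n)$ admitting a harmonic function with outgoing slope $-a_i$ along each leg $p_i$. Then $\mathrm{DR}_{g,a}$ is a semilinear subset of $M_{g,n}^{trop}$, contained in $\mathrm{PD}_{g,a}$, of dimension $2g-3+n$.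
   Context: A tropical curve is a connected metric space $\Gamma$ which is the metric realization of a finite connected graph whose edges are closed intervals of positive length and whose legs are half-lines $[0,\infty)$ attached at $0$ (no point at the infinite end), together with a genus function $g:\Gamma\to\mathbb{Z}_{\geq0}$ nonzero at finitely many points; its genus is $b_1(\Gamma)+\sum_x g(x)$. For $x\in\Gamma$, $\mathrm{val}(x)$ is the number of tangent directions at $x$ and $\chi(x)=2-2g(x)-\mathrm{val}(x)$. $\Gamma$ is stable if no point $x$ with $g(x)=0$ has $\mathrm{val}(x)\le1$ and $2g-2+\#\{\text{legs}\}>0$. A tropical modification of $\Gamma$ is a tropical curve obtained by attaching finitely many finite trees (genus zero, finite edges) at points of $\Gamma$; the legs of $\Gamma'$ are those of $\Gamma$. $M_{g,n}^{trop}$ is the moduli space of stable tropical curves of genus $g$ with $n$ labelled legs, a generalized cone complex with one cone $\mathbb{R}_{\geq0}^{E(G)}$ (modulo automorphisms) per combinatorial type $G$ (a stable vertex-weighted graph with $n$ marked legs), coordinates being edge lengths; dimension of a subset is the maximal dimension of its intersections with cones. A subset is semilinear if its preimage in each cone is a finite union of sets defined by finitely many homogeneous $\mathbb{Z}$-linear non-strict inequalities. A morphism $\tau:\Gamma'\to\Gamma''$ of tropical curves is a continuous piecewise-linear map with integer slopes, eventually linear on each leg (a leg mapped eventually to a leg $p$ with slope $a>0$ is said to map to $p$ with degree $a$). It is harmonic if slopes are nonnegative in the sense that for each $x'\in\Gamma'$ the number $d_\tau(x')=\sum_{h'\mapsto h}\mathrm{slope}(h')$ (sum over tangent directions $h'$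 at $x'$ mapping to a tangent direction $h$ at $\tau(x')$) is independent of $h$; finite if no edge or leg segment is contracted (nonzero slope everywhere); effective if $d_\tau(x')\chi(\tau(x'))-\chi(x')\geq 0$ for every $x'\in\Gamma'$. A harmonic function on $\Gamma$ is a continuous piecewise-linear $f:\Gamma\to\mathbb{R}$ with integer slopes, eventually linear on legs, whose outgoing slopes sum to zero at every point. *)

theory Defs
  imports Complex_Main
begin

section \<open>Tropical curves given by (arbitrary) graph models\<close>

text \<open>A tropical curve is presented by a finite connected graph model: vertices, edges with
endpoints (loops and multiple edges allowed), legs attached at vertices, a genus weight on
vertices and positive edge lengths. Legs are identified with their labels (natural numbers).
Any model (including 2-valent genus 0 vertices) is allowed.\<close>

record tcurve =
  cV :: "nat set"
  cE :: "nat set"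
  cends :: "nat \<Rightarrow> nat \<times> nat"
  cL :: "nat set"
  clegv :: "nat \<Rightarrow> nat"
  cwt :: "nat \<Rightarrow> nat"
  clen :: "nat \<Rightarrow> real"

definition adj :: "tcurve \<Rightarrow> (nat \<times> nat) set" where
  "adj C = {(v, w). \<exists>e\<in>cE C. cends C e = (v, w) \<or> cends C e = (w, v)}"

definition wf_graph :: "tcurve \<Rightarrow> bool" where
  "wf_graph C \<longleftrightarrow> finite (cV C) \<and> finite (cE C) \<and> finite (cL C) \<and> cV C \<noteq> {} \<and>
     (\<forall>e\<in>cE C. fst (cends C e) \<in> cV C \<and> snd (cends C e) \<in> cV C) \<and>
     (\<forall>l\<in>cL C. clegv C l \<in> cV C) \<and>
     (\<forall>v\<in>cV C. \<forall>w\<in>cV C. (v, w) \<in> (adj C)\<^sup>*)"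

definition is_curve :: "tcurve \<Rightarrow> bool" where
  "is_curve C \<longleftrightarrow> wf_graph C \<and> (\<forall>e\<in>cE C. 0 < clen C e)"

text \<open>Genus = first Betti number + total vertex weight (for connected models).\<close>
definition tgenus :: "tcurve \<Rightarrow> int" where
  "tgenus C = int (card (cE C)) - int (card (cV C)) + 1 + (\<Sum>v\<in>cV C. int (cwt C v))"

text \<open>Points of the metric realization: vertices, interior points of edges (parameter in
the open interval (0, length)), points of legs (parameter > 0; no point at infinity).\<close>
datatype pt = PV nat | PE nat real | PLg nat real

datatype seg = SE nat | SL nat

definition pts :: "tcurve \<Rightarrow> pt set" where
  "pts C = PV ` cV C \<union> {PE e t | e t. e \<in> cE C \<and> 0 < t \<and> t < clen C e}
            \<union> {PLg l t | l t. l \<in> cL C \<and> 0 < t}"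

definition segs :: "tcurve \<Rightarrow> seg set" where
  "segs C = SE ` cE C \<union> SL ` cL C"

definition seg_dom :: "tcurve \<Rightarrow> seg \<Rightarrow> real \<Rightarrow> bool" where
  "seg_dom C s t = (case s of SE e \<Rightarrow> 0 \<le> t \<and> t \<le> clen C e | SL l \<Rightarrow> 0 \<le> t)"

text \<open>The point at parameter t of a closed edge segment / leg.\<close>
definition pos :: "tcurve \<Rightarrow> seg \<Rightarrow> real \<Rightarrow> pt" where
  "pos C s t = (case s of
      SE e \<Rightarrow> (if t = 0 then PV (fst (cends C e)) else if t = clen C e then PV (snd (cends C e)) else PE e t)
    | SL l \<Rightarrow> (if t = 0 then PV (clegv C l) else PLg l t))"

text \<open>A tangent direction is (segment, base parameter, True = increasing / False = decreasing
parameter). Each tangent direction at a point has exactly one such representation.\<close>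
type_synonym dir = "seg \<times> real \<times> bool"

definition dirs :: "tcurve \<Rightarrow> dir set" where
  "dirs C = {(s, t, \<sigma>). s \<in> segs C \<and> seg_dom C s t \<and> (\<not> \<sigma> \<longrightarrow> 0 < t) \<and>
              (\<sigma> \<longrightarrow> (case s of SE e \<Rightarrow> t < clen C e | SL l \<Rightarrow> True))}"

definition dir_at :: "tcurve \<Rightarrow> pt \<Rightarrow> dir set" where
  "dir_at C x = {h \<in> dirs C. pos C (fst h) (fst (snd h)) = x}"

definition val :: "tcurve \<Rightarrow> pt \<Rightarrow> nat" where
  "val C x = card (dir_at C x)"

definition gen :: "tcurve \<Rightarrow> pt \<Rightarrow> nat" where
  "gen C x = (case x of PV v \<Rightarrow> cwt C v | _ \<Rightarrow> 0)"

definition chi :: "tcurve \<Rightarrow> pt \<Rightarrow> int" where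
  "chi C x = 2 - 2 * int (gen C x) - int (val C x)"

definition mv :: "bool \<Rightarrow> real \<Rightarrow> real \<Rightarrow> real" where
  "mv \<sigma> t \<delta> = (if \<sigma> then t + \<delta> else t - \<delta>)"

section \<open>Harmonic functions\<close>

text \<open>f has outgoing (integer) slope k along the direction h (germ is linear).\<close>
definition fgerm :: "tcurve \<Rightarrow> (pt \<Rightarrow> real) \<Rightarrow> dir \<Rightarrow> int \<Rightarrow> bool" where
  "fgerm C f h k = (case h of (s, t, \<sigma>) \<Rightarrow>
     \<exists>\<epsilon>>0. \<forall>\<delta>. 0 \<le> \<delta> \<and> \<delta> \<le> \<epsilon> \<longrightarrow>
        seg_dom C s (mv \<sigma> t \<delta>) \<and> f (pos C s (mv \<sigma> t \<delta>)) = f (pos C s t) + of_int k * \<delta>)"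

definition fun_eventually_lin :: "tcurve \<Rightarrow> (pt \<Rightarrow> real) \<Rightarrow> nat \<Rightarrow> int \<Rightarrow> bool" where
  "fun_eventually_lin C f l k \<longleftrightarrow> (\<exists>T>0. \<exists>c. \<forall>t\<ge>T. f (PLg l t) = of_int k * t + c)"

text \<open>Continuous piecewise linear function with integer slopes (linear germs in every
direction at every point, which by compactness gives finitely many pieces on each edge),
eventually linear on legs, outgoing slopes summing to zero at every point.\<close>
definition harmonic_fun :: "tcurve \<Rightarrow> (pt \<Rightarrow> real) \<Rightarrow> bool" where
  "harmonic_fun C f \<longleftrightarrow> (\<exists>sl :: dir \<Rightarrow> int.
     (\<forall>h\<in>dirs C. fgerm C f h (sl h)) \<and>
     (\<forall>x\<in>pts C. (\<Sum>h\<in>dir_at C x. sl h) = 0) \<and>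
     (\<forall>l\<in>cL C. \<exists>k. fun_eventually_lin C f l k))"

section \<open>Morphisms\<close>

text \<open>tau maps the direction h linearly onto the direction h' with slope k > 0.\<close>
definition mgerm :: "tcurve \<Rightarrow> tcurve \<Rightarrow> (pt \<Rightarrow> pt) \<Rightarrow> dir \<Rightarrow> dir \<Rightarrow> nat \<Rightarrow> bool" where
  "mgerm C1 C2 \<tau> h h' k = (case h of (s, t, \<sigma>) \<Rightarrow> case h' of (s', t', \<sigma>') \<Rightarrow>
     0 < k \<and> (\<exists>\<epsilon>>0. \<forall>\<delta>. 0 \<le> \<delta> \<and> \<delta> \<le> \<epsilon> \<longrightarrow>
        seg_dom C1 s (mv \<sigma> t \<delta>) \<and> seg_dom C2 s' (mv \<sigma>' t' (real k * \<delta>)) \<and>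
        \<tau> (pos C1 s (mv \<sigma> t \<delta>)) = pos C2 s' (mv \<sigma>' t' (real k * \<delta>))))"

text \<open>tau maps leg l eventually linearly to leg l' with degree k > 0.\<close>
definition mleg :: "tcurve \<Rightarrow> tcurve \<Rightarrow> (pt \<Rightarrow> pt) \<Rightarrow> nat \<Rightarrow> nat \<Rightarrow> nat \<Rightarrow> bool" where
  "mleg C1 C2 \<tau> l l' k \<longleftrightarrow> 0 < k \<and> (\<exists>T>0. \<exists>c. \<forall>t\<ge>T.
       0 < real k * t + c \<and> \<tau> (PLg l t) = PLg l' (real k * t + c))"

text \<open>Finite harmonic morphism data: continuous PL map with integer slopes, nonzero slope in
every direction (finite), eventually linear on legs (mapping legs to legs), img/sl are the
induced map on tangent directions and the slopes, d is the local degree d_tau.\<close>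
definition fin_harm :: "tcurve \<Rightarrow> tcurve \<Rightarrow> (pt \<Rightarrow> pt) \<Rightarrow> (dir \<Rightarrow> dir) \<Rightarrow> (dir \<Rightarrow> nat)
    \<Rightarrow> (pt \<Rightarrow> nat) \<Rightarrow> bool" where
  "fin_harm C1 C2 \<tau> img sl d \<longleftrightarrow>
     (\<forall>x\<in>pts C1. \<tau> x \<in> pts C2) \<and>
     (\<forall>h\<in>dirs C1. img h \<in> dirs C2 \<and> mgerm C1 C2 \<tau> h (img h) (sl h)) \<and>
     (\<forall>l\<in>cL C1. \<exists>l'\<in>cL C2. \<exists>k. mleg C1 C2 \<tau> l l' k) \<and>
     (\<forall>x\<in>pts C1. \<forall>h'\<in>dir_at C2 (\<tau> x). (\<Sum>h\<in>{h\<in>dir_at C1 x. img h = h'}. sl h) = d x)"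

definition fin_eff_harm :: "tcurve \<Rightarrow> tcurve \<Rightarrow> (pt \<Rightarrow> pt) \<Rightarrow> bool" where
  "fin_eff_harm C1 C2 \<tau> \<longleftrightarrow> (\<exists>img sl d. fin_harm C1 C2 \<tau> img sl d \<and>
      (\<forall>x\<in>pts C1. 0 \<le> int (d x) * chi C2 (\<tau> x) - chi C1 x))"

text \<open>Tropical modification: C' contains an isometric copy of C (injective, slope 1 in every
direction, genus-preserving), has the same legs (leg l of C eventually is leg l of C'), and
the rest of C' has genus 0 and creates no cycles (total genus unchanged), i.e. consists of
finite trees attached at points of C.\<close>
definition modification :: "tcurve \<Rightarrow> tcurve \<Rightarrow> bool" where
  "modification C C' \<longleftrightarrow> is_curve C' \<and> (\<exists>\<iota>.
     (\<forall>x\<in>pts C. \<iota> x \<in> pts C') \<and> inj_on \<iota> (pts C) \<and>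
     (\<forall>x\<in>pts C. gen C' (\<iota> x) = gen C x) \<and>
     (\<forall>h\<in>dirs C. \<exists>h'\<in>dirs C'. mgerm C C' \<iota> h h' 1) \<and>
     cL C' = cL C \<and> (\<forall>l\<in>cL C. mleg C C' \<iota> l l 1) \<and>
     (\<forall>y\<in>pts C' - \<iota> ` pts C. gen C' y = 0) \<and>
     tgenus C' = tgenus C)"

section \<open>DR and PD loci\<close>

text \<open>The target Delta has legs 0 (label 0) and 1 (label infinity).\<close>
definition leg_zero :: nat where "leg_zero = 0"
definition leg_inf :: nat where "leg_inf = 1"

definition DR :: "nat \<Rightarrow> (nat \<Rightarrow> int) \<Rightarrow> tcurve \<Rightarrow> bool" where
  "DR n a \<Gamma> \<longleftrightarrow> (\<exists>\<Gamma>' \<Delta> \<tau>. modification \<Gamma> \<Gamma>' \<and> is_curve \<Delta> \<and> tgenus \<Delta> = 0 \<and>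
      cL \<Delta> = {leg_zero, leg_inf} \<and> fin_eff_harm \<Gamma>' \<Delta> \<tau> \<and>
      (\<forall>i\<in>{1..n}. (0 < a i \<longrightarrow> mleg \<Gamma>' \<Delta> \<tau> i leg_zero (nat (a i))) \<and>
                   (a i < 0 \<longrightarrow> mleg \<Gamma>' \<Delta> \<tau> i leg_inf (nat (- a i)))))"

definition PD :: "nat \<Rightarrow> (nat \<Rightarrow> int) \<Rightarrow> tcurve \<Rightarrow> bool" where
  "PD n a \<Gamma> \<longleftrightarrow> (\<exists>f. harmonic_fun \<Gamma> f \<and> (\<forall>i\<in>{1..n}. fun_eventually_lin \<Gamma> f i (- a i)))"

section \<open>The moduli space M_{g,n}^trop as a cone complex\<close>

definition gval :: "tcurve \<Rightarrow> nat \<Rightarrow> nat" where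
  "gval G v = card {e\<in>cE G. fst (cends G e) = v} + card {e\<in>cE G. snd (cends G e) = v}
              + card {l\<in>cL G. clegv G l = v}"

text \<open>Combinatorial types: stable vertex-weighted graphs of genus g with legs labelled 1..n
(edge lengths are ignored).\<close>
definition stable_graph :: "nat \<Rightarrow> nat \<Rightarrow> tcurve \<Rightarrow> bool" where
  "stable_graph g n G \<longleftrightarrow> wf_graph G \<and> cL G = {1..n} \<and> tgenus G = int g \<and>
     (\<forall>v\<in>cV G. 3 \<le> 2 * cwt G v + gval G v)"

definition cone :: "tcurve \<Rightarrow> (nat \<Rightarrow> real) set" where
  "cone G = {ll. (\<forall>e\<in>cE G. 0 \<le> ll e) \<and> (\<forall>e. e \<notin> cE G \<longrightarrow> ll e = 0)}"

text \<open>The tropical curve corresponding to a point of the cone of G: zero-length edges are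
contracted (weights of contracted components increase by their first Betti number).\<close>
definition curve_of :: "tcurve \<Rightarrow> (nat \<Rightarrow> real) \<Rightarrow> tcurve" where
  "curve_of G ll = (let Z = {e\<in>cE G. ll e = 0};
       R = ({(v, w). \<exists>e\<in>Z. cends G e = (v, w) \<or> cends G e = (w, v)})\<^sup>*;
       cls = (\<lambda>v. {w\<in>cV G. (v, w) \<in> R});
       rep = (\<lambda>v. Min (cls v));
       V' = rep ` cV G
     in \<lparr> cV = V', cE = cE G - Z,
          cends = (\<lambda>e. (rep (fst (cends G e)), rep (snd (cends G e)))),
          cL = cL G, clegv = (\<lambda>l. rep (clegv G l)),
          cwt = (\<lambda>w. if w \<in> V' then (\<Sum>v\<in>cls w. cwt G v) + card {e\<in>Z. fst (cends G e) \<in> cls w}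
                                       + 1 - card (cls w) else 0),
          clen = ll \<rparr>)"

definition preimage_in :: "tcurve \<Rightarrow> (tcurve \<Rightarrow> bool) \<Rightarrow> (nat \<Rightarrow> real) set" where
  "preimage_in G P = {ll\<in>cone G. P (curve_of G ll)}"

text \<open>Finite union of sets cut out by finitely many homogeneous integer linear non-strict
inequalities (in the edge-length coordinates of the cone).\<close>
definition semilinear_in :: "tcurve \<Rightarrow> (nat \<Rightarrow> real) set \<Rightarrow> bool" where
  "semilinear_in G S \<longleftrightarrow> (\<exists>F :: (nat \<Rightarrow> int) set set. finite F \<and> (\<forall>A\<in>F. finite A) \<and>
     S = (\<Union>A\<in>F. {ll\<in>cone G. \<forall>\<alpha>\<in>A. 0 \<le> (\<Sum>e\<in>cE G. of_int (\<alpha> e) * ll e)}))"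

definition semilinear_M :: "nat \<Rightarrow> nat \<Rightarrow> (tcurve \<Rightarrow> bool) \<Rightarrow> bool" where
  "semilinear_M g n P \<longleftrightarrow> (\<forall>G. stable_graph g n G \<longrightarrow> semilinear_in G (preimage_in G P))"

text \<open>S has dimension at least k: it contains a k-simplex (k+1 affinely independent points and
their convex hull). For semilinear sets this is the usual dimension.\<close>
definition dim_ge :: "(nat \<Rightarrow> real) set \<Rightarrow> nat \<Rightarrow> bool" where
  "dim_ge S k \<longleftrightarrow> (\<exists>p :: nat \<Rightarrow> nat \<Rightarrow> real.
     (\<forall>c :: nat \<Rightarrow> real. (\<forall>e. (\<Sum>i\<in>{1..k}. c i * (p i e - p 0 e)) = 0) \<longrightarrow> (\<forall>i\<in>{1..k}. c i = 0)) \<and>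
     (\<forall>w :: nat \<Rightarrow> real. (\<forall>i\<le>k. 0 \<le> w i) \<and> (\<Sum>i\<le>k. w i) = 1 \<longrightarrow>
        (\<lambda>e. \<Sum>i\<le>k. w i * p i e) \<in> S))"

text \<open>Dimension of a subset of M_{g,n}^trop: maximal dimension of its preimages in the cones.\<close>
definition trop_dim_eq :: "nat \<Rightarrow> nat \<Rightarrow> (tcurve \<Rightarrow> bool) \<Rightarrow> nat \<Rightarrow> bool" where
  "trop_dim_eq g n P N \<longleftrightarrow> (\<exists>G. stable_graph g n G \<and> dim_ge (preimage_in G P) N) \<and>
     (\<forall>G. stable_graph g n G \<longrightarrow> \<not> dim_ge (preimage_in G P) (Suc N))"

end

theory Submission
 imports Defs "HOL-Library.Nat_Bijection"
begin

notation iff (infixr "<->" 25)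

text \<open>
  Let \<open>\<phi> : \<Gamma> \<rightarrow> \<Delta>\<close> be the restriction to \<Gamma> of a finite effective harmonic morphism defined on a modification of
  \<Gamma>, and root the tree \<Delta> at its leg 0. The morphism determines \<phi> up to attached trees, and conversely a
  piecewise linear map \<phi> extends to such a morphism if and only if at each point the slopes over every direction
  away from the root sum to at most the local degree, with equality on the path from 0 to \<infinity>, and a local
  Riemann-Hurwitz defect is nonnegative: missing degree is filled in by copies of branches of \<Delta> with slope 1.
  So the locus is described by combinatorial covers together with the edge lengths of \<Delta>, the edge lengths of
  \<Gamma> being rational linear combinations of the edge lengths of \<Delta>.

  Contracting edges of \<Delta>, one may assume that the vectors of edge lengths of \<Gamma> contributed by the edges of \<Delta>
  are nonzero and distinct. Then at every vertex of \<Delta> the number of children, plus one at the end of the path to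
  \<infinity>, plus the local defect is at least 2; as the total defect is \<open>2g - 2 + n\<close>, there are at most \<open>2g - 3 + n\<close> edges.
  The degree being bounded, only finitely many generating vectors occur, so the locus is a finite union of
  rational cones with at most \<open>2g - 3 + n\<close> generators. Such cones are polyhedral by Fourier-Motzkin elimination. The
  bound on the dimension is attained by a trivalent chain of g cycles mapping to a path.
\<close>

text \<open>The cones must be closed, and this shapes the encoding. When tree edges shrink to length
  0, vertices of the source merge and balance at a single vertex is lost. So a type keeps its graph
  and sets slopes to 0, and balance is demanded on unions of components of the slope-0 part; every
  face of a cone is then described by the same kind of data. Equality on the path from 0 to
  \<infinity> has a topological reason: attached trees carry no legs, so none is entered in a
  direction leading to a leg of \<Delta>. Distinct vectors matter because over an inner tree vertex
  with one child and no defect all points of the source are 2-valent, so that the tree edges above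
  and below it contribute the same vector and can be merged. With d the total positive degree, all
  slopes are at most d; hence the entries of the generators are multiples of 1/d!, which leaves
  finitely many of them. Curves come with arbitrary models, so vertices of source, target and
  subcurve need not correspond; this is why subdivisions and isometries are carried along.\<close>

definition ipt :: "seg => real => pt" where
 "ipt s t = (case s of SE e => PE e t | SL l => PLg l t)"

definition sint :: "tcurve => seg => real => bool" where
 "sint C s t = (case s of SE e => 0 < t & t < clen C e | SL l => 0 < t)"

lemma ipt_simps [simp]: "ipt (SE e) t = PE e t" "ipt (SL l) t = PLg l t"
 by (auto simp: ipt_def)

lemma ipt_eq [simp]: "ipt s t = ipt s' t' <-> s = s' & t = t'"
 by (cases s; cases s') auto

lemma ipt_PV [simp]: "ipt s t ~= PV v" "PV v ~= ipt s t"
 by (cases s; auto)+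

lemma pts_alt: "pts C = PV ` cV C Un {ipt s t | s t. s : segs C & sint C s t}"
proof -
 have "x : pts C <-> x : PV ` cV C Un {ipt s t | s t. s : segs C & sint C s t}" for x
 proof (cases x)
  case (PV v)
  thus ?thesis by (auto simp: pts_def)
 next
  case (PE e t)
  have "(EX s u. PE e t = ipt s u & s : segs C & sint C s u) <-> e : cE C & 0 < t & t < clen C e"
  proof
   assume "EX s u. PE e t = ipt s u & s : segs C & sint C s u"
   then obtain s u where "PE e t = ipt s u" "s : segs C" "sint C s u" by blast
   thus "e : cE C & 0 < t & t < clen C e"
    by (cases s) (auto simp: segs_def sint_def)
  next
   assume "e : cE C & 0 < t & t < clen C e"
   thus "EX s u. PE e t = ipt s u & s : segs C & sint C s u"
    by (intro exI[of _ "SE e"] exI[of _ t]) (auto simp: segs_def sint_def)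
  qed
  thus ?thesis using PE by (auto simp: pts_def)
 next
  case (PLg l t)
  have "(EX s u. PLg l t = ipt s u & s : segs C & sint C s u) <-> l : cL C & 0 < t"
  proof
   assume "EX s u. PLg l t = ipt s u & s : segs C & sint C s u"
   then obtain s u where "PLg l t = ipt s u" "s : segs C" "sint C s u" by blast
   thus "l : cL C & 0 < t"
    by (cases s) (auto simp: segs_def sint_def)
  next
   assume "l : cL C & 0 < t"
   thus "EX s u. PLg l t = ipt s u & s : segs C & sint C s u"
    by (intro exI[of _ "SL l"] exI[of _ t]) (auto simp: segs_def sint_def)
  qed
  thus ?thesis using PLg by (auto simp: pts_def)
 qed
 thus ?thesis by blast
qed

lemma pts_PV [simp]: "PV v : pts C <-> v : cV C"
 by (auto simp: pts_def)

lemma pts_ipt [simp]: "ipt s t : pts C <-> s : segs C & sint C s t"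
 by (auto simp: pts_alt)

lemma pts_PE [simp]: "PE e t : pts C <-> e : cE C & 0 < t & t < clen C e"
 by (auto simp: pts_def)

lemma pts_PLg [simp]: "PLg l t : pts C <-> l : cL C & 0 < t"
 by (auto simp: pts_def)

lemma pos_sint: "sint C s t ==> pos C s t = ipt s t"
 by (cases s) (auto simp: sint_def pos_def)

lemma sint_seg_dom: "sint C s t ==> seg_dom C s t"
 by (cases s) (auto simp: sint_def seg_dom_def)

lemma segs_SE [simp]: "SE e : segs C <-> e : cE C"
 and segs_SL [simp]: "SL l : segs C <-> l : cL C"
 by (auto simp: segs_def)

lemma is_curve_wf: "is_curve C ==> wf_graph C"
 by (simp add: is_curve_def)

lemma is_curve_len: "is_curve C ==> e : cE C ==> 0 < clen C e"
 by (simp add: is_curve_def)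

lemma pos_in_pts: "wf_graph C ==> s : segs C ==> seg_dom C s t ==> pos C s t : pts C"
 by (cases s) (auto simp: seg_dom_def pos_def wf_graph_def)

section \<open>Tangent directions and germs of maps\<close>

lemma dirs_segs: "(s, t, sn) : dirs C ==> s : segs C"
 by (auto simp: dirs_def)

text \<open>A direction may be based at a vertex, where several segments meet, but the points just
  after it lie inside one open segment. There \<open>pos\<close> agrees with \<open>ipt\<close> and
  is injective, which every comparison of germs uses.\<close>

lemma dirs_small:
 assumes "h : dirs C"
 obtains ep where "0 < ep" "!!dl. 0 < dl ==> dl <= ep ==> sint C (fst h) (mv (snd (snd h)) (fst (snd h)) dl)"
proof -
 obtain s t sn where h: "h = (s, t, sn)" by (cases h)
 have h': "seg_dom C s t" "~  sn ==> 0 < t" "sn ==> (case s of SE e => t < clen C e | SL l => True)"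
  using assms by (auto simp: h dirs_def)
 show ?thesis
 proof (cases s)
  case (SE e)
  define ep where "ep = (if sn then (clen C e - t) / 2 else t / 2)"
  have "0 < ep" using h' by (auto simp: SE ep_def)
  moreover have "sint C s (mv sn t dl)" if "0 < dl" "dl <= ep" for dl
   using that h' by (auto simp: SE ep_def sint_def mv_def seg_dom_def split: if_splits)
  ultimately show ?thesis using that by (auto simp: h)
 next
  case (SL l)
  define ep where "ep = (if sn then 1 else t / 2)"
  have "0 < ep" using h' by (auto simp: ep_def)
  moreover have "sint C s (mv sn t dl)" if "0 < dl" "dl <= ep" for dl
   using that h' by (auto simp: SL ep_def sint_def mv_def seg_dom_def split: if_splits)
  ultimately show ?thesis using that by (auto simp: h)
 qed
qed

lemma mv0 [simp]: "mv sn t 0 = t"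
 by (simp add: mv_def)

lemma mv_inj: "mv sn t dl = mv sn t dl' <-> dl = dl'"
 by (simp add: mv_def)

lemma mgermE:
 assumes "mgerm C1 C2 ta (s, t, sn) (s', t', sn') k"
 obtains ep where "0 < ep" "0 < k"
  "!!dl. 0 <= dl ==> dl <= ep ==> seg_dom C1 s (mv sn t dl)"
  "!!dl. 0 <= dl ==> dl <= ep ==> seg_dom C2 s' (mv sn' t' (real k * dl))"
  "!!dl. 0 <= dl ==> dl <= ep ==> ta (pos C1 s (mv sn t dl)) = pos C2 s' (mv sn' t' (real k * dl))"
 using assms unfolding mgerm_def by auto

lemma mgermI:
 assumes "0 < ep" "0 < k"
  "!!dl. 0 <= dl ==> dl <= ep ==> seg_dom C1 s (mv sn t dl)"
  "!!dl. 0 <= dl ==> dl <= ep ==> seg_dom C2 s' (mv sn' t' (real k * dl))"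
  "!!dl. 0 <= dl ==> dl <= ep ==> ta (pos C1 s (mv sn t dl)) = pos C2 s' (mv sn' t' (real k * dl))"
 shows "mgerm C1 C2 ta (s, t, sn) (s', t', sn') k"
 using assms unfolding mgerm_def by auto

lemma mgerm_base:
 assumes "mgerm C1 C2 ta h h' k"
 shows "ta (pos C1 (fst h) (fst (snd h))) = pos C2 (fst h') (fst (snd h'))"
proof -
 obtain s t sn s' t' sn' where h: "h = (s, t, sn)" "h' = (s', t', sn')" by (cases h; cases h')
 from assms[unfolded h] obtain ep where "0 < ep"
  "!!dl. 0 <= dl ==> dl <= ep ==> ta (pos C1 s (mv sn t dl)) = pos C2 s' (mv sn' t' (real k * dl))"
  by (rule mgermE) blast
 from this(2)[of 0] this(1) show ?thesis by (simp add: h)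
qed

lemma mgerm_pos: "mgerm C1 C2 ta h h' k ==> 0 < k"
 by (auto simp: mgerm_def)

lemma mgerm_comp:
 assumes 1: "mgerm C1 C2 f h h' k" and 2: "mgerm C2 C3 g h' h'' k'"
 shows "mgerm C1 C3 (g o f) h h'' (k' * k)"
proof -
 obtain s t sn s' t' sn' s'' t'' sn'' where h: "h = (s, t, sn)" "h' = (s', t', sn')" "h'' = (s'', t'', sn'')"
  by (cases h; cases h'; cases h'')
 obtain ep1 where e1: "0 < ep1" "0 < k"
  "!!dl. 0 <= dl ==> dl <= ep1 ==> seg_dom C1 s (mv sn t dl)"
  "!!dl. 0 <= dl ==> dl <= ep1 ==> seg_dom C2 s' (mv sn' t' (real k * dl))"
  "!!dl. 0 <= dl ==> dl <= ep1 ==> f (pos C1 s (mv sn t dl)) = pos C2 s' (mv sn' t' (real k * dl))"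
  using 1[unfolded h] by (rule mgermE) blast
 obtain ep2 where e2: "0 < ep2" "0 < k'"
  "!!dl. 0 <= dl ==> dl <= ep2 ==> seg_dom C3 s'' (mv sn'' t'' (real k' * dl))"
  "!!dl. 0 <= dl ==> dl <= ep2 ==> g (pos C2 s' (mv sn' t' dl)) = pos C3 s'' (mv sn'' t'' (real k' * dl))"
  using 2[unfolded h] by (rule mgermE) blast
 define ep where "ep = min ep1 (ep2 / real k)"
 have le: "real k * dl <= ep2 & 0 <= real k * dl & dl <= ep1" if "0 <= dl" "dl <= ep" for dl
  using that e1(2) by (auto simp: ep_def field_simps)
 show ?thesis unfolding h
 proof (rule mgermI[of ep])
  show "0 < ep" "0 < k' * k" using e1 e2 by (auto simp: ep_def)
 next
  fix dl :: real assume d: "0 <= dl" "dl <= ep"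
  note l = le[OF d]
  show "seg_dom C1 s (mv sn t dl)" using d l e1(3) by blast
  show "seg_dom C3 s'' (mv sn'' t'' (real (k' * k) * dl))"
   using l e2(3)[of "real k * dl"] by (simp add: mult.assoc)
  show "(g o f) (pos C1 s (mv sn t dl)) = pos C3 s'' (mv sn'' t'' (real (k' * k) * dl))"
   using l d e1(5)[of dl] e2(4)[of "real k * dl"] by (simp add: mult.assoc)
 qed
qed

lemma mgerm_inv:
 assumes inj: "inj_on bt (pts C1)" and wf: "wf_graph C1" and h: "h : dirs C1"
  and m: "mgerm C1 C2 bt h h' 1"
 shows "mgerm C2 C1 (inv_into (pts C1) bt) h' h 1"
proof -
 obtain s t sn s' t' sn' where hh: "h = (s, t, sn)" "h' = (s', t', sn')" by (cases h; cases h')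
 obtain ep where e: "0 < ep"
  "!!dl. 0 <= dl ==> dl <= ep ==> seg_dom C1 s (mv sn t dl)"
  "!!dl. 0 <= dl ==> dl <= ep ==> seg_dom C2 s' (mv sn' t' (real 1 * dl))"
  "!!dl. 0 <= dl ==> dl <= ep ==> bt (pos C1 s (mv sn t dl)) = pos C2 s' (mv sn' t' (real 1 * dl))"
  using m[unfolded hh] by (rule mgermE) blast
 show ?thesis unfolding hh
 proof (rule mgermI[of ep])
  fix dl :: real assume d: "0 <= dl" "dl <= ep"
  have "pos C1 s (mv sn t dl) : pts C1"
   using pos_in_pts[OF wf] e(2)[OF d] h by (auto simp: hh dirs_def)
  thus "inv_into (pts C1) bt (pos C2 s' (mv sn' t' dl)) = pos C1 s (mv sn t (real 1 * dl))"
   using e(4)[OF d] inv_into_f_f[OF inj] by (metis mult_1 of_nat_1)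
  show "seg_dom C2 s' (mv sn' t' dl)" using e(3)[OF d] by simp
  show "seg_dom C1 s (mv sn t (real 1 * dl))" using e(2)[OF d] by simp
 qed (use e in auto)
qed

lemma mlegI:
 assumes "0 < k" "0 < T" "!!t. t >= T ==> 0 < real k * t + c"
  "!!t. t >= T ==> ta (PLg l t) = PLg l' (real k * t + c)"
 shows "mleg C1 C2 ta l l' k"
 using assms unfolding mleg_def by blast

lemma fun_eventually_linI:
 assumes "0 < T" "!!t. t >= T ==> f (PLg l t) = of_int k * t + c"
 shows "fun_eventually_lin C f l k"
 using assms unfolding fun_eventually_lin_def by blast

lemma mleg_comp:
 assumes "mleg C1 C2 f l l' k" "mleg C2 C3 g l' l'' k'"
 shows "mleg C1 C3 (g o f) l l'' (k' * k)"
proof -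
 obtain T1 c1 where 1: "0 < k" "0 < T1" "!!t. t >= T1 ==> 0 < real k * t + c1"
  "!!t. t >= T1 ==> f (PLg l t) = PLg l' (real k * t + c1)"
  using assms(1) by (auto simp: mleg_def)
 obtain T2 c2 where 2: "0 < k'" "0 < T2" "!!t. t >= T2 ==> 0 < real k' * t + c2"
  "!!t. t >= T2 ==> g (PLg l' t) = PLg l'' (real k' * t + c2)"
  using assms(2) by (auto simp: mleg_def)
 define T where "T = max T1 ((T2 - c1) / real k)"
 have k: "real k > 0" using 1 by simp
 have T: "real k * t + c1 >= T2" "t >= T1" if "t >= T" for t
  using that k by (auto simp: T_def field_simps)
 show ?thesis
 proof (rule mlegI[of _ T "real k' * c1 + c2"])
  show "0 < k' * k" "0 < T" using 1 2 by (auto simp: T_def)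
  fix t assume t: "T <= t"
  have *: "real (k' * k) * t + (real k' * c1 + c2) = real k' * (real k * t + c1) + c2"
   by (simp add: algebra_simps)
  show "0 < real (k' * k) * t + (real k' * c1 + c2)"
   unfolding * using 2(3) T[OF t] by blast
  show "(g o f) (PLg l t) = PLg l'' (real (k' * k) * t + (real k' * c1 + c2))"
   unfolding * using 2(4) 1(4) T[OF t] by simp
 qed
qed

lemma mleg_inv:
 assumes inj: "inj_on bt (pts C1)" and l: "l : cL C1" and m: "mleg C1 C2 bt l l' 1"
 shows "mleg C2 C1 (inv_into (pts C1) bt) l' l 1"
proof -
 obtain T c where 1: "0 < T" "!!t. t >= T ==> 0 < t + c"
  "!!t. t >= T ==> bt (PLg l t) = PLg l' (t + c)"
  using m by (auto simp: mleg_def)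
 show ?thesis
 proof (rule mlegI[of _ "max 1 (T + c)" "- c"])
  fix t assume t: "max 1 (T + c) <= t"
  hence t': "T <= t - c" by simp
  thus "0 < real 1 * t + - c" using 1(1) by simp
  have "PLg l (t - c) : pts C1" using l t' 1(1) by simp
  thus "inv_into (pts C1) bt (PLg l' t) = PLg l (real 1 * t + - c)"
   using inv_into_f_f[OF inj, of "PLg l (t - c)"] 1(3)[OF t'] by simp
 qed auto
qed

text \<open>Two parameters suffice: the segments agree, the difference of the two positions recovers
  orientation and speed, and the base parameter follows.\<close>

lemma germ_unique:
 assumes h1: "h1 : dirs C" and h2: "h2 : dirs C" and k: "0 < k1" "0 < (k2::real)" and e: "0 < ep"
  and eq: "!!dl. 0 < dl ==> dl <= ep ==> pos C (fst h1) (mv (snd (snd h1)) (fst (snd h1)) (k1 * dl))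
        = pos C (fst h2) (mv (snd (snd h2)) (fst (snd h2)) (k2 * dl))"
 shows "h1 = h2 & k1 = k2"
proof -
 obtain s1 t1 sn1 s2 t2 sn2 where h: "h1 = (s1, t1, sn1)" "h2 = (s2, t2, sn2)" by (cases h1; cases h2)
 obtain ep1 where e1: "0 < ep1" "!!dl. 0 < dl ==> dl <= ep1 ==> sint C s1 (mv sn1 t1 dl)"
  using dirs_small[OF h1] by (auto simp: h)
 obtain ep2 where e2: "0 < ep2" "!!dl. 0 < dl ==> dl <= ep2 ==> sint C s2 (mv sn2 t2 dl)"
  using dirs_small[OF h2] by (auto simp: h)
 define et where "et = min ep (min (ep1 / k1) (ep2 / k2))"
 have eta: "0 < et" using e e1 e2 k by (auto simp: et_def)
 have *: "s1 = s2 & mv sn1 t1 (k1 * dl) = mv sn2 t2 (k2 * dl)" if d: "0 < dl" "dl <= et" for dl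
 proof -
  have "k1 * dl <= ep1" "k2 * dl <= ep2" "dl <= ep" using d k by (auto simp: et_def field_simps)
  moreover have "0 < k1 * dl" "0 < k2 * dl" using d k by auto
  ultimately have "ipt s1 (mv sn1 t1 (k1 * dl)) = ipt s2 (mv sn2 t2 (k2 * dl))"
   using e1(2)[of "k1*dl"] e2(2)[of "k2*dl"] eq[of dl] d by (simp add: pos_sint h)
  thus ?thesis by simp
 qed
 have 1: "mv sn1 t1 (k1 * et) = mv sn2 t2 (k2 * et)" and 2: "mv sn1 t1 (k1 * (et/2)) = mv sn2 t2 (k2 * (et/2))"
  and s: "s1 = s2" using *[of et] *[of "et/2"] eta by auto
 have *: "(if sn1 then k1 else - k1) * (et/2) = (if sn2 then k2 else - k2) * (et/2)"
 proof -
  have "(if sn then k else - k) * (et/2) = mv sn t (k * et) - mv sn t (k * (et/2))" for sn t k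
   by (simp add: mv_def)
  thus ?thesis using 1 2 by metis
 qed
 hence sk: "(if sn1 then k1 else - k1) = (if sn2 then k2 else - k2)" using eta by simp
 hence "sn1 = sn2" "k1 = k2" using k by (auto split: if_splits)
 thus ?thesis using s 1 by (auto simp: h mv_def)
qed

text \<open>Embeddings are only assumed to be injective on points; this lifts injectivity to tangent
  directions.\<close>

lemma mgerm_inj_dirs:
 assumes inj: "inj_on bt (pts C1)" and wf: "wf_graph C1" and h: "h1 : dirs C1" "h2 : dirs C1"
  and m: "mgerm C1 C2 bt h1 h' k" "mgerm C1 C2 bt h2 h' k"
 shows "h1 = h2"
proof -
 obtain s' t' sn' s1 t1 sn1 s2 t2 sn2 where hh: "h' = (s', t', sn')" "h1 = (s1, t1, sn1)" "h2 = (s2, t2, sn2)"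
  by (cases h'; cases h1; cases h2)
 obtain ep1 where e1: "0 < ep1"
  "!!dl. 0 <= dl ==> dl <= ep1 ==> seg_dom C1 s1 (mv sn1 t1 dl)"
  "!!dl. 0 <= dl ==> dl <= ep1 ==> bt (pos C1 s1 (mv sn1 t1 dl)) = pos C2 s' (mv sn' t' (real k * dl))"
  using m(1)[unfolded hh] by (rule mgermE) blast
 obtain ep2 where e2: "0 < ep2"
  "!!dl. 0 <= dl ==> dl <= ep2 ==> seg_dom C1 s2 (mv sn2 t2 dl)"
  "!!dl. 0 <= dl ==> dl <= ep2 ==> bt (pos C1 s2 (mv sn2 t2 dl)) = pos C2 s' (mv sn' t' (real k * dl))"
  using m(2)[unfolded hh] by (rule mgermE) blast
 have "h1 = h2 & (1::real) = 1"
 proof (rule germ_unique[OF h])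
  show "0 < min ep1 ep2" using e1 e2 by auto
  fix dl assume d: "0 < dl" "dl <= min ep1 ep2"
  have "pos C1 s1 (mv sn1 t1 dl) : pts C1" "pos C1 s2 (mv sn2 t2 dl) : pts C1"
   using e1(2)[of dl] e2(2)[of dl] d h wf by (auto intro!: pos_in_pts simp: hh dirs_segs)
  moreover have "bt (pos C1 s1 (mv sn1 t1 dl)) = bt (pos C1 s2 (mv sn2 t2 dl))"
   using e1(3)[of dl] e2(3)[of dl] d by simp
  ultimately show "pos C1 (fst h1) (mv (snd (snd h1)) (fst (snd h1)) (1 * dl)) =
     pos C1 (fst h2) (mv (snd (snd h2)) (fst (snd h2)) (1 * dl))"
   using inj by (simp add: hh inj_on_def)
 qed auto
 thus ?thesis by simp
qed

section \<open>Directions at vertices and at interior points\<close>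

lemma dir_at_dirs: "h : dir_at C x ==> h : dirs C"
 by (simp add: dir_at_def)

lemma dir_at_PV:
 assumes "is_curve C"
 shows "dir_at C (PV v) = (%e. (SE e, 0, True)) ` {e : cE C. fst (cends C e) = v}
  Un (%e. (SE e, clen C e, False)) ` {e : cE C. snd (cends C e) = v}
  Un (%l. (SL l, 0, True)) ` {l : cL C. clegv C l = v}" (is "_ = ?R")
proof -
 have "h : dir_at C (PV v) <-> h : ?R" for h
 proof -
  obtain s t sn where h: "h = (s, t, sn)" by (cases h)
  show ?thesis
  proof (cases s)
   case (SE e)
   show ?thesis
   proof (cases "e : cE C")
    case True
    thus ?thesis using is_curve_len[OF assms True] SE by (auto simp: h dir_at_def dirs_def seg_dom_def pos_def image_iff split: if_splits)
   qed (auto simp: SE h dir_at_def dirs_def)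
  qed (auto simp: h dir_at_def dirs_def seg_dom_def pos_def image_iff split: if_splits)
 qed
 thus ?thesis by blast
qed

lemma dir_at_ipt:
 assumes "s : segs C" "sint C s t"
 shows "dir_at C (ipt s t) = {(s, t, True), (s, t, False)}"
proof -
 have "h : dir_at C (ipt s t) <-> h = (s, t, True) | h = (s, t, False)" for h
 proof -
  obtain s' t' sn where h: "h = (s', t', sn)" by (cases h)
  show ?thesis
   using assms by (cases s; cases s') (auto simp: h dir_at_def dirs_def seg_dom_def sint_def pos_def
    split: if_splits)
 qed
 thus ?thesis by blast
qed

lemma finite_dir_at: "is_curve C ==> x : pts C ==> finite (dir_at C x)"
 by (frule is_curve_wf) (auto simp: pts_alt dir_at_PV dir_at_ipt wf_graph_def)

lemma sum_dir_at_PV: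
 assumes C: "is_curve C"
 shows "(SUM h:dir_at C (PV v). F h) = (SUM e:{e : cE C. fst (cends C e) = v}. F (SE e, 0, True))
  + (SUM e:{e : cE C. snd (cends C e) = v}. F (SE e, clen C e, False))
  + (SUM l:{l : cL C. clegv C l = v}. F (SL l, 0, True))"
proof -
 have fin: "finite (cE C)" "finite (cL C)" using C by (auto simp: is_curve_def wf_graph_def)
 show ?thesis unfolding dir_at_PV[OF C] by (subst sum.union_disjoint, use fin in \<open>auto\<close>)+ (simp add: sum.reindex inj_on_def)
qed

lemma val_PV: "is_curve C ==> val C (PV v) = gval C v"
 unfolding val_def gval_def using sum_dir_at_PV[of C "%_. 1::nat" v] by simp

lemma val_ipt: "s : segs C ==> sint C s t ==> val C (ipt s t) = 2"
 by (simp add: val_def dir_at_ipt)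

lemma gen_ipt [simp]: "gen C (ipt s t) = 0"
 by (cases s) (auto simp: gen_def)

lemma chi_ipt: "s : segs C ==> sint C s t ==> chi C (ipt s t) = 0"
 by (simp add: chi_def val_ipt)

definition vchi :: "tcurve => nat => int" where
 "vchi C v = 2 - 2 * int (cwt C v) - int (gval C v)"

lemma chi_PV: "is_curve C ==> chi C (PV v) = vchi C v"
 by (simp add: chi_def vchi_def val_PV gen_def)

section \<open>Isometries of tropical curves\<close>

text \<open>The bijection of directions is carried along because harmonicity is stated through maps
  of directions. Legs keep their labels but are matched only eventually, so a leg may gain or lose
  an initial piece.\<close>

definition isom :: "tcurve => tcurve => (pt => pt) => (dir => dir) => bool" where
 "isom C C' bt D <-> bij_betw bt (pts C) (pts C') & bij_betw D (dirs C) (dirs C') &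
  (ALL x:pts C. gen C' (bt x) = gen C x) & (ALL h:dirs C. mgerm C C' bt h (D h) 1) &
  cL C' = cL C & (ALL l:cL C. mleg C C' bt l l 1) & tgenus C' = tgenus C"

lemma isom_sym:
 assumes i: "isom C C' bt D" and wf: "wf_graph C"
 shows "isom C' C (inv_into (pts C) bt) (inv_into (dirs C) D)"
proof -
 have b: "bij_betw bt (pts C) (pts C')" and d: "bij_betw D (dirs C) (dirs C')"
  using i by (auto simp: isom_def)
 have inj: "inj_on bt (pts C)" "inj_on D (dirs C)" using b d by (auto simp: bij_betw_def)
 have 1: "gen C (inv_into (pts C) bt x) = gen C' x" if "x : pts C'" for x
 proof -
  have "bt (inv_into (pts C) bt x) = x" "inv_into (pts C) bt x : pts C"
   using that b by (auto simp: bij_betw_def f_inv_into_f inv_into_into)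
  thus ?thesis using i by (metis isom_def)
 qed
 have 2: "mgerm C' C (inv_into (pts C) bt) h (inv_into (dirs C) D h) 1" if "h : dirs C'" for h
 proof -
  have *: "D (inv_into (dirs C) D h) = h" "inv_into (dirs C) D h : dirs C"
   using that d by (auto simp: bij_betw_def f_inv_into_f inv_into_into)
  hence "mgerm C C' bt (inv_into (dirs C) D h) h 1" using i by (metis isom_def)
  thus ?thesis using mgerm_inv[OF inj(1) wf *(2)] by blast
 qed
 show ?thesis using 1 2 i d mleg_inv[OF inj(1)] by (auto simp: isom_def bij_betw_inv_into)
qed

lemma isom_trans:
 assumes "isom C C' bt D" "isom C' C'' bt' D'"
 shows "isom C C'' (bt' o bt) (D' o D)"
proof -
 have 1: "bt x : pts C'" if "x : pts C" for x using assms that by (auto simp: isom_def bij_betw_def)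
 have 2: "D h : dirs C'" if "h : dirs C" for h using assms that by (auto simp: isom_def bij_betw_def)
 have "mgerm C C'' (bt' o bt) h (D' (D h)) 1" if "h : dirs C" for h
  using mgerm_comp[of C C' bt h "D h" 1 C'' bt' "D' (D h)" 1] that 2 assms by (auto simp: isom_def)
 moreover have "mleg C C'' (bt' o bt) l l 1" if "l : cL C" for l
  using mleg_comp[of C C' bt l l 1 C'' bt' l 1] that assms by (auto simp: isom_def)
 ultimately show ?thesis using assms 1 by (auto simp: isom_def intro: bij_betw_trans)
qed

lemma isom_base:
 assumes "isom C C' bt D" "h : dirs C"
 shows "pos C' (fst (D h)) (fst (snd (D h))) = bt (pos C (fst h) (fst (snd h)))"
proof -
 have "mgerm C C' bt h (D h) 1" using assms by (auto simp: isom_def)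
 from mgerm_base[OF this] show ?thesis by simp
qed

lemma isom_dir_at:
 assumes i: "isom C C' bt D" and wf: "wf_graph C" and x: "x : pts C"
 shows "bij_betw D (dir_at C x) (dir_at C' (bt x))"
proof -
 have d: "bij_betw D (dirs C) (dirs C')" and b: "bij_betw bt (pts C) (pts C')"
  using i by (auto simp: isom_def)
 have p: "pos C (fst h) (fst (snd h)) : pts C" if "h : dirs C" for h
  using that pos_in_pts[OF wf] by (auto simp: dirs_def)
 have "D ` dir_at C x = dir_at C' (bt x)"
 proof (intro subset_antisym subsetI)
  fix h' assume "h' : D ` dir_at C x"
  then obtain h where h: "h : dirs C" "pos C (fst h) (fst (snd h)) = x" "h' = D h"
   by (auto simp: dir_at_def)
  thus "h' : dir_at C' (bt x)"
   using isom_base[OF i h(1)] d by (auto simp: dir_at_def bij_betw_def)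
 next
  fix h' assume h': "h' : dir_at C' (bt x)"
  hence "h' : dirs C'" by (rule dir_at_dirs)
  then obtain h where h: "h : dirs C" "h' = D h" using d by (metis (no_types, lifting) bij_betw_imp_surj_on imageE)
  have "bt (pos C (fst h) (fst (snd h))) = bt x"
   using isom_base[OF i h(1)] h' h by (simp add: dir_at_def)
  hence "pos C (fst h) (fst (snd h)) = x"
   using b p[OF h(1)] x by (auto simp: bij_betw_def inj_on_def)
  thus "h' : D ` dir_at C x" using h by (auto simp: dir_at_def)
 qed
 moreover have "inj_on D (dir_at C x)"
  using d by (auto simp: bij_betw_def dir_at_def intro: inj_on_subset)
 ultimately show ?thesis by (simp add: bij_betw_def)
qed

lemma isom_chi:
 assumes "isom C C' bt D" "wf_graph C" "x : pts C"
 shows "chi C' (bt x) = chi C x"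
proof -
 have "val C' (bt x) = val C x"
  unfolding val_def using bij_betw_same_card[OF isom_dir_at[OF assms]] by simp
 thus ?thesis using assms by (simp add: chi_def isom_def)
qed

text \<open>\<open>DR\<close> sees the curve only through its modifications, so this is all that
  invariance of \<open>DR\<close> under isometry requires.\<close>

lemma modification_isom_left:
 assumes i: "isom C C1 bt D" and m: "modification C1 C'"
 shows "modification C C'"
proof -
 obtain ic where m1: "is_curve C'" and io: "ALL x:pts C1. ic x : pts C'" "inj_on ic (pts C1)"
   "ALL x:pts C1. gen C' (ic x) = gen C1 x"
   "ALL h:dirs C1. EX h':dirs C'. mgerm C1 C' ic h h' 1"
   "cL C' = cL C1" "ALL l:cL C1. mleg C1 C' ic l l 1"
   "ALL y:pts C' - ic ` pts C1. gen C' y = 0" "tgenus C' = tgenus C1"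
  using m by (auto simp: modification_def)
 have b: "bt ` pts C = pts C1" "inj_on bt (pts C)" and d: "D ` dirs C = dirs C1"
  using i by (auto simp: isom_def bij_betw_def)
 show ?thesis unfolding modification_def
 proof (intro conjI exI[of _ "ic o bt"])
  show "ALL x:pts C. gen C' ((ic o bt) x) = gen C x"
  proof
   fix x assume x: "x : pts C"
   hence "bt x : pts C1" using b by blast
   thus "gen C' ((ic o bt) x) = gen C x" using io(3) i x by (simp add: isom_def)
  qed
  show "inj_on (ic o bt) (pts C)" using b io(2) by (simp add: comp_inj_on)
  show "ALL h:dirs C. EX h':dirs C'. mgerm C C' (ic o bt) h h' 1"
  proof
   fix h assume h: "h : dirs C"
   hence "D h : dirs C1" using d by blast
   then obtain h' where "h' : dirs C'" "mgerm C1 C' ic (D h) h' 1" using io by blast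
   thus "EX h':dirs C'. mgerm C C' (ic o bt) h h' 1"
    using mgerm_comp[of C C1 bt h "D h" 1 C' ic h' 1] i h by (auto simp: isom_def)
  qed
  show "ALL l:cL C. mleg C C' (ic o bt) l l 1"
   using mleg_comp[of C C1 bt _ _ 1 C' ic _ 1] i io by (auto simp: isom_def)
  have "(ic o bt) ` pts C = ic ` pts C1" using b by (metis image_comp)
  thus "ALL y:pts C' - (ic o bt) ` pts C. gen C' y = 0" using io by simp
 qed (use m1 io i b in \<open>auto simp: isom_def\<close>)
qed

lemma DR_isom:
 assumes "isom C C1 bt D" "DR n a C1"
 shows "DR n a C"
 using assms modification_isom_left unfolding DR_def by blast

lemma modification_isom_right:
 assumes i: "isom C' C'' bt D" and c: "is_curve C''"
  and io: "ALL x:pts C. ic x : pts C'" "inj_on ic (pts C)"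
   "ALL x:pts C. gen C' (ic x) = gen C x"
   "ALL h:dirs C. Dm h : dirs C' & mgerm C C' ic h (Dm h) 1"
   "cL C' = cL C" "ALL l:cL C. mleg C C' ic l l 1"
   "ALL y:pts C' - ic ` pts C. gen C' y = 0" "tgenus C' = tgenus C"
 shows "ALL x:pts C. (bt o ic) x : pts C''" "inj_on (bt o ic) (pts C)"
   "ALL x:pts C. gen C'' ((bt o ic) x) = gen C x"
   "ALL h:dirs C. (D o Dm) h : dirs C'' & mgerm C C'' (bt o ic) h ((D o Dm) h) 1"
   "cL C'' = cL C" "ALL l:cL C. mleg C C'' (bt o ic) l l 1"
   "ALL y:pts C'' - (bt o ic) ` pts C. gen C'' y = 0" "tgenus C'' = tgenus C"
proof -
 have b: "bt ` pts C' = pts C''" "inj_on bt (pts C')" and d: "D ` dirs C' = dirs C''"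
  using i by (auto simp: isom_def bij_betw_def)
 show 1: "ALL x:pts C. (bt o ic) x : pts C''" using io b by auto
 show "inj_on (bt o ic) (pts C)"
  using io(1,2) b(2) by (auto intro!: comp_inj_on intro: inj_on_subset)
 show "ALL x:pts C. gen C'' ((bt o ic) x) = gen C x" using io i by (simp add: isom_def)
 show "ALL h:dirs C. (D o Dm) h : dirs C'' & mgerm C C'' (bt o ic) h ((D o Dm) h) 1"
 proof (intro ballI conjI)
  fix h assume h: "h : dirs C"
  thus "(D o Dm) h : dirs C''" using io d by auto
  show "mgerm C C'' (bt o ic) h ((D o Dm) h) 1"
   using mgerm_comp[of C C' ic h "Dm h" 1 C'' bt "D (Dm h)" 1] h io i by (auto simp: isom_def)
 qed
 show "cL C'' = cL C" "tgenus C'' = tgenus C" using io i by (auto simp: isom_def)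
 show "ALL l:cL C. mleg C C'' (bt o ic) l l 1"
  using mleg_comp[of C C' ic _ _ 1 C'' bt _ 1] io i by (auto simp: isom_def)
 show "ALL y:pts C'' - (bt o ic) ` pts C. gen C'' y = 0"
 proof
  fix y assume y: "y : pts C'' - (bt o ic) ` pts C"
  then obtain x where x: "x : pts C'" "y = bt x" using b by blast
  hence "x ~: ic ` pts C" using y by auto
  thus "gen C'' y = 0" using x io i by (auto simp: isom_def)
 qed
qed

text \<open>Pull back along the isometry of the source and push forward along that of the target.
  Slopes are multiplied by 1 and the fibres of \<open>img\<close> correspond, so local degrees and
  Euler characteristics do not change.\<close>

lemma fin_harm_isom:
 assumes i1: "isom C1 C1' bt1 D1" and i2: "isom C2 C2' bt2 D2" and wf: "wf_graph C1" "wf_graph C2"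
  and f: "fin_harm C1 C2 ta img sl d"
  and eff: "ALL x:pts C1. 0 <= int (d x) * chi C2 (ta x) - chi C1 x"
 shows "fin_harm C1' C2' (bt2 o ta o inv_into (pts C1) bt1) (D2 o img o inv_into (dirs C1) D1)
   (sl o inv_into (dirs C1) D1) (d o inv_into (pts C1) bt1)"
  and "ALL x:pts C1'. 0 <= int ((d o inv_into (pts C1) bt1) x) * chi C2' ((bt2 o ta o inv_into (pts C1) bt1) x) - chi C1' x"
  and "ALL l l' k. l : cL C1 --> l' : cL C2 --> mleg C1 C2 ta l l' k --> mleg C1' C2' (bt2 o ta o inv_into (pts C1) bt1) l l' k"
proof -
 define bt where "bt = inv_into (pts C1) bt1"
 define D where "D = inv_into (dirs C1) D1"
 have i: "isom C1' C1 bt D" unfolding bt_def D_def using isom_sym[OF i1 wf(1)] .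
 have b: "bij_betw bt (pts C1') (pts C1)" "bij_betw D (dirs C1') (dirs C1)"
  "bij_betw D2 (dirs C2) (dirs C2')" "bij_betw bt2 (pts C2) (pts C2')"
  using i i2 by (auto simp: isom_def)
 have bbt: "bt x : pts C1" "bt1 (bt x) = x" if "x : pts C1'" for x
  using that i1 unfolding bt_def by (auto simp: isom_def bij_betw_def f_inv_into_f inv_into_into)
 have bD: "D h : dirs C1" if "h : dirs C1'" for h using b that by (auto simp: bij_betw_def)
 have ta: "ALL x:pts C1. ta x : pts C2" and g: "ALL h:dirs C1. img h : dirs C2 & mgerm C1 C2 ta h (img h) (sl h)"
  and l: "ALL l:cL C1. EX l':cL C2. EX k. mleg C1 C2 ta l l' k"
  and s: "ALL x:pts C1. ALL h':dir_at C2 (ta x). (SUM h:{h:dir_at C1 x. img h = h'}. sl h) = d x"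
  using f by (auto simp: fin_harm_def)
 have legs: "mleg C1' C2' (bt2 o ta o bt) l l' k" if "l : cL C1" "l' : cL C2" "mleg C1 C2 ta l l' k" for l l' k
 proof -
  have "mleg C1' C1 bt l l 1" "mleg C2 C2' bt2 l' l' 1" using that i i2 by (auto simp: isom_def)
  from mleg_comp[OF mleg_comp[OF this(1) that(3)] this(2)] show ?thesis by (simp add: comp_assoc)
 qed
 thus "ALL l l' k. l : cL C1 --> l' : cL C2 --> mleg C1 C2 ta l l' k --> mleg C1' C2' (bt2 o ta o inv_into (pts C1) bt1) l l' k"
  unfolding bt_def by blast
 show "fin_harm C1' C2' (bt2 o ta o inv_into (pts C1) bt1) (D2 o img o inv_into (dirs C1) D1)
   (sl o inv_into (dirs C1) D1) (d o inv_into (pts C1) bt1)"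
  unfolding bt_def[symmetric] D_def[symmetric] unfolding fin_harm_def
 proof (intro conjI ballI)
  fix x assume x: "x : pts C1'"
  thus "(bt2 o ta o bt) x : pts C2'" using bbt ta b by (auto simp: bij_betw_def)
  fix h' assume h': "h' : dir_at C2' ((bt2 o ta o bt) x)"
  have tx: "ta (bt x) : pts C2" using x bbt ta by auto
  have "bij_betw D2 (dir_at C2 (ta (bt x))) (dir_at C2' (bt2 (ta (bt x))))"
   by (rule isom_dir_at[OF i2 wf(2) tx])
  then obtain h2 where h2: "h2 : dir_at C2 (ta (bt x))" "h' = D2 h2" using h' by (metis (no_types, lifting) bij_betw_imp_surj_on comp_apply imageE)
  have wf': "wf_graph C1" by fact
  have bd1: "bij_betw D1 (dir_at C1 (bt x)) (dir_at C1' (bt1 (bt x)))"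
   by (rule isom_dir_at[OF i1 wf(1)]) (use bbt x in auto)
  hence bd1: "bij_betw D1 (dir_at C1 (bt x)) (dir_at C1' x)" using bbt x by simp
  have D1D: "D (D1 h) = h" if "h : dirs C1" for h
   unfolding D_def using i1 that by (simp add: isom_def bij_betw_def)
  have eq: "D2 (img h) = h' <-> img h = h2" if "h : dirs C1" for h
  proof -
   have "img h : dirs C2" "h2 : dirs C2" using g that h2(1) dir_at_dirs by blast+
   thus ?thesis using bij_betw_imp_inj_on[OF b(3)] h2(2) inj_on_eq_iff by fastforce
  qed
  have img: "D1 ` {h:dir_at C1 (bt x). img h = h2} = {h:dir_at C1' x. (D2 o img o D) h = h'}" (is "?L = ?R")
  proof (intro subset_antisym subsetI)
   fix h assume "h : ?L"
   then obtain h0 where h0: "h0 : dir_at C1 (bt x)" "img h0 = h2" "h = D1 h0" by blast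
   have "h0 : dirs C1" using h0(1) by (rule dir_at_dirs)
   thus "h : ?R" using h0 bd1 eq[of h0] D1D[of h0] bij_betwE by auto
  next
   fix h assume h: "h : ?R"
   then obtain h0 where h0: "h0 : dir_at C1 (bt x)" "h = D1 h0"
    by (metis (no_types, lifting) bd1 bij_betw_imp_surj_on imageE mem_Collect_eq)
   have "h0 : dirs C1" using h0(1) by (rule dir_at_dirs)
   thus "h : ?L" using h0 h eq[of h0] D1D[of h0] by auto
  qed
  have "inj_on D1 {h:dir_at C1 (bt x). img h = h2}"
   by (rule inj_on_subset[OF bij_betw_imp_inj_on[OF bd1]]) auto
  hence "(SUM h:{h:dir_at C1' x. (D2 o img o D) h = h'}. (sl o D) h)
    = (SUM h:{h:dir_at C1 (bt x). img h = h2}. (sl o D) (D1 h))"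
   unfolding img[symmetric] by (subst sum.reindex) simp_all
  also have "... = (SUM h:{h:dir_at C1 (bt x). img h = h2}. sl h)"
  proof (rule sum.cong[OF refl])
   fix h assume "h : {h:dir_at C1 (bt x). img h = h2}"
   hence "h : dirs C1" using dir_at_dirs by blast
   thus "(sl o D) (D1 h) = sl h" by (simp add: D1D)
  qed
  also have "... = d (bt x)" using s bbt[OF x] h2 by blast
  finally show "(SUM h:{h:dir_at C1' x. (D2 o img o D) h = h'}. (sl o D) h) = (d o bt) x" by simp
 next
  fix h assume h: "h : dirs C1'"
  have Dh: "D h : dirs C1" using bD h by blast
  hence ih: "img (D h) : dirs C2" using g by blast
  thus "(D2 o img o D) h : dirs C2'" using b by (auto simp: bij_betw_def)
  have "mgerm C1' C1 bt h (D h) 1" "mgerm C2 C2' bt2 (img (D h)) (D2 (img (D h))) 1"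
   using i i2 h ih by (auto simp: isom_def)
  from mgerm_comp[OF mgerm_comp[OF this(1)] this(2)] g Dh
  show "mgerm C1' C2' (bt2 o ta o bt) h ((D2 o img o D) h) ((sl o D) h)"
   by (fastforce simp: comp_assoc)
 next
  fix l assume "l : cL C1'"
  hence "l : cL C1" using i by (simp add: isom_def)
  thus "EX l':cL C2'. EX k. mleg C1' C2' (bt2 o ta o bt) l l' k"
   using l legs i2 by (metis isom_def)
 qed
 show "ALL x:pts C1'. 0 <= int ((d o inv_into (pts C1) bt1) x) * chi C2' ((bt2 o ta o inv_into (pts C1) bt1) x) - chi C1' x"
  unfolding bt_def[symmetric]
 proof
  fix x assume x: "x : pts C1'"
  have "chi C1' x = chi C1 (bt x)" using isom_chi[OF i1 wf(1), of "bt x"] bbt[OF x] by simp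
  moreover have "chi C2' (bt2 (ta (bt x))) = chi C2 (ta (bt x))"
   by (rule isom_chi[OF i2 wf(2)]) (use ta bbt[OF x] in auto)
  ultimately show "0 <= int ((d o bt) x) * chi C2' ((bt2 o ta o bt) x) - chi C1' x"
   using eff bbt[OF x] by simp
 qed
qed

lemma PD_isom:
 assumes i: "isom C C1 bt D" and wf: "wf_graph C" and L: "cL C = {1..n}" and p: "PD n a C1"
 shows "PD n a C"
proof -
 obtain f sl where f: "ALL h:dirs C1. fgerm C1 f h (sl h)" "ALL x:pts C1. (SUM h:dir_at C1 x. sl h) = 0"
  "ALL l:cL C1. EX k. fun_eventually_lin C1 f l k" "ALL i:{1..n}. fun_eventually_lin C1 f i (- a i)"
  using p by (auto simp: PD_def harmonic_fun_def)
 have lin: "fun_eventually_lin C (f o bt) l k" if l: "l : cL C" and k: "fun_eventually_lin C1 f l k" for l k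
 proof -
  obtain T c where T: "0 < T" "ALL t>=T. bt (PLg l t) = PLg l (t + c)"
   using i l unfolding isom_def mleg_def by fastforce
  obtain T' c' where T': "0 < T'" "ALL t>=T'. f (PLg l t) = of_int k * t + c'"
   using k by (auto simp: fun_eventually_lin_def)
  show ?thesis
  proof (rule fun_eventually_linI[of "max T (T' - c)" _ _ _ "of_int k * c + c'"])
   fix t assume "max T (T' - c) <= t"
   thus "(f o bt) (PLg l t) = of_int k * t + (of_int k * c + c')"
    using T T' by (simp add: algebra_simps)
  qed (use T in auto)
 qed
 have g: "fgerm C (f o bt) h (sl (D h))" if h: "h : dirs C" for h
 proof -
  obtain s t sn s' t' sn' where hh: "h = (s, t, sn)" "D h = (s', t', sn')" by (cases h; cases "D h")
  have m: "mgerm C C1 bt (s, t, sn) (s', t', sn') 1" using i h hh by (auto simp: isom_def)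
  obtain ep1 where e1: "0 < ep1" "!!dl. 0 <= dl ==> dl <= ep1 ==> seg_dom C s (mv sn t dl)"
   "!!dl. 0 <= dl ==> dl <= ep1 ==> bt (pos C s (mv sn t dl)) = pos C1 s' (mv sn' t' (real 1 * dl))"
   using m by (rule mgermE) blast
  have "D h : dirs C1" using i h by (auto simp: isom_def bij_betw_def)
  hence "fgerm C1 f (s', t', sn') (sl (D h))" using f hh by metis
  then obtain ep2 where e2: "0 < ep2" "ALL dl. 0 <= dl & dl <= ep2 -->
    f (pos C1 s' (mv sn' t' dl)) = f (pos C1 s' t') + of_int (sl (D h)) * dl"
   by (auto simp: fgerm_def)
  show ?thesis unfolding hh(1) fgerm_def prod.case
  proof (intro exI[of _ "min ep1 ep2"] conjI allI impI)
   fix dl assume d: "0 <= dl & dl <= min ep1 ep2"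
   thus "seg_dom C s (mv sn t dl)" using e1 by auto
   show "(f o bt) (pos C s (mv sn t dl)) = (f o bt) (pos C s t) + of_int (sl (D (s, t, sn))) * dl"
    using e1(3)[of dl] e1(3)[of 0] e2(2) d by (simp add: hh(1)[symmetric])
  qed (use e1 e2 in auto)
 qed
 have s: "(SUM h:dir_at C x. sl (D h)) = 0" if x: "x : pts C" for x
 proof -
  have "(SUM h:dir_at C x. sl (D h)) = (SUM h:dir_at C1 (bt x). sl h)"
   by (rule sum.reindex_bij_betw[OF isom_dir_at[OF i wf x]])
  thus ?thesis using f(2) x i by (auto simp: isom_def bij_betw_def)
 qed
 have L1: "cL C1 = cL C" using i by (simp add: isom_def)
 have "harmonic_fun C (f o bt)" unfolding harmonic_fun_def by (intro exI[of _ "sl o D"]) (use g s f(3) lin L1 in fastforce)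
 moreover have "ALL i:{1..n}. fun_eventually_lin C (f o bt) i (- a i)" using lin f(4) L by auto
 ultimately show ?thesis unfolding PD_def by blast
qed

section \<open>Connectivity\<close>

definition erel :: "('e => 'v \<times> 'v) => 'e set => ('v \<times> 'v) set" where
 "erel ends E = {(x, y). EX e:E. ends e = (x, y) | ends e = (y, x)}"

lemma adj_erel: "adj C = erel (cends C) (cE C)"
 by (simp add: adj_def erel_def)

lemma sym_erel: "sym (erel ends E)"
 by (auto simp: sym_def erel_def)

lemma erel_rtrancl_sym: "(x, y) : (erel ends E)^* ==> (y, x) : (erel ends E)^*"
 using sym_erel sym_rtrancl by (metis symD)

text \<open>Breadth-first search: away from the roots every vertex has an edge to a vertex that is
  closer to the roots, and these edges are pairwise distinct.\<close>

lemma bfs: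
 fixes ends :: "'e => 'v \<times> 'v"
 assumes reach: "ALL v:V. EX r:H. (r, v) : (erel ends E)^*"
 obtains lev :: "'v => nat" and pe pv where
  "!!v. v : V - H ==> pe v : E & (ends (pe v) = (v, pv v) | ends (pe v) = (pv v, v)) & lev (pv v) < lev v
    & (EX r:H. (r, pv v) : (erel ends E)^*)"
  "inj_on pe (V - H)"
proof -
 let ?A = "erel ends E"
 define lev where "lev v = (LEAST n. EX r:H. (r, v) : ?A ^^ n)" for v
 have ex: "EX e u. e : E & (ends e = (v, u) | ends e = (u, v)) & lev u < lev v & (EX r:H. (r, u) : ?A^*)"
  if v: "v : V - H" for v
 proof -
  obtain r n where "r : H" "(r, v) : ?A ^^ n" using reach v rtrancl_imp_relpow by blast
  hence "EX r:H. (r, v) : ?A ^^ (lev v)" unfolding lev_def by (intro LeastI_ex[of "%n. EX r:H. (r, v) : ?A ^^ n"]) blast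
  then obtain r where r: "r : H" "(r, v) : ?A ^^ (lev v)" by blast
  have "lev v ~= 0" using r v by (metis Diff_iff pair_in_Id_conv relpow.simps(1))
  then obtain m where m: "lev v = Suc m" using not0_implies_Suc by blast
  obtain u where u: "(r, u) : ?A ^^ m" "(u, v) : ?A" using r(2) m by auto
  have "lev u <= m" unfolding lev_def by (rule Least_le) (use r u in blast)
  moreover obtain e where "e : E" "ends e = (u, v) | ends e = (v, u)" using u(2) by (auto simp: erel_def)
  moreover have "(r, u) : ?A^*" using u(1) by (rule relpow_imp_rtrancl)
  ultimately show ?thesis using m r(1) by fastforce
 qed
 then obtain pe pv where p: "!!v. v : V - H ==> pe v : E & (ends (pe v) = (v, pv v) | ends (pe v) = (pv v, v))
   & lev (pv v) < lev v & (EX r:H. (r, pv v) : ?A^*)"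
  by metis
 have "inj_on pe (V - H)"
 proof (rule inj_onI, rule ccontr)
  fix x y assume x: "x : V - H" "y : V - H" "pe x = pe y" "x ~= y"
  \<comment> \<open>Two vertices with the same edge would each be closer to the roots than the
    other.\<close>
  hence "x = pv y" "y = pv x" using p[OF x(1)] p[OF x(2)] by auto
  thus False using p[OF x(1)] p[OF x(2)] by auto
 qed
 with p show ?thesis using that by blast
qed

section \<open>Contraction of zero-length edges\<close>

text \<open>\<open>zset\<close>, \<open>zcls\<close> and \<open>zrep\<close> name the let-bound
  parts of \<open>curve_of\<close>.\<close>

definition zset :: "tcurve => (nat => real) => nat set" where
 "zset G ll = {e:cE G. ll e = 0}"

definition zcls :: "tcurve => (nat => real) => nat => nat set" where
 "zcls G ll v = {w:cV G. (v, w) : (erel (cends G) (zset G ll))^*}"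

definition zrep :: "tcurve => (nat => real) => nat => nat" where
 "zrep G ll v = Min (zcls G ll v)"

lemma curve_of_simps:
 "cV (curve_of G ll) = zrep G ll ` cV G"
 "cE (curve_of G ll) = cE G - zset G ll"
 "cends (curve_of G ll) = (%e. (zrep G ll (fst (cends G e)), zrep G ll (snd (cends G e))))"
 "cL (curve_of G ll) = cL G"
 "clegv (curve_of G ll) = (%l. zrep G ll (clegv G l))"
 "clen (curve_of G ll) = ll"
 "cwt (curve_of G ll) = (%w. if w : zrep G ll ` cV G then (SUM v:zcls G ll w. cwt G v)
   + card {e:zset G ll. fst (cends G e) : zcls G ll w} + 1 - card (zcls G ll w) else 0)"
 unfolding curve_of_def Let_def zrep_def[abs_def] zcls_def[abs_def] erel_def zset_def by simp_all

lemma zcls_refl: "v : cV G ==> v : zcls G ll v"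
 by (simp add: zcls_def)

lemma zcls_sub: "zcls G ll v <= cV G"
 by (auto simp: zcls_def)

lemma zcls_finite: "wf_graph G ==> finite (zcls G ll v)"
 using zcls_sub finite_subset by (metis wf_graph_def)

lemma zrep_in: "wf_graph G ==> v : cV G ==> zrep G ll v : zcls G ll v"
 unfolding zrep_def by (rule Min_in) (auto simp: zcls_finite dest: zcls_refl)

lemma zrep_V: "wf_graph G ==> v : cV G ==> zrep G ll v : cV G"
 using zrep_in zcls_sub by blast

lemma zcls_eq: "(v, w) : (erel (cends G) (zset G ll))^* ==> zcls G ll v = zcls G ll w"
 unfolding zcls_def by (meson erel_rtrancl_sym rtrancl_trans)

lemma zcls_mem_eq: "w : zcls G ll v ==> zcls G ll w = zcls G ll v"
proof -
 assume "w : zcls G ll v"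
 hence "(v, w) : (erel (cends G) (zset G ll))^*" by (simp add: zcls_def)
 thus ?thesis by (rule zcls_eq[symmetric])
qed

lemma zrep_eq: "(v, w) : (erel (cends G) (zset G ll))^* ==> zrep G ll v = zrep G ll w"
 by (simp add: zrep_def zcls_eq)

lemma zrep_mem_eq: "w : zcls G ll v ==> zrep G ll w = zrep G ll v"
 by (simp add: zrep_def zcls_mem_eq)

lemma zrep_eq_iff:
 assumes "wf_graph G" "v : cV G" "w : cV G"
 shows "zrep G ll v = zrep G ll w <-> w : zcls G ll v"
proof
 assume e: "zrep G ll v = zrep G ll w"
 have "zcls G ll v = zcls G ll (zrep G ll v)" using zrep_in[OF assms(1,2)] zcls_mem_eq by metis
 also have "... = zcls G ll w" using zrep_in[OF assms(1,3)] zcls_mem_eq e by metis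
 finally show "w : zcls G ll v" using zcls_refl[OF assms(3)] by simp
qed (simp add: zrep_mem_eq)

lemma zcls_zrep: "wf_graph G ==> v : cV G ==> zcls G ll (zrep G ll v) = zcls G ll v"
 using zrep_in zcls_mem_eq by metis

lemma zrep_idem: "wf_graph G ==> v : cV G ==> zrep G ll (zrep G ll v) = zrep G ll v"
 using zrep_mem_eq zrep_in by metis

lemma zcls_rep: "wf_graph G ==> w : zrep G ll ` cV G ==> zcls G ll w = {v:cV G. zrep G ll v = w}"
proof -
 assume wf: "wf_graph G" and "w : zrep G ll ` cV G"
 then obtain u where u: "u : cV G" "w = zrep G ll u" by blast
 have "v : zcls G ll w <-> v : cV G & zrep G ll v = w" for v
  using zcls_zrep[OF wf u(1)] zrep_eq_iff[OF wf u(1), of v] zcls_sub u by (metis subsetD)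
 thus ?thesis by blast
qed

lemma zedge_rep: "e : zset G ll ==> zrep G ll (fst (cends G e)) = zrep G ll (snd (cends G e))"
 by (rule zrep_eq) (auto simp: erel_def)

lemma wf_ends: "wf_graph G ==> e : cE G ==> fst (cends G e) : cV G & snd (cends G e) : cV G"
 by (simp add: wf_graph_def)

lemma wf_legv: "wf_graph G ==> l : cL G ==> clegv G l : cV G"
 by (simp add: wf_graph_def)

lemma wf_fin: "wf_graph G ==> finite (cV G) & finite (cE G) & finite (cL G)"
 by (simp add: wf_graph_def)

text \<open>The weights in \<open>curve_of\<close> are a truncated subtraction of natural numbers. A
  contracted class is connected, so breadth-first search from \<open>v\<close> finds a separate edge
  for every other vertex and the subtraction is exact.\<close>

lemma zcls_card:
 assumes wf: "wf_graph G" and v: "v : cV G"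
 shows "card (zcls G ll v) <= card {e:zset G ll. fst (cends G e) : zcls G ll v} + 1"
proof -
 let ?K = "zcls G ll v" and ?Z = "zset G ll"
 have r: "ALL w:?K. EX r:{v}. (r, w) : (erel (cends G) ?Z)^*" by (auto simp: zcls_def)
 obtain lev :: "nat => nat" and pe pv where p: "!!w. w : ?K - {v} ==> pe w : ?Z &
   (cends G (pe w) = (w, pv w) | cends G (pe w) = (pv w, w)) & lev (pv w) < lev w
    & (EX r:{v}. (r, pv w) : (erel (cends G) ?Z)^*)" "inj_on pe (?K - {v})"
  by (rule bfs[OF r], rule that, assumption+)
 have fin: "finite ?K" using zcls_finite[OF wf] .
 have "pe ` (?K - {v}) <= {e:?Z. fst (cends G e) : ?K}"
 proof
  fix e assume "e : pe ` (?K - {v})"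
  then obtain w where w: "w : ?K - {v}" "e = pe w" by blast
  have "pe w : cE G" using p(1)[OF w(1)] by (auto simp: zset_def)
  hence "pv w : cV G" using p(1)[OF w(1)] wf_ends[OF wf, of "pe w"] by auto
  hence "pv w : ?K" using p(1)[OF w(1)] by (auto simp: zcls_def)
  thus "e : {e:?Z. fst (cends G e) : ?K}" using p(1)[OF w(1)] w by auto
 qed
 moreover have "finite {e:?Z. fst (cends G e) : ?K}" using wf_fin[OF wf] by (simp add: zset_def)
 ultimately have "card (?K - {v}) <= card {e:?Z. fst (cends G e) : ?K}"
  using card_inj_on_le[OF p(2)] by blast
 thus ?thesis by (simp add: card_Diff_singleton_if split: if_splits)
qed

lemma cwt_curve_of:
 assumes wf: "wf_graph G" and w: "w : zrep G ll ` cV G"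
 shows "int (cwt (curve_of G ll) w) = (SUM v:zcls G ll w. int (cwt G v))
   + int (card {e:zset G ll. fst (cends G e) : zcls G ll w}) + 1 - int (card (zcls G ll w))"
proof -
 have "w : cV G" using w zrep_V[OF wf] by auto
 from zcls_card[OF wf this, of ll] show ?thesis using w by (simp add: curve_of_simps)
qed

lemma sum_classes:
 fixes F :: "nat => 'a::comm_monoid_add"
 assumes "wf_graph G" "zrep G ll ` A = B" "A <= cV G" "!!v. v : cV G ==> zrep G ll v : B ==> v : A"
 shows "(SUM w:B. SUM v:zcls G ll w. F v) = (SUM v:A. F v)"
proof -
 have fin: "finite A" using assms wf_fin finite_subset by blast
 have "(SUM v:A. F v) = (SUM w:B. SUM v:{v:A. zrep G ll v = w}. F v)"
  using sum.group[OF fin, of B "zrep G ll" F] assms fin by auto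
 also have "... = (SUM w:B. SUM v:zcls G ll w. F v)"
 proof (rule sum.cong[OF refl])
  fix w assume w: "w : B"
  hence "w : zrep G ll ` cV G" using assms by auto
  hence "zcls G ll w = {v:A. zrep G ll v = w}" using zcls_rep[OF assms(1)] assms w by auto
  thus "(SUM v:{v:A. zrep G ll v = w}. F v) = (SUM v:zcls G ll w. F v)" by simp
 qed
 finally show ?thesis by simp
qed

lemma wf_curve_of:
 assumes wf: "wf_graph G"
 shows "wf_graph (curve_of G ll)"
proof -
 let ?C = "curve_of G ll"
 have step: "(zrep G ll x, zrep G ll y) : (adj ?C)^*" if xy: "(x, y) : adj G" for x y
 proof -
  obtain e where e: "e : cE G" "cends G e = (x, y) | cends G e = (y, x)" using xy by (auto simp: adj_def)
  show ?thesis
  proof (cases "e : zset G ll")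
   case True
   hence "zrep G ll x = zrep G ll y" using zedge_rep[OF True] e by auto
   thus ?thesis by simp
  next
   case False
   hence "(zrep G ll x, zrep G ll y) : adj ?C"
    using e by (auto simp: adj_def curve_of_simps intro!: bexI[of _ e])
   thus ?thesis by blast
  qed
 qed
 have path: "(zrep G ll x, zrep G ll y) : (adj ?C)^*" if "(x, y) : (adj G)^*" for x y
  using that by (induction) (auto intro: rtrancl_trans step)
 show ?thesis using wf path by (auto simp: curve_of_simps wf_graph_def)
qed

lemma is_curve_of:
 assumes "wf_graph G" "ALL e:cE G. 0 <= ll e"
 shows "is_curve (curve_of G ll)"
 using wf_curve_of[OF assms(1)] assms(2) unfolding is_curve_def by (force simp: curve_of_simps zset_def)

text \<open>A class with k vertices and z contracted edges costs k - 1 vertices and z edges and adds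
  z + 1 - k to the weight, which cancels.\<close>

lemma tgenus_curve_of:
 assumes wf: "wf_graph G"
 shows "tgenus (curve_of G ll) = tgenus G"
proof -
 let ?R = "zrep G ll ` cV G" and ?Z = "zset G ll"
 have fin: "finite (cV G)" "finite (cE G)" "finite ?Z" using wf_fin[OF wf] by (auto simp: zset_def)
 have V: "(SUM w:?R. SUM v:zcls G ll w. F v) = (SUM v:cV G. F v)" for F :: "nat => int"
  by (rule sum_classes[OF wf refl]) auto
 have Z: "(SUM w:?R. int (card {e:?Z. fst (cends G e) : zcls G ll w})) = int (card ?Z)"
 proof -
  have "int (card ?Z) = (SUM e:?Z. 1)" by simp
  also have "... = (SUM w:?R. SUM e:{e:?Z. zrep G ll (fst (cends G e)) = w}. 1)"
  proof (rule sum.group[OF fin(3), symmetric])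
   show "finite ?R" using fin by simp
   show "(%e. zrep G ll (fst (cends G e))) ` ?Z <= ?R" using wf_ends[OF wf] by (auto simp: zset_def)
  qed
  also have "... = (SUM w:?R. int (card {e:?Z. fst (cends G e) : zcls G ll w}))"
  proof (rule sum.cong[OF refl])
   fix w assume "w : ?R"
   hence "{e:?Z. zrep G ll (fst (cends G e)) = w} = {e:?Z. fst (cends G e) : zcls G ll w}"
    using zcls_rep[OF wf] wf_ends[OF wf] by (auto simp: zset_def)
   thus "(SUM e:{e:?Z. zrep G ll (fst (cends G e)) = w}. 1) = int (card {e:?Z. fst (cends G e) : zcls G ll w})"
    by simp
  qed
  finally show ?thesis by simp
 qed
 have "(SUM w:?R. int (cwt (curve_of G ll) w)) = (SUM w:?R. (SUM v:zcls G ll w. int (cwt G v))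
   + int (card {e:?Z. fst (cends G e) : zcls G ll w}) + 1 - int (card (zcls G ll w)))"
  by (rule sum.cong[OF refl]) (rule cwt_curve_of[OF wf])
 also have "... = (SUM v:cV G. int (cwt G v)) + int (card ?Z) + int (card ?R) - int (card (cV G))"
 proof -
  have "(SUM w:?R. int (card (zcls G ll w))) = int (card (cV G))"
   using V[of "%_. 1"] by simp
  thus ?thesis by (simp add: sum.distrib sum_subtractf Z V)
 qed
 finally have W: "(SUM w:?R. int (cwt (curve_of G ll) w)) =
   (SUM v:cV G. int (cwt G v)) + int (card ?Z) + int (card ?R) - int (card (cV G))" .
 have "?Z <= cE G" by (auto simp: zset_def)
 hence "int (card (cE G - ?Z)) = int (card (cE G)) - int (card ?Z)"
  using fin by (simp add: card_Diff_subset card_mono)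
 thus ?thesis unfolding tgenus_def by (simp add: curve_of_simps(1,2) W)
qed

section \<open>Subdivision\<close>

definition segstart :: "tcurve => seg => nat" where
 "segstart H s = (case s of SE e => fst (cends H e) | SL l => clegv H l)"

text \<open>The new edge is the initial piece, from the old start to the new vertex, and the old
  segment keeps its name for the rest. Edges and legs are thus cut in the same way, and a leg keeps
  its infinite end.\<close>

definition subdivide :: "tcurve => seg => nat => nat => tcurve" where
 "subdivide H s v e1 = H\<lparr>cV := insert v (cV H), cE := insert e1 (cE H),
   cends := (case s of SE e => (cends H)(e := (v, snd (cends H e))) | SL l => cends H)(e1 := (segstart H s, v)),
   clegv := (case s of SE e => clegv H | SL l => (clegv H)(l := v)),
   cwt := (cwt H)(v := 0)\<rparr>"

text \<open>The lengths before the cut, recovered from those after it; an initial piece of a leg is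
  absorbed by the leg.\<close>

definition mlen :: "seg => nat => (nat => real) => nat => real" where
 "mlen s e1 ll = (case s of SE e => ll(e := ll e + ll e1, e1 := 0) | SL l => ll(e1 := 0))"

text \<open>A contracted class is represented by its minimum, so a new vertex above all old ones
  never displaces an old representative.\<close>

locale subdiv_graph =
 fixes H :: tcurve and s :: seg and v e1 :: nat
 assumes wf: "wf_graph H" and s: "s : segs H" and vfresh: "ALL w:cV H. w < v" and e1: "e1 ~: cE H"
begin

abbreviation "H1 == subdivide H s v e1"
abbreviation "st == segstart H s"

lemma v_notin: "v ~: cV H" using vfresh by auto

lemma H1_simps: "cV H1 = insert v (cV H)" "cE H1 = insert e1 (cE H)" "cL H1 = cL H"
 "cends H1 e1 = (st, v)" "cwt H1 = (cwt H)(v := 0)"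
 by (auto simp: subdivide_def)

lemma e_e1: "s = SE e ==> e : cE H & e ~= e1" using s e1 by auto

lemma ends_other: "f : cE H ==> SE f ~= s ==> cends H1 f = cends H f"
 using e1 by (cases s) (auto simp: subdivide_def)

lemma ends_s: "s = SE e ==> cends H1 e = (v, snd (cends H e))"
 using e_e1 by (auto simp: subdivide_def)

lemma legv_other: "SL l ~= s ==> clegv H1 l = clegv H l"
 by (cases s) (auto simp: subdivide_def)

lemma legv_s: "s = SL l ==> clegv H1 l = v"
 by (auto simp: subdivide_def)

lemma st_V: "st : cV H"
 using s wf_ends[OF wf] wf_legv[OF wf] by (cases s) (auto simp: segstart_def)

lemma wf1: "wf_graph H1"
proof -
 have e1a: "(st, v) : adj H1" by (auto simp: adj_def H1_simps)
 have step: "(x, y) : (adj H1)^*" if "(x, y) : adj H" for x y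
 proof -
  from that obtain f where f: "f : cE H" "cends H f = (x, y) | cends H f = (y, x)" by (auto simp: adj_def)
  show ?thesis
  proof (cases "SE f = s")
   case False
   hence "(x, y) : adj H1" using f ends_other[OF f(1)] by (auto simp: adj_def H1_simps)
   thus ?thesis by blast
  next
   case True
   have ee: "st = fst (cends H f)" using True by (auto simp: segstart_def)
   have "(v, snd (cends H f)) : adj H1"
    using ends_s[of f] True f by (auto simp: adj_def H1_simps intro!: bexI[of _ f])
   hence "(st, snd (cends H f)) : (adj H1)^*" using e1a by (meson converse_rtrancl_into_rtrancl r_into_rtrancl)
   hence "(x, y) : (adj H1)^* & (y, x) : (adj H1)^* | (y, x) : (adj H1)^*"
    using f ee by (auto simp: adj_erel dest: erel_rtrancl_sym)
   thus ?thesis by (auto simp: adj_erel dest: erel_rtrancl_sym)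
  qed
 qed
 have path: "(x, y) : (adj H1)^*" if "(x, y) : (adj H)^*" for x y
  using that by induction (auto intro: rtrancl_trans step)
 have conn: "(st, x) : (adj H1)^*" if "x : cV H1" for x
 proof (cases "x = v")
  case False
  hence "(st, x) : (adj H)^*" using wf st_V that by (auto simp: wf_graph_def H1_simps)
  thus ?thesis by (rule path)
 qed (use e1a in blast)
 have "(x, y) : (adj H1)^*" if "x : cV H1" "y : cV H1" for x y
  using conn[OF that(1)] conn[OF that(2)] by (metis adj_erel erel_rtrancl_sym rtrancl_trans)
 moreover have "fst (cends H1 f) : cV H1 & snd (cends H1 f) : cV H1" if "f : cE H1" for f
 proof (cases "f = e1")
  case False
  hence f: "f : cE H" using that by (simp add: H1_simps)
  thus ?thesis using ends_other[OF f] ends_s[of f] wf_ends[OF wf f] by (cases "SE f = s") (auto simp: H1_simps)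
 qed (use st_V in \<open>simp add: H1_simps\<close>)
 moreover have "clegv H1 l : cV H1" if "l : cL H1" for l
  using legv_other[of l] legv_s[of l] wf_legv[OF wf] that by (cases "SL l = s") (auto simp: H1_simps)
 ultimately show ?thesis unfolding wf_graph_def using wf_fin[OF wf] by (simp add: H1_simps)
qed

lemma tgenus1: "tgenus H1 = tgenus H"
proof -
 have "(SUM w:cV H. int (cwt H1 w)) = (SUM w:cV H. int (cwt H w))"
  by (rule sum.cong) (use v_notin in \<open>auto simp: H1_simps\<close>)
 thus ?thesis unfolding tgenus_def using wf_fin[OF wf] v_notin e1 by (simp add: H1_simps)
qed

end

text \<open>Lengths may be 0, so the new vertex may fall onto an end of the cut segment; cut and
  uncut graph are compared after contraction.\<close>

locale subdiv_step = subdiv_graph +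
 fixes ll :: "nat => real"
 assumes nn: "ALL e:insert e1 (cE H). 0 <= ll e"
begin

abbreviation "mm == mlen s e1 ll"
abbreviation "C == curve_of H mm"
abbreviation "C1 == curve_of H1 ll"
abbreviation "t == ll e1"

lemma mm_other: "f : cE H ==> SE f ~= s ==> mm f = ll f"
 using e1 by (cases s) (auto simp: mlen_def)

lemma mm_s: "s = SE e ==> mm e = ll e + t"
 using e_e1 by (auto simp: mlen_def)

lemma t_nn: "0 <= t" using nn by simp

lemma mm_nn: "ALL e:cE H. 0 <= mm e"
 using nn mm_other mm_s by (metis add_nonneg_nonneg insertCI)

lemma zset_other: "SE f ~= s ==> f ~= e1 ==> f : zset H1 ll <-> f : zset H mm"
 using mm_other by (auto simp: zset_def H1_simps)

lemma zset_e1: "e1 : zset H1 ll <-> t = 0" "e1 ~: zset H mm"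
 using e1 by (auto simp: zset_def H1_simps)

lemma zset_s: "s = SE e ==> e : zset H1 ll <-> ll e = 0" "s = SE e ==> e : zset H mm <-> ll e = 0 & t = 0"
proof -
 assume "s = SE e"
 hence "e : cE H" "0 <= ll e" using e_e1 nn by auto
 thus "e : zset H1 ll <-> ll e = 0" "e : zset H mm <-> ll e = 0 & t = 0"
  using mm_s[OF \<open>s = SE e\<close>] t_nn by (auto simp: zset_def H1_simps)
qed

abbreviation "R == erel (cends H) (zset H mm)"
abbreviation "R1 == erel (cends H1) (zset H1 ll)"

text \<open>A retraction onto the old graph that turns contracted paths into contracted paths: if
  the first piece is contracted the new vertex belongs to the start, and otherwise it can only be
  absorbed by the far end.\<close>

definition pj :: "nat => nat" where
 "pj x = (if x = v then (if t = 0 then st else (case s of SE e => snd (cends H e) | SL _ => st)) else x)"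

lemma zset_V: "f : zset H mm ==> fst (cends H f) ~= v & snd (cends H f) ~= v"
 using wf_ends[OF wf] v_notin by (auto simp: zset_def)

lemma R1_R: assumes "(x, y) : R1" shows "(pj x, pj y) : R^*"
proof -
 obtain f where f: "f : zset H1 ll" "cends H1 f = (x, y) | cends H1 f = (y, x)"
  using assms by (auto simp: erel_def)
 have "(pj (fst (cends H1 f)), pj (snd (cends H1 f))) : R^*"
 proof (cases "f = e1")
  case True
  hence "t = 0" using f zset_e1 by simp
  thus ?thesis using True by (auto simp: H1_simps pj_def)
 next
  case False
  show ?thesis
  proof (cases "SE f = s")
   case True
   hence e: "cends H1 f = (v, snd (cends H f))" and l: "ll f = 0" and sf: "st = fst (cends H f)"
    and fE: "f : cE H"
    using ends_s zset_s(1) f e_e1 by (auto simp: segstart_def)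
   have nv: "snd (cends H f) ~= v" using wf_ends[OF wf fE] v_notin by auto
   show ?thesis
   proof (cases "t = 0")
    case True
    hence "f : zset H mm" using zset_s(2)[of f] l \<open>SE f = s\<close> by auto
    hence "(st, snd (cends H f)) : R" using sf by (auto simp: erel_def)
    thus ?thesis using True by (auto simp: e pj_def)
   next
    case False
    have "pj v = snd (cends H f)" unfolding pj_def using False \<open>SE f = s\<close> by auto
    moreover have "pj (snd (cends H f)) = snd (cends H f)" using nv by (simp add: pj_def)
    ultimately show ?thesis unfolding e by simp
   qed
  next
   case nf: False
   hence fz: "f : zset H mm" using zset_other False f by blast
   hence "cends H1 f = cends H f" using ends_other nf by (auto simp: zset_def)
   thus ?thesis using zset_V[OF fz] fz by (auto simp: pj_def erel_def intro!: bexI[of _ f])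
  qed
 qed
 thus ?thesis using f(2) erel_rtrancl_sym by auto
qed

lemma R1_R_path: "(x, y) : R1^* ==> (pj x, pj y) : R^*"
 by (induction rule: rtrancl_induct) (auto intro: rtrancl_trans R1_R)

lemma R_R1: assumes "(x, y) : R" shows "(x, y) : R1^*"
proof -
 obtain f where f: "f : zset H mm" "cends H f = (x, y) | cends H f = (y, x)"
  using assms by (auto simp: erel_def)
 have "(fst (cends H f), snd (cends H f)) : R1^*"
 proof (cases "SE f = s")
  case True
  hence z: "ll f = 0" "t = 0" "st = fst (cends H f)" using zset_s(2)[of f] f by (auto simp: segstart_def)
  have "(st, v) : R1" using z zset_e1 H1_simps by (auto simp: erel_def)
  moreover have "(v, snd (cends H f)) : R1"
   using z True zset_s(1)[of f] ends_s[of f] by (auto simp: erel_def intro!: bexI[of _ f])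
  ultimately show ?thesis using z by (metis converse_rtrancl_into_rtrancl r_into_rtrancl)
 next
  case False
  hence "f : zset H1 ll" using f zset_other zset_e1 by metis
  moreover have "cends H1 f = cends H f" using False f ends_other by (auto simp: zset_def)
  ultimately show ?thesis by (auto simp: erel_def intro!: bexI[of _ f])
 qed
 thus ?thesis using f(2) erel_rtrancl_sym by auto
qed

lemma R_R1_path: "(x, y) : R^* ==> (x, y) : R1^*"
 by (induction rule: rtrancl_induct) (auto intro: rtrancl_trans R_R1)

lemma cls1:
 assumes w: "w : cV H"
 shows "zcls H1 ll w = zcls H mm w Un (if v : zcls H1 ll w then {v} else {})"
proof -
 have nv: "w ~= v" using w v_notin by blast
 have "(w, x) : R1^* <-> (w, x) : R^*" if "x : cV H" for x
 proof
  assume "(w, x) : R1^*"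
  hence "(pj w, pj x) : R^*" by (rule R1_R_path)
  thus "(w, x) : R^*" using nv that v_notin by (auto simp: pj_def split: if_splits)
 qed (rule R_R1_path)
 thus ?thesis by (auto simp: zcls_def H1_simps)
qed

lemma rep1: assumes w: "w : cV H" shows "zrep H1 ll w = zrep H mm w"
proof -
 have ne: "zcls H mm w ~= {}" "finite (zcls H mm w)" using zcls_refl[OF w] zcls_finite[OF wf] by auto
 have "Min (zcls H mm w) : cV H" using Min_in[OF ne(2,1)] zcls_sub by blast
 hence "min v (Min (zcls H mm w)) = Min (zcls H mm w)" using vfresh by auto
 hence "Min (insert v (zcls H mm w)) = Min (zcls H mm w)"
  using Min_insert[OF ne(2,1), of v] by simp
 thus ?thesis unfolding zrep_def using cls1[OF w] by (auto split: if_splits)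
qed

lemma rep1_v_t0: "t = 0 ==> zrep H1 ll v = zrep H mm st & v : zcls H1 ll st"
proof -
 assume t: "t = 0"
 have "(st, v) : R1" using t zset_e1 H1_simps by (auto simp: erel_def)
 hence "(st, v) : R1^*" by blast
 thus ?thesis using zrep_eq[of st v H1 ll] rep1[OF st_V] by (auto simp: zcls_def H1_simps)
qed

lemma rep1_v_end: "s = SE e ==> ll e = 0 ==> zrep H1 ll v = zrep H mm (snd (cends H e)) & v : zcls H1 ll (snd (cends H e))"
proof -
 assume e: "s = SE e" "ll e = 0"
 hence sn: "snd (cends H e) : cV H" using wf_ends[OF wf] e_e1 by blast
 have "(snd (cends H e), v) : R1" using e zset_s(1)[OF e(1)] ends_s[OF e(1)] by (auto simp: erel_def)
 hence "(snd (cends H e), v) : R1^*" by blast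
 thus ?thesis using zrep_eq[of "snd (cends H e)" v H1 ll] rep1[OF sn] by (auto simp: zcls_def H1_simps)
qed

text \<open>Tells whether anything is left of the segment beyond the new vertex; together with
  \<open>t ~= 0\<close> it decides whether \<open>v\<close> is a point of its own.\<close>

definition live :: bool where "live = (case s of SE e => ll e ~= 0 | SL l => True)"

lemma not_live: "~  live ==> EX e. s = SE e & ll e = 0"
 unfolding live_def by (auto split: seg.splits)

lemma live_SE: "s = SE e ==> live <-> ll e ~= 0"
 unfolding live_def by simp

lemma live_SL: "s = SL l ==> live"
 unfolding live_def by simp

lemma cls_v: assumes "t ~= 0" live shows "zcls H1 ll v = {v}"
proof -
 have iso: "x ~= v & y ~= v" if "(x, y) : R1" for x y
 proof -
  from that obtain f where f: "f : zset H1 ll" "cends H1 f = (x, y) | cends H1 f = (y, x)" by (auto simp: erel_def)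
  have "f ~= e1" using assms zset_e1 f by auto
  moreover have "SE f ~= s" using assms(2) zset_s(1)[of f] f by (auto simp: live_def)
  ultimately have "f : zset H mm" using zset_other f by blast
  thus ?thesis using zset_V[of f] ends_other[of f] \<open>SE f ~= s\<close> f by (auto simp: zset_def)
 qed
 have "x = v" if "(v, x) : R1^*" for x
  using that
 proof (cases rule: converse_rtranclE)
  case (step y)
  thus ?thesis using iso[of v y] by blast
 qed simp
 thus ?thesis unfolding zcls_def using H1_simps(1) by blast
qed

lemma rep_v: "t ~= 0 ==> live ==> zrep H1 ll v = v"
 by (simp add: zrep_def cls_v)

lemma rep_v_old: "~  (t ~= 0 & live) ==> zrep H1 ll v : zrep H mm ` cV H"
proof (cases "t = 0")
 case True
 thus ?thesis using rep1_v_t0 st_V by auto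
next
 case False
 assume "~  (t ~= 0 & live)"
 then obtain e where e: "s = SE e" "ll e = 0" using False not_live by blast
 thus ?thesis using rep1_v_end[OF e] wf_ends[OF wf, of e] e_e1[OF e(1)] by auto
qed

lemma V_C1: "cV C1 = zrep H mm ` cV H Un {zrep H1 ll v}"
 using rep1 by (auto simp: curve_of_simps H1_simps)

lemma v_notin_C: "v ~: zrep H mm ` cV H"
 using zrep_V[OF wf] v_notin by auto

text \<open>When an old class absorbs \<open>v\<close>, exactly one more contracted edge is counted:
  the first piece if it has length 0, otherwise the second. The class gains one vertex and one edge
  together, so its weight stays the same.\<close>

lemma zcount:
 assumes w: "w : cV H"
 shows "{f:zset H1 ll. fst (cends H1 f) : zcls H1 ll w} = {f:zset H mm. fst (cends H f) : zcls H mm w}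
   Un (if v : zcls H1 ll w then {if t = 0 then e1 else (THE e. s = SE e)} else {})"
  and "v : zcls H1 ll w ==> (if t = 0 then e1 else (THE e. s = SE e)) ~: zset H mm"
proof -
 let ?K1 = "zcls H1 ll w" and ?K = "zcls H mm w"
 have w1: "w : cV H1" using w by (simp add: H1_simps)
 have K: "x : ?K1 <-> x : ?K" if "x : cV H" for x using cls1[OF w] that v_notin by (auto split: if_splits)
 have vs: "v : ?K1 <-> st : ?K1" if "t = 0"
  using rep1_v_t0[OF that] zcls_mem_eq[of v H1 ll st] zcls_mem_eq[of st H1 ll w] zcls_mem_eq[of v H1 ll w] zcls_refl[of st H1 ll] st_V by (auto simp: H1_simps)
 have ve: "v : ?K1 ==> t = 0 | ~  live"
 proof (rule ccontr)
  assume "v : ?K1" "~  (t = 0 | ~  live)"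
  hence "zcls H1 ll v = ?K1" "zcls H1 ll v = {v}" using zcls_mem_eq cls_v by blast+
  thus False using zcls_refl[OF w1, of ll] w v_notin by auto
 qed
 have other: "f : zset H1 ll & fst (cends H1 f) : ?K1 <-> f : zset H mm & fst (cends H f) : ?K"
  if f: "f ~= e1" "SE f ~= s" for f
 proof -
  have "f : cE H ==> fst (cends H1 f) : ?K1 <-> fst (cends H f) : ?K"
   using ends_other[of f] f K wf_ends[OF wf, of f] by auto
  moreover have "f : zset H mm ==> f : cE H" by (simp add: zset_def)
  ultimately show ?thesis using zset_other f by blast
 qed
 have e1m: "e1 : zset H1 ll & fst (cends H1 e1) : ?K1 <-> t = 0 & v : ?K1"
  using zset_e1 vs by (auto simp: H1_simps)
 have sm1: "e : zset H1 ll & fst (cends H1 e) : ?K1 <-> ll e = 0 & v : ?K1" if "s = SE e" for e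
  using zset_s(1)[OF that] ends_s[OF that] by auto
 have sm: "e : zset H mm & fst (cends H e) : ?K <-> ll e = 0 & t = 0 & v : ?K1" if "s = SE e" for e
  using zset_s(2)[OF that] K[OF st_V] vs that by (auto simp: segstart_def)
 show "{f:zset H1 ll. fst (cends H1 f) : ?K1} = {f:zset H mm. fst (cends H f) : ?K}
   Un (if v : ?K1 then {if t = 0 then e1 else (THE e. s = SE e)} else {})" (is "?A = ?B")
 proof (rule set_eqI)
  fix f
  consider "f = e1" | "f ~= e1" "SE f = s" | "f ~= e1" "SE f ~= s" by blast
  thus "f : ?A <-> f : ?B"
  proof cases
   case 1
   have "t ~= 0 ==> v : ?K1 ==> e1 ~= (THE e. s = SE e)"
   proof -
    assume "t ~= 0" "v : ?K1"
    then obtain e where e: "s = SE e" using ve not_live by blast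
    hence "(THE e. s = SE e) = e" by simp
    thus ?thesis using e_e1[OF e] by simp
   qed
   thus ?thesis using e1m zset_e1 1 by auto
  next
   case 2
   hence "(THE e. s = SE e) = f" by auto
   thus ?thesis using sm1[of f] sm[of f] ve live_SE[of f] 2 by auto
  next
   case 3
   have "t ~= 0 ==> v : ?K1 ==> f ~= (THE e. s = SE e)"
   proof -
    assume "t ~= 0" "v : ?K1"
    then obtain e where e: "s = SE e" using ve not_live by blast
    hence "(THE e. s = SE e) = e" by simp
    thus ?thesis using e 3 by auto
   qed
   thus ?thesis using other[OF 3] 3 by auto
  qed
 qed
 show "v : ?K1 ==> (if t = 0 then e1 else (THE e. s = SE e)) ~: zset H mm"
 proof (cases "t = 0")
  case False
  assume "v : ?K1"
  then obtain e where e: "s = SE e" using ve not_live False by blast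
  hence "(THE e. s = SE e) = e" by simp
  thus ?thesis using zset_s(2)[OF e] False by simp
 qed (use zset_e1 in simp)
qed

lemma cwt1: assumes w: "w : zrep H mm ` cV H" shows "cwt C1 w = cwt C w"
proof -
 have wV: "w : cV H" using w zrep_V[OF wf] by auto
 have wr: "w : zrep H1 ll ` cV H1" using w V_C1 by (simp add: curve_of_simps)
 let ?K1 = "zcls H1 ll w" and ?K = "zcls H mm w"
 have fin: "finite ?K" "finite {f:zset H mm. fst (cends H f) : ?K}" using zcls_finite[OF wf] wf_fin[OF wf] by (auto simp: zset_def)
 have vK: "v ~: ?K" using zcls_sub v_notin by blast
 have 1: "(SUM x:?K1. int (cwt H1 x)) = (SUM x:?K. int (cwt H x))"
 proof -
  have "(SUM x:?K. int (cwt H1 x)) = (SUM x:?K. int (cwt H x))"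
   by (rule sum.cong) (use vK in \<open>auto simp: H1_simps\<close>)
  moreover have "int (cwt H1 v) = 0" by (simp add: H1_simps)
  ultimately show ?thesis using cls1[OF wV] fin vK by (cases "v : ?K1") auto
 qed
 have 2: "int (card {f:zset H1 ll. fst (cends H1 f) : ?K1}) - int (card ?K1)
  = int (card {f:zset H mm. fst (cends H f) : ?K}) - int (card ?K)"
 proof (cases "v : ?K1")
  case True
  hence "?K1 = insert v ?K" using cls1[OF wV] by auto
  hence "card ?K1 = Suc (card ?K)" using fin vK by simp
  moreover have "card {f:zset H1 ll. fst (cends H1 f) : ?K1} = Suc (card {f:zset H mm. fst (cends H f) : ?K})"
   unfolding zcount(1)[OF wV] using True zcount(2)[OF wV True] fin by simp
  ultimately show ?thesis by simp
 next
  case False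
  hence "?K1 = ?K" using cls1[OF wV] by auto
  thus ?thesis using zcount(1)[OF wV] False by simp
 qed
 have "int (cwt C1 w) = int (cwt C w)"
  using cwt_curve_of[OF wf1 wr] cwt_curve_of[OF wf w] 1 2 by simp
 thus ?thesis by simp
qed

lemma cwt1_v: assumes "t ~= 0" live shows "cwt C1 v = 0"
proof -
 have vr: "v : zrep H1 ll ` cV H1" using rep_v[OF assms] by (force simp: H1_simps)
 have emp: "{f:zset H1 ll. fst (cends H1 f) = v} = {}"
 proof -
  have "fst (cends H1 f) ~= v" if f: "f : zset H1 ll" for f
  proof -
   have "f ~= e1" using assms zset_e1 f by auto
   moreover have "SE f ~= s" using assms(2) zset_s(1)[of f] f by (auto simp: live_def)
   ultimately have "f : zset H mm" using zset_other f by blast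
   thus ?thesis using zset_V[of f] ends_other[of f] \<open>SE f ~= s\<close> by (auto simp: zset_def)
  qed
  thus ?thesis by auto
 qed
 show ?thesis using cwt_curve_of[OF wf1 vr] cls_v[OF assms] by (simp add: H1_simps emp)
qed

definition sB :: "seg => real => pt" where
 "sB f u = (if f = s then (if u < t then PE e1 u else if u = t then PV (zrep H1 ll v) else ipt s (u - t)) else ipt f u)"

definition sbeta :: "pt => pt" where
 "sbeta x = (case x of PV w => PV w | PE f u => sB (SE f) u | PLg l u => sB (SL l) u)"

lemma sbeta_simps [simp]: "sbeta (PV w) = PV w" "sbeta (ipt f u) = sB f u"
 by (simp_all add: sbeta_def) (cases f; simp)

definition sG :: "seg => real => pt" where
 "sG f u = (if f = SE e1 then ipt s u else if f = s then ipt s (u + t) else ipt f u)"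

definition sgam :: "pt => pt" where
 "sgam x = (case x of PV w => if w = v then ipt s t else PV w | PE f u => sG (SE f) u | PLg l u => sG (SL l) u)"

lemma sgam_simps [simp]: "sgam (PV w) = (if w = v then ipt s t else PV w)" "sgam (ipt f u) = sG f u"
 by (simp_all add: sgam_def) (cases f; simp)

text \<open>At the cut parameter \<open>u = t\<close> the backward direction belongs to the first
  piece and the forward one to the second, hence one strict and one non-strict comparison.\<close>

definition sD :: "dir => dir" where
 "sD h = (case h of (f, u, sn) => if f = s then (if sn & u < t | ~  sn & u <= t then (SE e1, u, sn) else (s, u - t, sn))
   else (f, u, sn))"

definition sDi :: "dir => dir" where
 "sDi h = (case h of (f, u, sn) => if f = SE e1 then (s, u, sn) else if f = s then (s, u + t, sn) else (f, u, sn))"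

lemma segs_C: "SE f : segs C <-> f : cE H & mm f ~= 0" "SL l : segs C <-> l : cL H"
 by (auto simp: curve_of_simps zset_def)

lemma segs_C1: "SE f : segs C1 <-> f : insert e1 (cE H) & ll f ~= 0" "SL l : segs C1 <-> l : cL H"
 by (auto simp: curve_of_simps zset_def H1_simps)

lemma s_ne_e1: "s ~= SE e1" using e_e1 by auto

lemma segs_other: "f ~= s ==> f ~= SE e1 ==> f : segs C1 <-> f : segs C"
 using mm_other by (cases f) (auto simp: segs_C segs_C1 simp del: segs_SE segs_SL)

lemma sint_other: "f ~= s ==> f : segs C ==> sint C1 f u <-> sint C f u"
 using mm_other by (cases f) (auto simp: sint_def curve_of_simps)

lemma dom_other: "f ~= s ==> f : segs C ==> seg_dom C1 f u <-> seg_dom C f u"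
 using mm_other by (cases f) (auto simp: seg_dom_def curve_of_simps)

lemma segC_ne: "f : segs C ==> f ~= SE e1"
 using e1 by (auto simp: segs_C simp del: segs_SE)

lemma s_C1: "s : segs C1 <-> live"
 using s segs_C1 live_SE live_SL by (cases s) (auto simp del: segs_SE segs_SL, auto)

lemma s_C: "s : segs C <-> live | t ~= 0"
proof (cases s)
 case (SE e)
 have "SE e : segs C <-> ll e ~= 0 | t ~= 0"
  unfolding segs_C mm_s[OF SE] using e_e1[OF SE] nn by auto
 thus ?thesis using live_SE[OF SE] SE by metis
next
 case (SL l)
 have "SL l : segs C" unfolding segs_C using SL s by simp
 thus ?thesis using live_SL[OF SL] SL by metis
qed

lemma sint_s: "sint C s u <-> (0 < u & u < t) | (0 < u & u = t & live) | (live & t < u & sint C1 s (u - t))"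
proof (cases s)
 case (SE e)
 have 1: "sint C (SE e) u <-> 0 < u & u < ll e + t" "sint C1 (SE e) (u - t) <-> 0 < u - t & u - t < ll e"
  by (simp_all add: sint_def curve_of_simps mm_s[OF SE])
 have 2: "sint C s u <-> sint C (SE e) u" "sint C1 s (u - t) <-> sint C1 (SE e) (u - t)" using SE by metis+
 show ?thesis unfolding 2 1 live_SE[OF SE] using nn e_e1[OF SE] t_nn by auto
next
 case (SL l)
 have 1: "sint C (SL l) u <-> 0 < u" "sint C1 (SL l) (u - t) <-> 0 < u - t"
  by (simp_all add: sint_def)
 have 2: "sint C s u <-> sint C (SL l) u" "sint C1 s (u - t) <-> sint C1 (SL l) (u - t)" using SL by metis+
 show ?thesis unfolding 2 1 using live_SL[OF SL] t_nn by auto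
qed

lemma dom_s: "seg_dom C s u <-> 0 <= u & (u <= t | seg_dom C1 s (u - t))"
proof (cases s)
 case (SE e)
 have 1: "seg_dom C (SE e) u <-> 0 <= u & u <= ll e + t" "seg_dom C1 (SE e) (u - t) <-> 0 <= u - t & u - t <= ll e"
  by (simp_all add: seg_dom_def curve_of_simps mm_s[OF SE])
 have 2: "seg_dom C s u <-> seg_dom C (SE e) u" "seg_dom C1 s (u - t) <-> seg_dom C1 (SE e) (u - t)" using SE by metis+
 show ?thesis unfolding 2 1 using nn e_e1[OF SE] by auto
next
 case (SL l)
 have 1: "seg_dom C (SL l) u <-> 0 <= u" "seg_dom C1 (SL l) (u - t) <-> 0 <= u - t"
  by (simp_all add: seg_dom_def)
 have 2: "seg_dom C s u <-> seg_dom C (SL l) u" "seg_dom C1 s (u - t) <-> seg_dom C1 (SL l) (u - t)" using SL by metis+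
 show ?thesis unfolding 2 1 by auto
qed

lemma e1_C1: "SE e1 : segs C1 <-> t ~= 0" by (auto simp: segs_C1 simp del: segs_SE)

lemma sint_e1: "sint C1 (SE e1) u <-> 0 < u & u < t" by (simp add: sint_def curve_of_simps)

lemma sbeta_bij: "bij_betw sbeta (pts C) (pts C1)"
proof (rule bij_betw_byWitness[where f' = sgam])

 have VC: "cV C = zrep H mm ` cV H" by (simp add: curve_of_simps)
 show "ALL a:pts C. sgam (sbeta a) = a"
 proof
  fix a assume "a : pts C"
  then consider w where "a = PV w" "w : cV C" | f u where "a = ipt f u" "f : segs C" "sint C f u"
   by (auto simp: pts_alt)
  thus "sgam (sbeta a) = a"
  proof cases
   case 1
   thus ?thesis using v_notin_C VC by auto
  next
   case 2
   show ?thesis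
   proof (cases "f = s")
    case True
    then consider "0 < u" "u < t" | "0 < u" "u = t" live | "t < u" using 2(3) sint_s by blast
    thus ?thesis
    proof cases
     case 1
     thus ?thesis using True 2(1) sgam_simps(2)[of "SE e1" u] by (simp add: sB_def sG_def)
    next
     case c: 2
     thus ?thesis using True 2(1) rep_v by (simp add: sB_def)
    next
     case 3
     thus ?thesis using True 2(1) s_ne_e1 by (simp add: sB_def sG_def)
    qed
   next
    case False
    thus ?thesis using 2 segC_ne by (simp add: sB_def sG_def)
   qed
  qed
 qed
 show "ALL a:pts C1. sbeta (sgam a) = a"
 proof
  fix a assume "a : pts C1"
  then consider w where "a = PV w" "w : cV C1" | f u where "a = ipt f u" "f : segs C1" "sint C1 f u"
   by (auto simp: pts_alt)
  thus "sbeta (sgam a) = a"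
  proof cases
   case 1
   thus ?thesis using V_C1 v_notin_C by (cases "w = v") (auto simp: sB_def)
  next
   case 2
   consider "f = SE e1" | "f = s" | "f ~= SE e1" "f ~= s" by blast
   thus ?thesis
   proof cases
    case 1
    hence "u < t" using 2 sint_e1 by blast
    thus ?thesis using 1 2 sgam_simps(2)[of "SE e1" u] by (simp add: sB_def sG_def)
   next
    case c: 2
    hence "0 < u" using 2 by (cases s) (auto simp: sint_def)
    thus ?thesis using c 2 s_ne_e1 by (simp add: sB_def sG_def)
   next
    case 3
    thus ?thesis using 2 by (simp add: sB_def sG_def)
   qed
  qed
 qed
 show "sbeta ` pts C <= pts C1"
 proof
  fix b assume "b : sbeta ` pts C"
  then obtain a where a: "a : pts C" "b = sbeta a" by blast
  then consider w where "a = PV w" "w : cV C" | f u where "a = ipt f u" "f : segs C" "sint C f u"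
   by (auto simp: pts_alt)
  thus "b : pts C1"
  proof cases
   case 1
   thus ?thesis using a V_C1 VC by auto
  next
   case 2
   show ?thesis
   proof (cases "f = s")
    case True
    then consider "0 < u" "u < t" | "0 < u" "u = t" live | "t < u" live "sint C1 s (u - t)" using 2(3) sint_s by blast
    thus ?thesis
    proof cases
     case 1
     thus ?thesis using True 2(1) a e1_C1 sint_e1 pts_ipt[of "SE e1" u C1] by (simp add: sB_def)
    next
     case c: 2
     thus ?thesis using True 2(1) a V_C1 by (simp add: sB_def)
    next
     case 3
     thus ?thesis using True 2(1) a s_C1 by (simp add: sB_def)
    qed
   next
    case False
    thus ?thesis using 2 a segC_ne segs_other sint_other by (simp add: sB_def)
   qed
  qed
 qed
 show "sgam ` pts C1 <= pts C"
 proof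
  fix b assume "b : sgam ` pts C1"
  then obtain a where a: "a : pts C1" "b = sgam a" by blast
  then consider w where "a = PV w" "w : cV C1" | f u where "a = ipt f u" "f : segs C1" "sint C1 f u"
   by (auto simp: pts_alt)
  thus "b : pts C"
  proof cases
   case 1
   show ?thesis
   proof (cases "w = v")
    case True
    hence "t ~= 0" live using 1 V_C1 v_notin_C rep_v_old by auto
    moreover have "0 < t" using \<open>t ~= 0\<close> t_nn by simp
    ultimately have "sint C s t" "s : segs C" using sint_s s_C by auto
    thus ?thesis using True 1 a by simp
   next
    case False
    thus ?thesis using 1 a V_C1 VC rep_v rep_v_old by auto
   qed
  next
   case 2
   consider "f = SE e1" | "f = s" | "f ~= SE e1" "f ~= s" by blast
   thus ?thesis
   proof cases
    case 1
    hence "0 < u" "u < t" using 2 sint_e1 by blast+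
    thus ?thesis using 1 2 a sint_s s_C sgam_simps(2)[of "SE e1" u] by (simp add: sG_def)
   next
    case c: 2
    hence "0 < u" using 2 by (cases s) (auto simp: sint_def)
    hence "sint C s (u + t)" "s : segs C" using c 2 sint_s s_C s_C1 t_nn by auto
    thus ?thesis using c 2 a s_ne_e1 by (simp add: sG_def)
   next
    case 3
    thus ?thesis using 2 a segs_other sint_other by (simp add: sG_def)
   qed
  qed
 qed
qed

lemma dirs_alt: "(f, u, sn) : dirs K <-> f : segs K & seg_dom K f u & (~  sn --> 0 < u) &
  (sn --> (case f of SE e => u < clen K e | SL l => True))"
 by (auto simp: dirs_def)

lemma dirs_other: "f ~= s ==> f ~= SE e1 ==> (f, u, sn) : dirs C1 <-> (f, u, sn) : dirs C"
 unfolding dirs_alt using segs_other[of f] dom_other[of f] mm_other by (cases f) (auto simp: curve_of_simps segs_C simp del: segs_SE)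

lemma dirs_s: "(s, u, sn) : dirs C <-> (if sn & u < t | ~  sn & u <= t then (SE e1, u, sn) : dirs C1
   else (s, u - t, sn) : dirs C1)"
proof (cases s)
 case (SE e)
 hence e: "e : cE H" "0 <= ll e" "e ~= e1" using e_e1 nn by auto
 have 1: "(SE e, u, sn) : dirs C <-> ll e + t ~= 0 & 0 <= u & u <= ll e + t & (~  sn --> 0 < u) & (sn --> u < ll e + t)"
  unfolding dirs_alt segs_C using e by (simp add: seg_dom_def curve_of_simps mm_s[OF SE])
 have 2: "(SE e1, u, sn) : dirs C1 <-> t ~= 0 & 0 <= u & u <= t & (~  sn --> 0 < u) & (sn --> u < t)"
  unfolding dirs_alt segs_C1 by (simp add: seg_dom_def curve_of_simps)
 have 3: "(SE e, u - t, sn) : dirs C1 <-> ll e ~= 0 & 0 <= u - t & u - t <= ll e & (~  sn --> 0 < u - t) & (sn --> u - t < ll e)"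
  unfolding dirs_alt segs_C1 using e by (simp add: seg_dom_def curve_of_simps)
 have 4: "(s, u, sn) = (SE e, u, sn)" "(s, u - t, sn) = (SE e, u - t, sn)" using SE by auto
 show ?thesis unfolding 4 1 2 3 using e(2) t_nn by auto
next
 case (SL l)
 hence l: "l : cL H" using s by simp
 have 1: "(SL l, u, sn) : dirs C <-> 0 <= u & (~  sn --> 0 < u)"
  unfolding dirs_alt using l by (simp add: seg_dom_def curve_of_simps)
 have 2: "(SE e1, u, sn) : dirs C1 <-> t ~= 0 & 0 <= u & u <= t & (~  sn --> 0 < u) & (sn --> u < t)"
  unfolding dirs_alt segs_C1 by (simp add: seg_dom_def curve_of_simps)
 have 3: "(SL l, u - t, sn) : dirs C1 <-> 0 <= u - t & (~  sn --> 0 < u - t)"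
  unfolding dirs_alt segs_C1 using l by (simp add: seg_dom_def)
 have 4: "(s, u, sn) = (SL l, u, sn)" "(s, u - t, sn) = (SL l, u - t, sn)" using SL by auto
 show ?thesis unfolding 4 1 2 3 using t_nn by auto
qed

lemma dirs_s1: "(s, u, sn) : dirs C1 ==> 0 <= u & (~  sn --> 0 < u)"
 unfolding dirs_alt by (cases s) (auto simp: seg_dom_def)

lemma dirs_e1: "(SE e1, u, sn) : dirs C1 ==> (sn & u < t | ~  sn & u <= t)"
 unfolding dirs_alt by (auto simp: seg_dom_def curve_of_simps)

lemma sD_bij: "bij_betw sD (dirs C) (dirs C1)"
proof (rule bij_betw_byWitness[where f' = sDi])
 have ne: "(f, u, sn) : dirs C ==> f ~= SE e1" for f u sn using segC_ne dirs_segs by blast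
 show "ALL a:dirs C. sDi (sD a) = a"
 proof
  fix a assume a: "a : dirs C"
  obtain f u sn where h: "a = (f, u, sn)" by (cases a)
  show "sDi (sD a) = a" using a ne by (auto simp: h sD_def sDi_def)
 qed
 show "ALL a:dirs C1. sD (sDi a) = a"
 proof
  fix a assume a: "a : dirs C1"
  obtain f u sn where h: "a = (f, u, sn)" by (cases a)
  consider "f = SE e1" | "f = s" | "f ~= SE e1" "f ~= s" by blast
  thus "sD (sDi a) = a" using a dirs_e1[of u sn] dirs_s1[of u sn] by cases (auto simp: h sD_def sDi_def)
 qed
 show "sD ` dirs C <= dirs C1"
 proof
  fix b assume "b : sD ` dirs C"
  then obtain f u sn where h: "(f, u, sn) : dirs C" "b = sD (f, u, sn)" by (metis imageE prod_cases3)
  show "b : dirs C1"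
   using h ne[OF h(1)] dirs_s[of u sn] dirs_other[of f u sn] by (auto simp: sD_def)
 qed
 show "sDi ` dirs C1 <= dirs C"
 proof
  fix b assume "b : sDi ` dirs C1"
  then obtain f u sn where h: "(f, u, sn) : dirs C1" "b = sDi (f, u, sn)" by (metis imageE prod_cases3)
  consider "f = SE e1" | "f = s" | "f ~= SE e1" "f ~= s" by blast
  thus "b : dirs C"
  proof cases
   case 1
   thus ?thesis using h dirs_e1[of u sn] dirs_s[of u sn] by (simp add: sDi_def)
  next
   case 2
   thus ?thesis using h dirs_s1[of u sn] dirs_s[of "u + t" sn] s_ne_e1 by (auto simp: sDi_def)
  next
   case 3
   thus ?thesis using h dirs_other by (simp add: sDi_def)
  qed
 qed
qed

lemma pos_other: assumes "f : segs C" "f ~= s" "seg_dom C f u"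
 shows "sbeta (pos C f u) = pos C1 f u"
proof (cases f)
 case (SE e)
 hence e: "e : cE H" "mm e = ll e" "cends H1 e = cends H e" using assms mm_other ends_other by (auto simp: segs_C simp del: segs_SE)
 have r: "zrep H1 ll (fst (cends H e)) = zrep H mm (fst (cends H e))"
  "zrep H1 ll (snd (cends H e)) = zrep H mm (snd (cends H e))" using wf_ends[OF wf e(1)] rep1 by auto
 have "sbeta (PE e u) = PE e u" using sbeta_simps(2)[of "SE e" u] assms SE by (simp add: sB_def)
 thus ?thesis using e r SE by (auto simp: pos_def curve_of_simps)
next
 case (SL l)
 hence l: "l : cL H" "clegv H1 l = clegv H l" using assms legv_other by (auto simp: segs_C simp del: segs_SL)
 have r: "zrep H1 ll (clegv H l) = zrep H mm (clegv H l)" using wf_legv[OF wf l(1)] rep1 by auto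
 have "sbeta (PLg l u) = PLg l u" using sbeta_simps(2)[of "SL l" u] assms SL by (simp add: sB_def)
 thus ?thesis using l r SL by (auto simp: pos_def curve_of_simps)
qed

lemma pos_s0: "pos C s 0 = PV (zrep H mm st)"
 by (cases s) (auto simp: pos_def curve_of_simps segstart_def)

lemma pos_1: assumes "0 < t" "0 <= u" "u <= t" shows "sbeta (pos C s u) = pos C1 (SE e1) u"
proof -
 have st1: "zrep H1 ll st = zrep H mm st" using rep1[OF st_V] .
 consider "u = 0" | "0 < u" "u < t" | "u = t" live | "u = t" "~  live" using assms by fastforce
 thus ?thesis
 proof cases
  case 1
  thus ?thesis using pos_s0 st1 by (simp add: pos_def curve_of_simps H1_simps)
 next
  case 2
  hence "sint C s u" using sint_s by blast
  thus ?thesis using 2 by (simp add: pos_sint sB_def) (simp add: pos_def curve_of_simps)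
 next
  case 3
  hence "sint C s u" using sint_s assms by blast
  thus ?thesis using 3 assms by (simp add: pos_sint sB_def) (simp add: pos_def curve_of_simps H1_simps)
 next
  case 4
  then obtain e where e: "s = SE e" "ll e = 0" using not_live by blast
  have "pos C (SE e) u = PV (zrep H mm (snd (cends H e)))" using 4 assms mm_s[OF e(1)] e(2) by (simp add: pos_def curve_of_simps)
  hence "pos C s u = PV (zrep H mm (snd (cends H e)))" using e(1) by metis
  thus ?thesis using rep1_v_end[OF e] 4 assms by (simp add: pos_def curve_of_simps H1_simps)
 qed
qed

lemma pos_2: assumes "t <= u" "seg_dom C s u" live shows "sbeta (pos C s u) = pos C1 s (u - t)"
proof -
 have p0: "pos C1 s 0 = PV (zrep H1 ll v)"
 proof (cases s)
  case (SE e)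
  have "pos C1 (SE e) 0 = PV (zrep H1 ll v)" by (simp add: pos_def curve_of_simps ends_s[OF SE])
  thus ?thesis using SE by metis
 next
  case (SL l)
  have "pos C1 (SL l) 0 = PV (zrep H1 ll v)" by (simp add: pos_def curve_of_simps legv_s[OF SL])
  thus ?thesis using SL by metis
 qed
 show ?thesis
 proof (cases "u = t")
  case True
  show ?thesis
  proof (cases "t = 0")
   case True
   thus ?thesis using \<open>u = t\<close> pos_s0 p0 rep1_v_t0 by simp
  next
   case False
   hence "sint C s u" using sint_s assms t_nn True by auto
   thus ?thesis using True p0 by (simp add: pos_sint sB_def)
  qed
 next
  case False
  hence tu: "t < u" using assms by simp
  show ?thesis
  proof (cases "sint C s u")
   case True
   hence "sint C1 s (u - t)" using sint_s tu by auto
   thus ?thesis using True tu by (simp add: pos_sint sB_def)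
  next
   case ns: False
   obtain e where e: "s = SE e" using ns tu t_nn by (cases s) (auto simp: sint_def)
   have "~  sint C (SE e) u" "seg_dom C (SE e) u" using ns assms(2) e by metis+
   hence u: "u = ll e + t" using tu t_nn mm_s[OF e] by (auto simp: sint_def seg_dom_def curve_of_simps)
   have "0 < ll e" using u tu by simp
   moreover have "zrep H1 ll (snd (cends H e)) = zrep H mm (snd (cends H e))"
    using wf_ends[OF wf, of e] e_e1[OF e] rep1 by auto
   ultimately have "sbeta (pos C (SE e) u) = pos C1 (SE e) (u - t)"
    using u t_nn mm_s[OF e] ends_s[OF e] by (simp add: pos_def curve_of_simps)
   thus ?thesis using e by metis
  qed
 qed
qed

lemma mgerm_s: assumes h: "h : dirs C" shows "mgerm C C1 sbeta h (sD h) 1"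
proof -
 obtain f u sn where hh: "h = (f, u, sn)" by (cases h)
 obtain ep where e: "0 < ep" "!!dl. 0 < dl ==> dl <= ep ==> sint C f (mv sn u dl)"
  using dirs_small[OF h] by (auto simp: hh)
 have dom: "seg_dom C f (mv sn u dl)" if "0 <= dl" "dl <= ep" for dl
  using that e(2)[of dl] sint_seg_dom h by (cases "dl = 0") (auto simp: hh dirs_alt)
 have f: "f : segs C" using h hh dirs_segs by blast
 have D1: "sD h : dirs C1" using bij_betwE[OF sD_bij] h by blast
 show ?thesis
 proof (cases "f = s")
  case False
  hence D: "sD h = (f, u, sn)" by (simp add: hh sD_def)
  show ?thesis unfolding D unfolding hh by (rule mgermI[of ep]) (use e dom dom_other[OF False f] pos_other[OF f False] in auto)
 next
  case True
  show ?thesis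
  proof (cases "sn & u < t | ~  sn & u <= t")
   case c: True
   hence D: "sD h = (SE e1, u, sn)" using True by (simp add: hh sD_def)
   have u0: "0 <= u" "~  sn ==> 0 < u" using h True by (auto simp: hh dirs_alt dom_s)
   have tp: "0 < t" using c u0 by auto
   define et where "et = (if sn then min ep (t - u) else min ep u)"
   have eta: "0 < et" "et <= ep" using c e u0 by (auto simp: et_def)
   have mvb: "0 <= mv sn u dl" "mv sn u dl <= t" if "0 <= dl" "dl <= et" for dl
    using that c u0 by (auto simp: mv_def et_def)
   show ?thesis unfolding D unfolding hh True
   proof (rule mgermI[of et])
    fix dl assume d: "0 <= dl" "dl <= et"
    show "seg_dom C s (mv sn u dl)" using dom d eta True by auto
    show "seg_dom C1 (SE e1) (mv sn u (real 1 * dl))" using mvb[OF d] by (simp add: seg_dom_def curve_of_simps)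
    show "sbeta (pos C s (mv sn u dl)) = pos C1 (SE e1) (mv sn u (real 1 * dl))"
     using pos_1[OF tp mvb[OF d]] by simp
   qed (use eta in auto)
  next
   case c: False
   hence D: "sD h = (s, u - t, sn)" using True by (auto simp: hh sD_def)
   have lv: live using D1 D dirs_segs s_C1 by auto
   have ut: "t <= u" "~  sn ==> t < u" using c by auto
   define et where "et = (if sn then ep else min ep (u - t))"
   have eta: "0 < et" "et <= ep" using ut e by (auto simp: et_def)
   have mvb: "t <= mv sn u dl" "mv sn (u - t) dl = mv sn u dl - t" if "0 <= dl" "dl <= et" for dl
    using that ut by (auto simp: mv_def et_def)
   show ?thesis unfolding D unfolding hh True
   proof (rule mgermI[of et])
    fix dl assume d: "0 <= dl" "dl <= et"
    show dm: "seg_dom C s (mv sn u dl)" using dom d eta True by auto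
    show "seg_dom C1 s (mv sn (u - t) (real 1 * dl))"
    proof (cases "mv sn u dl = t")
     case True
     have "seg_dom C1 s 0"
     proof (cases s)
      case (SE e)
      have "seg_dom C1 (SE e) 0" using nn e_e1[OF SE] by (simp add: seg_dom_def curve_of_simps)
      thus ?thesis using SE by metis
     next
      case (SL l)
      have "seg_dom C1 (SL l) 0" by (simp add: seg_dom_def)
      thus ?thesis using SL by metis
     qed
     thus ?thesis using mvb[OF d] True by simp
    next
     case False
     thus ?thesis using mvb[OF d] dm dom_s by auto
    qed
    show "sbeta (pos C s (mv sn u dl)) = pos C1 s (mv sn (u - t) (real 1 * dl))"
     using pos_2[OF mvb(1)[OF d] dm lv] mvb(2)[OF d] by simp
   qed (use eta in auto)
  qed
 qed
qed

lemma subdiv_isom: "isom C C1 sbeta sD"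
 unfolding isom_def
proof (intro conjI ballI)
 show "bij_betw sbeta (pts C) (pts C1)" "bij_betw sD (dirs C) (dirs C1)" by (rule sbeta_bij sD_bij)+
 show "mgerm C C1 sbeta h (sD h) 1" if "h : dirs C" for h by (rule mgerm_s[OF that])
 show "cL C1 = cL C" by (simp add: curve_of_simps H1_simps)
 show "tgenus C1 = tgenus C" using tgenus_curve_of[OF wf1] tgenus_curve_of[OF wf] tgenus1 by simp
next
 fix x assume "x : pts C"
 then consider w where "x = PV w" "w : cV C" | f u where "x = ipt f u" "f : segs C" "sint C f u"
  by (auto simp: pts_alt)
 thus "gen C1 (sbeta x) = gen C x"
 proof cases
  case 1
  thus ?thesis using cwt1 by (simp add: gen_def curve_of_simps(1))
 next
  case 2
  show ?thesis
  proof (cases "f = s & u = t")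
   case True
   hence "0 < t" live using 2 sint_s[of u] by auto
   thus ?thesis using 2 cwt1_v rep_v by (simp add: sB_def) (simp add: gen_def)
  next
   case False
   thus ?thesis using 2 gen_ipt[of C1 "SE e1" u] by (auto simp: sB_def)
  qed
 qed
next
 fix l assume l: "l : cL C"
 have b: "sbeta (PLg l u) = sB (SL l) u" for u using sbeta_simps(2)[of "SL l" u] by simp
 show "mleg C C1 sbeta l l 1"
 proof (cases "SL l = s")
  case True
  have b': "sbeta (PLg l u) = sB s u" for u using b True by simp
  have ip: "ipt s u = PLg l u" for u by (metis True ipt_simps(2))
  show ?thesis by (rule mlegI[of _ "t + 1" "- t"]) (use t_nn in \<open>auto simp: b' sB_def ip\<close>)
 next
  case False
  show ?thesis by (rule mlegI[of _ 1 0]) (use False in \<open>auto simp: b sB_def\<close>)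
 qed
qed

end

text \<open>Records hold arbitrary values outside their vertex, edge and leg sets, so curves that
  agree on these sets are identified by an isometry instead of an equation.\<close>

lemma isom_id:
 assumes wf: "wf_graph C" and eq: "cV C' = cV C" "cE C' = cE C" "cL C' = cL C"
  "ALL e:cE C. cends C' e = cends C e & clen C' e = clen C e" "ALL l:cL C. clegv C' l = clegv C l"
  "ALL v:cV C. cwt C' v = cwt C v"
 shows "isom C C' id id"
proof -
 have sg: "segs C' = segs C" using eq by (simp add: segs_def)
 have sd: "seg_dom C' s t = seg_dom C s t" "sint C' s t = sint C s t" "pos C' s t = pos C s t"
  if "s : segs C" for s t
  using that eq by (auto simp: seg_dom_def sint_def pos_def split: seg.splits)
 have p: "pts C' = pts C" using eq(1) sg sd by (auto simp: pts_alt)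
 have d: "dirs C' = dirs C"
 proof -
  have "h : dirs C' <-> h : dirs C" for h
  proof -
   obtain s t sn where h: "h = (s, t, sn)" by (cases h)
   show ?thesis
   proof (cases "s : segs C")
    case True
    hence "(case s of SE e => t < clen C' e | SL l => True) = (case s of SE e => t < clen C e | SL l => True)"
     using eq(4) by (cases s) auto
    thus ?thesis using sg sd[OF True] by (auto simp: h dirs_def)
   next
    case False
    thus ?thesis using sg by (auto simp: h dirs_def)
   qed
  qed
  thus ?thesis by blast
 qed
 have g: "mgerm C C' id h h 1" if h: "h : dirs C" for h
 proof -
  obtain s t sn where hh: "h = (s, t, sn)" by (cases h)
  have s: "s : segs C" using h hh dirs_segs by blast
  obtain ep where e: "0 < ep" "!!dl. 0 < dl ==> dl <= ep ==> sint C s (mv sn t dl)"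
   using dirs_small[OF h] by (auto simp: hh)
  have dom: "seg_dom C s (mv sn t dl)" if "0 <= dl" "dl <= ep" for dl
   using that e(2)[of dl] sint_seg_dom h by (cases "dl = 0") (auto simp: hh dirs_def)
  show ?thesis unfolding hh by (rule mgermI[of ep]) (use e dom sd[OF s] in auto)
 qed
 have gn: "gen C' x = gen C x" if "x : pts C" for x
  using that eq by (cases x) (auto simp: gen_def)
 have l: "mleg C C' id l l 1" for l by (rule mlegI[of _ 1 0]) auto
 have tg: "tgenus C' = tgenus C" using eq by (simp add: tgenus_def)
 show ?thesis unfolding isom_def using p d g gn l tg eq(3) by simp
qed

lemma isom_curve_of_cong:
 assumes wf: "wf_graph G" and eq: "ALL e:cE G. ll' e = ll e"
 shows "isom (curve_of G ll) (curve_of G ll') id id"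
proof -
 have z: "zset G ll' = zset G ll" using eq by (auto simp: zset_def)
 hence "zcls G ll' = zcls G ll" by (auto simp: zcls_def)
 moreover from this have "zrep G ll' = zrep G ll" by (auto simp: zrep_def)
 ultimately show ?thesis using z eq by (intro isom_id wf_curve_of[OF wf]) (auto simp: curve_of_simps)
qed

lemma isom_curve_of_self:
 assumes C: "is_curve C"
 shows "isom C (curve_of C (clen C)) id id"
proof -
 have wf: "wf_graph C" using C by (rule is_curve_wf)
 have z: "zset C (clen C) = {}" using is_curve_len[OF C] by (force simp: zset_def)
 have "zcls C (clen C) v = {v}" if "v : cV C" for v
  using that by (auto simp: zcls_def z erel_def)
 moreover from this have "zrep C (clen C) v = v" if "v : cV C" for v using that by (simp add: zrep_def)
 ultimately show ?thesis using z wf_ends[OF wf] wf_legv[OF wf] by (intro isom_id wf) (auto simp: curve_of_simps)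
qed

section \<open>Valences and iterated subdivision\<close>

context subdiv_graph
begin

lemma fst_sets: "w : cV H ==> {f:cE H1. fst (cends H1 f) = w} =
  {f:cE H. SE f ~= s & fst (cends H f) = w} Un (if w = st then {e1} else {})"
proof -
 assume w: "w : cV H"
 have "f : cE H1 & fst (cends H1 f) = w <-> (f : cE H & SE f ~= s & fst (cends H f) = w) | (w = st & f = e1)" for f
  using w v_notin e1 ends_other[of f] ends_s[of f] H1_simps by (cases "f = e1"; cases "SE f = s") auto
 thus ?thesis by auto
qed

lemma snd_sets: "w : cV H ==> {f:cE H1. snd (cends H1 f) = w} = {f:cE H. snd (cends H f) = w}"
proof -
 assume w: "w : cV H"
 have "f : cE H1 & snd (cends H1 f) = w <-> f : cE H & snd (cends H f) = w" for f
  using w v_notin e1 ends_other[of f] ends_s[of f] H1_simps by (cases "f = e1"; cases "SE f = s") auto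
 thus ?thesis by auto
qed

lemma leg_sets: "w : cV H ==> {l:cL H1. clegv H1 l = w} = {l:cL H. SL l ~= s & clegv H l = w}"
proof -
 assume w: "w : cV H"
 have "l : cL H1 & clegv H1 l = w <-> l : cL H & SL l ~= s & clegv H l = w" for l
  using w v_notin legv_other[of l] legv_s[of l] H1_simps by (cases "SL l = s") auto
 thus ?thesis by auto
qed

text \<open>The start of the cut segment loses the half-edge of \<open>s\<close> and gains that of
  \<open>e1\<close>; elsewhere nothing happens.\<close>

lemma gval_old: assumes w: "w : cV H" shows "gval H1 w = gval H w"
proof -
 have fin: "finite (cE H)" "finite (cL H)" using wf_fin[OF wf] by auto
 have "card {f:cE H1. fst (cends H1 f) = w} + card {l:cL H1. clegv H1 l = w}
   = card {f:cE H. fst (cends H f) = w} + card {l:cL H. clegv H l = w}"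
 proof (cases "w = st")
  case False
  hence "SE f ~= s" if "fst (cends H f) = w" for f using that by (auto simp: segstart_def)
  moreover have "SL l ~= s" if "clegv H l = w" for l using that False by (auto simp: segstart_def)
  ultimately have "{f:cE H. SE f ~= s & fst (cends H f) = w} = {f:cE H. fst (cends H f) = w}"
   "{l:cL H. SL l ~= s & clegv H l = w} = {l:cL H. clegv H l = w}" by auto
  thus ?thesis unfolding fst_sets[OF w] leg_sets[OF w] using False by simp
 next
  case True
  have c1: "card ({f:cE H. SE f ~= s & fst (cends H f) = w} Un {e1}) = Suc (card {f:cE H. SE f ~= s & fst (cends H f) = w})"
   using fin e1 by simp
  show ?thesis
  proof (cases s)
   case (SE e)
   hence e: "e : cE H" "fst (cends H e) = w" using s True by (auto simp: segstart_def)
   have "{f:cE H. fst (cends H f) = w} = insert e {f:cE H. SE f ~= s & fst (cends H f) = w}" using e SE by auto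
   hence "card {f:cE H. fst (cends H f) = w} = Suc (card {f:cE H. SE f ~= s & fst (cends H f) = w})"
    using fin SE by simp
   moreover have "{l:cL H. SL l ~= s & clegv H l = w} = {l:cL H. clegv H l = w}" using SE by auto
   ultimately show ?thesis unfolding fst_sets[OF w] leg_sets[OF w] using c1 True by simp
  next
   case (SL l)
   hence l: "l : cL H" "clegv H l = w" using s True by (auto simp: segstart_def)
   have "{f:cL H. clegv H f = w} = insert l {f:cL H. SL f ~= s & clegv H f = w}" using l SL by auto
   hence "card {f:cL H. clegv H f = w} = Suc (card {f:cL H. SL f ~= s & clegv H f = w})"
    using fin SL by simp
   moreover have "{f:cE H. SE f ~= s & fst (cends H f) = w} = {f:cE H. fst (cends H f) = w}" using SL by auto
   ultimately show ?thesis unfolding fst_sets[OF w] leg_sets[OF w] using c1 True by simp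
  qed
 qed
 thus ?thesis unfolding gval_def snd_sets[OF w] by simp
qed

lemma new_sets:
 "{f:cE H1. fst (cends H1 f) = v} = {f. SE f = s}" "{f:cE H1. snd (cends H1 f) = v} = {e1}"
 "{l:cL H1. clegv H1 l = v} = {l. SL l = s}"
proof -
 have "f : cE H1 & fst (cends H1 f) = v <-> SE f = s" for f
  using v_notin e_e1[of f] st_V ends_other[of f] ends_s[of f] H1_simps wf_ends[OF wf, of f] by (cases "f = e1"; cases "SE f = s") auto
 thus "{f:cE H1. fst (cends H1 f) = v} = {f. SE f = s}" by auto
 have "f : cE H1 & snd (cends H1 f) = v <-> f = e1" for f
  using v_notin ends_other[of f] ends_s[of f] H1_simps wf_ends[OF wf, of f] by (cases "f = e1"; cases "SE f = s") auto
 thus "{f:cE H1. snd (cends H1 f) = v} = {e1}" by auto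
 have "l : cL H1 & clegv H1 l = v <-> SL l = s" for l
  using s v_notin legv_other[of l] legv_s[of l] H1_simps wf_legv[OF wf, of l] by (cases "SL l = s") auto
 thus "{l:cL H1. clegv H1 l = v} = {l. SL l = s}" by auto
qed

lemma gval_new: "gval H1 v = 2"
 unfolding gval_def new_sets by (cases s) auto

end

text \<open>\<open>lab\<close> records the segment of \<open>G\<close> on which an edge of
  \<open>H\<close> lies; \<open>vl\<close> is \<open>None\<close> at old vertices and gives the
  segment of an inserted one. No lengths occur, so that one subdivision serves a whole cone of
  lengths.\<close>

inductive subdiv :: "tcurve => tcurve => (nat => seg) => (nat => seg option) => bool" for G where
 subdiv_refl: "subdiv G G SE (%_. None)"
| subdiv_step: "subdiv G H lab vl ==> s : segs H ==> ALL w:cV H. w < v ==> e1 ~: cE H ==>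
   ls = (case s of SE e => lab e | SL l => SL l) ==>
   subdiv G (subdivide H s v e1) (lab(e1 := ls)) (vl(v := Some ls))"

definition pushl :: "tcurve => tcurve => (nat => seg) => (nat => real) => nat => real" where
 "pushl G H lab ll = (%e. if e : cE G then (SUM f:{f:cE H. lab f = SE e}. ll f) else 0)"

text \<open>The last clause is what the later count of tree edges relies on: everything around an
  inserted vertex lies on one segment of \<open>G\<close>, so a connected set of inserted vertices
  never leaves that segment.\<close>

lemma subdiv_inv:
 assumes "subdiv G H lab vl" "wf_graph G"
 shows "wf_graph H & tgenus H = tgenus G & cL H = cL G & (ALL f:cE H. lab f : segs G) &
  (ALL v:cV H. vl v = None --> v : cV G & cwt H v = cwt G v & gval H v = gval G v) &
  (ALL v:cV H. ALL s'. vl v = Some s' --> cwt H v = 0 & gval H v = 2 &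
    (ALL f:cE H. fst (cends H f) = v | snd (cends H f) = v --> lab f = s') &
    (ALL l:cL H. clegv H l = v --> SL l = s'))"
 using assms
proof induction
 case subdiv_refl
 thus ?case by auto
next
 case (subdiv_step H lab vl s v e1 ls)
 then interpret subdiv_graph H s v e1 by unfold_locales auto
 have IH: "wf_graph H" "tgenus H = tgenus G" "cL H = cL G" "ALL f:cE H. lab f : segs G"
  "ALL v:cV H. vl v = None --> v : cV G & cwt H v = cwt G v & gval H v = gval G v"
  "ALL v:cV H. ALL s'. vl v = Some s' --> cwt H v = 0 & gval H v = 2 &
    (ALL f:cE H. fst (cends H f) = v | snd (cends H f) = v --> lab f = s') &
    (ALL l:cL H. clegv H l = v --> SL l = s')"
  using subdiv_step by auto
 have ls: "ls : segs G" using subdiv_step.hyps(5) s IH(3,4) by (cases s) auto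

 have ls_st: "ls = s'" if "vl st = Some s'" for s'
 proof (cases s)
  case (SE e)
  thus ?thesis using IH(6) st_V that s subdiv_step.hyps(5) by (auto simp: segstart_def)
 next
  case (SL l)
  have "ls = SL l" using subdiv_step.hyps(5) SL by simp
  moreover have "SL l = s'" using IH(6) st_V that s unfolding SL segstart_def by simp
  ultimately show ?thesis by simp
 qed
 have old: "cwt H1 w = 0 & gval H1 w = 2 &
    (ALL f:cE H1. fst (cends H1 f) = w | snd (cends H1 f) = w --> (lab(e1 := ls)) f = s') &
    (ALL l:cL H1. clegv H1 l = w --> SL l = s')" if w: "w : cV H" "vl w = Some s'" for w s'
 proof -
  have 1: "cwt H w = 0" "gval H w = 2" "ALL f:cE H. fst (cends H f) = w | snd (cends H f) = w --> lab f = s'"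
    "ALL l:cL H. clegv H l = w --> SL l = s'" using IH(6) w by auto
  have "(lab(e1 := ls)) f = s'" if f: "f : cE H1" "fst (cends H1 f) = w | snd (cends H1 f) = w" for f
  proof -
   have "f : {f:cE H1. fst (cends H1 f) = w} Un {f:cE H1. snd (cends H1 f) = w}" using f by auto
   thus ?thesis unfolding fst_sets[OF w(1)] snd_sets[OF w(1)] using 1(3) ls_st w(2) e1 by (auto split: if_splits)
  qed
  moreover have "SL l = s'" if "l : cL H1" "clegv H1 l = w" for l
   using that leg_sets[OF w(1)] 1(4) by blast
  moreover have "w ~= v" using w v_notin by auto
  ultimately show ?thesis using 1 gval_old[OF w(1)] by (simp add: H1_simps)
 qed
 have new: "(lab(e1 := ls)) f = ls" if "f : cE H1" "fst (cends H1 f) = v | snd (cends H1 f) = v" for f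
 proof -
  have "f : {f:cE H1. fst (cends H1 f) = v} Un {f:cE H1. snd (cends H1 f) = v}" using that by auto
  thus ?thesis unfolding new_sets using subdiv_step.hyps(5) by auto
 qed
 have newl: "SL l = ls" if "l : cL H1" "clegv H1 l = v" for l
 proof -
  have "l : {l:cL H1. clegv H1 l = v}" using that by auto
  thus ?thesis unfolding new_sets using subdiv_step.hyps(5) by auto
 qed
 show ?case
 proof (intro conjI)
  show "wf_graph H1" by (rule wf1)
  show "tgenus H1 = tgenus G" using tgenus1 IH by simp
  show "cL H1 = cL G" using IH H1_simps by simp
  show "ALL f:cE H1. (lab(e1 := ls)) f : segs G" using IH(4) ls H1_simps by auto
  show "ALL w:cV H1. (vl(v := Some ls)) w = None --> w : cV G & cwt H1 w = cwt G w & gval H1 w = gval G w"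
   using IH(5) gval_old H1_simps by auto
  show "ALL w:cV H1. ALL s'. (vl(v := Some ls)) w = Some s' --> cwt H1 w = 0 & gval H1 w = 2 &
    (ALL f:cE H1. fst (cends H1 f) = w | snd (cends H1 f) = w --> (lab(e1 := ls)) f = s') &
    (ALL l:cL H1. clegv H1 l = w --> SL l = s')"
  proof (intro ballI allI impI)
   fix w s' assume w: "w : cV H1" "(vl(v := Some ls)) w = Some s'"
   show "cwt H1 w = 0 & gval H1 w = 2 &
    (ALL f:cE H1. fst (cends H1 f) = w | snd (cends H1 f) = w --> (lab(e1 := ls)) f = s') &
    (ALL l:cL H1. clegv H1 l = w --> SL l = s')"
   proof (cases "w = v")
    case True
    hence "s' = ls" using w by simp
    thus ?thesis using True new newl gval_new H1_simps(5) by auto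
   next
    case False
    thus ?thesis using old[of w s'] w H1_simps(1) by auto
   qed
  qed
 qed
qed

lemma subdiv_vfresh: "wf_graph H ==> EX v. ALL w:cV H. w < v"
 using wf_fin finite_nat_set_iff_bounded by blast

lemma subdiv_efresh: "wf_graph H ==> EX e. e ~: cE H"
 using wf_fin infinite_UNIV_nat by (metis ex_new_if_finite)

lemma pushl_step:
 assumes "subdiv_graph H s v e1" and ls: "ls = (case s of SE e => lab e | SL l => SL l)"
 shows "pushl G (subdivide H s v e1) (lab(e1 := ls)) ll = pushl G H lab (mlen s e1 ll)"
proof -
 interpret subdiv_graph H s v e1 by fact
 have fin: "finite (cE H)" using wf_fin[OF wf] by simp
 have "(SUM f:{f:cE H1. (lab(e1 := ls)) f = SE e}. ll f) = (SUM f:{f:cE H. lab f = SE e}. mlen s e1 ll f)" for e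
 proof -
  have 1: "{f:cE H1. (lab(e1 := ls)) f = SE e} = {f:cE H. lab f = SE e} Un (if ls = SE e then {e1} else {})"
   using e1 by (auto simp: H1_simps)
  have L: "(SUM f:{f:cE H1. (lab(e1 := ls)) f = SE e}. ll f) = (SUM f:{f:cE H. lab f = SE e}. ll f)
    + (if ls = SE e then ll e1 else 0)"
   unfolding 1 using e1 fin by simp
  show ?thesis
  proof (cases s)
   case (SE e0)
   have e0: "e0 : cE H" "e0 ~= e1" using e_e1[OF SE] by auto
   have "(SUM f:{f:cE H. lab f = SE e}. mlen s e1 ll f) = (SUM f:{f:cE H. lab f = SE e}. ll f + (if f = e0 then ll e1 else 0))"
    by (rule sum.cong) (use e1 SE in \<open>auto simp: mlen_def\<close>)
   also have "... = (SUM f:{f:cE H. lab f = SE e}. ll f) + (if ls = SE e then ll e1 else 0)"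
    using fin e0 ls SE by (simp add: sum.distrib)
   finally show ?thesis using L by simp
  next
   case (SL l)
   have "(SUM f:{f:cE H. lab f = SE e}. mlen s e1 ll f) = (SUM f:{f:cE H. lab f = SE e}. ll f)"
    by (rule sum.cong) (use e1 SL in \<open>auto simp: mlen_def\<close>)
   thus ?thesis using L ls SL by simp
  qed
 qed
 thus ?thesis unfolding pushl_def by presburger
qed

lemma subdiv_isom:
 assumes "subdiv G H lab vl" "wf_graph G" "ALL e:cE H. 0 <= ll e"
 shows "EX bt D. isom (curve_of G (pushl G H lab ll)) (curve_of H ll) bt D"
 using assms
proof (induction arbitrary: ll)
 case subdiv_refl
 have "ALL e:cE G. ll e = pushl G G SE ll e"
 proof
  fix e assume "e : cE G"
  hence "{f:cE G. SE f = SE e} = {e}" by auto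
  thus "ll e = pushl G G SE ll e" using \<open>e : cE G\<close> by (simp add: pushl_def)
 qed
 thus ?case using isom_curve_of_cong subdiv_refl by blast
next
 case (subdiv_step H lab vl s v e1 ls)
 have wf: "wf_graph H" using subdiv_inv subdiv_step by blast
 have g: "subdiv_graph H s v e1" using subdiv_step wf by unfold_locales auto
 then interpret subdiv_graph H s v e1 .
 interpret subdiv_step H s v e1 ll using subdiv_step.prems H1_simps by unfold_locales auto
 obtain bt D where "isom (curve_of G (pushl G H lab mm)) (curve_of H mm) bt D"
  using subdiv_step.IH[OF subdiv_step.prems(1) mm_nn] by blast
 from isom_trans[OF this subdiv_isom] show ?case
  unfolding pushl_step[OF g subdiv_step.hyps(5)] by blast
qed

text \<open>Turns a finite set of points into vertices, one point at a time. Only the subdivision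
  grows while \<open>G\<close> is kept, so the new lengths stay related to the old ones by
  \<open>pushl\<close>.\<close>

lemma refine:
 assumes wf: "wf_graph G" and nn: "ALL e:cE G. 0 <= ll e" and X: "finite X" "X <= pts (curve_of G ll)"
 shows "EX H lab vl ll' bt D. subdiv G H lab vl & (ALL e:cE H. 0 <= ll' e) & (ALL e:cE G. pushl G H lab ll' e = ll e) &
  isom (curve_of G ll) (curve_of H ll') bt D &
  PV ` cV (curve_of H ll') = bt ` (X Un PV ` cV (curve_of G ll))"
 using X
proof induction
 case empty
 have "pushl G G SE ll e = ll e" if "e : cE G" for e
 proof -
  have "{f:cE G. SE f = SE e} = {e}" using that by auto
  thus ?thesis using that by (simp add: pushl_def)
 qed
 moreover have "isom (curve_of G ll) (curve_of G ll) id id" by (rule isom_curve_of_cong[OF wf]) simp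
 ultimately show ?case using subdiv_refl[of G] nn by (metis image_id sup_bot_left id_apply)
next
 case (insert x X)
 then obtain H lab vl ll' bt D where IH: "subdiv G H lab vl" "ALL e:cE H. 0 <= ll' e"
  "ALL e:cE G. pushl G H lab ll' e = ll e" "isom (curve_of G ll) (curve_of H ll') bt D"
  "PV ` cV (curve_of H ll') = bt ` (X Un PV ` cV (curve_of G ll))" by auto
 show ?case
 proof (cases "bt x : PV ` cV (curve_of H ll')")
  case True
  hence "PV ` cV (curve_of H ll') = bt ` (insert x X Un PV ` cV (curve_of G ll))" using IH(5) by auto
  thus ?thesis using IH by blast
 next
  case False
  have bx: "bt x : pts (curve_of H ll')" using IH(4) insert by (auto simp: isom_def bij_betw_def)
  then obtain s t where st: "bt x = ipt s t" "s : segs (curve_of H ll')" "sint (curve_of H ll') s t"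
   using False by (auto simp: pts_alt)
  have wfH: "wf_graph H" using subdiv_inv[OF IH(1) wf] by blast
  obtain v where v: "ALL w:cV H. w < v" using subdiv_vfresh[OF wfH] by blast
  obtain e1 where e1: "e1 ~: cE H" using subdiv_efresh[OF wfH] by blast
  have sH: "s : segs H" using st(2) by (cases s) (auto simp: curve_of_simps)
  have g: "subdiv_graph H s v e1" using wfH v e1 sH by unfold_locales auto
  \<comment> \<open>The point sits at parameter \<open>t\<close> of its segment: the first piece
    gets length \<open>t\<close> and the rest what remains, so that \<open>mlen\<close> returns the
    old lengths.\<close>
  define l2 where "l2 = (case s of SE e => ll'(e := ll' e - t, e1 := t) | SL l => ll'(e1 := t))"
  have t0: "0 < t" using st(3) by (cases s) (auto simp: sint_def)
  have l2: "ALL e:insert e1 (cE H). 0 <= l2 e"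
   using st(3) IH(2) by (cases s) (auto simp: l2_def sint_def curve_of_simps)
  have l2e1: "l2 e1 = t" by (cases s) (auto simp: l2_def)
  have ml: "ALL e:cE H. mlen s e1 l2 e = ll' e"
   using e1 by (cases s) (auto simp: l2_def mlen_def)
  interpret subdiv_graph H s v e1 by (rule g)
  interpret subdiv_step H s v e1 l2 using l2 by unfold_locales auto
  define ls where "ls = (case s of SE e => lab e | SL l => SL l)"
  have i1: "isom (curve_of H ll') (curve_of H (mlen s e1 l2)) id id"
   by (rule isom_curve_of_cong[OF wfH ml])
  have i: "isom (curve_of G ll) C1 (sbeta o (id o bt)) (sD o (id o D))"
   by (rule isom_trans[OF isom_trans[OF IH(4) i1] subdiv_isom])
  have "PV ` cV (curve_of H ll') = PV ` cV C"
   using ml by (simp add: curve_of_simps zrep_def zcls_def zset_def cong: conj_cong)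
  hence P: "PV ` cV C = bt ` (X Un PV ` cV (curve_of G ll))" using IH(5) by simp
  have "sbeta ` PV ` cV C = PV ` cV C" by (simp add: image_image)
  moreover have "sbeta (bt x) = PV (zrep H1 l2 v)" using st l2e1 by (simp add: sB_def)
  ultimately have "PV ` cV C1 = insert (sbeta (bt x)) (sbeta ` PV ` cV C)"
   using V_C1 by (auto simp: curve_of_simps)
  also have "... = (sbeta o (id o bt)) ` (insert x X Un PV ` cV (curve_of G ll))"
   unfolding P by auto
  finally have 1: "PV ` cV C1 = (sbeta o (id o bt)) ` (insert x X Un PV ` cV (curve_of G ll))" .
  have 2: "subdiv G H1 (lab(e1 := ls)) (vl(v := Some ls))"
   by (rule subdiv_step[OF IH(1) sH v e1 ls_def])
  have 3: "ALL e:cE H1. 0 <= l2 e" using l2 H1_simps by simp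
  have 4: "ALL e:cE G. pushl G H1 (lab(e1 := ls)) l2 e = ll e"
  proof -
   have "pushl G H lab (mlen s e1 l2) = pushl G H lab ll'"
    unfolding pushl_def using ml by auto
   thus ?thesis using IH(3) unfolding pushl_step[OF g ls_def] by simp
  qed
  show ?thesis using 1 2 3 4 i by blast
 qed
qed

section \<open>Piecewise linear maps between tropical curves\<close>

lemma affine_agree:
 fixes b c b' c' t ep :: real
 assumes "0 < ep" "!!u. \<bar>u - t\<bar> < ep ==> b + c * u = b' + c' * u"
 shows "b = b' & c = c'"
proof -
 have 1: "b + c * t = b' + c' * t" using assms(2)[of t] assms(1) by simp
 have 2: "b + c * (t + ep / 2) = b' + c' * (t + ep / 2)" using assms(2)[of "t + ep / 2"] assms(1) by simp
 have "b + (c * t + c * (ep / 2)) = b' + (c' * t + c' * (ep / 2))" using 2 by (simp only: distrib_left)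
 hence "c * (ep / 2) = c' * (ep / 2)" using 1 by linarith
 hence "c = c'" using assms(1) by simp
 thus ?thesis using 1 by simp
qed

lemma connected_sint: "connected {t. sint C s t}"
proof (cases s)
 case (SE e)
 hence "{t. sint C s t} = {0<..<clen C e}" by (auto simp: sint_def)
 thus ?thesis by simp
next
 case (SL l)
 hence "{t. sint C s t} = {0<..}" by (auto simp: sint_def)
 thus ?thesis by simp
qed

locale pl_map =
 fixes C1 C2 :: tcurve and sn :: "pt => pt" and Dm :: "dir => dir" and k :: "dir => nat"
 assumes C1: "is_curve C1" and C2: "is_curve C2"
  and g: "!!h. h : dirs C1 ==> Dm h : dirs C2 & mgerm C1 C2 sn h (Dm h) (k h)"
begin

lemma k_pos: "h : dirs C1 ==> 0 < k h"
 using g mgerm_pos by blast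

lemma germ_in:
 assumes h: "(s, t, ta) : dirs C1" and D: "Dm (s, t, ta) = (s', t', ta')"
 obtains ep where "0 < ep" "!!dl. 0 < dl ==> dl <= ep ==> sint C1 s (mv ta t dl)"
  "!!dl. 0 < dl ==> dl <= ep ==> sint C2 s' (mv ta' t' (real (k (s, t, ta)) * dl))"
  "!!dl. 0 < dl ==> dl <= ep ==> sn (ipt s (mv ta t dl)) = ipt s' (mv ta' t' (real (k (s, t, ta)) * dl))"
proof -
 let ?k = "real (k (s, t, ta))"
 have Dd: "(s', t', ta') : dirs C2" and m: "mgerm C1 C2 sn (s, t, ta) (s', t', ta') (k (s, t, ta))"
  using g[OF h] D by auto
 obtain ep0 where e0: "0 < ep0" "0 < k (s, t, ta)"
  "!!dl. 0 <= dl ==> dl <= ep0 ==> sn (pos C1 s (mv ta t dl)) = pos C2 s' (mv ta' t' (?k * dl))"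
  using m by (rule mgermE) blast
 obtain ep1 where e1: "0 < ep1" "!!dl. 0 < dl ==> dl <= ep1 ==> sint C1 s (mv ta t dl)"
  using dirs_small[OF h] by auto
 obtain ep2 where e2: "0 < ep2" "!!dl. 0 < dl ==> dl <= ep2 ==> sint C2 s' (mv ta' t' dl)"
  using dirs_small[OF Dd] by auto
 have kp: "?k > 0" using e0 by simp
 define ep where "ep = min ep0 (min ep1 (ep2 / ?k))"
 have le: "dl <= ep0 & dl <= ep1 & ?k * dl <= ep2 & 0 < ?k * dl" if "0 < dl" "dl <= ep" for dl
  using that kp by (auto simp: ep_def field_simps)
 show ?thesis
 proof (rule that[of ep])
  show "0 < ep" using e0 e1 e2 by (simp add: ep_def)
  fix dl assume d: "0 < dl" "dl <= ep"
  note l = le[OF d]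
  show 1: "sint C1 s (mv ta t dl)" using e1 d l by blast
  show 2: "sint C2 s' (mv ta' t' (?k * dl))" using e2 l by blast
  show "sn (ipt s (mv ta t dl)) = ipt s' (mv ta' t' (?k * dl))"
   using e0(3)[of dl] d l pos_sint[OF 1] pos_sint[OF 2] by simp
 qed
qed

lemma dir_avoids:
 assumes h: "(s, t, ta) : dirs C1" and Y: "finite Y"
 obtains ep where "0 < ep" "!!dl. 0 < dl ==> dl <= ep ==> sn (ipt s (mv ta t dl)) ~: Y"
proof -
 obtain s' t' ta' where D: "Dm (s, t, ta) = (s', t', ta')" by (cases "Dm (s, t, ta)")
 obtain ep0 where e: "0 < ep0" "!!dl. 0 < dl ==> dl <= ep0 ==> sint C1 s (mv ta t dl)"
  "!!dl. 0 < dl ==> dl <= ep0 ==> sint C2 s' (mv ta' t' (real (k (s, t, ta)) * dl))"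
  "!!dl. 0 < dl ==> dl <= ep0 ==> sn (ipt s (mv ta t dl)) = ipt s' (mv ta' t' (real (k (s, t, ta)) * dl))"
  by (rule germ_in[OF h D]) blast
 have kp: "real (k (s, t, ta)) > 0" using k_pos[OF h] by simp
 define B where "B = {dl. 0 < dl & dl <= ep0 & sn (ipt s (mv ta t dl)) : Y}"
 have "inj_on (%dl. sn (ipt s (mv ta t dl))) B"
  using e(4) kp by (auto simp: inj_on_def B_def mv_inj)
 moreover have "(%dl. sn (ipt s (mv ta t dl))) ` B <= Y" by (auto simp: B_def)
 ultimately have fB: "finite B" using Y by (metis inj_on_finite)
 define ep where "ep = Min (insert ep0 B) / 2"
 have m: "Min (insert ep0 B) : insert ep0 B" using fB by (intro Min_in) auto
 hence mp: "0 < Min (insert ep0 B)" using e(1) by (auto simp: B_def)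
 have "sn (ipt s (mv ta t dl)) ~: Y" if d: "0 < dl" "dl <= ep" for dl
 proof
  assume a: "sn (ipt s (mv ta t dl)) : Y"
  have l: "dl < Min (insert ep0 B)" using d by (simp add: ep_def)
  hence "dl < ep0" using fB by simp
  hence "dl : B" using a d by (simp add: B_def)
  hence "Min (insert ep0 B) <= dl" using fB by (intro Min_le) auto
  thus False using l by simp
 qed
 thus ?thesis using that[of ep] mp by (simp add: ep_def)
qed

text \<open>Positive slopes make the map injective along short germs, so the preimage of a finite
  set is discrete on every segment. Compactness of edges and the injective linear tail of legs make
  it finite.\<close>

lemma finite_preimage:
 assumes Y: "finite Y" and L: "!!l. l : cL C1 ==> EX l' m. mleg C1 C2 sn l l' m"
 shows "finite {x:pts C1. sn x : Y}"
proof -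
 define B where "B s = {t. sint C1 s t & sn (ipt s t) : Y}" for s
 have loc: "EX d>0. B s Int {x - d..x + d} <= {x}" if s: "s : segs C1" and x: "seg_dom C1 s x" for s x
 proof -
  have up: "EX d>0. ALL dl. 0 < dl & dl <= d --> x + dl ~: B s"
  proof (cases "(s, x, True) : dirs C1")
   case True
   obtain ep where "0 < ep" "!!dl. 0 < dl ==> dl <= ep ==> sn (ipt s (mv True x dl)) ~: Y"
    by (rule dir_avoids[OF True Y]) blast
   thus ?thesis by (auto simp: mv_def B_def)
  next
   case False
   hence "~  sint C1 s (x + dl)" if "0 < dl" for dl
    using that x s by (cases s) (auto simp: dirs_def sint_def seg_dom_def)
   thus ?thesis by (intro exI[of _ 1]) (auto simp: B_def)
  qed
  have dn: "EX d>0. ALL dl. 0 < dl & dl <= d --> x - dl ~: B s"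
  proof (cases "(s, x, False) : dirs C1")
   case True
   obtain ep where "0 < ep" "!!dl. 0 < dl ==> dl <= ep ==> sn (ipt s (mv False x dl)) ~: Y"
    by (rule dir_avoids[OF True Y]) blast
   thus ?thesis by (auto simp: mv_def B_def)
  next
   case False
   hence "~  sint C1 s (x - dl)" if "0 < dl" for dl
    using that x s by (cases s) (auto simp: dirs_def sint_def seg_dom_def)
   thus ?thesis by (intro exI[of _ 1]) (auto simp: B_def)
  qed
  obtain d1 where d1: "0 < d1" "ALL dl. 0 < dl & dl <= d1 --> x + dl ~: B s" using up by blast
  obtain d2 where d2: "0 < d2" "ALL dl. 0 < dl & dl <= d2 --> x - dl ~: B s" using dn by blast
  have "u = x" if u: "u : B s" "x - min d1 d2 <= u" "u <= x + min d1 d2" for u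
  proof (rule ccontr)
   assume "u ~= x"
   then consider "x < u" | "u < x" by linarith
   thus False
   proof cases
    case 1
    thus False using d1(2)[rule_format, of "u - x"] u by simp linarith
   next
    case 2
    thus False using d2(2)[rule_format, of "x - u"] u by simp linarith
   qed
  qed
  thus ?thesis using d1 d2 by (intro exI[of _ "min d1 d2"]) auto
 qed
 have fin_int: "finite (B s Int {0..b})" if s: "s : segs C1" and b: "0 <= b" "!!x. 0 <= x ==> x <= b ==> seg_dom C1 s x" for s b
  using b(1)
 proof (induction rule: Bolzano)
  case (trans a b c)
  hence "B s Int {a..c} <= (B s Int {a..b}) Un (B s Int {b..c})" by auto
  thus ?case using trans by (meson finite_UnI finite_subset)
 next
  case (local x)
  then obtain d where d: "0 < d" "B s Int {x - d..x + d} <= {x}" using loc[OF s b(2)] by blast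
  show ?case
  proof (intro exI[of _ d] conjI allI impI)
   fix p q assume pq: "p <= x & x <= q & q - p < d"
   hence "B s Int {p..q} <= {x}" using d by auto
   thus "finite (B s Int {p..q})" using finite_subset by blast
  qed (use d in simp)
 qed
 have fB: "finite (B s)" if s: "s : segs C1" for s
 proof (cases s)
  case (SE e)
  hence "0 < clen C1 e" using is_curve_len[OF C1] s by simp
  hence "finite (B s Int {0..clen C1 e})"
   by (intro fin_int[OF s]) (auto simp: SE seg_dom_def)
  moreover have "B s Int {0..clen C1 e} = B s" by (auto simp: B_def SE sint_def)
  ultimately show ?thesis by simp
 next
  case (SL l)
  hence "l : cL C1" using s by simp
  then obtain l' m where "mleg C1 C2 sn l l' m" using L by blast
  then obtain T c where T: "0 < m" "0 < T" "!!t. t >= T ==> sn (PLg l t) = PLg l' (real m * t + c)"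
   by (auto simp: mleg_def)
  have 1: "finite (B s Int {0..T})" using T by (intro fin_int[OF s]) (auto simp: SL seg_dom_def)
  have "inj_on (%t. sn (ipt s t)) (B s Int {T..})" using T by (auto simp: inj_on_def SL)
  moreover have "(%t. sn (ipt s t)) ` (B s Int {T..}) <= Y" by (auto simp: B_def)
  ultimately have 2: "finite (B s Int {T..})" using Y by (metis inj_on_finite)
  have "B s <= (B s Int {0..T}) Un (B s Int {T..})" by (auto simp: B_def SL sint_def)
  thus ?thesis using 1 2 finite_subset by blast
 qed
 have "{x:pts C1. sn x : Y} <= PV ` cV C1 Un (UN s:segs C1. ipt s ` B s)"
  by (auto simp: pts_alt B_def)
 moreover have "finite (PV ` cV C1 Un (UN s:segs C1. ipt s ` B s))"
  using fB wf_fin[OF is_curve_wf[OF C1]] by (auto simp: segs_def)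
 ultimately show ?thesis by (rule finite_subset)
qed

end

text \<open>The situation after refinement: vertices go to vertices, and at interior points the map
  runs straight on with a single slope. Nothing folds or bends inside a segment.\<close>

locale straight_map = pl_map +
 assumes V: "!!v. v : cV C1 ==> sn (PV v) : PV ` cV C2"
  and N: "!!s t. s : segs C1 ==> sint C1 s t ==> EX s' t' ta. s' : segs C2 & sint C2 s' t' & sn (ipt s t) = ipt s' t' &
    Dm (s, t, True) = (s', t', ta) & Dm (s, t, False) = (s', t', ~  ta) & k (s, t, True) = k (s, t, False)"
begin

lemma loc_affine:
 assumes s: "s : segs C1" and t: "sint C1 s t"
 shows "EX ep>0. EX s' c b. c ~= 0 & s' : segs C2 & (ALL u. \<bar>u - t\<bar> < ep --> sint C1 s u & sint C2 s' (b + c * u) & sn (ipt s u) = ipt s' (b + c * u))"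
proof -
 obtain s' t' ta where st: "s' : segs C2" "sint C2 s' t'" "sn (ipt s t) = ipt s' t'"
  "Dm (s, t, True) = (s', t', ta)" "Dm (s, t, False) = (s', t', ~  ta)" "k (s, t, True) = k (s, t, False)"
  using N[OF s t] by blast
 have d: "(s, t, True) : dirs C1" "(s, t, False) : dirs C1"
  using s t by (auto simp: dirs_def sint_seg_dom sint_def split: seg.splits)
 let ?k = "real (k (s, t, True))"
 have kp: "?k > 0" using k_pos[OF d(1)] by simp
 obtain ep1 where e1: "0 < ep1" "!!dl. 0 < dl ==> dl <= ep1 ==> sint C1 s (mv True t dl)"
  "!!dl. 0 < dl ==> dl <= ep1 ==> sint C2 s' (mv ta t' (?k * dl))"
  "!!dl. 0 < dl ==> dl <= ep1 ==> sn (ipt s (mv True t dl)) = ipt s' (mv ta t' (?k * dl))"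
  by (rule germ_in[OF d(1) st(4)]) blast
 obtain ep2 where e2: "0 < ep2" "!!dl. 0 < dl ==> dl <= ep2 ==> sint C1 s (mv False t dl)"
  "!!dl. 0 < dl ==> dl <= ep2 ==> sint C2 s' (mv (~  ta) t' (real (k (s, t, False)) * dl))"
  "!!dl. 0 < dl ==> dl <= ep2 ==> sn (ipt s (mv False t dl)) = ipt s' (mv (~  ta) t' (real (k (s, t, False)) * dl))"
  by (rule germ_in[OF d(2) st(5)]) blast
 define c where "c = (if ta then ?k else - ?k)"
 define b where "b = t' - c * t"
 have "sint C1 s u & sint C2 s' (b + c * u) & sn (ipt s u) = ipt s' (b + c * u)" if u: "\<bar>u - t\<bar> < min ep1 ep2" for u
 proof -
  consider "u = t" | "t < u" | "u < t" by linarith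
  thus ?thesis
  proof cases
   case 1
   thus ?thesis using st t by (simp add: b_def)
  next
   case 2
   have *: "mv True t (u - t) = u" "mv ta t' (?k * (u - t)) = b + c * u"
    by (auto simp: mv_def b_def c_def algebra_simps)
   have "0 < u - t" "u - t <= ep1" using 2 u by auto
   thus ?thesis using e1(2-4)[of "u - t"] unfolding * by blast
  next
   case 3
   have *: "mv False t (t - u) = u" "mv (~  ta) t' (real (k (s, t, False)) * (t - u)) = b + c * u"
    using st(6) by (auto simp: mv_def b_def c_def algebra_simps)
   have "0 < t - u" "t - u <= ep2" using 3 u by auto
   thus ?thesis using e2(2-4)[of "t - u"] unfolding * by blast
  qed
 qed
 moreover have "c ~= 0" using kp by (simp add: c_def)
 ultimately show ?thesis using e1(1) e2(1) st(1) by (intro exI[of _ "min ep1 ep2"]) auto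
qed

text \<open>The affine formula near a point is unique, so it is a locally constant function on the
  connected open segment.\<close>

lemma affine_on_seg:
 assumes s: "s : segs C1"
 obtains s' c b where "c ~= 0" "s' : segs C2"
  "!!t. sint C1 s t ==> sint C2 s' (b + c * t) & sn (ipt s t) = ipt s' (b + c * t)"
proof -
 define Rp where "Rp t x = (case x of (s', c, b) => c ~= 0 & s' : segs C2 & (EX ep>0. ALL u. \<bar>u - t\<bar> < ep -->
   sint C1 s u & sint C2 s' (b + c * u) & sn (ipt s u) = ipt s' (b + c * u)))" for t :: real and x :: "seg \<times> real \<times> real"
 have ex: "EX x. Rp t x" if "sint C1 s t" for t
  using loc_affine[OF s that] unfolding Rp_def by auto
 have un: "x = y" if x: "Rp t x" and y: "Rp t y" for t x y
 proof -
  obtain s1 c1 b1 s2 c2 b2 where xy: "x = (s1, c1, b1)" "y = (s2, c2, b2)" by (cases x; cases y)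
  obtain ep1 where e1: "0 < ep1" "ALL u. \<bar>u - t\<bar> < ep1 --> sn (ipt s u) = ipt s1 (b1 + c1 * u)"
   using x unfolding xy Rp_def by auto
  obtain ep2 where e2: "0 < ep2" "ALL u. \<bar>u - t\<bar> < ep2 --> sn (ipt s u) = ipt s2 (b2 + c2 * u)"
   using y unfolding xy Rp_def by auto
  have *: "s1 = s2 & b1 + c1 * u = b2 + c2 * u" if "\<bar>u - t\<bar> < min ep1 ep2" for u
   using e1(2)[rule_format, of u] e2(2)[rule_format, of u] that by simp
  have "s1 = s2" using *[of t] e1 e2 by simp
  moreover have "b1 = b2 & c1 = c2"
   by (rule affine_agree[of "min ep1 ep2" t]) (use * e1 e2 in auto)
  ultimately show ?thesis by (simp add: xy)
 qed
 define F where "F t = (SOME x. Rp t x)" for t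
 have F: "Rp t (F t)" if "sint C1 s t" for t using ex[OF that] unfolding F_def by (rule someI_ex)
 have near: "EX ep>0. ALL u. \<bar>u - t\<bar> < ep --> Rp u x" if rx: "Rp t x" for t x
 proof -
  obtain s1 c1 b1 where x: "x = (s1, c1, b1)" by (cases x)
  obtain ep where e: "c1 ~= 0" "s1 : segs C2" "0 < ep" "ALL u. \<bar>u - t\<bar> < ep -->
    sint C1 s u & sint C2 s1 (b1 + c1 * u) & sn (ipt s u) = ipt s1 (b1 + c1 * u)"
   using rx unfolding x Rp_def by auto
  have "Rp u x" if u: "\<bar>u - t\<bar> < ep" for u
   unfolding x Rp_def prod.case
  proof (intro conjI exI[of _ "ep - \<bar>u - t\<bar>"] allI impI)
   fix w assume "\<bar>w - u\<bar> < ep - \<bar>u - t\<bar>"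
   hence "\<bar>w - t\<bar> < ep" by linarith
   thus "sint C1 s w" "sint C2 s1 (b1 + c1 * w)" "sn (ipt s w) = ipt s1 (b1 + c1 * w)" using e(4) by auto
  qed (use e u in auto)
  thus ?thesis using e by blast
 qed
 have const: "F a = F b" if "sint C1 s a" "sint C1 s b" for a b
 proof (rule connected_local_const[of "{t. sint C1 s t}"])
  show "ALL a:{t. sint C1 s t}. \<forall>\<^sub>F b in at a within {t. sint C1 s t}. F a = F b"
  proof
   fix a assume a: "a : {t. sint C1 s t}"
   then obtain ep where e: "0 < ep" "ALL u. \<bar>u - a\<bar> < ep --> Rp u (F a)" using near F by blast
   show "\<forall>\<^sub>F b in at a within {t. sint C1 s t}. F a = F b"
    unfolding eventually_at
   proof (intro exI[of _ ep] conjI ballI impI)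
    fix x assume x: "x : {t. sint C1 s t}" "x ~= a & dist x a < ep"
    hence "Rp x (F a)" using e(2) by (auto simp: dist_real_def)
    moreover have "Rp x (F x)" using F x by blast
    ultimately show "F a = F x" by (rule un)
   qed (use e in simp)
  qed
 qed (use that connected_sint in auto)
 show ?thesis
 proof (cases "EX t. sint C1 s t")
  case True
  then obtain t0 where t0: "sint C1 s t0" by blast
  obtain s' c b where x: "F t0 = (s', c, b)" by (cases "F t0")
  have 1: "c ~= 0" "s' : segs C2" using F[OF t0] unfolding x Rp_def by auto
  have "sint C2 s' (b + c * t) & sn (ipt s t) = ipt s' (b + c * t)" if "sint C1 s t" for t
   using F[OF that] const[OF t0 that] unfolding x Rp_def by auto
  thus ?thesis using that[of c s' b] 1 by blast
 next
  case False
  have "sint C1 s (case s of SE e => clen C1 e / 2 | SL l => 1)"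
   using s is_curve_len[OF C1] by (cases s) (auto simp: sint_def)
  thus ?thesis using False by blast
 qed
qed

lemma dir_of_affine:
 assumes h: "(s, t, ta) : dirs C1"
  and a: "!!t. sint C1 s t ==> sn (ipt s t) = ipt s' (b + c * t)" and c: "c ~= 0"
 shows "Dm (s, t, ta) = (s', b + c * t, if 0 < c then ta else ~  ta) & real (k (s, t, ta)) = \<bar>c\<bar>"
proof -
 obtain s2 t2 ta2 where D: "Dm (s, t, ta) = (s2, t2, ta2)" by (cases "Dm (s, t, ta)")
 let ?k = "real (k (s, t, ta))"
 have kp: "?k > 0" using k_pos[OF h] by simp
 obtain ep where e: "0 < ep" "!!dl. 0 < dl ==> dl <= ep ==> sint C1 s (mv ta t dl)"
  "!!dl. 0 < dl ==> dl <= ep ==> sint C2 s2 (mv ta2 t2 (?k * dl))"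
  "!!dl. 0 < dl ==> dl <= ep ==> sn (ipt s (mv ta t dl)) = ipt s2 (mv ta2 t2 (?k * dl))"
  by (rule germ_in[OF h D]) blast
 define k2 where "k2 = (if ta2 then ?k else - ?k)"
 define c2 where "c2 = (if ta then c else - c)"
 have *: "s2 = s' & t2 + k2 * dl = (b + c * t) + c2 * dl" if "0 < dl" "dl <= ep" for dl
 proof -
  have "ipt s2 (mv ta2 t2 (?k * dl)) = ipt s' (b + c * mv ta t dl)"
   using e(4)[OF that] a[OF e(2)[OF that]] by simp
  thus ?thesis by (auto simp: mv_def k2_def c2_def algebra_simps)
 qed
 have s: "s2 = s'" using *[of ep] e(1) by simp
 have "t2 = b + c * t & k2 = c2"
 proof (rule affine_agree[of "ep / 2" "ep / 2"])
  fix u assume "\<bar>u - ep / 2\<bar> < ep / 2"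
  hence "0 < u" "u <= ep" by linarith+
  thus "t2 + k2 * u = b + c * t + c2 * u" using * by blast
 qed (use e(1) in simp)
 thus ?thesis using s D c by (auto simp: k2_def c2_def split: if_splits)
qed

text \<open>Ends go to vertices and the inside to interior points, so the affine image runs once
  through a whole segment. It is not a leg, whose only end would have to be met by both ends of the
  edge.\<close>

lemma edge_image:
 assumes e: "e : cE C1"
 obtains j m up where "j : cE C2" "real m * clen C1 e = clen C2 j"
  "Dm (SE e, 0, True) = (if up then (SE j, 0, True) else (SE j, clen C2 j, False))"
  "Dm (SE e, clen C1 e, False) = (if up then (SE j, clen C2 j, False) else (SE j, 0, True))"
  "k (SE e, 0, True) = m" "k (SE e, clen C1 e, False) = m"
proof -
 let ?l = "clen C1 e"
 have lp: "0 < ?l" using is_curve_len[OF C1 e] .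
 have s: "SE e : segs C1" using e by simp
 obtain s' c b where a: "c ~= 0" "s' : segs C2"
  "!!t. sint C1 (SE e) t ==> sint C2 s' (b + c * t) & sn (ipt (SE e) t) = ipt s' (b + c * t)"
  by (rule affine_on_seg[OF s], rule that, assumption+)
 have a3: "!!t. sint C1 (SE e) t ==> sn (ipt (SE e) t) = ipt s' (b + c * t)" using a(3) by blast
 have d: "(SE e, 0, True) : dirs C1" "(SE e, ?l, False) : dirs C1"
  using e lp by (auto simp: dirs_def seg_dom_def)
 have D1: "Dm (SE e, 0, True) = (s', b, 0 < c)" "real (k (SE e, 0, True)) = \<bar>c\<bar>"
  using dir_of_affine[OF d(1) a3 a(1)] by auto
 have D2: "Dm (SE e, ?l, False) = (s', b + c * ?l, ~  0 < c)" "real (k (SE e, ?l, False)) = \<bar>c\<bar>"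
  using dir_of_affine[OF d(2) a3 a(1)] by auto
 have keq: "k (SE e, 0, True) = k (SE e, ?l, False)" using D1(2) D2(2) by linarith
 have n1: "~  sint C2 s' b" "seg_dom C2 s' b"
 proof -
  have "Dm (SE e, 0, True) : dirs C2" "mgerm C1 C2 sn (SE e, 0, True) (Dm (SE e, 0, True)) (k (SE e, 0, True))"
   using g[OF d(1)] by auto
  from mgerm_base[OF this(2)] have "sn (PV (fst (cends C1 e))) = pos C2 s' b" by (simp add: D1 pos_def)
  thus "~  sint C2 s' b" using V[of "fst (cends C1 e)"] wf_ends[OF is_curve_wf[OF C1] e] by (auto simp: pos_sint)
  show "seg_dom C2 s' b" using \<open>Dm (SE e, 0, True) : dirs C2\<close> by (auto simp: D1 dirs_def)
 qed
 have n2: "~  sint C2 s' (b + c * ?l)" "seg_dom C2 s' (b + c * ?l)"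
 proof -
  have "Dm (SE e, ?l, False) : dirs C2" "mgerm C1 C2 sn (SE e, ?l, False) (Dm (SE e, ?l, False)) (k (SE e, ?l, False))"
   using g[OF d(2)] by auto
  from mgerm_base[OF this(2)] have "sn (PV (snd (cends C1 e))) = pos C2 s' (b + c * ?l)" using lp by (simp add: D2 pos_def)
  thus "~  sint C2 s' (b + c * ?l)" using V[of "snd (cends C1 e)"] wf_ends[OF is_curve_wf[OF C1] e] by (auto simp: pos_sint)
  show "seg_dom C2 s' (b + c * ?l)" using \<open>Dm (SE e, ?l, False) : dirs C2\<close> by (auto simp: D2 dirs_def)
 qed
 have ne: "c * ?l ~= 0" using a lp by simp
 obtain j where j: "s' = SE j"
 proof (cases s')
  case (SL l)
  hence "b = 0" "b + c * ?l = 0" using n1 n2 by (auto simp: sint_def seg_dom_def)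
  thus ?thesis using ne by simp
 qed
 have jE: "j : cE C2" using a j by simp
 have 1: "b = 0 | b = clen C2 j" "b + c * ?l = 0 | b + c * ?l = clen C2 j"
  using n1 n2 by (auto simp: j sint_def seg_dom_def)
 have jp: "0 < clen C2 j" using is_curve_len[OF C2 jE] .
 show ?thesis
 proof (cases "0 < c")
  case True
  hence cl: "0 < c * ?l" using lp by simp
  hence "b = 0" "c * ?l = clen C2 j" using 1 jp by auto
  thus ?thesis using that[of j "k (SE e, 0, True)" True] jE D1 D2 True by (simp add: j)
 next
  case False
  hence cl: "c * ?l < 0" using lp a(1) by (simp add: mult_neg_pos)
  hence "b = clen C2 j" "- c * ?l = clen C2 j" using 1 jp by auto
  thus ?thesis using that[of j "k (SE e, 0, True)" False] jE D1 D2 False by (simp add: j)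
 qed
qed

lemma leg_image:
 assumes l: "l : cL C1" and m: "mleg C1 C2 sn l l' m"
 shows "Dm (SL l, 0, True) = (SL l', 0, True)" "k (SL l, 0, True) = m"
proof -
 have s: "SL l : segs C1" using l by simp
 obtain s' c b where a: "c ~= 0" "s' : segs C2"
  "!!t. sint C1 (SL l) t ==> sint C2 s' (b + c * t) & sn (ipt (SL l) t) = ipt s' (b + c * t)"
  by (rule affine_on_seg[OF s], rule that, assumption+)
 have a3: "!!t. sint C1 (SL l) t ==> sn (ipt (SL l) t) = ipt s' (b + c * t)" using a(3) by blast
 have d: "(SL l, 0, True) : dirs C1" using l by (auto simp: dirs_def seg_dom_def)
 have D: "Dm (SL l, 0, True) = (s', b, 0 < c)" "real (k (SL l, 0, True)) = \<bar>c\<bar>"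
  using dir_of_affine[OF d a3 a(1)] by auto
 obtain T cc where T: "0 < m" "0 < T" "!!t. t >= T ==> sn (PLg l t) = PLg l' (real m * t + cc)"
  using m by (auto simp: mleg_def)
 have "ipt s' (b + c * t) = ipt (SL l') (real m * t + cc)" if "t >= T" for t
  using a(3)[of t] T(3)[OF that] that T(2) by (simp add: sint_def)
 hence *: "s' = SL l' & b + c * t = cc + real m * t" if "t >= T" for t
  using that unfolding ipt_eq by (metis add.commute)
 have s': "s' = SL l'" using *[of T] by simp
 have bc: "b = cc & c = real m"
  by (rule affine_agree[of 1 "T + 1"]) (use * in \<open>auto simp: abs_less_iff\<close>)
 have "Dm (SL l, 0, True) : dirs C2" "mgerm C1 C2 sn (SL l, 0, True) (Dm (SL l, 0, True)) (k (SL l, 0, True))"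
  using g[OF d] by auto
 from mgerm_base[OF this(2)] have "sn (PV (clegv C1 l)) = pos C2 s' b" by (simp add: D pos_def)
 hence "~  sint C2 s' b" using V[of "clegv C1 l"] wf_legv[OF is_curve_wf[OF C1] l] by (auto simp: pos_sint)
 moreover have "seg_dom C2 s' b" using \<open>Dm (SL l, 0, True) : dirs C2\<close> by (auto simp: D dirs_def)
 ultimately have "b = 0" by (auto simp: s' sint_def seg_dom_def)
 thus "Dm (SL l, 0, True) = (SL l', 0, True)" "k (SL l, 0, True) = m"
  using D s' bc T(1) by auto
qed

end

section \<open>Combinatorial covers of rooted trees\<close>

lemma sum_fibers:
 assumes "finite E" "finite K"
 shows "(SUM v:K. SUM e:{e:E. P e & f e = v}. F e) = (SUM e:{e:E. P e & f e : K}. F e)"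
proof -
 have "(SUM e:{e:E. P e & f e : K}. F e) = (SUM v:K. SUM e:{e:{e:E. P e & f e : K}. f e = v}. F e)"
  by (rule sum.group[symmetric]) (use assms in auto)
 also have "... = (SUM v:K. SUM e:{e:E. P e & f e = v}. F e)"
  by (intro sum.cong) auto
 finally show ?thesis by simp
qed

lemma card_fibers:
 assumes "finite E" "finite K"
 shows "(SUM v:K. card {e:E. f e = v}) = card {e:E. f e : K}"
 using sum_fibers[OF assms, where P = "%_. True" and f = f and F = "%_. 1::nat"] by simp

lemma vchi_sum:
 assumes wf: "wf_graph H" and K: "finite K"
 shows "(SUM v:K. vchi H v) = 2 * int (card K) - 2 * (SUM v:K. int (cwt H v))
  - int (card {e:cE H. fst (cends H e) : K}) - int (card {e:cE H. snd (cends H e) : K})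
  - int (card {l:cL H. clegv H l : K})"
proof -
 have fin: "finite (cE H)" "finite (cL H)" using wf_fin[OF wf] by auto
 have "(SUM v:K. int (gval H v)) = int (SUM v:K. gval H v)" by simp
 also have "(SUM v:K. gval H v) = card {e:cE H. fst (cends H e) : K} + card {e:cE H. snd (cends H e) : K}
  + card {l:cL H. clegv H l : K}"
  unfolding gval_def by (simp add: sum.distrib card_fibers[OF fin(1) K] card_fibers[OF fin(2) K])
 finally show ?thesis unfolding vchi_def by (simp add: sum_subtractf sum_distrib_left[symmetric])
qed

text \<open>The end of an edge farther from the root of the tree, \<open>hi\<close> being the nearer
  one; \<open>up e\<close> says that the orientation of \<open>e\<close> runs towards the
  root.\<close>

definition lo :: "tcurve => (nat => bool) => nat => nat" where
 "lo H up e = (if up e then fst (cends H e) else snd (cends H e))"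

definition hi :: "tcurve => (nat => bool) => nat => nat" where
 "hi H up e = (if up e then snd (cends H e) else fst (cends H e))"

text \<open>Unions of components of the slope-0 part, that is, the sets that come from points of the
  contracted curve.\<close>

definition satur :: "tcurve => (nat => nat) => nat set => bool" where
 "satur H m A <-> A <= cV H & (ALL e:cE H. m e = 0 --> (fst (cends H e) : A <-> snd (cends H e) : A))"

definition PLs :: "(nat => int) => tcurve => nat set => nat" where
 "PLs a H A = (SUM l:{l:cL H. 0 < a l & clegv H l : A}. nat (a l))"

definition NLs :: "(nat => int) => tcurve => nat set => nat" where
 "NLs a H A = (SUM l:{l:cL H. a l < 0 & clegv H l : A}. nat (- a l))"

text \<open>\<open>UU\<close> collects slopes from \<open>A\<close> towards the root,
  \<open>DD\<close> slopes from \<open>A\<close> away from it, along the tree edge named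
  \<open>c\<close>. In \<open>UT\<close> the legs of positive degree continue the edges beyond the
  root, so that over the image of a point it is the local degree.\<close>

definition UU :: "tcurve => (nat => bool) => (nat => nat) => (nat => nat) => nat => nat set => nat" where
 "UU H up ka m c A = (SUM e:{e:cE H. ka (lo H up e) = c & lo H up e : A}. m e)"

definition DD :: "tcurve => (nat => bool) => (nat => nat) => (nat => nat) => nat => nat set => nat" where
 "DD H up ka m c A = (SUM e:{e:cE H. ka (lo H up e) = c & hi H up e : A}. m e)"

definition UT :: "(nat => int) => tcurve => nat => (nat => bool) => (nat => nat) => (nat => nat) => nat => nat set => nat" where
 "UT a H rt up ka m c A = UU H up ka m c A + (if c = rt then PLs a H A else 0)"

text \<open>The local Riemann-Hurwitz defect after the missing degree has been filled in by branches
  of slope 1. For each child of the tree vertex the target contributes minus the degree and the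
  attached branches contribute the missing degree, together minus the slope already present; so only
  slopes remain.\<close>

definition RR :: "(nat => int) => tcurve => (nat => bool) => (nat => nat) => nat set => int" where
 "RR a H up m A = int (SUM e:{e:cE H. lo H up e : A}. m e) + int (PLs a H A)
   - int (SUM e:{e:cE H. hi H up e : A}. m e) - int (NLs a H A) - (SUM v:A. vchi H v)"

text \<open>A rooted tree is given by its vertices \<open>W\<close>, the parent map \<open>pa\<close> and the root \<open>rt\<close>; the edge above
  a vertex is named after that vertex. The target has its leg 0 at \<open>rt\<close>, its leg \<open>\<infinity>\<close> at \<open>om\<close>,
  and \<open>LL\<close> is the path from \<open>rt\<close> to \<open>om\<close>. The source \<open>H\<close> is mapped to the tree by \<open>ka\<close>, with slope \<open>m e\<close> on the
  edge \<open>e\<close>; slope 0 marks the edges which are contracted.\<close>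

definition rtree :: "nat set => (nat => nat) => nat => nat => nat set => bool" where
 "rtree W pa rt om LL <-> finite W & rt : W & om : W & (EX lev::nat => nat. ALL w:W - {rt}. pa w : W & lev (pa w) < lev w) &
   LL <= W & rt : LL & om : LL & bij_betw pa (LL - {rt}) (LL - {om})"

definition tmap :: "(nat => int) => tcurve => nat set => (nat => nat) => nat => nat => (nat => nat) => (nat => nat)
  => (nat => bool) => bool" where
 "tmap a H W pa rt om ka m up <-> ka ` cV H <= W &
   (ALL e:cE H. m e = 0 --> ka (fst (cends H e)) = ka (snd (cends H e))) &
   (ALL e:cE H. 0 < m e --> ka (lo H up e) ~= rt & ka (hi H up e) = pa (ka (lo H up e))) &
   (ALL l:cL H. (0 < a l --> ka (clegv H l) = rt) & (a l < 0 --> ka (clegv H l) = om))"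

definition tbal :: "(nat => int) => tcurve => nat set => (nat => nat) => nat => nat => nat set => (nat => nat) => (nat => nat)
  => (nat => bool) => nat set => bool" where
 "tbal a H W pa rt om LL ka m up A <->
   (ALL c:W - {rt}. DD H up ka m c A <= UT a H rt up ka m (pa c) A &
    (c : LL --> DD H up ka m c A = UT a H rt up ka m (pa c) A)) &
   NLs a H A = UT a H rt up ka m om A & 0 <= RR a H up m A"

text \<open>Balance is asked on saturated sets instead of vertices, since these are the points of
  the contracted curve. Setting more slopes to 0 leaves fewer saturated sets, which is why the
  notion survives contraction of tree edges.\<close>

definition tcov :: "(nat => int) => tcurve => nat set => (nat => nat) => nat => nat => nat set => (nat => nat) => (nat => nat)
  => (nat => bool) => bool" where
 "tcov a H W pa rt om LL ka m up <-> rtree W pa rt om LL & tmap a H W pa rt om ka m up &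
   (ALL A. satur H m A --> tbal a H W pa rt om LL ka m up A)"

lemma sum_points:
 assumes wf: "wf_graph H" and A: "finite A"
 shows "PLs a H A = (SUM v:A. PLs a H {v})" "NLs a H A = (SUM v:A. NLs a H {v})"
  "DD H up ka m c A = (SUM v:A. DD H up ka m c {v})" "UT a H rt up ka m c A = (SUM v:A. UT a H rt up ka m c {v})"
  "RR a H up m A = (SUM v:A. RR a H up m {v})"
proof -
 have fin: "finite (cE H)" "finite (cL H)" using wf_fin[OF wf] by auto
 show P: "PLs a H A = (SUM v:A. PLs a H {v})" unfolding PLs_def singleton_iff sum_fibers[OF fin(2) A] ..
 show N: "NLs a H A = (SUM v:A. NLs a H {v})" unfolding NLs_def singleton_iff sum_fibers[OF fin(2) A] ..
 show D: "DD H up ka m c A = (SUM v:A. DD H up ka m c {v})" unfolding DD_def singleton_iff sum_fibers[OF fin(1) A] ..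
 have U: "UU H up ka m c A = (SUM v:A. UU H up ka m c {v})" for c unfolding UU_def singleton_iff sum_fibers[OF fin(1) A] ..
 show "UT a H rt up ka m c A = (SUM v:A. UT a H rt up ka m c {v})"
  unfolding UT_def U[of c] using P by (simp add: sum.distrib)
 have L: "(SUM e:{e:cE H. lo H up e : A}. m e) = (SUM v:A. SUM e:{e:cE H. lo H up e : {v}}. m e)"
  using sum_fibers[OF fin(1) A, where P = "%_. True" and f = "lo H up" and F = m] by simp
 have Hi: "(SUM e:{e:cE H. hi H up e : A}. m e) = (SUM v:A. SUM e:{e:cE H. hi H up e : {v}}. m e)"
  using sum_fibers[OF fin(1) A, where P = "%_. True" and f = "hi H up" and F = m] by simp
 show "RR a H up m A = (SUM v:A. RR a H up m {v})"
  unfolding RR_def L Hi P N by (simp add: sum.distrib sum_subtractf)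
qed

text \<open>All quantities are additive in the set. The lemma serves covers with positive slopes
  only, where single vertices are saturated.\<close>

lemma tbal_points:
 assumes wf: "wf_graph H" and A: "finite A" and s: "!!v. v : A ==> tbal a H W pa rt om LL ka m up {v}"
 shows "tbal a H W pa rt om LL ka m up A"
 unfolding tbal_def
proof (intro conjI ballI impI)
 fix c assume c: "c : W - {rt}"
 show "DD H up ka m c A <= UT a H rt up ka m (pa c) A"
  unfolding sum_points(3,4)[OF wf A] by (rule sum_mono) (use s c in \<open>auto simp: tbal_def\<close>)
 assume "c : LL"
 thus "DD H up ka m c A = UT a H rt up ka m (pa c) A"
  unfolding sum_points(3,4)[OF wf A] by (intro sum.cong) (use s c in \<open>auto simp: tbal_def\<close>)
next
 show "NLs a H A = UT a H rt up ka m om A"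
  unfolding sum_points(2,4)[OF wf A] by (intro sum.cong) (use s in \<open>auto simp: tbal_def\<close>)
 show "0 <= RR a H up m A"
  unfolding sum_points(5)[OF wf A] by (rule sum_nonneg) (use s in \<open>auto simp: tbal_def\<close>)
qed

locale contracted =
 fixes H :: tcurve and ll :: "nat => real" and m :: "nat => nat"
 assumes wf: "wf_graph H" and nn: "ALL e:cE H. 0 <= ll e" and z: "ALL e:cE H. m e = 0 <-> ll e = 0"
begin

abbreviation "C == curve_of H ll"
abbreviation "r == zrep H ll"

lemma satur_rel:
 assumes A: "satur H m A" and p: "(x, y) : (erel (cends H) (zset H ll))^*" and x: "x : A"
 shows "y : A"
 using p x
proof induction
 case (step y w)
 then obtain e where "e : zset H ll" "cends H e = (y, w) | cends H e = (w, y)" by (auto simp: erel_def)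
 thus ?case using A step z by (auto simp: satur_def zset_def)
qed

lemma satur_rep:
 assumes A: "satur H m A" and v: "v : cV H"
 shows "r v : r ` A <-> v : A"
proof
 assume "r v : r ` A"
 then obtain u where u: "u : A" "r v = r u" by auto
 hence "u : cV H" using A by (auto simp: satur_def)
 hence "v : zcls H ll u" using zrep_eq_iff[OF wf, of u v ll] v u by simp
 thus "v : A" using satur_rel[OF A] u by (auto simp: zcls_def)
qed simp

lemma lo_C: "e : cE H ==> lo C up e = r (lo H up e)" and hi_C: "e : cE H ==> hi C up e = r (hi H up e)"
 by (auto simp: lo_def hi_def curve_of_simps)

lemma lo_V: "e : cE H ==> lo H up e : cV H" and hi_V: "e : cE H ==> hi H up e : cV H"
 using wf_ends[OF wf] by (auto simp: lo_def hi_def)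

lemma cE_C: "cE C = {e:cE H. m e ~= 0}"
 using z by (auto simp: curve_of_simps zset_def)

text \<open>Every contracted edge of the class removes two half-edges, while the Betti number of the
  class moves into the weight.\<close>

lemma vchi_C: assumes w: "w : r ` cV H" shows "vchi C w = (SUM v:zcls H ll w. vchi H v)"
proof -
 let ?K = "zcls H ll w" and ?Z = "zset H ll"
 have fin: "finite ?K" "finite (cE H)" "finite (cL H)" using zcls_finite[OF wf] wf_fin[OF wf] by auto
 have K: "r x = w <-> x : ?K" if "x : cV H" for x using zcls_rep[OF wf w] that by auto
 have zK: "fst (cends H e) : ?K <-> snd (cends H e) : ?K" if "e : ?Z" for e
  using zedge_rep[OF that] K wf_ends[OF wf, of e] that by (metis (no_types, lifting) mem_Collect_eq zset_def)
 let ?zc = "card {e:?Z. fst (cends H e) : ?K}"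
 have split: "card {e:cE H. P e} = card {e:cE H - ?Z. P e} + card {e:?Z. P e}" for P
 proof -
  have "{e:cE H. P e} = {e:cE H - ?Z. P e} Un {e:?Z. P e}" by (auto simp: zset_def)
  moreover have "card ({e:cE H - ?Z. P e} Un {e:?Z. P e}) = card {e:cE H - ?Z. P e} + card {e:?Z. P e}"
   by (rule card_Un_disjoint) (use fin in \<open>auto simp: zset_def\<close>)
  ultimately show ?thesis by simp
 qed
 have zs: "card {e:?Z. snd (cends H e) : ?K} = ?zc" using zK by (metis (no_types, lifting))
 have f: "{e:cE C. fst (cends C e) = w} = {e:cE H - ?Z. fst (cends H e) : ?K}"
   "{e:cE C. snd (cends C e) = w} = {e:cE H - ?Z. snd (cends H e) : ?K}"
   "{l:cL C. clegv C l = w} = {l:cL H. clegv H l : ?K}"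
  using K wf_ends[OF wf] wf_legv[OF wf] by (auto simp: curve_of_simps)
 have "int (gval C w) = int (card {e:cE H. fst (cends H e) : ?K}) + int (card {e:cE H. snd (cends H e) : ?K})
   + int (card {l:cL H. clegv H l : ?K}) - 2 * int ?zc"
  unfolding gval_def f using split[of "%e. fst (cends H e) : ?K"] split[of "%e. snd (cends H e) : ?K"] zs by simp
 moreover have "vchi C w = 2 - 2 * int (cwt C w) - int (gval C w)" by (simp add: vchi_def)
 ultimately show ?thesis using vchi_sum[OF wf fin(1)] cwt_curve_of[OF wf w] by simp
qed

lemma sums_C:
 assumes A: "satur H m A" and ka: "ALL v:cV H. ka v = ka (r v)"
 shows "PLs a C (r ` A) = PLs a H A" "NLs a C (r ` A) = NLs a H A"
  "DD C up ka m c (r ` A) = DD H up ka m c A" "UT a C rt up ka m c (r ` A) = UT a H rt up ka m c A"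
  "RR a C up m (r ` A) = RR a H up m A"
proof -
 have fin: "finite (cE H)" "finite (cL H)" using wf_fin[OF wf] by auto
 have E: "(SUM e:{e:cE C. P e}. m e) = (SUM e:{e:cE H. Q e}. m e)" if "!!e. e : cE H ==> P e <-> Q e" for P Q
  by (rule sum.mono_neutral_left) (use fin that in \<open>auto simp: cE_C\<close>)
 have legs: "{l:cL C. Q l & clegv C l : r ` A} = {l:cL H. Q l & clegv H l : A}" for Q
  using satur_rep[OF A] wf_legv[OF wf] by (auto simp: curve_of_simps)
 show P: "PLs a C (r ` A) = PLs a H A" unfolding PLs_def legs ..
 show N: "NLs a C (r ` A) = NLs a H A" unfolding NLs_def legs ..
 have L: "lo C up e : r ` A <-> lo H up e : A" "hi C up e : r ` A <-> hi H up e : A"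
  "ka (lo C up e) = ka (lo H up e)" if "e : cE H" for e
  using that satur_rep[OF A] lo_V hi_V ka by (auto simp: lo_C hi_C)
 show D: "DD C up ka m c (r ` A) = DD H up ka m c A" unfolding DD_def by (rule E) (use L in auto)
 have U: "UU C up ka m c (r ` A) = UU H up ka m c A" for c unfolding UU_def by (rule E) (use L in auto)
 show "UT a C rt up ka m c (r ` A) = UT a H rt up ka m c A" unfolding UT_def U P ..
 have 1: "(SUM e:{e:cE C. lo C up e : r ` A}. m e) = (SUM e:{e:cE H. lo H up e : A}. m e)"
  "(SUM e:{e:cE C. hi C up e : r ` A}. m e) = (SUM e:{e:cE H. hi H up e : A}. m e)"
  by (rule E, use L in auto)+
 have Asub: "A <= cV H" using A by (simp add: satur_def)
 have "(SUM w:r ` A. vchi C w) = (SUM w:r ` A. SUM v:zcls H ll w. vchi H v)"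
  by (rule sum.cong) (use vchi_C Asub in auto)
 also have "... = (SUM v:A. vchi H v)"
  by (rule sum_classes[OF wf refl Asub]) (use satur_rep[OF A] in auto)
 finally show "RR a C up m (r ` A) = RR a H up m A" unfolding RR_def 1 P N by simp
qed

text \<open>Saturated sets of \<open>H\<close> are the preimages of sets of vertices of the
  contracted curve, and slope-0 edges contribute nothing to any of the sums.\<close>

lemma tcov_contracted:
 assumes ka: "ALL v:cV H. ka v = ka (r v)"
 shows "tcov a H W pa rt om LL ka m up <-> tcov a C W pa rt om LL ka m up"
proof -
 have tm: "tmap a H W pa rt om ka m up <-> tmap a C W pa rt om ka m up"
 proof -
  have "ka ` cV C = ka ` cV H" using ka by (auto simp: curve_of_simps)
  moreover have "ka (fst (cends H e)) = ka (snd (cends H e))" if "e : cE H" "m e = 0" for e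
  proof -
   have "e : zset H ll" using that z by (simp add: zset_def)
   from zedge_rep[OF this] show ?thesis using ka wf_ends[OF wf that(1)] by metis
  qed
  moreover have "ka (lo C up e) = ka (lo H up e)" "ka (hi C up e) = ka (hi H up e)" if "e : cE H" for e
   using that ka lo_V hi_V by (simp_all add: lo_C hi_C)
  moreover have "ka (clegv C l) = ka (clegv H l)" if "l : cL H" for l
   using ka wf_legv[OF wf that] by (simp add: curve_of_simps)
  ultimately show ?thesis unfolding tmap_def cE_C curve_of_simps(4) by auto
 qed
 have "(ALL A. satur H m A --> tbal a H W pa rt om LL ka m up A) <-> (ALL A. satur C m A --> tbal a C W pa rt om LL ka m up A)"
 proof
  assume L: "ALL A. satur H m A --> tbal a H W pa rt om LL ka m up A"
  show "ALL A. satur C m A --> tbal a C W pa rt om LL ka m up A"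
  proof (intro allI impI)
   fix B assume B: "satur C m B"
   define A where "A = {v:cV H. r v : B}"
   have A: "satur H m A" unfolding satur_def
   proof (intro conjI ballI impI)
    fix e assume e: "e : cE H" "m e = 0"
    have "e : zset H ll" using e z by (simp add: zset_def)
    from zedge_rep[OF this] show "fst (cends H e) : A <-> snd (cends H e) : A"
     using wf_ends[OF wf e(1)] by (simp add: A_def)
   qed (simp add: A_def)
   have "r ` A = B" using B by (auto simp: A_def satur_def curve_of_simps)
   thus "tbal a C W pa rt om LL ka m up B"
    using L[rule_format, OF A] sums_C[OF A ka] unfolding tbal_def by metis
  qed
 next
  assume R: "ALL A. satur C m A --> tbal a C W pa rt om LL ka m up A"
  show "ALL A. satur H m A --> tbal a H W pa rt om LL ka m up A"
  proof (intro allI impI)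
   fix A assume A: "satur H m A"
   hence "satur C m (r ` A)" unfolding satur_def cE_C by (auto simp: curve_of_simps(1))
   thus "tbal a H W pa rt om LL ka m up A"
    using R sums_C[OF A ka] unfolding tbal_def by metis
  qed
 qed
 thus ?thesis unfolding tcov_def tm by blast
qed

end

section \<open>Trees\<close>

text \<open>Genus 0 leaves at most one edge for each vertex other than \<open>r\<close>, so the
  breadth-first edges are all the edges.\<close>

lemma tree_parents:
 assumes C: "is_curve C" and g: "tgenus C = 0" and r: "r : cV C"
 shows "EX (lev::nat => nat) pe pv. (ALL v:cV C - {r}. pe v : cE C & (cends C (pe v) = (v, pv v) | cends C (pe v) = (pv v, v))
   & pv v : cV C & lev (pv v) < lev v) & bij_betw pe (cV C - {r}) (cE C)"
proof -
 have wf: "wf_graph C" using C by (rule is_curve_wf)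
 have fin: "finite (cV C)" "finite (cE C)" using wf_fin[OF wf] by auto
 have reach: "ALL v:cV C. EX r:{r}. (r, v) : (erel (cends C) (cE C))^*"
  using wf r by (auto simp: wf_graph_def adj_erel)
 obtain lev :: "nat => nat" and pe pv where p: "!!v. v : cV C - {r} ==> pe v : cE C &
   (cends C (pe v) = (v, pv v) | cends C (pe v) = (pv v, v)) & lev (pv v) < lev v
    & (EX r:{r}. (r, pv v) : (erel (cends C) (cE C))^*)" "inj_on pe (cV C - {r})"
  by (rule bfs[OF reach], rule that, assumption+)
 have sub: "pe ` (cV C - {r}) <= cE C" using p(1) by blast
 have "int (card (cE C)) <= int (card (cV C)) - 1"
  using g sum_nonneg[of "cV C" "%v. int (cwt C v)"] unfolding tgenus_def by simp
 hence "card (cE C) <= card (cV C - {r})" using r by simp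
 moreover have "card (pe ` (cV C - {r})) = card (cV C - {r})" by (rule card_image[OF p(2)])
 ultimately have "pe ` (cV C - {r}) = cE C" using sub fin by (simp add: card_seteq)
 hence "bij_betw pe (cV C - {r}) (cE C)" using p(2) by (simp add: bij_betw_def)
 moreover have "pv v : cV C" if "v : cV C - {r}" for v
  using p(1)[OF that] wf_ends[OF wf, of "pe v"] by auto
 ultimately show ?thesis using p(1) by blast
qed

text \<open>The path to \<infinity> is the orbit of \<open>om\<close> under the parent map up to its
  first visit of the root; levels decrease strictly, so the orbit has no repetition and the parent
  map shifts it bijectively.\<close>

lemma rtree_path:
 fixes lev :: "nat => nat"
 assumes W: "finite W" "rt : W" "om : W" and lev: "ALL w:W - {rt}. pa w : W & lev (pa w) < lev w"
 obtains N where "(pa ^^ N) om = rt" "!!i. i < N ==> (pa ^^ i) om : W - {rt}"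
  "rtree W pa rt om ((%i. (pa ^^ i) om) ` {..N})"
proof -
 have "EX N. (pa ^^ N) x = rt" if "x : W" for x
  using that
 proof (induction "lev x" arbitrary: x rule: less_induct)
  case less
  show ?case
  proof (cases "x = rt")
   case True
   thus ?thesis by (intro exI[of _ 0]) simp
  next
   case False
   hence "pa x : W" "lev (pa x) < lev x" using lev less by auto
   then obtain N where "(pa ^^ N) (pa x) = rt" using less by blast
   thus ?thesis by (intro exI[of _ "Suc N"]) (simp add: funpow_swap1)
  qed
 qed
 hence ex: "EX N. (pa ^^ N) om = rt" using W by blast
 define N where "N = (LEAST N. (pa ^^ N) om = rt)"
 have N: "(pa ^^ N) om = rt" unfolding N_def using ex by (rule LeastI_ex)
 have less: "(pa ^^ i) om ~= rt" if "i < N" for i using not_less_Least that unfolding N_def by blast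
 have inW: "(pa ^^ i) om : W" if "i <= N" for i
  using that
 proof (induction i)
  case (Suc i)
  hence "(pa ^^ i) om : W - {rt}" using less by auto
  thus ?case using lev by simp
 qed (use W in simp)
 have dec: "i < j ==> j <= N ==> lev ((pa ^^ j) om) < lev ((pa ^^ i) om)" for i j
 proof (induction j)
  case (Suc j)
  hence "(pa ^^ j) om : W - {rt}" using less inW by auto
  hence "lev ((pa ^^ Suc j) om) < lev ((pa ^^ j) om)" using lev by simp
  thus ?case using Suc by (cases "i = j") auto
 qed simp
 have inj: "inj_on (%i. (pa ^^ i) om) {..N}"
 proof (rule inj_onI)
  fix i j assume ij: "i : {..N}" "j : {..N}" "(pa ^^ i) om = (pa ^^ j) om"
  thus "i = j" using dec[of i j] dec[of j i] by (cases i j rule: linorder_cases) auto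
 qed
 let ?L = "(%i. (pa ^^ i) om) ` {..N}"
 have ini: "i <= N ==> (pa ^^ i) om = (pa ^^ j) om ==> j <= N ==> i = j" for i j using inj by (auto simp: inj_on_def)
 have 1: "?L - {rt} = (%i. (pa ^^ i) om) ` {..<N}"
  using less N by (auto simp: le_less)
 have 2: "?L - {om} = (%i. (pa ^^ i) om) ` {1..N}"
 proof -
  have "om ~= (pa ^^ i) om" if "Suc 0 <= i" "i <= N" for i using ini[of i 0] that by auto
  hence "om ~: (%i. (pa ^^ i) om) ` {1..N}" by auto
  moreover have "?L = insert om ((%i. (pa ^^ i) om) ` {1..N})"
  proof -
   have "{..N} = insert 0 {1..N}" by auto
   thus ?thesis by simp
  qed
  ultimately show ?thesis by blast
 qed
 have "bij_betw pa (?L - {rt}) (?L - {om})" unfolding bij_betw_def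
 proof
  show "inj_on pa (?L - {rt})" unfolding 1
  proof (rule inj_onI)
   fix x y assume "x : (%i. (pa ^^ i) om) ` {..<N}" "y : (%i. (pa ^^ i) om) ` {..<N}" "pa x = pa y"
   then obtain i j where ij: "i < N" "j < N" "x = (pa ^^ i) om" "y = (pa ^^ j) om" "(pa ^^ Suc i) om = (pa ^^ Suc j) om" by auto
   hence "Suc i = Suc j" using ini[of "Suc i" "Suc j"] by simp
   thus "x = y" using ij by simp
  qed
  have "pa ` (%i. (pa ^^ i) om) ` {..<N} = (%i. (pa ^^ i) om) ` Suc ` {..<N}" by (simp add: image_image)
  also have "Suc ` {..<N} = {1..N}" by (simp add: image_Suc_lessThan)
  finally show "pa ` (?L - {rt}) = ?L - {om}" unfolding 1 2 .
 qed
 moreover have "om : ?L" by (rule image_eqI[of _ _ 0]) auto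
 moreover have "rt : ?L" using N by (intro image_eqI[of _ _ N]) auto
 moreover have "?L <= W" using inW by auto
 ultimately have "rtree W pa rt om ?L" unfolding rtree_def using W lev by blast
 thus ?thesis using that[of N] N less inW by auto
qed

section \<open>From harmonic morphisms to combinatorial covers\<close>

definition ed :: "tcurve => nat => nat => dir" where
 "ed K e v = (if fst (cends K e) = v then (SE e, 0, True) else (SE e, clen K e, False))"

lemma ed_seg: "fst (ed K e v) = SE e" by (simp add: ed_def)

definition dirl :: "tcurve => (nat => bool) => nat => dir" where
 "dirl K up e = (if up e then (SE e, 0, True) else (SE e, clen K e, False))"

definition dirh :: "tcurve => (nat => bool) => nat => dir" where
 "dirh K up e = (if up e then (SE e, clen K e, False) else (SE e, 0, True))"

lemma sum_dir_lohi:
 assumes C: "is_curve C"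
 shows "(SUM h:dir_at C (PV v). F h) = (SUM e:{e:cE C. lo C up e = v}. F (dirl C up e))
  + (SUM e:{e:cE C. hi C up e = v}. F (dirh C up e)) + (SUM l:{l:cL C. clegv C l = v}. F (SL l, 0, True))"
proof -
 have fin: "finite (cE C)" using wf_fin[OF is_curve_wf[OF C]] by simp
 have sp: "(SUM e:{e:cE C. P e}. G e) = (SUM e:{e:cE C. P e & up e}. G e) + (SUM e:{e:cE C. P e & ~  up e}. G e)" for P and G :: "nat => 'a"
 proof -
  have "{e:cE C. P e} = {e:cE C. P e & up e} Un {e:cE C. P e & ~  up e}" by auto
  thus ?thesis using sum.union_disjoint[of "{e:cE C. P e & up e}" "{e:cE C. P e & ~  up e}" G] fin by auto
 qed
 have 1: "(SUM e:{e:cE C. lo C up e = v}. F (dirl C up e)) = (SUM e:{e:cE C. fst (cends C e) = v & up e}. F (SE e, 0, True))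
   + (SUM e:{e:cE C. snd (cends C e) = v & ~  up e}. F (SE e, clen C e, False))"
  unfolding sp[where P = "%e. lo C up e = v"]
  by (intro arg_cong2[of _ _ _ _ "(+)"] sum.cong) (auto simp: lo_def dirl_def)
 have 2: "(SUM e:{e:cE C. hi C up e = v}. F (dirh C up e)) = (SUM e:{e:cE C. snd (cends C e) = v & up e}. F (SE e, clen C e, False))
   + (SUM e:{e:cE C. fst (cends C e) = v & ~  up e}. F (SE e, 0, True))"
  unfolding sp[where P = "%e. hi C up e = v"]
  by (intro arg_cong2[of _ _ _ _ "(+)"] sum.cong) (auto simp: hi_def dirh_def)
 show ?thesis unfolding sum_dir_at_PV[OF C] 1 2
  using sp[where P = "%e. fst (cends C e) = v" and G = "%e. F (SE e, 0, True)"]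
   sp[where P = "%e. snd (cends C e) = v" and G = "%e. F (SE e, clen C e, False)"]
  by (simp add: algebra_simps)
qed

text \<open>A modification and a morphism on compatible models: \<open>vi\<close> and
  \<open>vt\<close> make the vertices the full preimages of vertices, as is arranged later by
  refinement.\<close>

locale rcover =
 fixes a :: "nat => int" and C C' D :: tcurve and ic :: "pt => pt" and Di :: "dir => dir"
  and ta :: "pt => pt" and img :: "dir => dir" and sl :: "dir => nat" and d :: "pt => nat"
 assumes cC: "is_curve C" and cC': "is_curve C'" and cD: "is_curve D"
  and gD: "tgenus D = 0" and LD: "cL D = {leg_zero, leg_inf}"
  and io: "ALL x:pts C. ic x : pts C'" "inj_on ic (pts C)" "ALL x:pts C. gen C' (ic x) = gen C x"
   "ALL h:dirs C. Di h : dirs C' & mgerm C C' ic h (Di h) 1" "cL C' = cL C" "ALL l:cL C. mleg C C' ic l l 1"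
   "ALL y:pts C' - ic ` pts C. gen C' y = 0" "tgenus C' = tgenus C"
  and fh: "fin_harm C' D ta img sl d"
  and eff: "ALL x:pts C'. 0 <= int (d x) * chi D (ta x) - chi C' x"
  and legs: "ALL i:cL C. (0 < a i --> mleg C' D ta i leg_zero (nat (a i))) & (a i < 0 --> mleg C' D ta i leg_inf (nat (- a i)))"
  and nz: "ALL i:cL C. a i ~= 0"
  and vi: "!!x. x : pts C ==> ic x : PV ` cV C' <-> x : PV ` cV C"
  and vt: "!!x. x : pts C' ==> ta x : PV ` cV D <-> x : PV ` cV C'"
begin

lemma wfs: "wf_graph C" "wf_graph C'" "wf_graph D" using cC cC' cD is_curve_wf by auto

lemma fh': "!!x. x : pts C' ==> ta x : pts D" "!!h. h : dirs C' ==> img h : dirs D & mgerm C' D ta h (img h) (sl h)"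
 "!!x h'. x : pts C' ==> h' : dir_at D (ta x) ==> (SUM h:{h:dir_at C' x. img h = h'}. sl h) = d x"
 using fh by (auto simp: fin_harm_def)

lemma Di_at: assumes "h : dir_at C x" shows "Di h : dir_at C' (ic x)"
proof -
 have h: "h : dirs C" "pos C (fst h) (fst (snd h)) = x" using assms by (auto simp: dir_at_def)
 have "mgerm C C' ic h (Di h) 1" "Di h : dirs C'" using io(4) h(1) by auto
 from mgerm_base[OF this(1)] show ?thesis using h by (simp add: dir_at_def \<open>Di h : dirs C'\<close>)
qed

lemma img_at: assumes "h : dir_at C' x" shows "img h : dir_at D (ta x)"
proof -
 have h: "h : dirs C'" "pos C' (fst h) (fst (snd h)) = x" using assms by (auto simp: dir_at_def)
 have "mgerm C' D ta h (img h) (sl h)" "img h : dirs D" using fh'(2) h(1) by auto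
 from mgerm_base[OF this(1)] show ?thesis using h by (simp add: dir_at_def \<open>img h : dirs D\<close>)
qed

lemma sl_pos: "h : dirs C' ==> 0 < sl h" using fh'(2) mgerm_pos by blast

lemma d_pos: assumes "h : dir_at C' x" "x : pts C'" shows "0 < d x"
proof -
 have h: "h : dirs C'" using assms dir_at_dirs by blast
 have "sl h <= (SUM h:{h':dir_at C' x. img h' = img h}. sl h)"
  by (rule member_le_sum) (use assms finite_dir_at[OF cC' assms(2)] in auto)
 also have "... = d x" by (rule fh'(3)[OF assms(2) img_at[OF assms(1)]])
 finally show ?thesis using sl_pos[OF h] by simp
qed

lemma Di_inj: "inj_on Di (dirs C)"
proof (rule inj_onI)
 fix h1 h2 assume h: "h1 : dirs C" "h2 : dirs C" "Di h1 = Di h2"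
 show "h1 = h2"
  by (rule mgerm_inj_dirs[OF io(2) wfs(1) h(1,2), of C' "Di h1" 1]) (use io(4) h in auto)
qed

lemma nonvertex: assumes "s : segs K" "sint K s t" shows "ipt s t : pts K & ipt s t ~: PV ` cV K"
 using assms by auto

lemma pts_nonvertex: assumes "x : pts K" "x ~: PV ` cV K" obtains s t where "x = ipt s t" "s : segs K" "sint K s t"
 using assms by (auto simp: pts_alt)

text \<open>At an interior point the local degree is positive, so both directions of the target are
  hit. The only two directions of the source must then be opposite, and their slopes agree.\<close>

lemma tau_straight: "straight_map C' D ta img sl"
proof
 show "is_curve C'" "is_curve D" by (fact cC' cD)+
 show "img h : dirs D & mgerm C' D ta h (img h) (sl h)" if "h : dirs C'" for h using fh'(2) that by blast
 show "ta (PV v) : PV ` cV D" if "v : cV C'" for v using vt[of "PV v"] that by auto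
next
 fix s t assume st: "s : segs C'" "sint C' s t"
 let ?x = "ipt s t"
 have x: "?x : pts C'" "?x ~: PV ` cV C'" using nonvertex[OF st] by auto
 hence "ta ?x : pts D" "ta ?x ~: PV ` cV D" using fh'(1) vt by auto
 then obtain s' t' where st': "ta ?x = ipt s' t'" "s' : segs D" "sint D s' t'" by (rule pts_nonvertex)
 have dC: "dir_at C' ?x = {(s, t, True), (s, t, False)}" by (rule dir_at_ipt[OF st])
 have dD: "dir_at D (ta ?x) = {(s', t', True), (s', t', False)}" unfolding st' by (rule dir_at_ipt[OF st'(2,3)])
 have im: "img (s, t, True) : dir_at D (ta ?x)" "img (s, t, False) : dir_at D (ta ?x)" using img_at dC by blast+
 have dp: "0 < d ?x" using d_pos[of "(s, t, True)" ?x] dC x by auto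
 have sum: "(SUM h:{h:{(s, t, True), (s, t, False)}. img h = (s', t', b)}. sl h) = d ?x" for b
  using fh'(3)[OF x(1), of "(s', t', b)"] dD dC by (cases b) auto
 have hit: "EX h:{(s, t, True), (s, t, False)}. img h = (s', t', b)" for b
 proof (rule ccontr)
  assume "~  ?thesis"
  hence emp: "{h:{(s, t, True), (s, t, False)}. img h = (s', t', b)} = {}" by blast
  show False using sum[of b] dp unfolding emp by simp
 qed
 have ne: "img (s, t, True) ~= img (s, t, False)"
 proof
  assume "img (s, t, True) = img (s, t, False)"
  thus False using hit[of True] hit[of False] by auto
 qed
 obtain b where b: "img (s, t, True) = (s', t', b)" using im(1) dD by auto
 have b': "img (s, t, False) = (s', t', ~  b)" using im(2) dD ne b by (cases b) auto
 have s1: "{h:{(s, t, True), (s, t, False)}. img h = (s', t', b)} = {(s, t, True)}"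
  "{h:{(s, t, True), (s, t, False)}. img h = (s', t', ~  b)} = {(s, t, False)}" using b b' by auto
 have "sl (s, t, True) = sl (s, t, False)" using sum[of b] sum[of "~  b"] unfolding s1 by simp
 thus "EX s' t' ta'. s' : segs D & sint D s' t' & ta (ipt s t) = ipt s' t' & img (s, t, True) = (s', t', ta') &
   img (s, t, False) = (s', t', ~  ta') & sl (s, t, True) = sl (s, t, False)"
  using st' b b' by blast
qed

lemma iota_straight: "straight_map C C' ic Di (%_. 1)"
proof
 show "is_curve C" "is_curve C'" by (fact cC cC')+
 show "Di h : dirs C' & mgerm C C' ic h (Di h) 1" if "h : dirs C" for h using io(4) that by blast
 show "ic (PV v) : PV ` cV C'" if "v : cV C" for v using vi[of "PV v"] that by auto
next
 fix s t assume st: "s : segs C" "sint C s t"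
 let ?x = "ipt s t"
 have x: "?x : pts C" "?x ~: PV ` cV C" using nonvertex[OF st] by auto
 hence "ic ?x : pts C'" "ic ?x ~: PV ` cV C'" using io(1) vi by auto
 then obtain s' t' where st': "ic ?x = ipt s' t'" "s' : segs C'" "sint C' s' t'" by (rule pts_nonvertex)
 have dC: "dir_at C ?x = {(s, t, True), (s, t, False)}" by (rule dir_at_ipt[OF st])
 have dD: "dir_at C' (ic ?x) = {(s', t', True), (s', t', False)}" unfolding st' by (rule dir_at_ipt[OF st'(2,3)])
 have im: "Di (s, t, True) : dir_at C' (ic ?x)" "Di (s, t, False) : dir_at C' (ic ?x)" using Di_at dC by blast+
 have "(s, t, True) : dirs C" "(s, t, False) : dirs C" using dC dir_at_dirs by blast+
 hence ne: "Di (s, t, True) ~= Di (s, t, False)" using Di_inj by (auto simp: inj_on_def)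
 obtain b where b: "Di (s, t, True) = (s', t', b)" using im(1) dD by auto
 have b': "Di (s, t, False) = (s', t', ~  b)" using im(2) dD ne b by (cases b) auto
 show "EX s' t' ta'. s' : segs C' & sint C' s' t' & ic (ipt s t) = ipt s' t' & Di (s, t, True) = (s', t', ta') &
   Di (s, t, False) = (s', t', ~  ta') & (1::nat) = 1"
  using st' b b' by blast
qed

sublocale T: straight_map C' D ta img sl by (rule tau_straight)
sublocale I: straight_map C C' ic Di "%_. 1" by (rule iota_straight)

lemma phi_straight: "straight_map C D (ta o ic) (img o Di) (sl o Di)"
proof
 show "is_curve C" "is_curve D" by (fact cC cD)+
 show "(img o Di) h : dirs D & mgerm C D (ta o ic) h ((img o Di) h) ((sl o Di) h)" if h: "h : dirs C" for h
  using io(4) fh'(2)[of "Di h"] mgerm_comp[of C C' ic h "Di h" 1 D ta "img (Di h)" "sl (Di h)"] h by auto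
 show "(ta o ic) (PV v) : PV ` cV D" if "v : cV C" for v
  using I.V[OF that] T.V by auto
next
 fix s t assume st: "s : segs C" "sint C s t"
 obtain s' t' b where 1: "s' : segs C'" "sint C' s' t'" "ic (ipt s t) = ipt s' t'"
  "Di (s, t, True) = (s', t', b)" "Di (s, t, False) = (s', t', ~  b)" using I.N[OF st] by blast
 obtain s2 t2 b2 where 2: "s2 : segs D" "sint D s2 t2" "ta (ipt s' t') = ipt s2 t2"
  "img (s', t', True) = (s2, t2, b2)" "img (s', t', False) = (s2, t2, ~  b2)"
  "sl (s', t', True) = sl (s', t', False)" using T.N[OF 1(1,2)] by blast
 show "EX s' t' ta'. s' : segs D & sint D s' t' & (ta o ic) (ipt s t) = ipt s' t' & (img o Di) (s, t, True) = (s', t', ta') &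
   (img o Di) (s, t, False) = (s', t', ~  ta') & (sl o Di) (s, t, True) = (sl o Di) (s, t, False)"
  using 1 2 by (intro exI[of _ s2] exI[of _ t2] exI[of _ "if b then b2 else ~  b2"]) auto
qed

sublocale F: straight_map C D "ta o ic" "img o Di" "sl o Di" by (rule phi_straight)

definition jv :: "nat => nat" where "jv v = (THE w. ic (PV v) = PV w)"
definition tv :: "nat => nat" where "tv v = (THE w. ta (PV v) = PV w)"

lemma jv: "v : cV C ==> ic (PV v) = PV (jv v) & jv v : cV C'"
 using I.V[of v] unfolding jv_def by auto

lemma tv: "v : cV C' ==> ta (PV v) = PV (tv v) & tv v : cV D"
 using T.V[of v] unfolding tv_def by auto

lemma jv_inj: "inj_on jv (cV C)"
proof (rule inj_onI)
 fix x y assume "x : cV C" "y : cV C" "jv x = jv y"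
 hence "ic (PV x) = ic (PV y)" "PV x : pts C" "PV y : pts C" using jv by auto
 hence "PV x = PV y" using io(2) inj_onD by metis
 thus "x = y" by simp
qed

lemma edge_emb: "EX ep upi. ALL e:cE C. ep e : cE C' &
  Di (SE e, 0, True) = (if upi e then (SE (ep e), 0, True) else (SE (ep e), clen C' (ep e), False)) &
  Di (SE e, clen C e, False) = (if upi e then (SE (ep e), clen C' (ep e), False) else (SE (ep e), 0, True))"
proof -
 have "ALL e:cE C. EX j u. j : cE C' &
  Di (SE e, 0, True) = (if u then (SE j, 0, True) else (SE j, clen C' j, False)) &
  Di (SE e, clen C e, False) = (if u then (SE j, clen C' j, False) else (SE j, 0, True))"
 proof
  fix e assume e: "e : cE C"
  obtain j m u where "j : cE C'" "real m * clen C e = clen C' j"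
   "Di (SE e, 0, True) = (if u then (SE j, 0, True) else (SE j, clen C' j, False))"
   "Di (SE e, clen C e, False) = (if u then (SE j, clen C' j, False) else (SE j, 0, True))"
   by (rule I.edge_image[OF e])
  thus "EX j u. j : cE C' &
   Di (SE e, 0, True) = (if u then (SE j, 0, True) else (SE j, clen C' j, False)) &
   Di (SE e, clen C e, False) = (if u then (SE j, clen C' j, False) else (SE j, 0, True))" by blast
 qed
 thus ?thesis by metis
qed

definition emb :: "nat => nat" where "emb = (SOME ep. EX upi. ALL e:cE C. ep e : cE C' &
  Di (SE e, 0, True) = (if upi e then (SE (ep e), 0, True) else (SE (ep e), clen C' (ep e), False)) &
  Di (SE e, clen C e, False) = (if upi e then (SE (ep e), clen C' (ep e), False) else (SE (ep e), 0, True)))"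

lemma emb: "EX upi. ALL e:cE C. emb e : cE C' &
  Di (SE e, 0, True) = (if upi e then (SE (emb e), 0, True) else (SE (emb e), clen C' (emb e), False)) &
  Di (SE e, clen C e, False) = (if upi e then (SE (emb e), clen C' (emb e), False) else (SE (emb e), 0, True))"
 unfolding emb_def using edge_emb by (rule someI_ex)

lemma dirs_ends: "e : cE C ==> (SE e, 0, True) : dirs C & (SE e, clen C e, False) : dirs C"
 using is_curve_len[OF cC, of e] by (auto simp: dirs_def seg_dom_def)

lemma emb_dirs: "e : cE C ==> {Di (SE e, 0, True), Di (SE e, clen C e, False)} = {(SE (emb e), 0, True), (SE (emb e), clen C' (emb e), False)}"
proof -
 assume e: "e : cE C"
 obtain upi where u: "Di (SE e, 0, True) = (if upi e then (SE (emb e), 0, True) else (SE (emb e), clen C' (emb e), False))"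
  "Di (SE e, clen C e, False) = (if upi e then (SE (emb e), clen C' (emb e), False) else (SE (emb e), 0, True))"
  using emb e by blast
 show ?thesis unfolding u by (cases "upi e") auto
qed

lemma emb_inj: "inj_on emb (cE C)"
proof (rule inj_onI)
 fix x y assume xy: "x : cE C" "y : cE C" "emb x = emb y"
 have eq: "{Di (SE x, 0, True), Di (SE x, clen C x, False)} = {Di (SE y, 0, True), Di (SE y, clen C y, False)}"
  unfolding emb_dirs[OF xy(1)] emb_dirs[OF xy(2)] xy(3) ..
 have "Di (SE x, 0, True) : {Di (SE x, 0, True), Di (SE x, clen C x, False)}" by (rule insertI1)
 hence "Di (SE x, 0, True) = Di (SE y, 0, True) | Di (SE x, 0, True) = Di (SE y, clen C y, False)"
  unfolding eq by (simp only: insert_iff empty_iff simp_thms)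
 thus "x = y"
 proof
  assume "Di (SE x, 0, True) = Di (SE y, 0, True)"
  hence "(SE x, 0::real, True) = (SE y, 0, True)"
   by (rule inj_onD[OF Di_inj]) (use dirs_ends[OF xy(1)] dirs_ends[OF xy(2)] in blast)+
  thus ?thesis by simp
 next
  assume "Di (SE x, 0, True) = Di (SE y, clen C y, False)"
  hence "(SE x, 0::real, True) = (SE y, clen C y, False)"
   by (rule inj_onD[OF Di_inj]) (use dirs_ends[OF xy(1)] dirs_ends[OF xy(2)] in blast)+
  thus ?thesis by simp
 qed
qed

lemma emb_E: "e : cE C ==> emb e : cE C'" using emb by blast

lemma pos_ends: "e : cE K ==> is_curve K ==> pos K (SE e) 0 = PV (fst (cends K e)) & pos K (SE e) (clen K e) = PV (snd (cends K e))"
 using is_curve_len[of K e] by (auto simp: pos_def)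

lemma emb_ends: assumes e: "e : cE C"
 shows "{fst (cends C' (emb e)), snd (cends C' (emb e))} = {jv (fst (cends C e)), jv (snd (cends C e))}"
proof -
 obtain upi where u: "Di (SE e, 0, True) = (if upi e then (SE (emb e), 0, True) else (SE (emb e), clen C' (emb e), False))"
  "Di (SE e, clen C e, False) = (if upi e then (SE (emb e), clen C' (emb e), False) else (SE (emb e), 0, True))"
  using emb e by blast
 have m: "mgerm C C' ic (SE e, 0, True) (Di (SE e, 0, True)) 1" "mgerm C C' ic (SE e, clen C e, False) (Di (SE e, clen C e, False)) 1"
  using io(4) dirs_ends[OF e] by auto
 have v: "fst (cends C e) : cV C" "snd (cends C e) : cV C" using wf_ends[OF wfs(1) e] by auto
 have "PV (jv (fst (cends C e))) = pos C' (SE (emb e)) (if upi e then 0 else clen C' (emb e))"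
  using mgerm_base[OF m(1)] u(1) pos_ends[OF e cC] jv[OF v(1)] by auto
 moreover have "PV (jv (snd (cends C e))) = pos C' (SE (emb e)) (if upi e then clen C' (emb e) else 0)"
  using mgerm_base[OF m(2)] u(2) pos_ends[OF e cC] jv[OF v(2)] by auto
 ultimately show ?thesis using pos_ends[OF emb_E[OF e] cC'] by (cases "upi e") auto
qed

lemma leg_emb: assumes "l : cL C" shows "Di (SL l, 0, True) = (SL l, 0, True)" "clegv C' l = jv (clegv C l)"
proof -
 show 1: "Di (SL l, 0, True) = (SL l, 0, True)" using I.leg_image(1)[OF assms, of l 1] io(6) assms by auto
 have "(SL l, 0, True) : dirs C" using assms by (auto simp: dirs_def seg_dom_def)
 hence "mgerm C C' ic (SL l, 0, True) (SL l, 0, True) 1" using io(4) 1 by metis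
 from mgerm_base[OF this] show "clegv C' l = jv (clegv C l)"
  using jv[OF wf_legv[OF wfs(1) assms]] by (simp add: pos_def)
qed

abbreviation "H0 == jv ` cV C"

lemma gen_sum: "(SUM v:cV C'. int (cwt C' v)) = (SUM v:cV C. int (cwt C v))"
proof -
 have H0: "H0 <= cV C'" using jv by auto
 have fin: "finite (cV C')" using wf_fin[OF wfs(2)] by simp
 have "(SUM v:cV C'. int (cwt C' v)) = (SUM v:H0. int (cwt C' v))"
 proof (rule sum.mono_neutral_right[OF fin H0], rule ballI)
  fix v assume v: "v : cV C' - H0"
  have "PV v ~: ic ` pts C"
  proof
   assume "PV v : ic ` pts C"
   then obtain x where x: "x : pts C" "ic x = PV v" by auto
   hence "x : PV ` cV C" using vi[OF x(1)] v by auto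
   thus False using x jv v by auto
  qed
  hence "gen C' (PV v) = 0" using io(7) v by auto
  thus "int (cwt C' v) = 0" by (simp add: gen_def)
 qed
 also have "... = (SUM v:cV C. int (cwt C' (jv v)))" by (rule sum.reindex_cong[OF jv_inj]) auto
 also have "... = (SUM v:cV C. int (cwt C v))"
 proof (rule sum.cong[OF refl])
  fix v assume v: "v : cV C"
  hence "gen C' (ic (PV v)) = gen C (PV v)" using io(3) by simp
  thus "int (cwt C' (jv v)) = int (cwt C v)" using jv[OF v] by (simp add: gen_def)
 qed
 finally show ?thesis .
qed

text \<open>Breadth-first search from the copy of \<open>C\<close> gives every outside vertex an
  edge of its own that is not in the copy. Equality of the genera leaves no further edges, so the
  complement is a forest hanging on the copy.\<close>

lemma forest: "EX (lev::nat => nat) pe pv. (ALL v:cV C' - H0. pe v : cE C' & (cends C' (pe v) = (v, pv v) | cends C' (pe v) = (pv v, v))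
   & lev (pv v) < lev v) & inj_on pe (cV C' - H0) & cE C' - emb ` cE C = pe ` (cV C' - H0)"
proof -
 have fin: "finite (cV C')" "finite (cE C')" "finite (cE C)" "finite (cV C)" using wf_fin[OF wfs(1)] wf_fin[OF wfs(2)] by auto
 obtain v0 where v0: "v0 : cV C" using wfs(1) by (auto simp: wf_graph_def)
 have reach: "ALL v:cV C'. EX r:H0. (r, v) : (erel (cends C') (cE C'))^*"
 proof
  fix v assume "v : cV C'"
  moreover have "jv v0 : cV C'" using jv[OF v0] by simp
  ultimately have "(jv v0, v) : (adj C')^*" using wfs(2) unfolding wf_graph_def by blast
  hence "(jv v0, v) : (erel (cends C') (cE C'))^*" unfolding adj_erel .
  moreover have "jv v0 : H0" using v0 by (rule imageI)
  ultimately show "EX r:H0. (r, v) : (erel (cends C') (cE C'))^*" by (rule bexI)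
 qed
 obtain lev :: "nat => nat" and pe pv where p: "!!v. v : cV C' - H0 ==> pe v : cE C' &
   (cends C' (pe v) = (v, pv v) | cends C' (pe v) = (pv v, v)) & lev (pv v) < lev v
    & (EX r:H0. (r, pv v) : (erel (cends C') (cE C'))^*)" "inj_on pe (cV C' - H0)"
  by (rule bfs[OF reach], rule that, assumption+)
 have sub: "pe ` (cV C' - H0) <= cE C' - emb ` cE C"
 proof
  fix x assume "x : pe ` (cV C' - H0)"
  then obtain v where v: "v : cV C' - H0" "x = pe v" by blast
  have "pe v ~: emb ` cE C"
  proof
   assume "pe v : emb ` cE C"
   then obtain e where e: "e : cE C" "pe v = emb e" by blast
   have "cends C' (pe v) = (v, pv v) | cends C' (pe v) = (pv v, v)" using p(1)[OF v(1)] by blast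
   hence "v : {fst (cends C' (pe v)), snd (cends C' (pe v))}" by auto
   hence "v : {jv (fst (cends C e)), jv (snd (cends C e))}"
    unfolding e(2) emb_ends[OF e(1)] .
   thus False using v wf_ends[OF wfs(1) e(1)] by auto
  qed
  moreover have "pe v : cE C'" using p(1)[OF v(1)] by (rule conjunct1)
  ultimately show "x : cE C' - emb ` cE C" unfolding v(2) by (rule DiffI[rotated])
 qed
 have H0c: "card H0 = card (cV C)" by (rule card_image[OF jv_inj])
 have Ec: "card (emb ` cE C) = card (cE C)" by (rule card_image[OF emb_inj])
 have H0: "H0 <= cV C'" using jv by auto
 have EE: "emb ` cE C <= cE C'" using emb_E by auto
 have "int (card (cE C')) - int (card (cE C)) = int (card (cV C')) - int (card (cV C))"
  using io(8) gen_sum unfolding tgenus_def by simp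
 moreover have "card (cE C' - emb ` cE C) = card (cE C') - card (cE C)" "card (cE C) <= card (cE C')"
  using card_Diff_subset[OF _ EE] Ec fin card_mono[OF fin(2) EE] by auto
 moreover have "card (cV C' - H0) = card (cV C') - card (cV C)" "card (cV C) <= card (cV C')"
  using card_Diff_subset[OF _ H0] H0c fin card_mono[OF fin(1) H0] by auto
 ultimately have "card (cE C' - emb ` cE C) = card (cV C' - H0)" by linarith
 hence "cE C' - emb ` cE C = pe ` (cV C' - H0)"
  using card_seteq[OF _ sub] card_image[OF p(2)] fin by simp
 with p show ?thesis by (intro exI[of _ lev] exI[of _ pe] exI[of _ pv]) simp
qed

end

lemma ed_at:
 assumes K: "is_curve K" and e: "e : cE K" and v: "fst (cends K e) = v | snd (cends K e) = v"
 shows "ed K e v : dir_at K (PV v)"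
 using e v unfolding dir_at_PV[OF K] ed_def by auto

section \<open>Attached trees never lead to a leg\<close>

context rcover
begin

definition tp :: "nat => (nat => nat) => (nat => nat) => (nat => nat) => bool" where
 "tp r lev pe pv <-> (ALL v:cV D - {r}. pe v : cE D & (cends D (pe v) = (v, pv v) | cends D (pe v) = (pv v, v))
   & pv v : cV D & lev (pv v) < lev v) & bij_betw pe (cV D - {r}) (cE D)"

text \<open>The direction at a tree vertex that leads to the leg \<open>l\<close>, for the tree
  rooted at the end of \<open>l\<close>. It is used for leg 0 and for leg \<infinity>, with
  different rootings.\<close>

definition updir :: "nat => (nat => nat) => nat => dir" where
 "updir l pe v = (if v = clegv D l then (SL l, 0, True) else ed D (pe v) v)"

lemma tpD: assumes "tp r lev pe pv" "v : cV D" "v ~= r"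
 shows "pe v : cE D" "cends D (pe v) = (v, pv v) | cends D (pe v) = (pv v, v)" "pv v : cV D" "lev (pv v) < lev v" "pv v ~= v"
proof -
 have p: "pe v : cE D & (cends D (pe v) = (v, pv v) | cends D (pe v) = (pv v, v)) & pv v : cV D & lev (pv v) < lev v"
  using assms unfolding tp_def by blast
 thus "pe v : cE D" "cends D (pe v) = (v, pv v) | cends D (pe v) = (pv v, v)" "pv v : cV D" "lev (pv v) < lev v" by auto
 show "pv v ~= v" using p by auto
qed

lemma tp_inj: assumes "tp r lev pe pv" "v : cV D" "v ~= r" "w : cV D" "w ~= r" "pe v = pe w" shows "v = w"
 using assms by (auto simp: tp_def bij_betw_def inj_on_def)

lemma updir_at:
 assumes t: "tp (clegv D l) lev pe pv" and l: "l : cL D" and v: "v : cV D"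
 shows "updir l pe v : dir_at D (PV v)"
proof (cases "v = clegv D l")
 case True
 thus ?thesis using l unfolding updir_def dir_at_PV[OF cD] by auto
next
 case False
 have "fst (cends D (pe v)) = v | snd (cends D (pe v)) = v" using tpD(2)[OF t v False] by auto
 thus ?thesis using ed_at[OF cD tpD(1)[OF t v False]] False by (simp add: updir_def)
qed

lemma img_base: assumes "h : dir_at C' (PV p)" "p : cV C'"
 shows "pos D (fst (img h)) (fst (snd (img h))) = PV (tv p)"
 using img_at[OF assms(1)] tv[OF assms(2)] by (simp add: dir_at_def)

lemma edge_two:
 assumes e: "e : cE C'" and pz: "cends C' e = (p, z) | cends C' e = (z, p)" "p ~= z"
 obtains j where "j : cE D" "{tv p, tv z} = {fst (cends D j), snd (cends D j)}"
  "fst (img (ed C' e p)) = SE j" "fst (img (ed C' e z)) = SE j"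
proof -
 obtain j m u where j: "j : cE D" "real m * clen C' e = clen D j"
  "img (SE e, 0, True) = (if u then (SE j, 0, True) else (SE j, clen D j, False))"
  "img (SE e, clen C' e, False) = (if u then (SE j, clen D j, False) else (SE j, 0, True))"
  by (rule T.edge_image[OF e], rule that, assumption+)
 have V: "p : cV C'" "z : cV C'" using wf_ends[OF wfs(2) e] pz by auto
 have eds: "{ed C' e p, ed C' e z} = {(SE e, 0, True), (SE e, clen C' e, False)}"
  using pz by (auto simp: ed_def)
 have at: "ed C' e p : dir_at C' (PV p)" "ed C' e z : dir_at C' (PV z)"
  using ed_at[OF cC' e] pz by auto
 have b: "pos D (fst (img (ed C' e p))) (fst (snd (img (ed C' e p)))) = PV (tv p)"
  "pos D (fst (img (ed C' e z))) (fst (snd (img (ed C' e z)))) = PV (tv z)"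
  using img_base at V by auto
 note pe = pos_ends[OF j(1) cD]
 have "(ed C' e p = (SE e, 0, True) & ed C' e z = (SE e, clen C' e, False)) |
   (ed C' e z = (SE e, 0, True) & ed C' e p = (SE e, clen C' e, False))" using pz by (auto simp: ed_def)
 thus ?thesis
 proof
  assume a: "ed C' e p = (SE e, 0, True) & ed C' e z = (SE e, clen C' e, False)"
  thus ?thesis using that[of j] j b pe by (cases u) auto
 next
  assume a: "ed C' e z = (SE e, 0, True) & ed C' e p = (SE e, clen C' e, False)"
  thus ?thesis using that[of j] j b pe by (cases u) auto
 qed
qed

text \<open>The edge covers a single edge of the tree, and its two ends cannot both see the leg
  across that edge.\<close>

lemma no_turn:
 assumes t: "tp (clegv D l) lev pe pv" and e: "e : cE C'" and pz: "cends C' e = (p, z) | cends C' e = (z, p)" "p ~= z"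
  and u: "img (ed C' e p) = updir l pe (tv p)"
 shows "img (ed C' e z) ~= updir l pe (tv z)"
proof
 assume c: "img (ed C' e z) = updir l pe (tv z)"
 obtain j where j: "j : cE D" "{tv p, tv z} = {fst (cends D j), snd (cends D j)}"
  "fst (img (ed C' e p)) = SE j" "fst (img (ed C' e z)) = SE j"
  by (rule edge_two[OF e pz])
 have V: "tv p : cV D" "tv z : cV D" using wf_ends[OF wfs(2) e] pz tv by auto
 have np: "tv p ~= clegv D l" using u j(3) by (auto simp: updir_def)
 have nz: "tv z ~= clegv D l" using c j(4) by (auto simp: updir_def)
 have "pe (tv p) = j" "pe (tv z) = j" using u c j(3,4) np nz by (auto simp: updir_def ed_seg)
 hence "tv p = tv z" using tp_inj[OF t V(1) np V(2) nz] by simp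
 moreover have "tv p ~= tv z"
  using j(2) tpD(2,5)[OF t V(1) np] \<open>pe (tv p) = j\<close> by (metis doubleton_eq_iff fst_conv snd_conv)
 ultimately show False by simp
qed

definition fr :: "(nat => nat) => (nat => nat) => (nat => nat) => bool" where
 "fr lev pe pv <-> (ALL v:cV C' - H0. pe v : cE C' & (cends C' (pe v) = (v, pv v) | cends C' (pe v) = (pv v, v))
   & lev (pv v) < lev v) & inj_on pe (cV C' - H0) & cE C' - emb ` cE C = pe ` (cV C' - H0)"

lemma frD: assumes "fr lev pe pv" "v : cV C' - H0"
 shows "pe v : cE C'" "cends C' (pe v) = (v, pv v) | cends C' (pe v) = (pv v, v)" "lev (pv v) < lev v" "pv v ~= v" "pv v : cV C'"
proof -
 have p: "pe v : cE C' & (cends C' (pe v) = (v, pv v) | cends C' (pe v) = (pv v, v)) & lev (pv v) < lev v"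
  using assms unfolding fr_def by blast
 thus "pe v : cE C'" "cends C' (pe v) = (v, pv v) | cends C' (pe v) = (pv v, v)" "lev (pv v) < lev v" by auto
 show "pv v ~= v" using p by auto
 show "pv v : cV C'" using p wf_ends[OF wfs(2), of "pe v"] by auto
qed

lemma non_emb: assumes "fr lev pe pv" "e : cE C'" "e ~: emb ` cE C"
 obtains z where "z : cV C' - H0" "e = pe z"
proof -
 have "e : cE C' - emb ` cE C" using assms(2,3) by (rule DiffI)
 hence "e : pe ` (cV C' - H0)" using assms(1) unfolding fr_def by metis
 thus ?thesis using that by (rule imageE)
qed

text \<open>A tree entered in the direction of a leg would have to be followed for ever. At the next
  vertex the way back does not lead to the leg, but the local degree is positive, so some other
  direction does; there being no legs in the tree, it is an edge to a vertex of higher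
  level.\<close>

lemma tree_dir:
 assumes t: "tp (clegv D l) lev pe pv" and l: "l : cL D" and f: "fr lev' pe' pv'" and z: "z : cV C' - H0"
 shows "img (ed C' (pe' z) (pv' z)) ~= updir l pe (tv (pv' z))"
proof -
 \<comment> \<open>Levels are bounded by \<open>M\<close>, so the induction runs outwards along the
   tree.\<close>
 define M where "M = Max (lev' ` cV C')"
 have M: "lev' z <= M" if "z : cV C'" for z
  using that wf_fin[OF wfs(2)] by (simp add: M_def)
 show ?thesis using z
 proof (induction "M - lev' z" arbitrary: z rule: less_induct)
  case less
  note F = frD[OF f less.prems]
  show ?case
  proof
   assume u: "img (ed C' (pe' z) (pv' z)) = updir l pe (tv (pv' z))"
   have ends: "cends C' (pe' z) = (pv' z, z) | cends C' (pe' z) = (z, pv' z)" using F(2) by auto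
   have nt: "img (ed C' (pe' z) z) ~= updir l pe (tv z)" by (rule no_turn[OF t F(1) ends F(4) u])
   have zV: "z : cV C'" using less.prems by simp
   have at: "ed C' (pe' z) z : dir_at C' (PV z)" using ed_at[OF cC' F(1)] F(2) by auto
   have dp: "0 < d (PV z)" using d_pos[OF at] zV by simp
   have "updir l pe (tv z) : dir_at D (ta (PV z))" using updir_at[OF t l] tv[OF zV] by simp
   hence "(SUM h:{h:dir_at C' (PV z). img h = updir l pe (tv z)}. sl h) = d (PV z)"
    using fh'(3) zV by simp
   hence "{h:dir_at C' (PV z). img h = updir l pe (tv z)} ~= {}" using dp by (metis less_irrefl sum.empty)
   then obtain h where h: "h : dir_at C' (PV z)" "img h = updir l pe (tv z)" by blast
   have "EX e3:cE C'. (fst (cends C' e3) = z | snd (cends C' e3) = z) & fst h = SE e3 &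
      (h = (SE e3, 0, True) & fst (cends C' e3) = z | h = (SE e3, clen C' e3, False) & snd (cends C' e3) = z)"
   proof -
    have "h ~: (%l. (SL l, 0, True)) ` {l:cL C'. clegv C' l = z}"
    proof
     assume "h : (%l. (SL l, 0, True)) ` {l:cL C'. clegv C' l = z}"
     then obtain l where "l : cL C" "clegv C' l = z" using io(5) by auto
     thus False using leg_emb(2) less.prems wf_legv[OF wfs(1)] by auto
    qed
    thus ?thesis using h(1) unfolding dir_at_PV[OF cC'] by auto
   qed
   then obtain e3 where e3: "e3 : cE C'" "fst (cends C' e3) = z | snd (cends C' e3) = z"
     "h = (SE e3, 0, True) & fst (cends C' e3) = z | h = (SE e3, clen C' e3, False) & snd (cends C' e3) = z" by blast
   have "e3 ~: emb ` cE C"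
   proof
    assume "e3 : emb ` cE C"
    then obtain e where e: "e : cE C" "e3 = emb e" by blast
    hence "z : {jv (fst (cends C e)), jv (snd (cends C e))}" using emb_ends[OF e(1)] e3(2) by auto
    thus False using less.prems wf_ends[OF wfs(1) e(1)] by auto
   qed
   then obtain z3 where z3: "z3 : cV C' - H0" "e3 = pe' z3" using non_emb[OF f e3(1)] by blast
   note F3 = frD[OF f z3(1)]
   have hd: "h = ed C' e3 z" using e3(3) F3(2,4) z3(2) by (auto simp: ed_def)
   show False
   proof (cases "z3 = z")
    case True
    thus False using hd h(2) nt z3(2) by simp
   next
    case False
    hence pz: "pv' z3 = z" using e3(2) F3(2) z3(2) by auto
    have "M - lev' z3 < M - lev' z" using F3(3) pz M[of z3] z3(1) by auto
    hence "img (ed C' (pe' z3) (pv' z3)) ~= updir l pe (tv (pv' z3))" using less.hyps z3(1) by blast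
    thus False using hd h(2) z3(2) pz by simp
   qed
  qed
 qed
qed

text \<open>The directions at \<open>v\<close> that enter attached trees.\<close>

definition Td :: "nat => dir set" where
 "Td v = dir_at C' (PV (jv v)) - Di ` dir_at C (PV v)"

lemma Di_sub: "v : cV C ==> Di ` dir_at C (PV v) <= dir_at C' (PV (jv v))"
 using Di_at[of _ "PV v"] jv by auto

lemma Td_dir:
 assumes f: "fr lev' pe' pv'" and v: "v : cV C" and h: "h : Td v"
 obtains z where "z : cV C' - H0" "h = ed C' (pe' z) (pv' z)" "pv' z = jv v"
proof -
 have h1: "h : dir_at C' (PV (jv v))" "h ~: Di ` dir_at C (PV v)" using h by (auto simp: Td_def)
 have notDi: "h ~= Di g" if "g : dirs C" for g
 proof
  assume e: "h = Di g"
  have g: "g : dir_at C (pos C (fst g) (fst (snd g)))" using that by (simp add: dir_at_def)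
  hence "h : dir_at C' (ic (pos C (fst g) (fst (snd g))))" using Di_at e by simp
  hence "ic (pos C (fst g) (fst (snd g))) = ic (PV v)" using h1(1) jv[OF v] by (simp add: dir_at_def)
  moreover have "pos C (fst g) (fst (snd g)) : pts C" using that pos_in_pts[OF wfs(1)] by (auto simp: dirs_def)
  ultimately have "pos C (fst g) (fst (snd g)) = PV v" using v inj_onD[OF io(2)] by simp
  thus False using g h1(2) e by auto
 qed
 have "h ~: (%l. (SL l, 0, True)) ` {l:cL C'. clegv C' l = jv v}"
 proof
  assume "h : (%l. (SL l, 0, True)) ` {l:cL C'. clegv C' l = jv v}"
  then obtain l where l: "l : cL C" "h = (SL l, 0, True)" using io(5) by auto
  have "(SL l, 0, True) : dirs C" using l by (auto simp: dirs_def seg_dom_def)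
  thus False using notDi leg_emb(1)[OF l(1)] l(2) by metis
 qed
 then obtain e3 where e3: "e3 : cE C'"
   "h = (SE e3, 0, True) & fst (cends C' e3) = jv v | h = (SE e3, clen C' e3, False) & snd (cends C' e3) = jv v"
  using h1(1) unfolding dir_at_PV[OF cC'] by auto
 have "e3 ~: emb ` cE C"
 proof
  assume "e3 : emb ` cE C"
  then obtain e where e: "e : cE C" "e3 = emb e" by blast
  have "h : {(SE (emb e), 0, True), (SE (emb e), clen C' (emb e), False)}" using e3(2) e by auto
  hence "h = Di (SE e, 0, True) | h = Di (SE e, clen C e, False)"
   unfolding emb_dirs[OF e(1), symmetric] by (simp only: insert_iff empty_iff simp_thms)
  thus False using notDi dirs_ends[OF e(1)] by blast
 qed
 then obtain z3 where z3: "z3 : cV C' - H0" "e3 = pe' z3" using non_emb[OF f e3(1)] by blast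
 note F3 = frD[OF f z3(1)]
 have "jv v ~= z3" using z3(1) v by auto
 hence pz: "pv' z3 = jv v" using e3(2) F3(2) z3(2) by auto
 have "h = ed C' (pe' z3) (pv' z3)" using e3(2) F3(2,4) z3(2) pz by (auto simp: ed_def)
 thus ?thesis using that[of z3] z3(1) pz by blast
qed

definition Su :: "nat => dir => nat" where
 "Su v h' = (SUM h:{h:dir_at C (PV v). img (Di h) = h'}. sl (Di h))"

lemma fin_at: "v : cV C ==> finite (dir_at C (PV v))" "v : cV C ==> finite (dir_at C' (PV (jv v)))"
 using finite_dir_at[OF cC, of "PV v"] finite_dir_at[OF cC', of "PV (jv v)"] jv by auto

lemma Di_inj_at: "inj_on Di (dir_at C x)"
 by (rule inj_on_subset[OF Di_inj]) (auto simp: dir_at_def)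

lemma Su_split:
 assumes v: "v : cV C" and h': "h' : dir_at D (PV (tv (jv v)))"
 shows "d (PV (jv v)) = Su v h' + (SUM h:{h:Td v. img h = h'}. sl h)"
proof -
 have jV: "jv v : cV C'" using jv[OF v] by simp
 have 1: "{h:dir_at C' (PV (jv v)). img h = h'} = Di ` {h:dir_at C (PV v). img (Di h) = h'} Un {h:Td v. img h = h'}"
  using Di_sub[OF v] by (auto simp: Td_def)
 have "d (PV (jv v)) = (SUM h:{h:dir_at C' (PV (jv v)). img h = h'}. sl h)"
  using fh'(3)[of "PV (jv v)" h'] tv[OF jV] jV h' by simp
 also have "... = (SUM h:Di ` {h:dir_at C (PV v). img (Di h) = h'}. sl h) + (SUM h:{h:Td v. img h = h'}. sl h)"
  unfolding 1 by (rule sum.union_disjoint) (use fin_at[OF v] in \<open>auto simp: Td_def\<close>)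
 also have "(SUM h:Di ` {h:dir_at C (PV v). img (Di h) = h'}. sl h) = Su v h'"
  unfolding Su_def by (subst sum.reindex) (auto intro: inj_on_subset[OF Di_inj_at])
 finally show ?thesis .
qed

text \<open>By \<open>tree_dir\<close> attached trees contribute nothing towards a leg, so the whole
  local degree is already visible in \<open>C\<close>.\<close>

lemma Su_up:
 assumes t: "tp (clegv D l) lev pe pv" and l: "l : cL D" and v: "v : cV C"
 shows "Su v (updir l pe (tv (jv v))) = d (PV (jv v))"
proof -
 obtain lev' pe' pv' where f: "fr lev' pe' pv'" using forest unfolding fr_def by metis
 have "{h:Td v. img h = updir l pe (tv (jv v))} = {}"
 proof (rule ccontr)
  assume "{h:Td v. img h = updir l pe (tv (jv v))} ~= {}"
  then obtain h where h: "h : Td v" "img h = updir l pe (tv (jv v))" by blast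
  obtain z where z: "z : cV C' - H0" "h = ed C' (pe' z) (pv' z)" "pv' z = jv v" by (rule Td_dir[OF f v h(1)])
  thus False using tree_dir[OF t l f z(1)] h(2) by simp
 qed
 moreover have "updir l pe (tv (jv v)) : dir_at D (PV (tv (jv v)))"
  using updir_at[OF t l] tv jv[OF v] by blast
 ultimately show ?thesis using Su_split[OF v, of "updir l pe (tv (jv v))"] by (metis add_0_right sum.empty)
qed

text \<open>Effectivity of the large morphism contains minus the slopes of the tree directions and
  plus their number. Every slope is at least 1, so removing the trees keeps the inequality.\<close>

lemma eff_bound:
 assumes v: "v : cV C"
 shows "0 <= 2 * int (d (PV (jv v))) - (SUM h:dir_at C (PV v). int (sl (Di h))) - vchi C v"
proof -
 have jV: "jv v : cV C'" using jv[OF v] by simp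
 let ?x = "PV (jv v)" and ?y = "PV (tv (jv v))"
 have tx: "ta ?x = ?y" "tv (jv v) : cV D" using tv[OF jV] by auto
 have fD: "finite (dir_at D ?y)" using finite_dir_at[OF cD, of ?y] tx by simp
 have "(SUM h:dir_at C' ?x. sl h) = (SUM h':dir_at D ?y. SUM h:{h:dir_at C' ?x. img h = h'}. sl h)"
  by (rule sum.group[symmetric]) (use fin_at[OF v] fD img_at[of _ ?x] tx in auto)
 also have "... = (SUM h':dir_at D ?y. d ?x)" by (rule sum.cong) (use fh'(3)[of ?x] jV tx in auto)
 finally have tot: "(SUM h:dir_at C' ?x. sl h) = val D ?y * d ?x" by (simp add: val_def)
 have un: "dir_at C' ?x = Di ` dir_at C (PV v) Un Td v" using Di_sub[OF v] by (auto simp: Td_def)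
 have "(SUM h:dir_at C' ?x. sl h) = (SUM h:Di ` dir_at C (PV v). sl h) + (SUM h:Td v. sl h)"
  unfolding un by (rule sum.union_disjoint) (use fin_at[OF v] in \<open>auto simp: Td_def\<close>)
 also have "(SUM h:Di ` dir_at C (PV v). sl h) = (SUM h:dir_at C (PV v). sl (Di h))"
  by (subst sum.reindex) (auto intro: Di_inj_at)
 finally have 1: "(SUM h:dir_at C (PV v). sl (Di h)) + (SUM h:Td v. sl h) = val D ?y * d ?x" using tot by simp
 have "card (Td v) = (SUM h:Td v. 1)" by simp
 also have "... <= (SUM h:Td v. sl h)"
 proof (rule sum_mono)
  fix h assume "h : Td v"
  hence "h : dirs C'" by (auto simp: Td_def dir_at_def)
  thus "1 <= sl h" using sl_pos by fastforce
 qed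
 finally have 2: "card (Td v) <= (SUM h:Td v. sl h)" .
 have "val C' ?x = card (Di ` dir_at C (PV v)) + card (Td v)"
  unfolding val_def un by (rule card_Un_disjoint) (use fin_at[OF v] in \<open>auto simp: Td_def\<close>)
 hence 3: "val C' ?x = val C (PV v) + card (Td v)" using card_image[OF Di_inj_at] by (simp add: val_def)
 have "gen C' ?x = gen C (PV v)" using io(3) jv[OF v] v by (metis pts_PV)
 hence 4: "chi C' ?x = vchi C v - int (card (Td v))" using 3 chi_PV[OF cC, of v] by (simp add: chi_def)
 have "?x : pts C'" using jV by simp
 hence 5: "0 <= int (d ?x) * chi D ?y - chi C' ?x" using eff tx(1) by metis
 have "int (d ?x) * chi D ?y <= int (d ?x) * (2 - int (val D ?y))"
  by (rule mult_left_mono) (auto simp: chi_def)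
 also have "... = 2 * int (d ?x) - int (val D ?y * d ?x)" by (simp add: algebra_simps)
 also have "... = 2 * int (d ?x) - int (SUM h:dir_at C (PV v). sl (Di h)) - int (SUM h:Td v. sl h)" using 1 by linarith
 finally have 6: "int (d ?x) * chi D ?y <= 2 * int (d ?x) - int (SUM h:dir_at C (PV v). sl (Di h)) - int (SUM h:Td v. sl h)" .
 have "(SUM h:dir_at C (PV v). int (sl (Di h))) = int (SUM h:dir_at C (PV v). sl (Di h))" by simp
 thus ?thesis using 2 4 5 6 by linarith
qed

end

section \<open>The cover defined by a refined morphism\<close>

context rcover
begin

abbreviation "rt == clegv D leg_zero"
abbreviation "om == clegv D leg_inf"

lemma legs_D: "leg_zero : cL D" "leg_inf : cL D" "rt : cV D" "om : cV D" "leg_zero ~= leg_inf"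
 using LD wf_legv[OF wfs(3)] by (auto simp: leg_zero_def leg_inf_def)

definition kap :: "nat => nat" where "kap v = tv (jv v)"

lemma kap: "v : cV C ==> kap v : cV D & (ta o ic) (PV v) = PV (kap v)"
 using jv tv by (auto simp: kap_def)

lemma edge_cov:
 assumes t: "tp rt lev pe pv" and e: "e : cE C"
 shows "EX c m u. c : cV D & c ~= rt & 0 < m & real m * clen C e = clen D (pe c) &
  kap (if u then fst (cends C e) else snd (cends C e)) = c &
  kap (if u then snd (cends C e) else fst (cends C e)) = pv c &
  img (Di (if u then (SE e, 0, True) else (SE e, clen C e, False))) = ed D (pe c) c &
  img (Di (if u then (SE e, clen C e, False) else (SE e, 0, True))) = ed D (pe c) (pv c) &
  sl (Di (SE e, 0, True)) = m & sl (Di (SE e, clen C e, False)) = m"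
proof -
 obtain j m w where j: "j : cE D" "real m * clen C e = clen D j"
  "(img o Di) (SE e, 0, True) = (if w then (SE j, 0, True) else (SE j, clen D j, False))"
  "(img o Di) (SE e, clen C e, False) = (if w then (SE j, clen D j, False) else (SE j, 0, True))"
  "(sl o Di) (SE e, 0, True) = m" "(sl o Di) (SE e, clen C e, False) = m"
  by (rule F.edge_image[OF e], rule that, assumption+)
 have "j : pe ` (cV D - {rt})" using t j(1) unfolding tp_def bij_betw_def by metis
 then obtain c where c0: "j = pe c" "c : cV D - {rt}" by (rule imageE)
 have c: "c : cV D" "c ~= rt" "pe c = j" using c0 by auto
 note P = tpD[OF t c(1,2)]
 have dd: "(SE e, 0, True) : dirs C" "(SE e, clen C e, False) : dirs C" using dirs_ends[OF e] by auto
 have mp: "0 < m" using F.k_pos[OF dd(1)] j(5) by simp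
 have V: "fst (cends C e) : cV C" "snd (cends C e) : cV C" using wf_ends[OF wfs(1) e] by auto
 have b1: "PV (kap (fst (cends C e))) = pos D (SE j) (if w then 0 else clen D j)"
  using mgerm_base[OF conjunct2[OF F.g[OF dd(1)]]] kap[OF V(1)] pos_ends[OF e cC] j(3) by (cases w) auto
 have b2: "PV (kap (snd (cends C e))) = pos D (SE j) (if w then clen D j else 0)"
  using mgerm_base[OF conjunct2[OF F.g[OF dd(2)]]] kap[OF V(2)] pos_ends[OF e cC] j(4) by (cases w) auto
 have k1: "kap (fst (cends C e)) = (if w then fst (cends D j) else snd (cends D j))"
  "kap (snd (cends C e)) = (if w then snd (cends D j) else fst (cends D j))"
  using b1 b2 pos_ends[OF j(1) cD] by (cases w; auto)+
 have ends: "cends D j = (c, pv c) | cends D j = (pv c, c)" using P(2) c(3) by simp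
 have i1: "img (Di (SE e, 0, True)) = (if w then (SE j, 0, True) else (SE j, clen D j, False))"
  and i2: "img (Di (SE e, clen C e, False)) = (if w then (SE j, clen D j, False) else (SE j, 0, True))" using j(3,4) by auto
 define u where "u = (kap (fst (cends C e)) = c)"
 have ne: "c ~= pv c" using P(5) by simp
 have "kap (if u then fst (cends C e) else snd (cends C e)) = c &
  kap (if u then snd (cends C e) else fst (cends C e)) = pv c &
  img (Di (if u then (SE e, 0, True) else (SE e, clen C e, False))) = ed D (pe c) c &
  img (Di (if u then (SE e, clen C e, False) else (SE e, 0, True))) = ed D (pe c) (pv c)"
 proof (cases "fst (cends D j) = c")
  case True
  hence ee: "fst (cends D j) = c" "snd (cends D j) = pv c" using ends by (cases "cends D j"; auto)+
  show ?thesis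
  proof (cases w)
   case True
   hence "u" using k1 ee by (simp add: u_def)
   thus ?thesis using True k1 ee i1 i2 c(3) ne by (simp add: ed_def)
  next
   case False
   hence "~  u" using k1 ee ne by (simp add: u_def)
   thus ?thesis using False k1 ee i1 i2 c(3) ne by (simp add: ed_def)
  qed
 next
  case False
  hence ee: "fst (cends D j) = pv c" "snd (cends D j) = c" using ends by (cases "cends D j"; auto)+
  show ?thesis
  proof (cases w)
   case True
   hence "~  u" using k1 ee ne by (simp add: u_def)
   thus ?thesis using True k1 ee i1 i2 c(3) ne by (simp add: ed_def)
  next
   case False
   hence "u" using k1 ee by (simp add: u_def)
   thus ?thesis using False k1 ee i1 i2 c(3) ne by (simp add: ed_def)
  qed
 qed
 thus ?thesis using c mp j(2,5,6) by (intro exI[of _ c] exI[of _ m] exI[of _ u]) simp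
qed

lemma leg_cov:
 assumes l: "l : cL C"
 shows "0 < a l ==> img (Di (SL l, 0, True)) = (SL leg_zero, 0, True) & sl (Di (SL l, 0, True)) = nat (a l) & kap (clegv C l) = rt"
  "a l < 0 ==> img (Di (SL l, 0, True)) = (SL leg_inf, 0, True) & sl (Di (SL l, 0, True)) = nat (- a l) & kap (clegv C l) = om"
proof -
 have dd: "(SL l, 0, True) : dirs C" using l by (auto simp: dirs_def seg_dom_def)
 have g: "img (Di (SL l, 0, True)) = (SL l', 0, True) & sl (Di (SL l, 0, True)) = k & kap (clegv C l) = clegv D l'"
  if m: "mleg C' D ta l l' k" for l' k
 proof -
  have "mleg C D (ta o ic) l l' (k * 1)" by (rule mleg_comp[OF _ m]) (use io(6) l in blast)
  hence 1: "(img o Di) (SL l, 0, True) = (SL l', 0, True)" "(sl o Di) (SL l, 0, True) = k"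
   using F.leg_image[OF l, of l' k] by auto
  have "PV (kap (clegv C l)) = PV (clegv D l')"
   using mgerm_base[OF conjunct2[OF F.g[OF dd]]] kap[OF wf_legv[OF wfs(1) l]] 1 by (simp add: pos_def)
  thus ?thesis using 1 by simp
 qed
 show "0 < a l ==> img (Di (SL l, 0, True)) = (SL leg_zero, 0, True) & sl (Di (SL l, 0, True)) = nat (a l) & kap (clegv C l) = rt"
  using g legs l by blast
 show "a l < 0 ==> img (Di (SL l, 0, True)) = (SL leg_inf, 0, True) & sl (Di (SL l, 0, True)) = nat (- a l) & kap (clegv C l) = om"
  using g legs l by blast
qed

text \<open>Compares the rootings at the two legs: on the path, the edge above \<open>c\<close> is
  for its parent \<open>c'\<close> the edge leading to \<infinity>. Equality on the path thereby
  becomes \<open>Su_up\<close> for leg \<infinity>.\<close>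

lemma line_dir:
 assumes t0: "tp rt lev0 pe0 pv0" and t1: "tp om lev1 pe1 pv1"
  and c: "(pv0 ^^ Suc i) om = c'" "c = (pv0 ^^ i) om" "!!k. k <= i ==> (pv0 ^^ k) om : cV D - {rt}"
 shows "c' ~= om & c' : cV D & pe1 c' = pe0 c"
 using c
proof (induction i arbitrary: c c')
 case 0
 hence w: "c = om" "om ~= rt" "c' = pv0 om" using "0"(3)[of 0] by auto
 note P = tpD[OF t0 legs_D(4) w(2)]
 have "pe0 om : pe1 ` (cV D - {om})" using t1 P(1) unfolding tp_def bij_betw_def by metis
 then obtain x where x0: "pe0 om = pe1 x" "x : cV D - {om}" by (rule imageE)
 have x: "x : cV D" "x ~= om" "pe1 x = pe0 om" using x0 by auto
 have "x = pv0 om" using tpD(2)[OF t1 x(1,2)] P(2) x(2,3) by auto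
 thus ?case using x w by auto
next
 case (Suc i)
 define b where "b = (pv0 ^^ i) om"
 have cb: "c = pv0 b" "c = (pv0 ^^ Suc i) om" using Suc.prems by (auto simp: b_def)
 have IH: "c ~= om & c : cV D & pe1 c = pe0 b"
  using Suc.IH[of c b] cb Suc.prems(3) b_def by auto
 have bV: "b : cV D" "b ~= rt" using Suc.prems(3)[of i] by (auto simp: b_def)
 have cV: "c : cV D" "c ~= rt" using Suc.prems(2) Suc.prems(3)[of "Suc i"] by auto
 have c': "c' = pv0 c" using Suc.prems by auto
 note P = tpD[OF t0 cV]
 have "pe0 c : pe1 ` (cV D - {om})" using t1 P(1) unfolding tp_def bij_betw_def by metis
 then obtain x where x0: "pe0 c = pe1 x" "x : cV D - {om}" by (rule imageE)
 have x: "x : cV D" "x ~= om" "pe1 x = pe0 c" using x0 by auto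
 have "x = c | x = pv0 c" using tpD(2)[OF t1 x(1,2)] P(2) x(3) by auto
 moreover have "x ~= c"
 proof
  assume "x = c"
  hence "pe0 b = pe0 c" using IH x(3) by simp
  hence "b = c" using tp_inj[OF t0 bV cV] by simp
  thus False using tpD(5)[OF t0 bV] cb(1) by simp
 qed
 ultimately show ?case using x c' by auto
qed

theorem cover_exists:
 "EX W pa rt om LL ka m up el. tcov a C W pa rt om LL ka m up & (ALL w:W - {rt}. (0::real) < el w) &
   (ALL e:cE C. 0 < m e & clen C e = el (ka (lo C up e)) / real (m e))"
proof -
 have "EX lev pe pv. tp rt lev pe pv" unfolding tp_def by (rule tree_parents[OF cD gD legs_D(3)])
 then obtain lev0 pe0 pv0 where t0: "tp rt lev0 pe0 pv0" by blast
 have "EX lev pe pv. tp om lev pe pv" unfolding tp_def by (rule tree_parents[OF cD gD legs_D(4)])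
 then obtain lev1 pe1 pv1 where t1: "tp om lev1 pe1 pv1" by blast
 have finD: "finite (cV D)" using wf_fin[OF wfs(3)] by simp
 have lev: "ALL w:cV D - {rt}. pv0 w : cV D & lev0 (pv0 w) < lev0 w" using tpD(3,4)[OF t0] by blast
 obtain N where N: "(pv0 ^^ N) om = rt" "!!i. i < N ==> (pv0 ^^ i) om : cV D - {rt}"
  "rtree (cV D) pv0 rt om ((%i. (pv0 ^^ i) om) ` {..N})"
  by (rule rtree_path[OF finD legs_D(3,4) lev], rule that, assumption+)
 define LL where "LL = (%i. (pv0 ^^ i) om) ` {..N}"
 obtain cc m up where ec: "!!e. e : cE C ==> cc e : cV D & cc e ~= rt & 0 < m e & real (m e) * clen C e = clen D (pe0 (cc e)) &
  kap (if up e then fst (cends C e) else snd (cends C e)) = cc e &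
  kap (if up e then snd (cends C e) else fst (cends C e)) = pv0 (cc e) &
  img (Di (if up e then (SE e, 0, True) else (SE e, clen C e, False))) = ed D (pe0 (cc e)) (cc e) &
  img (Di (if up e then (SE e, clen C e, False) else (SE e, 0, True))) = ed D (pe0 (cc e)) (pv0 (cc e)) &
  sl (Di (SE e, 0, True)) = m e & sl (Di (SE e, clen C e, False)) = m e"
  using edge_cov[OF t0] by metis
 have E: "kap (lo C up e) = cc e" "kap (hi C up e) = pv0 (cc e)" "cc e : cV D" "cc e ~= rt" "0 < m e"
  "img (Di (dirl C up e)) = ed D (pe0 (cc e)) (cc e)" "img (Di (dirh C up e)) = ed D (pe0 (cc e)) (pv0 (cc e))"
  "sl (Di (dirl C up e)) = m e" "sl (Di (dirh C up e)) = m e" "real (m e) * clen C e = clen D (pe0 (cc e))"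
  if "e : cE C" for e
  using ec[OF that] by (auto simp: lo_def hi_def dirl_def dirh_def)
 have finC: "finite (cE C)" "finite (cL C)" using wf_fin[OF wfs(1)] by auto
 have pe_ne: "pe0 c ~= pe0 (pv0 c)" if "c : cV D" "c ~= rt" "pv0 c ~= rt" for c
  using tp_inj[OF t0 that(1,2) _ that(3)] tpD(3,5)[OF t0 that(1,2)] by metis
 have bal: "tbal a C (cV D) pv0 rt om LL kap m up {v}" if v: "v : cV C" for v
 proof -
  let ?y = "kap v" and ?d = "d (PV (jv v))"
  have y: "?y : cV D" using kap[OF v] by simp
  have Su: "Su v h' = (SUM e:{e:cE C. lo C up e = v}. if ed D (pe0 (cc e)) (cc e) = h' then m e else 0)
    + (SUM e:{e:cE C. hi C up e = v}. if ed D (pe0 (cc e)) (pv0 (cc e)) = h' then m e else 0)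
    + (SUM l:{l:cL C. clegv C l = v}. if img (Di (SL l, 0, True)) = h' then sl (Di (SL l, 0, True)) else 0)" for h'
  proof -
   have "Su v h' = (SUM h:dir_at C (PV v). if img (Di h) = h' then sl (Di h) else 0)"
    unfolding Su_def using fin_at(1)[OF v] by (simp add: sum.inter_filter)
   also have "... = (SUM e:{e:cE C. lo C up e = v}. if ed D (pe0 (cc e)) (cc e) = h' then m e else 0)
    + (SUM e:{e:cE C. hi C up e = v}. if ed D (pe0 (cc e)) (pv0 (cc e)) = h' then m e else 0)
    + (SUM l:{l:cL C. clegv C l = v}. if img (Di (SL l, 0, True)) = h' then sl (Di (SL l, 0, True)) else 0)"
    unfolding sum_dir_lohi[OF cC, of _ v up] by (intro arg_cong2[of _ _ _ _ "(+)"] sum.cong refl) (auto simp: E)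
   finally show ?thesis .
  qed
  have loy: "cc e = ?y" if "e : cE C" "lo C up e = v" for e using E(1)[OF that(1)] that(2) by simp
  have hiy: "pv0 (cc e) = ?y" if "e : cE C" "hi C up e = v" for e using E(2)[OF that(1)] that(2) by simp
  have legP: "?y = rt" if "l : cL C" "0 < a l" "clegv C l = v" for l using leg_cov(1)[OF that(1,2)] that(3) by simp
  have legN: "?y = om" if "l : cL C" "a l < 0" "clegv C l = v" for l using leg_cov(2)[OF that(1,2)] that(3) by simp
  define SL1 where "SL1 = (SUM e:{e:cE C. lo C up e = v}. m e)"
  have hi_up: "ed D (pe0 (cc e)) (pv0 (cc e)) ~= updir leg_zero pe0 ?y" if e: "e : cE C" "hi C up e = v" for e
  proof
   assume a: "ed D (pe0 (cc e)) (pv0 (cc e)) = updir leg_zero pe0 ?y"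
   hence "?y ~= rt" by (auto simp: updir_def ed_def split: if_splits)
   hence "ed D (pe0 (cc e)) (pv0 (cc e)) = ed D (pe0 ?y) ?y" using a by (simp add: updir_def)
   hence "pe0 (cc e) = pe0 ?y" by (metis ed_seg seg.inject(1))
   thus False using pe_ne[OF E(3,4)[OF e(1)]] hiy[OF e] \<open>?y ~= rt\<close> by simp
  qed
  have legsum: "(SUM l:{l:cL C. clegv C l = v}. if img (Di (SL l, 0, True)) = (SL leg_zero, 0, True) then sl (Di (SL l, 0, True)) else 0) = PLs a C {v}"
   "(SUM l:{l:cL C. clegv C l = v}. if img (Di (SL l, 0, True)) = (SL leg_inf, 0, True) then sl (Di (SL l, 0, True)) else 0) = NLs a C {v}"
   "(SUM l:{l:cL C. clegv C l = v}. int (sl (Di (SL l, 0, True)))) = int (PLs a C {v}) + int (NLs a C {v})"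
  proof -
   have sp: "sl (Di (SL l, 0, True)) = (if 0 < a l then nat (a l) else 0) + (if a l < 0 then nat (- a l) else 0)"
    "img (Di (SL l, 0, True)) = (if 0 < a l then (SL leg_zero, 0, True) else (SL leg_inf, 0, True))" if "l : cL C" for l
    using leg_cov[OF that] that by (auto dest: bspec[OF nz])
   have P: "PLs a C {v} = (SUM l:{l:cL C. clegv C l = v}. if 0 < a l then nat (a l) else 0)"
    unfolding PLs_def using finC by (subst sum.inter_filter[symmetric]) (auto intro!: sum.cong)
   have N: "NLs a C {v} = (SUM l:{l:cL C. clegv C l = v}. if a l < 0 then nat (- a l) else 0)"
    unfolding NLs_def using finC by (subst sum.inter_filter[symmetric]) (auto intro!: sum.cong)
   show "(SUM l:{l:cL C. clegv C l = v}. if img (Di (SL l, 0, True)) = (SL leg_zero, 0, True) then sl (Di (SL l, 0, True)) else 0) = PLs a C {v}"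
    unfolding P by (rule sum.cong) (auto simp: sp leg_zero_def leg_inf_def)
   show "(SUM l:{l:cL C. clegv C l = v}. if img (Di (SL l, 0, True)) = (SL leg_inf, 0, True) then sl (Di (SL l, 0, True)) else 0) = NLs a C {v}"
    unfolding N
   proof (rule sum.cong[OF refl])
    fix l assume l: "l : {l:cL C. clegv C l = v}"
    hence "a l ~= 0" using nz by auto
    thus "(if img (Di (SL l, 0, True)) = (SL leg_inf, 0, True) then sl (Di (SL l, 0, True)) else 0) = (if a l < 0 then nat (- a l) else 0)"
     using sp[of l] l by (auto simp: leg_zero_def leg_inf_def)
   qed
   have "(SUM l:{l:cL C. clegv C l = v}. sl (Di (SL l, 0, True))) = PLs a C {v} + NLs a C {v}"
    unfolding P N sum.distrib[symmetric] by (rule sum.cong) (auto simp: sp)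
   thus "(SUM l:{l:cL C. clegv C l = v}. int (sl (Di (SL l, 0, True)))) = int (PLs a C {v}) + int (NLs a C {v})"
    by (simp flip: of_nat_sum of_nat_add)
  qed
  have legimg: "img (Di (SL l, 0, True)) : {(SL leg_zero, 0, True), (SL leg_inf, 0, True)}" if "l : cL C" for l
   using leg_cov[OF that] nz that by (metis insertCI linorder_less_linear)
  have P0: "PLs a C {v} = 0" if "?y ~= rt"
   unfolding PLs_def using that legP by (intro sum.neutral) auto
  have N0: "NLs a C {v} = 0" if "?y ~= om"
   unfolding NLs_def using that legN by (intro sum.neutral) auto
  have d1: "?d = SL1 + PLs a C {v}"
  proof -
   have "?d = Su v (updir leg_zero pe0 ?y)" using Su_up[OF t0 legs_D(1) v] by (simp add: kap_def)
   also have "... = SL1 + 0 + PLs a C {v}"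
    unfolding Su
   proof (intro arg_cong2[of _ _ _ _ "(+)"])
    show "(SUM e:{e:cE C. lo C up e = v}. if ed D (pe0 (cc e)) (cc e) = updir leg_zero pe0 ?y then m e else 0) = SL1"
     unfolding SL1_def
    proof (rule sum.cong[OF refl])
     fix e assume e: "e : {e:cE C. lo C up e = v}"
     hence ce: "cc e = ?y" using loy by simp
     moreover have "?y ~= rt" using E(4)[of e] e ce by simp
     ultimately show "(if ed D (pe0 (cc e)) (cc e) = updir leg_zero pe0 ?y then m e else 0) = m e" by (simp add: updir_def)
    qed
    show "(SUM e:{e:cE C. hi C up e = v}. if ed D (pe0 (cc e)) (pv0 (cc e)) = updir leg_zero pe0 ?y then m e else 0) = 0"
     by (rule sum.neutral) (use hi_up in auto)
    show "(SUM l:{l:cL C. clegv C l = v}. if img (Di (SL l, 0, True)) = updir leg_zero pe0 ?y then sl (Di (SL l, 0, True)) else 0) = PLs a C {v}"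
    proof (cases "?y = rt")
     case True
     thus ?thesis using legsum(1) by (simp add: updir_def)
    next
     case False
     have "img (Di (SL l, 0, True)) ~= updir leg_zero pe0 ?y" if "l : cL C" for l
      using legimg[OF that] False by (auto simp: updir_def ed_def)
     thus ?thesis using P0[OF False] by simp
    qed
   qed
   finally show ?thesis by simp
  qed
  have UT1: "UT a C rt up kap m ?y {v} = ?d"
  proof -
   have "{e:cE C. kap (lo C up e) = ?y & lo C up e : {v}} = {e:cE C. lo C up e = v}" by auto
   hence "UU C up kap m ?y {v} = SL1" unfolding UU_def SL1_def by simp
   thus ?thesis unfolding UT_def d1 using P0 by auto
  qed
  have UT2: "UT a C rt up kap m c {v} = 0" if "c ~= ?y" for c
  proof -
   have emp: "{e:cE C. kap (lo C up e) = c & lo C up e : {v}} = {}" using that by auto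
   have "UU C up kap m c {v} = 0" unfolding UU_def emp by simp
   thus ?thesis unfolding UT_def using P0 that by auto
  qed
  have Dn: "DD C up kap m c {v} = Su v (ed D (pe0 c) (pv0 c))" if c: "c : cV D" "c ~= rt" "pv0 c = ?y" for c
  proof -
   have "Su v (ed D (pe0 c) (pv0 c)) = 0 + (SUM e:{e:cE C. hi C up e = v}. if cc e = c then m e else 0) + 0"
    unfolding Su
   proof (intro arg_cong2[of _ _ _ _ "(+)"])
    show "(SUM e:{e:cE C. lo C up e = v}. if ed D (pe0 (cc e)) (cc e) = ed D (pe0 c) (pv0 c) then m e else 0) = 0"
    proof (rule sum.neutral, rule ballI)
     fix e assume e: "e : {e:cE C. lo C up e = v}"
     hence ce1: "cc e = ?y" using loy by simp
     hence ce: "cc e = ?y" "?y ~= rt" using E(4)[of e] e by simp_all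
     have "ed D (pe0 (cc e)) (cc e) ~= ed D (pe0 c) (pv0 c)"
     proof
      assume "ed D (pe0 (cc e)) (cc e) = ed D (pe0 c) (pv0 c)"
      hence "pe0 (cc e) = pe0 c" by (metis ed_seg seg.inject(1))
      thus False using pe_ne[OF c(1,2)] c(3) ce by simp
     qed
     thus "(if ed D (pe0 (cc e)) (cc e) = ed D (pe0 c) (pv0 c) then m e else 0) = 0" by simp
    qed
    show "(SUM e:{e:cE C. hi C up e = v}. if ed D (pe0 (cc e)) (pv0 (cc e)) = ed D (pe0 c) (pv0 c) then m e else 0) =
     (SUM e:{e:cE C. hi C up e = v}. if cc e = c then m e else 0)"
    proof (rule sum.cong[OF refl])
     fix e assume e: "e : {e:cE C. hi C up e = v}"
     have "ed D (pe0 (cc e)) (pv0 (cc e)) = ed D (pe0 c) (pv0 c) <-> cc e = c"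
     proof
      assume "ed D (pe0 (cc e)) (pv0 (cc e)) = ed D (pe0 c) (pv0 c)"
      hence "pe0 (cc e) = pe0 c" by (metis ed_seg seg.inject(1))
      thus "cc e = c" using tp_inj[OF t0 _ _ c(1,2)] E(3,4) e by simp
     qed simp
     thus "(if ed D (pe0 (cc e)) (pv0 (cc e)) = ed D (pe0 c) (pv0 c) then m e else 0) = (if cc e = c then m e else 0)" by simp
    qed
    show "(SUM l:{l:cL C. clegv C l = v}. if img (Di (SL l, 0, True)) = ed D (pe0 c) (pv0 c) then sl (Di (SL l, 0, True)) else 0) = 0"
    proof (rule sum.neutral, rule ballI)
     fix l assume "l : {l:cL C. clegv C l = v}"
     hence "img (Di (SL l, 0, True)) ~= ed D (pe0 c) (pv0 c)" using legimg[of l] by (auto simp: ed_def)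
     thus "(if img (Di (SL l, 0, True)) = ed D (pe0 c) (pv0 c) then sl (Di (SL l, 0, True)) else 0) = 0" by simp
    qed
   qed
   also have "... = DD C up kap m c {v}"
    unfolding DD_def using finC by (simp add: sum.inter_filter[symmetric]) (auto intro!: sum.cong simp: E)
   finally show ?thesis by simp
  qed
  have D0: "DD C up kap m c {v} = 0" if c: "pv0 c ~= ?y" for c
  proof -
   have emp: "{e:cE C. kap (lo C up e) = c & hi C up e : {v}} = {}" using E(1,2) c by auto
   show ?thesis unfolding DD_def emp by simp
  qed
  have ddir: "ed D (pe0 c) (pv0 c) : dir_at D (PV ?y)" if c: "c : cV D" "c ~= rt" "pv0 c = ?y" for c
   using ed_at[OF cD tpD(1)[OF t0 c(1,2)], of "pv0 c"] tpD(2)[OF t0 c(1,2)] c(3) by auto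
  show ?thesis unfolding tbal_def
  proof (intro conjI ballI impI)
   fix c assume c: "c : cV D - {rt}"
   show "DD C up kap m c {v} <= UT a C rt up kap m (pv0 c) {v}"
   proof (cases "pv0 c = ?y")
    case True
    have "Su v (ed D (pe0 c) (pv0 c)) <= ?d" using Su_split[OF v, of "ed D (pe0 c) (pv0 c)"] ddir True c by (simp add: kap_def)
    thus ?thesis using Dn True c UT1 by simp
   qed (simp add: D0)
   assume cL: "c : LL"
   show "DD C up kap m c {v} = UT a C rt up kap m (pv0 c) {v}"
   proof (cases "pv0 c = ?y")
    case True
    \<comment> \<open>The path edge \<open>c\<close> below \<open>ka v\<close> leads to \<infinity>,
      so it carries the full local degree.\<close>
    obtain i where i: "i <= N" "c = (pv0 ^^ i) om" using cL by (auto simp: LL_def)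
    hence iN: "i < N" using N(1) c by (cases "i = N") auto
    have "pv0 c ~= om & pv0 c : cV D & pe1 (pv0 c) = pe0 c"
     by (rule line_dir[OF t0 t1 _ i(2)]) (use i N(2) iN in auto)
    hence "ed D (pe0 c) (pv0 c) = updir leg_inf pe1 (tv (jv v))" using True by (simp add: updir_def kap_def)
    hence "Su v (ed D (pe0 c) (pv0 c)) = ?d" using Su_up[OF t1 legs_D(2) v] by simp
    thus ?thesis using Dn True c UT1 by simp
   qed (use D0 UT2 in simp)
  next
   show "NLs a C {v} = UT a C rt up kap m om {v}"
   proof (cases "?y = om")
    case True
    have "?d = Su v (updir leg_inf pe1 ?y)" using Su_up[OF t1 legs_D(2) v] by (simp add: kap_def)
    also have "... = Su v (SL leg_inf, 0, True)" using True by (simp add: updir_def)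
    also have "... = 0 + 0 + NLs a C {v}"
    proof -
     have edSL: "ed D p q ~= (SL leg_inf, 0, True)" for p q by (simp add: ed_def)
     show ?thesis unfolding Su legsum(2)[symmetric] by (intro arg_cong2[of _ _ _ _ "(+)"] refl) (simp_all add: edSL)
    qed
    finally show ?thesis using UT1 True by simp
   next
    case False
    thus ?thesis using N0 UT2[of om] by simp
   qed
   have "(SUM h:dir_at C (PV v). int (sl (Di h))) = int SL1 + (SUM e:{e:cE C. hi C up e = v}. int (m e)) + (int (PLs a C {v}) + int (NLs a C {v}))"
    unfolding sum_dir_lohi[OF cC, of _ v up] legsum(3) SL1_def by (intro arg_cong2[of _ _ _ _ "(+)"] sum.cong refl) (auto simp: E)
   thus "0 <= RR a C up m {v}"
    using eff_bound[OF v] d1 unfolding RR_def SL1_def by simp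
  qed
 qed
 have "tcov a C (cV D) pv0 rt om LL kap m up"
  unfolding tcov_def
 proof (intro conjI allI impI)
  show "rtree (cV D) pv0 rt om LL" using N(3) by (simp add: LL_def)
  show "tmap a C (cV D) pv0 rt om kap m up" unfolding tmap_def using E leg_cov kap by (auto simp: dest: E(5))
  fix A assume "satur C m A"
  hence A: "A <= cV C" by (simp add: satur_def)
  hence "finite A" using wf_fin[OF wfs(1)] finite_subset by blast
  thus "tbal a C (cV D) pv0 rt om LL kap m up A"
   using tbal_points[OF wfs(1)] bal A by blast
 qed
 moreover have "ALL w:cV D - {rt}. 0 < clen D (pe0 w)" using tpD(1)[OF t0] is_curve_len[OF cD] by auto
 moreover have "ALL e:cE C. 0 < m e & clen C e = clen D (pe0 (kap (lo C up e))) / real (m e)"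
  using E by (auto simp: field_simps)
 ultimately show ?thesis by (intro exI[of _ "cV D"] exI[of _ pv0] exI[of _ rt] exI[of _ om] exI[of _ LL] exI[of _ kap]
   exI[of _ m] exI[of _ up] exI[of _ "%w. clen D (pe0 w)"]) simp
qed

end

section \<open>Making the models of source, target and subcurve compatible\<close>

lemma refine_curve:
 assumes C: "is_curve C" and X: "finite X" "X <= pts C"
 obtains C1 bt D where "is_curve C1" "isom C C1 bt D" "PV ` cV C1 = bt ` (X Un PV ` cV C)"
proof -
 have wf: "wf_graph C" using C by (rule is_curve_wf)
 have nn: "ALL e:cE C. 0 <= clen C e" using is_curve_len[OF C] by (auto intro: less_imp_le)
 have i0: "isom C (curve_of C (clen C)) id id" by (rule isom_curve_of_self[OF C])
 have p: "pts (curve_of C (clen C)) = pts C" using i0 by (simp add: isom_def bij_betw_def)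
 have V: "PV ` cV (curve_of C (clen C)) = PV ` cV C"
 proof -
  have "v : cV (curve_of C (clen C)) <-> v : cV C" for v using p by (metis pts_PV)
  thus ?thesis by auto
 qed
 have "EX H lab vl ll' bt D. subdiv C H lab vl & (ALL e:cE H. 0 <= ll' e) & (ALL e:cE C. pushl C H lab ll' e = clen C e) &
  isom (curve_of C (clen C)) (curve_of H ll') bt D &
  PV ` cV (curve_of H ll') = bt ` (X Un PV ` cV (curve_of C (clen C)))"
  by (rule refine[OF wf nn X(1)]) (use X p in simp)
 then obtain H lab vl ll' bt D where r: "subdiv C H lab vl" "ALL e:cE H. 0 <= ll' e"
  "isom (curve_of C (clen C)) (curve_of H ll') bt D"
  "PV ` cV (curve_of H ll') = bt ` (X Un PV ` cV C)" using V by metis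
 have "wf_graph H" using subdiv_inv[OF r(1) wf] by blast
 hence "is_curve (curve_of H ll')" using r(2) by (rule is_curve_of)
 moreover have "isom C (curve_of H ll') (bt o id) (D o id)" by (rule isom_trans[OF i0 r(3)])
 ultimately show ?thesis using that r(4) by (metis comp_id)
qed

text \<open>The set \<open>Y\<close> contains all images of vertices from the start. Its preimage
  then already contains the vertices of the source, and the points of the subcurve over that
  preimage contain the vertices of the subcurve, so no refinement spoils an earlier one.\<close>

theorem DR_imp_type:
 assumes wf: "wf_graph G" and L: "cL G = {1..n}" and nz: "ALL i:{1..n}. a i ~= 0"
  and nn: "ALL e:cE G. 0 <= ll e" and DR: "DR n a (curve_of G ll)"
 shows "EX H lab vl W pa rt om LL ka m up (el::nat => real). subdiv G H lab vl & tcov a H W pa rt om LL ka m up &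
   (ALL w:W - {rt}. 0 < el w) &
   (ALL e:cE G. ll e = (SUM f:{f:cE H. lab f = SE e}. el (ka (lo H up f)) / real (m f)))"
proof -
 let ?C = "curve_of G ll"
 have cC: "is_curve ?C" by (rule is_curve_of[OF wf nn])
 have LC: "cL ?C = {1..n}" using L by (simp add: curve_of_simps)
 obtain C' D ta where d1: "modification ?C C'" "is_curve D" "tgenus D = 0" "cL D = {leg_zero, leg_inf}"
  "fin_eff_harm C' D ta"
  "ALL i:{1..n}. (0 < a i --> mleg C' D ta i leg_zero (nat (a i))) & (a i < 0 --> mleg C' D ta i leg_inf (nat (- a i)))"
  using DR unfolding DR_def by blast
 obtain img sl d where fh: "fin_harm C' D ta img sl d" "ALL x:pts C'. 0 <= int (d x) * chi D (ta x) - chi C' x"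
  using d1(5) unfolding fin_eff_harm_def by blast
 obtain ic where cC': "is_curve C'" and io0: "ALL x:pts ?C. ic x : pts C'" "inj_on ic (pts ?C)"
   "ALL x:pts ?C. gen C' (ic x) = gen ?C x"
   "ALL h:dirs ?C. EX h':dirs C'. mgerm ?C C' ic h h' 1"
   "cL C' = cL ?C" "ALL l:cL ?C. mleg ?C C' ic l l 1"
   "ALL y:pts C' - ic ` pts ?C. gen C' y = 0" "tgenus C' = tgenus ?C"
  using d1(1) unfolding modification_def by blast
 have "ALL h:dirs ?C. EX h'. h' : dirs C' & mgerm ?C C' ic h h' 1" using io0(4) by blast
 hence "EX Dm. ALL h:dirs ?C. Dm h : dirs C' & mgerm ?C C' ic h (Dm h) 1" by (rule bchoice)
 then obtain Dm where Dm: "ALL h:dirs ?C. Dm h : dirs C' & mgerm ?C C' ic h (Dm h) 1" by blast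
 have wfs: "wf_graph ?C" "wf_graph C'" "wf_graph D" using cC cC' d1(2) is_curve_wf by auto
 have finV: "finite (cV ?C)" "finite (cV C')" "finite (cV D)" using wf_fin wfs by auto
 have tap: "ta x : pts D" if "x : pts C'" for x using fh(1) that by (auto simp: fin_harm_def)
 \<comment> \<open>refine the target, then the source, then the subcurve, so that vertices correspond\<close>
 define Y where "Y = ta ` PV ` cV C' Un ta ` ic ` PV ` cV ?C Un PV ` cV D"
 have Y: "finite Y" "Y <= pts D" using finV tap io0(1) by (auto simp: Y_def)
 obtain D1 btD DD' where D1: "is_curve D1" "isom D D1 btD DD'" "PV ` cV D1 = btD ` (Y Un PV ` cV D)"
  by (rule refine_curve[OF d1(2) Y])
 have VD1: "PV ` cV D1 = btD ` Y" using D1(3) by (simp add: Y_def)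
 interpret T: pl_map C' D ta img sl
  by unfold_locales (use cC' d1(2) fh(1) in \<open>auto simp: fin_harm_def\<close>)
 define X' where "X' = {x:pts C'. ta x : Y}"
 have lg: "!!l. l : cL C' ==> EX l' m. mleg C' D ta l l' m" using fh(1) unfolding fin_harm_def by blast
 have X': "finite X'" "X' <= pts C'"
  unfolding X'_def using T.finite_preimage[OF Y(1) lg] by auto
 obtain C1' bt' D' where C1': "is_curve C1'" "isom C' C1' bt' D'" "PV ` cV C1' = bt' ` (X' Un PV ` cV C')"
  by (rule refine_curve[OF cC' X'])
 have VX': "PV ` cV C' <= X'" by (auto simp: X'_def Y_def)
 hence VC1': "PV ` cV C1' = bt' ` X'" using C1'(3) by (simp add: Un_absorb2)
 define ta1 where "ta1 = btD o ta o inv_into (pts C') bt'"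
 define img1 where "img1 = DD' o img o inv_into (dirs C') D'"
 define sl1 where "sl1 = sl o inv_into (dirs C') D'"
 define d1' where "d1' = d o inv_into (pts C') bt'"
 have fh1: "fin_harm C1' D1 ta1 img1 sl1 d1'" "ALL x:pts C1'. 0 <= int (d1' x) * chi D1 (ta1 x) - chi C1' x"
  "ALL l l' k. l : cL C' --> l' : cL D --> mleg C' D ta l l' k --> mleg C1' D1 ta1 l l' k"
  unfolding ta1_def img1_def sl1_def d1'_def using fin_harm_isom[OF C1'(2) D1(2) wfs(2,3) fh] by blast+
 have bij': "bij_betw bt' (pts C') (pts C1')" "bij_betw btD (pts D) (pts D1)"
  using C1'(2) D1(2) by (auto simp: isom_def)
 have inv': "inv_into (pts C') bt' (bt' x) = x" if "x : pts C'" for x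
  using that bij'(1) by (simp add: bij_betw_def)
 have vt: "ta1 x1 : PV ` cV D1 <-> x1 : PV ` cV C1'" if x1: "x1 : pts C1'" for x1
 proof -
  obtain x where x: "x : pts C'" "x1 = bt' x" using x1 bij'(1) by (auto simp: bij_betw_def)
  have "ta1 x1 : PV ` cV D1 <-> btD (ta x) : btD ` Y" unfolding VD1 using x inv' by (simp add: ta1_def)
  also have "... <-> ta x : Y" using inj_on_image_mem_iff[OF bij_betw_imp_inj_on[OF bij'(2)] tap[OF x(1)] Y(2)] .
  also have "... <-> x : X'" using x by (simp add: X'_def)
  also have "... <-> x1 : bt' ` X'" unfolding x(2) using inj_on_image_mem_iff[OF bij_betw_imp_inj_on[OF bij'(1)] x(1) X'(2)] by simp
  finally show ?thesis unfolding VC1' .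
 qed
 have io1: "ALL x:pts ?C. (bt' o ic) x : pts C1'" "inj_on (bt' o ic) (pts ?C)"
   "ALL x:pts ?C. gen C1' ((bt' o ic) x) = gen ?C x"
   "ALL h:dirs ?C. (D' o Dm) h : dirs C1' & mgerm ?C C1' (bt' o ic) h ((D' o Dm) h) 1"
   "cL C1' = cL ?C" "ALL l:cL ?C. mleg ?C C1' (bt' o ic) l l 1"
   "ALL y:pts C1' - (bt' o ic) ` pts ?C. gen C1' y = 0" "tgenus C1' = tgenus ?C"
  by (fact modification_isom_right[OF C1'(2,1) io0(1,2,3) Dm io0(5,6,7,8)])+
 define X where "X = {x:pts ?C. (bt' o ic) x : PV ` cV C1'}"
 have "finite X"
 proof (rule inj_on_finite[of "bt' o ic" X "PV ` cV C1'"])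
  show "inj_on (bt' o ic) X" by (rule inj_on_subset[OF io1(2)]) (auto simp: X_def)
  show "(bt' o ic) ` X <= PV ` cV C1'" by (auto simp: X_def)
  show "finite (PV ` cV C1')" using wf_fin[OF is_curve_wf[OF C1'(1)]] by simp
 qed
 hence "EX H lab vl ll' bt D. subdiv G H lab vl & (ALL e:cE H. 0 <= ll' e) & (ALL e:cE G. pushl G H lab ll' e = ll e) &
  isom ?C (curve_of H ll') bt D & PV ` cV (curve_of H ll') = bt ` (X Un PV ` cV ?C)"
  by (rule refine[OF wf nn]) (auto simp: X_def)
 then obtain H lab vl ll' bt D2 where r: "subdiv G H lab vl" "ALL e:cE H. 0 <= ll' e"
  "ALL e:cE G. pushl G H lab ll' e = ll e" "isom ?C (curve_of H ll') bt D2"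
  "PV ` cV (curve_of H ll') = bt ` (X Un PV ` cV ?C)" by (elim exE conjE) (rule that)
 have wfH: "wf_graph H" using subdiv_inv[OF r(1) wf] by blast
 let ?K = "curve_of H ll'"
 have cK: "is_curve ?K" by (rule is_curve_of[OF wfH r(2)])
 have VX: "PV ` cV ?C <= X"
 proof
  fix x assume x: "x : PV ` cV ?C"
  hence xp: "x : pts ?C" by auto
  have "ta (ic x) : Y" using x by (auto simp: Y_def)
  hence "ic x : X'" using io0(1) xp by (simp add: X'_def)
  thus "x : X" using VC1' xp by (auto simp: X_def)
 qed
 have VK: "PV ` cV ?K = bt ` X" using r(5) VX by (simp add: Un_absorb2)
 have i2: "isom ?K ?C (inv_into (pts ?C) bt) (inv_into (dirs ?C) D2)" by (rule isom_sym[OF r(4) wfs(1)])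
 define ga where "ga = inv_into (pts ?C) bt"
 define Dga where "Dga = inv_into (dirs ?C) D2"
 have i2': "isom ?K ?C ga Dga" using i2 by (simp add: ga_def Dga_def)
 have bga: "bij_betw ga (pts ?K) (pts ?C)" "bij_betw Dga (dirs ?K) (dirs ?C)" using i2' by (auto simp: isom_def)
 have bbt: "bij_betw bt (pts ?C) (pts ?K)" using r(4) by (auto simp: isom_def)
 define ic2 where "ic2 = (bt' o ic) o ga"
 define Di2 where "Di2 = (D' o Dm) o Dga"
 have g1: "ga x : pts ?C" if "x : pts ?K" for x using bij_betwE[OF bga(1)] that by blast
 have g2: "Dga h : dirs ?C" if "h : dirs ?K" for h using bij_betwE[OF bga(2)] that by blast
 have vi: "ic2 x : PV ` cV C1' <-> x : PV ` cV ?K" if x: "x : pts ?K" for x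
 proof -
  have "ic2 x : PV ` cV C1' <-> ga x : X" using g1[OF x] by (simp add: ic2_def X_def)
  also have "... <-> bt (ga x) : bt ` X"
   using inj_on_image_mem_iff[OF bij_betw_imp_inj_on[OF bbt] g1[OF x], of X] by (auto simp: X_def)
  also have "bt (ga x) = x" using x bbt unfolding ga_def by (simp add: bij_betw_def f_inv_into_f)
  finally show ?thesis unfolding VK .
 qed
 have im: "ic2 ` pts ?K = (bt' o ic) ` pts ?C"
  unfolding ic2_def image_comp[symmetric] bij_betw_imp_surj_on[OF bga(1)] ..
 have LK: "cL ?K = cL ?C" "tgenus ?K = tgenus ?C" using r(4) by (auto simp: isom_def)
 interpret rcover a ?K C1' D1 ic2 Di2 ta1 img1 sl1 d1'
 proof
  show "is_curve ?K" "is_curve C1'" "is_curve D1" by (fact cK C1'(1) D1(1))+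
  show "tgenus D1 = 0" "cL D1 = {leg_zero, leg_inf}" using D1(2) d1(3,4) by (auto simp: isom_def)
  show "ALL x:pts ?K. ic2 x : pts C1'" using io1(1) g1 by (simp add: ic2_def)
  show "inj_on ic2 (pts ?K)" unfolding ic2_def by (rule comp_inj_on) (use bga(1) io1(2) in \<open>auto simp: bij_betw_def\<close>)
  show "ALL x:pts ?K. gen C1' (ic2 x) = gen ?K x"
  proof
   fix x assume x: "x : pts ?K"
   have "gen C1' ((bt' o ic) (ga x)) = gen ?C (ga x)" using io1(3) g1[OF x] by blast
   also have "... = gen ?K x" using i2' x by (simp add: isom_def)
   finally show "gen C1' (ic2 x) = gen ?K x" by (simp add: ic2_def)
  qed
  show "ALL h:dirs ?K. Di2 h : dirs C1' & mgerm ?K C1' ic2 h (Di2 h) 1"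
  proof
   fix h assume h: "h : dirs ?K"
   have 1: "mgerm ?K ?C ga h (Dga h) 1" using i2' h by (simp add: isom_def)
   have 2: "(D' o Dm) (Dga h) : dirs C1'" "mgerm ?C C1' (bt' o ic) (Dga h) ((D' o Dm) (Dga h)) 1" using io1(4) g2[OF h] by blast+
   from mgerm_comp[OF 1 2(2)] show "Di2 h : dirs C1' & mgerm ?K C1' ic2 h (Di2 h) 1"
    using 2(1) by (simp add: ic2_def Di2_def)
  qed
  show "cL C1' = cL ?K" "tgenus C1' = tgenus ?K" using io1(5,8) LK by auto
  show "ALL l:cL ?K. mleg ?K C1' ic2 l l 1"
  proof
   fix l assume l: "l : cL ?K"
   have "mleg ?K ?C ga l l 1" "mleg ?C C1' (bt' o ic) l l 1" using i2' io1(6) l by (auto simp: isom_def)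
   from mleg_comp[OF this] show "mleg ?K C1' ic2 l l 1" by (simp add: ic2_def)
  qed
  show "ALL y:pts C1' - ic2 ` pts ?K. gen C1' y = 0" unfolding im by (rule io1(7))
  show "fin_harm C1' D1 ta1 img1 sl1 d1'" "ALL x:pts C1'. 0 <= int (d1' x) * chi D1 (ta1 x) - chi C1' x" by (fact fh1)+
  show "ALL i:cL ?K. (0 < a i --> mleg C1' D1 ta1 i leg_zero (nat (a i))) & (a i < 0 --> mleg C1' D1 ta1 i leg_inf (nat (- a i)))"
   using d1(4,6) fh1(3) LK LC io0(5) by auto
  show "ALL i:cL ?K. a i ~= 0" using LK LC nz by simp
 qed (use vi vt in auto)
 obtain W pa rt om LL ka m up el where t: "tcov a ?K W pa rt om LL ka m up" "ALL w:W - {rt}. (0::real) < el w"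
  "ALL e:cE ?K. 0 < m e & clen ?K e = el (ka (lo ?K up e)) / real (m e)"
  using cover_exists by blast
 \<comment> \<open>Vertices absorbed by a contraction are mapped like their representatives, and
   \<open>m2\<close> has slope 0 exactly on the edges of length 0.\<close>
 define ka2 where "ka2 = ka o zrep H ll'"
 define m2 where "m2 e = (if ll' e = 0 then 0 else m e)" for e
 have cKm: "e : cE ?K <-> e : cE H & ll' e ~= 0" for e by (auto simp: curve_of_simps zset_def)
 interpret c: contracted H ll' m2
  by unfold_locales (use wfH r(2) t(3) cKm in \<open>auto simp: m2_def\<close>)
 have k2: "ka2 v = ka2 (zrep H ll' v)" if "v : cV H" for v using zrep_idem[OF wfH that] by (simp add: ka2_def)
 have k2K: "ka2 w = ka w" if "w : cV ?K" for w
  using that zrep_idem[OF wfH] by (auto simp: ka2_def curve_of_simps)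
 have loK: "lo ?K up e : cV ?K" "hi ?K up e : cV ?K" if "e : cE ?K" for e
  using wf_ends[OF is_curve_wf[OF cK] that] by (auto simp: lo_def hi_def)
 have m2K: "m2 e = m e" if "e : cE ?K" for e using that cKm by (simp add: m2_def)
 have "tcov a ?K W pa rt om LL ka2 m2 up"
 proof -
  have tm: "tmap a ?K W pa rt om ka2 m2 up <-> tmap a ?K W pa rt om ka m up"
   unfolding tmap_def using k2K loK m2K wf_ends[OF is_curve_wf[OF cK]] wf_legv[OF is_curve_wf[OF cK]] by (auto simp: image_subset_iff)
  have s: "satur ?K m2 = satur ?K m" using m2K by (auto simp: satur_def)
  have U: "UU ?K up ka2 m2 = UU ?K up ka m" "DD ?K up ka2 m2 = DD ?K up ka m"
   unfolding UU_def DD_def using k2K loK m2K by (auto intro!: ext sum.cong)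
  have R: "RR a ?K up m2 = RR a ?K up m" unfolding RR_def using m2K by auto
  show ?thesis using t(1) unfolding tcov_def tm s tbal_def UT_def U R .
 qed
 hence tH: "tcov a H W pa rt om LL ka2 m2 up" using c.tcov_contracted k2 by blast
 have "ll e = (SUM f:{f:cE H. lab f = SE e}. el (ka2 (lo H up f)) / real (m2 f))" if e: "e : cE G" for e
 proof -
  have "ll e = (SUM f:{f:cE H. lab f = SE e}. ll' f)" using r(3) e by (simp add: pushl_def)
  also have "... = (SUM f:{f:cE H. lab f = SE e}. el (ka2 (lo H up f)) / real (m2 f))"
  proof (rule sum.cong[OF refl])
   fix f assume f: "f : {f:cE H. lab f = SE e}"
   show "ll' f = el (ka2 (lo H up f)) / real (m2 f)"
   proof (cases "ll' f = 0")
    case False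
    hence fK: "f : cE ?K" using f cKm by simp
    have "ka (lo ?K up f) = ka2 (lo H up f)" using f c.lo_C[of f up] by (simp add: ka2_def)
    thus ?thesis using t(3) fK by (auto simp: m2_def curve_of_simps(6))
   qed (simp add: m2_def)
  qed
  finally show ?thesis .
 qed
 thus ?thesis using r(1) tH t(2) by blast
qed

section \<open>Realization of combinatorial covers\<close>

definition tree_curve :: "nat set => (nat => nat) => nat => nat => (nat => real) => tcurve" where
 "tree_curve W pa rt om el = \<lparr>cV = W, cE = W - {rt}, cends = (%j. (j, pa j)), cL = {leg_zero, leg_inf},
   clegv = (%l. if l = leg_zero then rt else om), cwt = (%_. 0), clen = el\<rparr>"

lemma tree_curve_simps [simp]:
 "cV (tree_curve W pa rt om el) = W" "cE (tree_curve W pa rt om el) = W - {rt}"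
 "cends (tree_curve W pa rt om el) j = (j, pa j)" "cL (tree_curve W pa rt om el) = {leg_zero, leg_inf}"
 "clegv (tree_curve W pa rt om el) leg_zero = rt" "clegv (tree_curve W pa rt om el) leg_inf = om"
 "cwt (tree_curve W pa rt om el) v = 0" "clen (tree_curve W pa rt om el) = el"
 by (auto simp: tree_curve_def leg_zero_def leg_inf_def)

lemma rtree_root:
 assumes t: "rtree W pa rt om LL" and P: "P rt" and S: "!!w. w : W ==> w ~= rt ==> pa w : W ==> P (pa w) ==> P w" and w: "w : W"
 shows "P w"
proof -
 obtain lev :: "nat => nat" where lev: "ALL w:W - {rt}. pa w : W & lev (pa w) < lev w" using t by (auto simp: rtree_def)
 show ?thesis using w
 proof (induction "lev w" arbitrary: w rule: less_induct)
  case less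
  show ?case
  proof (cases "w = rt")
   case False
   hence "pa w : W" "lev (pa w) < lev w" using lev less.prems by auto
   thus ?thesis using S[OF less.prems False] less.hyps by blast
  qed (simp add: P)
 qed
qed

lemma rtree_pi: "rtree W pa rt om LL ==> w : W ==> w ~= rt ==> pa w : W & pa w ~= w"
 by (force simp: rtree_def)

lemma tree_curve:
 assumes t: "rtree W pa rt om LL" and el: "ALL w:W - {rt}. 0 < el w"
 shows "is_curve (tree_curve W pa rt om el)" "tgenus (tree_curve W pa rt om el) = 0"
proof -
 let ?D = "tree_curve W pa rt om el"
 have W: "finite W" "rt : W" "om : W" using t by (auto simp: rtree_def)
 have conn: "(w, rt) : (adj ?D)^*" if "w : W" for w
 proof (rule rtree_root[OF t _ _ that])
  fix w assume w: "w : W" "w ~= rt" "(pa w, rt) : (adj ?D)^*"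
  have "(w, pa w) : adj ?D" using w by (auto simp: adj_def)
  thus "(w, rt) : (adj ?D)^*" using w(3) by (rule converse_rtrancl_into_rtrancl)
 qed simp
 have "(v, w) : (adj ?D)^*" if "v : W" "w : W" for v w
  using conn[OF that(1)] conn[OF that(2)] by (metis adj_erel erel_rtrancl_sym rtrancl_trans)
 moreover have "pa e : W" if "e : W" "e ~= rt" for e using rtree_pi[OF t that] by blast
 ultimately show "is_curve ?D" unfolding is_curve_def wf_graph_def using W el by auto
 have "card (W - {rt}) = card W - 1" "1 <= card W" using W by (auto simp: card_gt_0_iff Suc_le_eq)
 thus "tgenus ?D = 0" by (simp add: tgenus_def)
qed

text \<open>The case without missing degree: every direction of the tree at \<open>ka v\<close>
  receives the whole degree \<open>d v\<close>, so the data already form a finite effective harmonic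
  morphism.\<close>

locale graph_cover =
 fixes a :: "nat => int" and K :: tcurve and W :: "nat set" and pa :: "nat => nat" and rt om :: nat and LL :: "nat set"
  and el :: "nat => real" and ka m :: "nat => nat" and up :: "nat => bool" and d :: "nat => nat"
 assumes K: "is_curve K" and t: "rtree W pa rt om LL" and el: "ALL w:W - {rt}. 0 < el w"
  and ka: "!!v. v : cV K ==> ka v : W"
  and E: "!!e. e : cE K ==> 0 < m e & ka (lo K up e) : W & ka (lo K up e) ~= rt & ka (hi K up e) = pa (ka (lo K up e))
    & real (m e) * clen K e = el (ka (lo K up e))"
  and nz: "!!l. l : cL K ==> a l ~= 0"
  and Lp: "!!l. l : cL K ==> 0 < a l ==> ka (clegv K l) = rt" and Ln: "!!l. l : cL K ==> a l < 0 ==> ka (clegv K l) = om"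
  and U: "!!v. v : cV K ==> UT a K rt up ka m (ka v) {v} = d v"
  and Dn: "!!v c. v : cV K ==> c : W ==> c ~= rt ==> pa c = ka v ==> DD K up ka m c {v} = d v"
  and N: "!!v. v : cV K ==> ka v = om ==> NLs a K {v} = d v"
  and eff: "!!v. v : cV K ==> 0 <= int (d v) * vchi (tree_curve W pa rt om el) (ka v) - vchi K v"
begin

abbreviation "T == tree_curve W pa rt om el"
abbreviation "sc e == ka (lo K up e)"

lemma T: "is_curve T" "tgenus T = 0" using tree_curve[OF t el] by auto

definition ll :: "nat => nat" where "ll l = (if 0 < a l then leg_zero else leg_inf)"
definition ml :: "nat => nat" where "ml l = nat \<bar>a l\<bar>"

definition iseg :: "seg => seg" where "iseg s = (case s of SE e => SE (sc e) | SL l => SL (ll l))"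
definition ipar :: "seg => real => real" where
 "ipar s u = (case s of SE e => if up e then real (m e) * u else el (sc e) - real (m e) * u | SL l => real (ml l) * u)"
definition isgn :: "seg => bool => bool" where "isgn s sn = (case s of SE e => sn = up e | SL l => sn)"
definition isl :: "seg => nat" where "isl s = (case s of SE e => m e | SL l => ml l)"

definition tau :: "pt => pt" where
 "tau x = (case x of PV v => PV (ka v) | PE e u => ipt (iseg (SE e)) (ipar (SE e) u) | PLg l u => ipt (iseg (SL l)) (ipar (SL l) u))"

lemma tau_simps [simp]: "tau (PV v) = PV (ka v)" "tau (ipt s u) = ipt (iseg s) (ipar s u)"
 by (simp_all add: tau_def) (cases s; simp)

definition img :: "dir => dir" where "img h = (case h of (s, u, sn) => (iseg s, ipar s u, isgn s sn))"
definition sl :: "dir => nat" where "sl h = isl (fst h)"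

lemma ml_pos: "l : cL K ==> 0 < ml l" using nz by (auto simp: ml_def)

lemma iseg_in: "s : segs K ==> iseg s : segs T"
 using E by (cases s) (auto simp: iseg_def ll_def)

lemma isl_pos: "s : segs K ==> 0 < isl s"
 using E ml_pos by (cases s) (auto simp: isl_def)

lemma isint: assumes s: "s : segs K" shows "sint T (iseg s) (ipar s u) <-> sint K s u"
proof (cases s)
 case (SE e)
 hence e: "0 < real (m e)" "real (m e) * clen K e = el (sc e)" using s E by auto
 have "real (m e) * u < el (sc e) <-> u < clen K e" unfolding e(2)[symmetric] using e(1) by simp
 moreover have "0 < real (m e) * u <-> 0 < u" using e(1) by (simp add: zero_less_mult_iff)
 ultimately show ?thesis by (auto simp: SE sint_def iseg_def ipar_def)
next
 case (SL l)
 hence "0 < real (ml l)" using s ml_pos by simp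
 thus ?thesis by (auto simp: SL sint_def iseg_def ipar_def zero_less_mult_iff)
qed

lemma idom: assumes s: "s : segs K" shows "seg_dom T (iseg s) (ipar s u) <-> seg_dom K s u"
proof (cases s)
 case (SE e)
 hence e: "0 < real (m e)" "real (m e) * clen K e = el (sc e)" using s E by auto
 have "real (m e) * u <= el (sc e) <-> u <= clen K e" unfolding e(2)[symmetric] using e(1) by simp
 moreover have "0 <= real (m e) * u <-> 0 <= u" using e(1) by (simp add: zero_le_mult_iff)
 ultimately show ?thesis by (auto simp: SE seg_dom_def iseg_def ipar_def)
next
 case (SL l)
 hence "0 < real (ml l)" using s ml_pos by simp
 thus ?thesis by (auto simp: SL seg_dom_def iseg_def ipar_def zero_le_mult_iff)
qed

lemma ipos: assumes s: "s : segs K" and u: "seg_dom K s u" shows "tau (pos K s u) = pos T (iseg s) (ipar s u)"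
proof (cases "sint K s u")
 case True
 thus ?thesis using isint[OF s] by (simp add: pos_sint)
next
 case False
 show ?thesis
 proof (cases s)
  case (SE e)
  hence e: "e : cE K" "real (m e) * clen K e = el (sc e)" "ka (hi K up e) = pa (sc e)" "0 < clen K e" "0 < el (sc e)"
   using s E is_curve_len[OF K] el by auto
  have "u = 0 | u = clen K e" using False u by (auto simp: SE sint_def seg_dom_def)
  thus ?thesis using e by (auto simp: SE pos_def iseg_def ipar_def lo_def hi_def)
 next
  case (SL l)
  hence l: "l : cL K" using s by simp
  have "u = 0" using False u by (auto simp: SL sint_def seg_dom_def)
  moreover have "ka (clegv K l) = clegv T (ll l)" using Lp[OF l] Ln[OF l] nz[OF l] by (auto simp: ll_def)
  ultimately show ?thesis by (simp add: SL pos_def iseg_def ipar_def)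
 qed
qed

lemma imv: "ipar s (mv sn u dl) = mv (isgn s sn) (ipar s u) (real (isl s) * dl)"
 by (cases s) (auto simp: ipar_def mv_def isgn_def isl_def algebra_simps)

lemma igerm: assumes h: "h : dirs K" shows "img h : dirs T & mgerm K T tau h (img h) (sl h)"
proof -
 obtain s u sn where hh: "h = (s, u, sn)" by (cases h)
 have s: "s : segs K" using h hh dirs_segs by blast
 obtain ep where e: "0 < ep" "!!dl. 0 < dl ==> dl <= ep ==> sint K s (mv sn u dl)"
  using dirs_small[OF h] by (auto simp: hh)
 have dom: "seg_dom K s (mv sn u dl)" if "0 <= dl" "dl <= ep" for dl
  using that e(2)[of dl] sint_seg_dom h by (cases "dl = 0") (auto simp: hh dirs_def)
 have 1: "mgerm K T tau h (img h) (sl h)" unfolding hh img_def sl_def prod.case fst_conv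
 proof (rule mgermI[of ep])
  fix dl assume d: "0 <= dl" "dl <= ep"
  show "seg_dom K s (mv sn u dl)" by (rule dom[OF d])
  thus "seg_dom T (iseg s) (mv (isgn s sn) (ipar s u) (real (isl s) * dl))"
   unfolding imv[symmetric] idom[OF s] .
  show "tau (pos K s (mv sn u dl)) = pos T (iseg s) (mv (isgn s sn) (ipar s u) (real (isl s) * dl))"
   unfolding imv[symmetric] by (rule ipos[OF s dom[OF d]])
 qed (use e isl_pos[OF s] in auto)
 have "(iseg s, ipar s u, isgn s sn) : dirs T"
 proof -
  have 2: "seg_dom T (iseg s) (ipar s u)" using dom[of 0] e(1) idom[OF s] by simp
  have 3: "sint T (iseg s) (mv (isgn s sn) (ipar s u) (real (isl s) * ep))"
   unfolding imv[symmetric] isint[OF s] using e by simp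
  have "0 < real (isl s) * ep" using isl_pos[OF s] e(1) by simp
  thus ?thesis using 2 3 iseg_in[OF s] by (cases "iseg s") (auto simp: dirs_def sint_def mv_def seg_dom_def split: if_splits)
 qed
 thus ?thesis using 1 by (simp add: hh img_def)
qed

lemma img_dirl: "e : cE K ==> img (dirl K up e) = (SE (sc e), 0, True) & sl (dirl K up e) = m e"
 using E[of e] by (auto simp: dirl_def img_def iseg_def ipar_def isgn_def sl_def isl_def)

lemma img_dirh: "e : cE K ==> img (dirh K up e) = (SE (sc e), el (sc e), False) & sl (dirh K up e) = m e"
 using E[of e] by (auto simp: dirh_def img_def iseg_def ipar_def isgn_def sl_def isl_def)

lemma img_leg: "img (SL l, 0, True) = (SL (ll l), 0, True) & sl (SL l, 0, True) = ml l"
 by (auto simp: img_def iseg_def ipar_def isgn_def sl_def isl_def)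

lemma sum_vertex:
 assumes v: "v : cV K" and h': "h' : dir_at T (PV (ka v))"
 shows "(SUM h:{h:dir_at K (PV v). img h = h'}. sl h) = d v"
proof -
 have fin: "finite (cE K)" "finite (cL K)" using wf_fin[OF is_curve_wf[OF K]] by auto
 have fa: "finite (dir_at K (PV v))" using finite_dir_at[OF K] v by simp
 have "(SUM h:{h:dir_at K (PV v). img h = h'}. sl h) = (SUM h:dir_at K (PV v). if img h = h' then sl h else 0)"
  using fa by (simp add: sum.inter_filter)
 also have "... = (SUM e:{e:cE K. lo K up e = v}. if (SE (sc e), 0, True) = h' then m e else 0)
    + (SUM e:{e:cE K. hi K up e = v}. if (SE (sc e), el (sc e), False) = h' then m e else 0)
    + (SUM l:{l:cL K. clegv K l = v}. if (SL (ll l), 0, True) = h' then ml l else 0)"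
  unfolding sum_dir_lohi[OF K, of _ v up] by (intro arg_cong2[of _ _ _ _ "(+)"] sum.cong refl) (simp_all add: img_dirl img_dirh img_leg)
 finally have S: "(SUM h:{h:dir_at K (PV v). img h = h'}. sl h) = (SUM e:{e:cE K. lo K up e = v}. if (SE (sc e), 0, True) = h' then m e else 0)
    + (SUM e:{e:cE K. hi K up e = v}. if (SE (sc e), el (sc e), False) = h' then m e else 0)
    + (SUM l:{l:cL K. clegv K l = v}. if (SL (ll l), 0, True) = h' then ml l else 0)" .
 consider (up) "h' = (SE (ka v), 0, True)" "ka v ~= rt" | (dn) c where "h' = (SE c, el c, False)" "c : W" "c ~= rt" "pa c = ka v"
  | (z) "h' = (SL leg_zero, 0, True)" "ka v = rt" | (i) "h' = (SL leg_inf, 0, True)" "ka v = om"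
  using h' unfolding dir_at_PV[OF T(1)] by auto
 thus ?thesis
 proof cases
  case up
  have "(SUM e:{e:cE K. lo K up e = v}. if (SE (sc e), 0, True) = h' then m e else 0) = UU K up ka m (ka v) {v}"
   unfolding UU_def up(1) by (rule sum.cong) auto
  thus ?thesis unfolding S using U[OF v] up by (simp add: UT_def)
 next
  case dn
  have "(SUM e:{e:cE K. hi K up e = v}. if (SE (sc e), el (sc e), False) = h' then m e else 0) = DD K up ka m c {v}"
   unfolding DD_def dn(1) using fin by (subst sum.inter_filter[symmetric]) (auto intro!: sum.cong)
  thus ?thesis unfolding S using Dn[OF v dn(2-4)] dn(1) by simp
 next
  case z
  have "(SUM l:{l:cL K. clegv K l = v}. if (SL (ll l), 0, True) = h' then ml l else 0) = PLs a K {v}"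
   unfolding PLs_def z(1) using fin by (subst sum.inter_filter[symmetric]) (auto intro!: sum.cong simp: ll_def ml_def leg_zero_def leg_inf_def)
  moreover have "UU K up ka m rt {v} = 0"
  proof -
   have emp: "{e:cE K. sc e = rt & lo K up e : {v}} = {}" using E by blast
   show ?thesis unfolding UU_def emp by simp
  qed
  ultimately show ?thesis unfolding S using U[OF v] z by (simp add: UT_def)
 next
  case i
  have "(SUM l:{l:cL K. clegv K l = v}. if (SL (ll l), 0, True) = h' then ml l else 0) = NLs a K {v}"
   unfolding NLs_def i(1) using fin nz by (subst sum.inter_filter[symmetric]) (force intro!: sum.cong simp: ll_def ml_def leg_zero_def leg_inf_def)+
  thus ?thesis unfolding S using N[OF v] i by simp
 qed
qed

definition dfun :: "pt => nat" where
 "dfun x = (case x of PV v => d v | PE e u => m e | PLg l u => ml l)"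

lemma dfun_ipt: "dfun (ipt s u) = isl s" by (cases s) (auto simp: dfun_def isl_def)

lemma tau_fin_harm: "fin_harm K T tau img sl dfun"
 unfolding fin_harm_def
proof (intro conjI ballI)
 fix x assume x: "x : pts K"
 thus "tau x : pts T" using ka iseg_in isint by (auto simp: pts_alt)
 fix h' assume h': "h' : dir_at T (tau x)"
 consider v where "x = PV v" "v : cV K" | s u where "x = ipt s u" "s : segs K" "sint K s u" using x by (auto simp: pts_alt)
 thus "(SUM h:{h:dir_at K x. img h = h'}. sl h) = dfun x"
 proof cases
  case 1
  thus ?thesis using sum_vertex[OF 1(2), of h'] h' by (simp add: dfun_def)
 next
  case 2
  have dK: "dir_at K x = {(s, u, True), (s, u, False)}" unfolding 2(1) by (rule dir_at_ipt[OF 2(2,3)])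
  have dT: "dir_at T (tau x) = {(iseg s, ipar s u, True), (iseg s, ipar s u, False)}"
   unfolding 2(1) tau_simps by (rule dir_at_ipt) (use iseg_in isint 2 in auto)
  obtain b where b: "h' = (iseg s, ipar s u, b)" using h' dT by auto
  define sn where "sn = (case s of SE e => b = up e | SL l => b)"
  have sn: "isgn s sn = b" "isgn s (~  sn) = (~  b)" by (cases s; auto simp: isgn_def sn_def)+
  have "{h:dir_at K x. img h = h'} = {(s, u, sn)}"
   unfolding dK b using sn by (cases sn) (auto simp: img_def)
  thus ?thesis unfolding 2(1) by (simp add: sl_def dfun_ipt)
 qed
next
 fix h assume "h : dirs K"
 thus "img h : dirs T" "mgerm K T tau h (img h) (sl h)" using igerm by auto
next
 fix l assume l: "l : cL K"
 have "tau (PLg l u) = PLg (ll l) (real (ml l) * u + 0)" for u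
  using tau_simps(2)[of "SL l" u] by (simp add: iseg_def ipar_def)
 hence "mleg K T tau l (ll l) (ml l)"
  by (intro mlegI[of _ 1 0]) (use ml_pos[OF l] in auto)
 moreover have "ll l : cL T" by (simp add: ll_def)
 ultimately show "EX l':cL T. EX k. mleg K T tau l l' k" by blast
qed

lemma tau_eff: "fin_eff_harm K T tau"
 unfolding fin_eff_harm_def
proof (intro exI conjI ballI)
 show "fin_harm K T tau img sl dfun" by (rule tau_fin_harm)
 fix x assume x: "x : pts K"
 consider v where "x = PV v" "v : cV K" | s u where "x = ipt s u" "s : segs K" "sint K s u" using x by (auto simp: pts_alt)
 thus "0 <= int (dfun x) * chi T (tau x) - chi K x"
 proof cases
  case 1
  thus ?thesis using eff[OF 1(2)] chi_PV[OF T(1)] chi_PV[OF K] by (simp add: dfun_def)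
 next
  case 2
  hence "chi K x = 0" "chi T (tau x) = 0" using chi_ipt[OF 2(2,3)] chi_ipt[of "iseg s" T "ipar s u"] iseg_in isint by auto
  thus ?thesis by simp
 qed
qed

lemma tau_legs: assumes l: "l : cL K"
 shows "0 < a l ==> mleg K T tau l leg_zero (nat (a l))" "a l < 0 ==> mleg K T tau l leg_inf (nat (- a l))"
proof -
 have "tau (PLg l u) = PLg (ll l) (real (ml l) * u + 0)" for u
  using tau_simps(2)[of "SL l" u] by (simp add: iseg_def ipar_def)
 hence "mleg K T tau l (ll l) (ml l)"
  by (intro mlegI[of _ 1 0]) (use ml_pos[OF l] in auto)
 thus "0 < a l ==> mleg K T tau l leg_zero (nat (a l))" "a l < 0 ==> mleg K T tau l leg_inf (nat (- a l))"
  by (auto simp: ll_def ml_def)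
qed

end

lemma gval_tree:
 assumes t: "rtree W pa rt om LL" and y: "y : W"
 shows "gval (tree_curve W pa rt om el) y = 1 + card {c:W - {rt}. pa c = y} + (if y = om then 1 else 0)"
proof -
 have 1: "card {j:W - {rt}. j = y} = (if y = rt then 0 else 1)"
 proof (cases "y = rt")
  case True
  hence "{j:W - {rt}. j = y} = {}" by auto
  thus ?thesis using True by simp
 next
  case False
  hence "{j:W - {rt}. j = y} = {y}" using y by auto
  thus ?thesis using False by simp
 qed
 let ?D = "tree_curve W pa rt om el"
 have "{l:cL ?D. clegv ?D l = y} = (if y = rt then {leg_zero} else {}) Un (if y = om then {leg_inf} else {})" by auto
 hence 2: "card {l:cL ?D. clegv ?D l = y} = (if y = rt then 1 else 0) + (if y = om then 1 else 0)"
  by (auto simp: leg_zero_def leg_inf_def)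
 show ?thesis unfolding gval_def 2 using 1 by auto
qed

section \<open>Attaching copies of branches for the missing degree\<close>

locale realize =
 fixes a :: "nat => int" and C :: tcurve and W :: "nat set" and pa :: "nat => nat" and rt om :: nat and LL :: "nat set"
  and el :: "nat => real" and ka m :: "nat => nat" and up :: "nat => bool"
 assumes C: "is_curve C" and tc: "tcov a C W pa rt om LL ka m up" and el: "ALL w:W - {rt}. 0 < el w"
  and mE: "!!e. e : cE C ==> 0 < m e & clen C e = el (ka (lo C up e)) / real (m e)"
  and nz: "!!l. l : cL C ==> a l ~= 0"
begin

lemma t: "rtree W pa rt om LL" and tm: "tmap a C W pa rt om ka m up" using tc by (auto simp: tcov_def)

lemma wf: "wf_graph C" using C by (rule is_curve_wf)

lemma bal: assumes v: "v : cV C" shows "tbal a C W pa rt om LL ka m up {v}"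
proof -
 have "m e ~= 0" if "e : cE C" for e using mE[OF that] by simp
 hence "satur C m {v}" using v unfolding satur_def by blast
 thus ?thesis using tc by (simp add: tcov_def)
qed

definition dd :: "nat => nat" where "dd v = UT a C rt up ka m (ka v) {v}"
text \<open>The degree missing at \<open>v\<close> along the tree edge \<open>c\<close>, which is
  the number of copies of the branch below \<open>c\<close> to be attached at
  \<open>v\<close>.\<close>

definition del :: "nat => nat => nat" where "del v c = dd v - DD C up ka m c {v}"
definition Tr :: "(nat \<times> nat) set" where "Tr = {(x, pa x) | x. x : W - {rt}}"
definition desc :: "nat => nat set" where "desc c = {z:W. (z, c) : Tr^*}"

lemma desc_self: "c : W ==> c : desc c" by (simp add: desc_def)

lemma desc_up: assumes "z : desc c" "z ~= c" shows "z ~= rt & pa z : desc c"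
proof -
 have "(z, c) : Tr^*" "z : W" using assms by (auto simp: desc_def)
 then obtain y where y: "(z, y) : Tr" "(y, c) : Tr^*" using assms(2) by (meson converse_rtranclE)
 hence "z : W" "z ~= rt" "y = pa z" by (auto simp: Tr_def)
 thus ?thesis using y rtree_pi[OF t, of z] by (auto simp: desc_def)
qed

lemma desc_ne: "c ~= rt ==> z : desc c ==> z ~= rt" using desc_up by metis

lemma desc_down: assumes "pa x : desc c" "x : W" "x ~= rt" shows "x : desc c"
proof -
 have "(x, pa x) : Tr" using assms by (auto simp: Tr_def)
 thus ?thesis using assms by (auto simp: desc_def)
qed

lemma parent_notin: assumes "c : W" "c ~= rt" shows "pa c ~: desc c"
proof
 assume p: "pa c : desc c"
 obtain lev :: "nat => nat" where lev: "ALL w:W - {rt}. pa w : W & lev (pa w) < lev w" using t by (auto simp: rtree_def)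
 have "(x, y) : Tr^* ==> lev y <= lev x" for x y
  by (induction rule: rtrancl_induct) (use lev in \<open>force simp: Tr_def\<close>)+
 hence "lev c <= lev (pa c)" using p by (simp add: desc_def)
 moreover have "lev (pa c) < lev c" using lev assms by blast
 ultimately show False by simp
qed

text \<open>With equality on the path, a branch with missing degree never contains
  \<open>om\<close>, over which a copy would need a leg.\<close>

lemma desc_line: assumes "om : desc c" shows "c : LL"
proof -
 have L: "om : LL" "bij_betw pa (LL - {rt}) (LL - {om})" using t by (auto simp: rtree_def)
 have "(x, y) : Tr^* ==> x : LL ==> y : LL" for x y
 proof (induction rule: rtrancl_induct)
  case (step y z)
  hence "y : LL - {rt}" "z = pa y" by (auto simp: Tr_def)
  thus ?case using bij_betwE[OF L(2)] by blast
 qed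
 thus ?thesis using assms L(1) by (auto simp: desc_def)
qed

lemma DD_le: assumes "v : cV C" "c : W" "c ~= rt" "pa c = ka v"
 shows "DD C up ka m c {v} <= dd v" "c : LL ==> del v c = 0"
proof -
 have "DD C up ka m c {v} <= UT a C rt up ka m (pa c) {v} & (c : LL --> DD C up ka m c {v} = UT a C rt up ka m (pa c) {v})"
  using bal[OF assms(1)] assms(2,3) unfolding tbal_def by blast
 thus "DD C up ka m c {v} <= dd v" "c : LL ==> del v c = 0" unfolding del_def dd_def assms(4) by auto
qed

text \<open>\<open>(v, c, i, z)\<close> stands for the vertex over \<open>z\<close> in copy
  \<open>i\<close> of the branch below \<open>c\<close>, attached at \<open>v\<close>; its code also
  names the edge above this vertex.\<close>

definition Ix :: "(nat \<times> nat \<times> nat \<times> nat) set" where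
 "Ix = {(v, c, i, z). v : cV C & c : W & c ~= rt & pa c = ka v & i < del v c & z : desc c}"

lemma fin: "finite (cV C)" "finite (cE C)" "finite (cL C)" "finite W"
 using wf_fin[OF wf] t by (auto simp: rtree_def)

lemma fin_Ix: "finite Ix"
proof (rule finite_subset)
 show "Ix <= (UN v:cV C. {v} \<times> W \<times> {..<dd v} \<times> W)" by (auto simp: Ix_def desc_def del_def)
 show "finite (UN v:cV C. {v} \<times> W \<times> {..<dd v} \<times> W)" using fin by auto
qed

definition M :: nat where "M = (SOME M. ALL x:cV C Un cE C. x < M)"

lemma M: "x : cV C Un cE C ==> x < M"
proof -
 have "finite (cV C Un cE C)" using fin by simp
 hence "EX M. ALL x:cV C Un cE C. x < M" using finite_nat_set_iff_bounded by blast
 hence "ALL x:cV C Un cE C. x < M" unfolding M_def by (rule someI_ex)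
 thus "x : cV C Un cE C ==> x < M" by blast
qed

text \<open>The shift by \<open>M\<close> puts all codes above the names already in use.\<close>

definition cd :: "nat \<times> nat \<times> nat \<times> nat => nat" where
 "cd p = M + (case p of (v, c, i, z) => prod_encode (v, prod_encode (c, prod_encode (i, z))))"

lemma cd_inj: "cd p = cd q <-> p = q"
 by (cases p; cases q) (auto simp: cd_def)

lemma cd_new: "cd p ~: cV C" "cd p ~: cE C" using M[of "cd p"] by (auto simp: cd_def)

definition dc :: "nat => nat \<times> nat \<times> nat \<times> nat" where "dc x = (THE p. cd p = x)"

lemma dc_cd [simp]: "dc (cd p) = p" unfolding dc_def by (simp add: cd_inj)

definition nd :: "nat \<times> nat \<times> nat \<times> nat => nat" where
 "nd p = (case p of (v, c, i, z) => if z = c then v else cd (v, c, i, pa z))"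
definition zz :: "nat \<times> nat \<times> nat \<times> nat => nat" where "zz p = snd (snd (snd p))"

definition K :: tcurve where
 "K = \<lparr>cV = cV C Un cd ` Ix, cE = cE C Un cd ` Ix, cends = (%e. if e : cE C then cends C e else (e, nd (dc e))),
   cL = cL C, clegv = clegv C, cwt = (%v. if v : cV C then cwt C v else 0),
   clen = (%e. if e : cE C then clen C e else el (zz (dc e)))\<rparr>"

lemma K_simps: "cV K = cV C Un cd ` Ix" "cE K = cE C Un cd ` Ix" "cL K = cL C" "clegv K = clegv C"
 "e : cE C ==> cends K e = cends C e" "cends K (cd p) = (cd p, nd p)"
 "e : cE C ==> clen K e = clen C e" "clen K (cd p) = el (zz p)"
 "v : cV C ==> cwt K v = cwt C v" "cwt K (cd p) = 0"
 using cd_new by (auto simp: K_def)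

lemma IxD: assumes "(v, c, i, z) : Ix"
 shows "v : cV C" "c : W" "c ~= rt" "pa c = ka v" "i < del v c" "z : desc c" "z : W" "z ~= rt"
 using assms desc_ne by (auto simp: Ix_def desc_def)

lemma nd_V: assumes "p : Ix" shows "nd p : cV K"
proof -
 obtain v c i z where p: "p = (v, c, i, z)" by (cases p)
 show ?thesis
 proof (cases "z = c")
  case True
  thus ?thesis using assms IxD by (simp add: p nd_def K_simps)
 next
  case False
  hence "(v, c, i, pa z) : Ix" using assms desc_up[of z c] by (auto simp: p Ix_def)
  thus ?thesis using False by (simp add: p nd_def K_simps)
 qed
qed

lemma to_C: assumes "p : Ix" shows "EX v:cV C. (cd p, v) : (adj K)^*"
proof -
 obtain v c i z where p: "p = (v, c, i, z)" by (cases p)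
 obtain lev :: "nat => nat" where lev: "ALL w:W - {rt}. pa w : W & lev (pa w) < lev w" using t by (auto simp: rtree_def)
 have "(v, c, i, z) : Ix ==> (cd (v, c, i, z), v) : (adj K)^*"
 proof (induction "lev z" arbitrary: z rule: less_induct)
  case less
  have s: "(cd (v, c, i, z), nd (v, c, i, z)) : adj K"
   using less.prems by (auto simp: adj_def K_simps intro!: bexI[of _ "cd (v, c, i, z)"])
  show ?case
  proof (cases "z = c")
   case True
   thus ?thesis using s by (auto simp: nd_def)
  next
   case False
   hence "(v, c, i, pa z) : Ix" "z : W - {rt}" using desc_up[of z c] IxD[OF less.prems] by (auto simp: Ix_def)
   hence "(cd (v, c, i, pa z), v) : (adj K)^*" using less.hyps[of "pa z"] lev by blast
   thus ?thesis using s by (auto simp: nd_def intro: converse_rtrancl_into_rtrancl)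
  qed
 qed
 thus ?thesis using assms IxD unfolding p by blast
qed

lemma wfK: "wf_graph K"
proof -
 have "adj C <= adj K"
 proof
  fix x assume "x : adj C"
  then obtain v w e where e: "x = (v, w)" "e : cE C" "cends C e = (v, w) | cends C e = (w, v)" by (auto simp: adj_def)
  hence "e : cE K" "cends K e = (v, w) | cends K e = (w, v)" by (auto simp: K_simps)
  thus "x : adj K" unfolding adj_def e(1) by blast
 qed
 hence sub: "(adj C)^* <= (adj K)^*" by (rule rtrancl_mono)
 have toC: "EX v:cV C. (x, v) : (adj K)^*" if "x : cV K" for x using that to_C by (auto simp: K_simps)
 have "(x, y) : (adj K)^*" if xy: "x : cV K" "y : cV K" for x y
 proof -
  obtain v where v: "v : cV C" "(x, v) : (adj K)^*" using toC[OF xy(1)] by blast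
  obtain w where w: "w : cV C" "(y, w) : (adj K)^*" using toC[OF xy(2)] by blast
  note vw = v(1) w(1) v(2) w(2)
  have "(v, w) : (adj C)^*" using wf vw(1,2) unfolding wf_graph_def by blast
  hence "(v, w) : (adj K)^*" using sub by blast
  thus ?thesis using vw(3,4) by (metis adj_erel erel_rtrancl_sym rtrancl_trans)
 qed
 moreover have "fst (cends K e) : cV K & snd (cends K e) : cV K" if eK: "e : cE K" for e
 proof -
  consider "e : cE C" | p where "p : Ix" "e = cd p" using eK unfolding K_simps by blast
  thus ?thesis
  proof cases
   case 1
   thus ?thesis using wf_ends[OF wf 1] by (simp add: K_simps)
  next
   case 2
   have "cd p : cV K" using 2(1) unfolding K_simps by blast
   thus ?thesis using nd_V[OF 2(1)] 2(2) K_simps(6) by simp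
  qed
 qed
 ultimately show ?thesis using fin_Ix wf by (auto simp: K_simps wf_graph_def)
qed

lemma cK: "is_curve K" unfolding is_curve_def
proof (intro conjI ballI wfK)
 fix e assume "e : cE K"
 then consider "e : cE C" | p where "p : Ix" "e = cd p" by (auto simp: K_simps)
 thus "0 < clen K e"
 proof cases
  case 1
  thus ?thesis using is_curve_len[OF C] by (simp add: K_simps)
 next
  case 2
  obtain v c i z where p: "p = (v, c, i, z)" by (cases p)
  show ?thesis using 2 el IxD unfolding p by (simp add: K_simps zz_def)
 qed
qed

text \<open>New vertices and new edges are both indexed by \<open>Ix\<close>, and the new weights
  are 0.\<close>

lemma tgenusK: "tgenus K = tgenus C"
proof -
 have inj: "inj_on cd Ix" by (auto simp: inj_on_def cd_inj)
 have dj: "cV C Int cd ` Ix = {}" "cE C Int cd ` Ix = {}" using cd_new by (metis disjoint_iff imageE)+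
 have 1: "card (cV K) = card (cV C) + card Ix" unfolding K_simps using card_Un_disjoint[OF _ _ dj(1)] fin fin_Ix card_image[OF inj] by simp
 have 2: "card (cE K) = card (cE C) + card Ix" unfolding K_simps using card_Un_disjoint[OF _ _ dj(2)] fin fin_Ix card_image[OF inj] by simp
 have "(SUM v:cV K. int (cwt K v)) = (SUM v:cV C. int (cwt C v))"
  by (rule sum.mono_neutral_cong_right) (use fin fin_Ix in \<open>auto simp: K_simps\<close>)
 thus ?thesis unfolding tgenus_def 1 2 by simp
qed

lemma modif: "modification C K"
proof -
 have sg: "s : segs C ==> s : segs K" for s by (cases s) (auto simp: K_simps)
 have sd: "seg_dom K s u = seg_dom C s u" "sint K s u = sint C s u" "pos K s u = pos C s u" if "s : segs C" for s u
  using that by (cases s; auto simp: seg_dom_def sint_def pos_def K_simps)+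
 have pt: "x : pts K" if x: "x : pts C" for x using x sg sd unfolding pts_alt by (auto simp: K_simps)
 have dr: "h : dirs K & mgerm C K id h h 1" if h: "h : dirs C" for h
 proof -
  obtain s u sn where hh: "h = (s, u, sn)" by (cases h)
  have s: "s : segs C" using h hh dirs_segs by blast
  have 1: "h : dirs K" using h sd[OF s] by (cases s) (auto simp: hh dirs_def K_simps)
  obtain ep where e: "0 < ep" "!!dl. 0 < dl ==> dl <= ep ==> sint C s (mv sn u dl)"
   using dirs_small[OF h] by (auto simp: hh)
  have dom: "seg_dom C s (mv sn u dl)" if "0 <= dl" "dl <= ep" for dl
   using that e(2)[of dl] sint_seg_dom h by (cases "dl = 0") (auto simp: hh dirs_def)
  have "mgerm C K id h h 1" unfolding hh by (rule mgermI[of ep]) (use e dom sd[OF s] in auto)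
  thus ?thesis using 1 by blast
 qed
 have gn: "gen K x = gen C x" if "x : pts C" for x
  using that by (cases x) (auto simp: gen_def K_simps)
 have rest: "gen K y = 0" if "y : pts K" "y ~: pts C" for y
  using that by (cases y) (auto simp: gen_def K_simps)
 have lg: "mleg C K id l l 1" for l by (rule mlegI[of _ 1 0]) auto
 show ?thesis unfolding modification_def
 proof (intro conjI exI[of _ id])
  show "ALL h:dirs C. EX h':dirs K. mgerm C K id h h' 1" using dr by blast
 qed (use cK pt gn rest lg tgenusK K_simps(3) in auto)
qed

definition kk :: "nat => nat" where "kk x = (if x : cV C then ka x else zz (dc x))"
definition mm :: "nat => nat" where "mm e = (if e : cE C then m e else 1)"
definition uu :: "nat => bool" where "uu e = (if e : cE C then up e else True)"
definition d' :: "nat => nat" where "d' x = (if x : cV C then dd x else 1)"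

lemma lo_old: "e : cE C ==> lo K uu e = lo C up e & hi K uu e = hi C up e"
 by (auto simp: lo_def hi_def uu_def K_simps)

lemma lo_new: "lo K uu (cd p) = cd p & hi K uu (cd p) = nd p"
 using cd_new by (auto simp: lo_def hi_def uu_def K_simps)

lemma lo_VC: "e : cE C ==> lo C up e : cV C & hi C up e : cV C"
 using wf_ends[OF wf] by (auto simp: lo_def hi_def)

lemma kk_simps: "v : cV C ==> kk v = ka v" "kk (cd p) = zz p" using cd_new by (auto simp: kk_def)

lemma nd_eq_old: assumes "(v', c', i, z) : Ix" "v : cV C" shows "nd (v', c', i, z) = v <-> z = c' & v' = v"
 using assms cd_new by (auto simp: nd_def)

lemma nd_eq_new: assumes "q : Ix" shows "nd q = cd p <-> (EX v c i z. q = (v, c, i, z) & z ~= c & p = (v, c, i, pa z))"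
proof -
 obtain v c i z where q: "q = (v, c, i, z)" by (cases q)
 have "v ~= cd p" using assms IxD(1) cd_new unfolding q by blast
 thus ?thesis by (auto simp: q nd_def cd_inj)
qed

lemma new_down: assumes p: "(v, c, i, z) : Ix" and c': "c' : W" "c' ~= rt" "pa c' = z"
 shows "(v, c, i, c') : Ix" "c' ~= c"
proof -
 note P = IxD[OF p]
 show "(v, c, i, c') : Ix" using p desc_down[of c' c] c' by (auto simp: Ix_def)
 show "c' ~= c" using parent_notin[OF P(2,3)] P(6) c'(3) by auto
qed

lemma snd_new_set: assumes p: "(v, c, i, z) : Ix"
 shows "{e:cE K. snd (cends K e) = cd (v, c, i, z)} = (%c'. cd (v, c, i, c')) ` {c':W - {rt}. pa c' = z}"
proof -
 have "e : cE K & snd (cends K e) = cd (v, c, i, z) <-> e : (%c'. cd (v, c, i, c')) ` {c':W - {rt}. pa c' = z}" for e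
 proof
  assume e: "e : cE K & snd (cends K e) = cd (v, c, i, z)"
  then consider "e : cE C" | q where "q : Ix" "e = cd q" by (auto simp: K_simps)
  thus "e : (%c'. cd (v, c, i, c')) ` {c':W - {rt}. pa c' = z}"
  proof cases
   case 1
   hence "snd (cends K e) : cV C" using wf_ends[OF wf] by (simp add: K_simps)
   thus ?thesis using e cd_new by auto
  next
   case 2
   hence "nd q = cd (v, c, i, z)" using e by (simp add: K_simps)
   then obtain z' where z': "q = (v, c, i, z')" "z = pa z'" using nd_eq_new[OF 2(1)] by auto
   thus ?thesis using 2 IxD[of v c i z'] by auto
  qed
 next
  assume "e : (%c'. cd (v, c, i, c')) ` {c':W - {rt}. pa c' = z}"
  then obtain c' where c': "c' : W" "c' ~= rt" "pa c' = z" "e = cd (v, c, i, c')" by auto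
  thus "e : cE K & snd (cends K e) = cd (v, c, i, z)"
   using new_down[OF p c'(1-3)] by (simp add: K_simps nd_def)
 qed
 thus ?thesis by blast
qed

lemma snd_old_set: assumes v: "v : cV C"
 shows "{e:cE K. snd (cends K e) = v} = {e:cE C. snd (cends C e) = v}
   Un (UN c:{c:W - {rt}. pa c = ka v}. (%i. cd (v, c, i, c)) ` {..<del v c})" (is "_ = ?A Un ?B")
proof -
 have "e : cE K & snd (cends K e) = v <-> e : ?A Un ?B" for e
 proof
  assume e: "e : cE K & snd (cends K e) = v"
  then consider "e : cE C" | q where "q : Ix" "e = cd q" by (auto simp: K_simps)
  thus "e : ?A Un ?B"
  proof cases
   case 1
   thus ?thesis using e by (simp add: K_simps)
  next
   case 2
   obtain v' c i z where q: "q = (v', c, i, z)" by (cases q)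
   have "nd q = v" using e 2 by (simp add: K_simps)
   hence "z = c" "v' = v" using nd_eq_old 2(1) v unfolding q by blast+
   thus ?thesis using 2 IxD[of v c i c] unfolding q by auto
  qed
 next
  assume "e : ?A Un ?B"
  thus "e : cE K & snd (cends K e) = v"
  proof
   assume "e : ?B"
   then obtain c i where ci: "c : W" "c ~= rt" "pa c = ka v" "i < del v c" "e = cd (v, c, i, c)" by auto
   hence "(v, c, i, c) : Ix" using v desc_self by (simp add: Ix_def)
   thus ?thesis using ci by (simp add: K_simps nd_def)
  qed (simp add: K_simps)
 qed
 thus ?thesis by blast
qed

text \<open>This is the Euler characteristic of the tree at \<open>z\<close> when \<open>z\<close>
  is not \<open>om\<close>, so a new vertex, of degree 1, has defect 0.\<close>

lemma vchiK_new: assumes p: "(v, c, i, z) : Ix" shows "vchi K (cd (v, c, i, z)) = 1 - int (card {c':W - {rt}. pa c' = z})"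
proof -
 have "{e:cE K. fst (cends K e) = cd (v, c, i, z)} = {cd (v, c, i, z)}"
  using p wf_ends[OF wf] by (auto simp: K_simps) (metis cd_new(1))+
 hence f: "card {e:cE K. fst (cends K e) = cd (v, c, i, z)} = 1" by simp
 have s: "card {e:cE K. snd (cends K e) = cd (v, c, i, z)} = card {c':W - {rt}. pa c' = z}"
  unfolding snd_new_set[OF p] by (rule card_image) (auto simp: inj_on_def cd_inj)
 have emp: "{l:cL K. clegv K l = cd (v, c, i, z)} = {}" using wf_legv[OF wf] by (auto simp: K_simps) (metis cd_new(1))
 have l: "card {l:cL K. clegv K l = cd (v, c, i, z)} = 0" unfolding emp by simp
 show ?thesis unfolding vchi_def gval_def f s l by (simp add: K_simps)
qed

lemma vchiK_old: assumes v: "v : cV C" shows "vchi K v = vchi C v - (SUM c:{c:W - {rt}. pa c = ka v}. int (del v c))"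
proof -
 have "{e:cE K. fst (cends K e) = v} = {e:cE C. fst (cends C e) = v}"
  using v cd_new by (auto simp: K_simps)
 hence f: "card {e:cE K. fst (cends K e) = v} = card {e:cE C. fst (cends C e) = v}" by simp
 have "card (UN c:{c:W - {rt}. pa c = ka v}. (%i. cd (v, c, i, c)) ` {..<del v c})
   = (SUM c:{c:W - {rt}. pa c = ka v}. card ((%i. cd (v, c, i, c)) ` {..<del v c}))"
  by (rule card_UN_disjoint) (use fin in \<open>auto simp: cd_inj\<close>)
 also have "... = (SUM c:{c:W - {rt}. pa c = ka v}. del v c)"
  by (rule sum.cong[OF refl], subst card_image) (auto simp: inj_on_def cd_inj)
 finally have u: "card (UN c:{c:W - {rt}. pa c = ka v}. (%i. cd (v, c, i, c)) ` {..<del v c}) = (SUM c:{c:W - {rt}. pa c = ka v}. del v c)" .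
 have s: "card {e:cE K. snd (cends K e) = v} = card {e:cE C. snd (cends C e) = v} + (SUM c:{c:W - {rt}. pa c = ka v}. del v c)"
  unfolding snd_old_set[OF v] u[symmetric] by (rule card_Un_disjoint) (use fin cd_new in auto)
 show ?thesis unfolding vchi_def gval_def f s using v by (simp add: K_simps)
qed

lemma UT_old: assumes v: "v : cV C" shows "UT a K rt uu kk mm (kk v) {v} = dd v"
proof -
 have "{e:cE K. kk (lo K uu e) = kk v & lo K uu e : {v}} = {e:cE C. ka (lo C up e) = ka v & lo C up e : {v}}"
  using v lo_old lo_new cd_new by (auto simp: K_simps kk_simps)
 hence "UU K uu kk mm (kk v) {v} = UU C up ka m (ka v) {v}" unfolding UU_def by (auto simp: mm_def)
 moreover have "PLs a K {v} = PLs a C {v}" by (simp add: PLs_def K_simps)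
 ultimately show ?thesis using v by (simp add: UT_def dd_def kk_simps)
qed

lemma UT_new: assumes p: "(v, c, i, z) : Ix" shows "UT a K rt uu kk mm z {cd (v, c, i, z)} = 1"
proof -
 have "{e:cE K. kk (lo K uu e) = z & lo K uu e : {cd (v, c, i, z)}} = {cd (v, c, i, z)}"
  using p lo_old lo_new lo_VC by (auto simp: K_simps kk_simps zz_def cd_inj) (metis cd_new(1))+
 hence "UU K uu kk mm z {cd (v, c, i, z)} = 1" unfolding UU_def using cd_new by (simp add: mm_def)
 thus ?thesis using IxD(8)[OF p] by (simp add: UT_def)
qed

lemma DD_old: assumes v: "v : cV C" and c: "c : W" "c ~= rt" "pa c = ka v" shows "DD K uu kk mm c {v} = dd v"
proof -
 have 1: "{e:cE K. kk (lo K uu e) = c & hi K uu e : {v}} = {e:cE C. ka (lo C up e) = c & hi C up e : {v}} Un (%i. cd (v, c, i, c)) ` {..<del v c}" (is "?L = ?A Un ?B")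
 proof -
  have "e : ?L <-> e : ?A Un ?B" for e
  proof
   assume e: "e : ?L"
   then consider "e : cE C" | q where "q : Ix" "e = cd q" by (auto simp: K_simps)
   thus "e : ?A Un ?B"
   proof cases
    case 1
    thus ?thesis using e lo_old lo_VC by (auto simp: kk_simps)
   next
    case 2
    obtain v' c' i z where q: "q = (v', c', i, z)" by (cases q)
    have "nd q = v" "zz q = c" using e 2 lo_new by (auto simp: kk_simps)
    hence "z = c'" "v' = v" "z = c" using nd_eq_old 2(1) v unfolding q zz_def by auto
    thus ?thesis using 2 IxD[of v c i c] unfolding q by auto
   qed
  next
   assume "e : ?A Un ?B"
   thus "e : ?L"
   proof
    assume "e : ?B"
    then obtain i where ci: "i < del v c" "e = cd (v, c, i, c)" by auto
    hence "(v, c, i, c) : Ix" using v desc_self c by (simp add: Ix_def)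
    thus ?thesis using ci lo_new by (simp add: K_simps kk_simps zz_def nd_def)
   next
    assume "e : ?A"
    thus ?thesis using lo_old lo_VC by (auto simp: K_simps kk_simps)
   qed
  qed
  thus ?thesis by blast
 qed
 have "DD K uu kk mm c {v} = (SUM e:?A. mm e) + (SUM e:?B. mm e)"
  unfolding DD_def 1 by (rule sum.union_disjoint) (use fin cd_new in auto)
 also have "(SUM e:?A. mm e) = DD C up ka m c {v}" unfolding DD_def by (rule sum.cong) (auto simp: mm_def)
 also have "(SUM e:?B. mm e) = (SUM i<del v c. 1)"
  by (subst sum.reindex) (use cd_new in \<open>auto simp: inj_on_def cd_inj mm_def\<close>)
 finally show ?thesis using DD_le(1)[OF v c] by (simp add: del_def)
qed

lemma DD_new: assumes p: "(v, c, i, z) : Ix" and c': "c' : W" "c' ~= rt" "pa c' = z"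
 shows "DD K uu kk mm c' {cd (v, c, i, z)} = 1"
proof -
 have n: "(v, c, i, c') : Ix" "c' ~= c" by (rule new_down[OF p c'])+
 have "{e:cE K. kk (lo K uu e) = c' & hi K uu e : {cd (v, c, i, z)}} = {cd (v, c, i, c')}" (is "?L = _")
 proof -
  have "e : ?L <-> e = cd (v, c, i, c')" for e
  proof
   assume e: "e : ?L"
   then consider "e : cE C" | q where "q : Ix" "e = cd q" by (auto simp: K_simps)
   thus "e = cd (v, c, i, c')"
   proof cases
    case 1
    thus ?thesis using e lo_old lo_VC cd_new(1) by fastforce
   next
    case 2
    have q: "nd q = cd (v, c, i, z)" "zz q = c'" using e 2 lo_new by (auto simp: kk_simps)
    then obtain z' where z': "q = (v, c, i, z')" using nd_eq_new[OF 2(1)] by auto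
    thus ?thesis using q(2) 2(2) by (simp add: zz_def)
   qed
  next
   assume "e = cd (v, c, i, c')"
   thus "e : ?L" using n c'(3) lo_new by (simp add: K_simps kk_simps zz_def nd_def)
  qed
  thus ?thesis by blast
 qed
 thus ?thesis unfolding DD_def using cd_new by (simp add: mm_def)
qed

text \<open>For each child of \<open>ka v\<close> the degree and the missing degree combine to the
  slope already present, which turns the inequality for \<open>K\<close> into
  \<open>0 <= RR\<close>.\<close>

lemma eff_old: assumes v: "v : cV C"
 shows "0 <= int (dd v) * vchi (tree_curve W pa rt om el) (ka v) - vchi K v"
proof -
 have yW: "ka v : W" using tm v by (auto simp: tmap_def)
 let ?ch = "{c:W - {rt}. pa c = ka v}"
 have fc: "finite ?ch" using fin by simp
 have vT: "vchi (tree_curve W pa rt om el) (ka v) = 1 - int (card ?ch) - (if ka v = om then 1 else 0)"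
  unfolding vchi_def gval_tree[OF t yW] by simp
 have sdel: "(SUM c:?ch. int (del v c)) = int (card ?ch) * int (dd v) - (SUM c:?ch. int (DD C up ka m c {v}))"
 proof -
  have "(SUM c:?ch. int (del v c)) = (SUM c:?ch. int (dd v) - int (DD C up ka m c {v}))"
   by (rule sum.cong) (use DD_le(1)[OF v] in \<open>auto simp: del_def\<close>)
  thus ?thesis by (simp add: sum_subtractf)
 qed
 have loE: "ka (lo C up e) : W - {rt}" "ka (hi C up e) = pa (ka (lo C up e))" if "e : cE C" for e
  using tm mE[OF that] that lo_VC[OF that] by (auto simp: tmap_def)
 have hsum: "(SUM c:?ch. DD C up ka m c {v}) = (SUM e:{e:cE C. hi C up e : {v}}. m e)"
 proof -
  have "(SUM e:{e:cE C. hi C up e : {v}}. m e) = (SUM c:?ch. SUM e:{e:{e:cE C. hi C up e : {v}}. ka (lo C up e) = c}. m e)"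
   by (rule sum.group[symmetric]) (use fin loE in auto)
  also have "... = (SUM c:?ch. DD C up ka m c {v})" unfolding DD_def by (intro sum.cong) auto
  finally show ?thesis by simp
 qed
 have lsum: "(SUM e:{e:cE C. lo C up e : {v}}. m e) + PLs a C {v} = dd v"
 proof -
  have "{e:cE C. ka (lo C up e) = ka v & lo C up e : {v}} = {e:cE C. lo C up e : {v}}" by auto
  hence 1: "UU C up ka m (ka v) {v} = (SUM e:{e:cE C. lo C up e : {v}}. m e)" unfolding UU_def by simp
  have "PLs a C {v} = 0" if "ka v ~= rt"
   unfolding PLs_def using that tm by (intro sum.neutral) (auto simp: tmap_def)
  thus ?thesis unfolding dd_def UT_def 1 by auto
 qed
 have NL: "NLs a C {v} = (if ka v = om then dd v else 0)"
 proof (cases "ka v = om")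
  case True
  thus ?thesis using bal[OF v] by (simp add: tbal_def dd_def)
 next
  case False
  thus ?thesis unfolding NLs_def using tm by (auto simp: tmap_def intro!: sum.neutral)
 qed
 have "0 <= RR a C up m {v}" using bal[OF v] by (simp add: tbal_def)
 hence "0 <= int (dd v) - int (SUM c:?ch. DD C up ka m c {v}) - int (NLs a C {v}) - vchi C v"
  unfolding RR_def hsum lsum[symmetric] by simp
 hence "0 <= int (dd v) - (SUM c:?ch. int (DD C up ka m c {v})) - (if ka v = om then int (dd v) else 0) - vchi C v"
  unfolding NL by auto
 thus ?thesis unfolding vT vchiK_old[OF v] sdel by (auto simp: algebra_simps)
qed

lemma cover: "graph_cover a K W pa rt om LL el kk mm uu d'"
proof
 show "is_curve K" "rtree W pa rt om LL" "ALL w:W - {rt}. 0 < el w" by (fact cK t el)+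
next
 fix v assume "v : cV K"
 then consider "v : cV C" | p where "p : Ix" "v = cd p" by (auto simp: K_simps)
 thus "kk v : W"
 proof cases
  case 1
  thus ?thesis using tm by (auto simp: tmap_def kk_simps)
 next
  case 2
  thus ?thesis using IxD by (cases p) (auto simp: kk_simps zz_def)
 qed
next
 fix e assume "e : cE K"
 then consider "e : cE C" | p where "p : Ix" "e = cd p" by (auto simp: K_simps)
 thus "0 < mm e & kk (lo K uu e) : W & kk (lo K uu e) ~= rt & kk (hi K uu e) = pa (kk (lo K uu e))
    & real (mm e) * clen K e = el (kk (lo K uu e))"
 proof cases
  case 1
  thus ?thesis using tm mE[OF 1] lo_VC[OF 1] lo_old[OF 1] by (auto simp: tmap_def kk_simps mm_def K_simps)
 next
  case 2
  obtain v c i z where p: "p = (v, c, i, z)" by (cases p)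
  note P = IxD[OF 2(1)[unfolded p]]
  have "kk (nd p) = pa z"
  proof (cases "z = c")
   case True
   thus ?thesis using P by (simp add: p nd_def kk_simps)
  next
   case False
   thus ?thesis by (simp add: p nd_def kk_simps zz_def)
  qed
  thus ?thesis using 2 P lo_new[of p] cd_new(2)[of p] by (auto simp: p kk_simps zz_def mm_def K_simps)
 qed
next
 fix l assume l: "l : cL K"
 hence l': "l : cL C" by (simp add: K_simps)
 show "a l ~= 0" using nz l' by blast
 show "0 < a l ==> kk (clegv K l) = rt" "a l < 0 ==> kk (clegv K l) = om"
  using tm l' wf_legv[OF wf l'] by (auto simp: tmap_def K_simps kk_simps)
next
 fix v assume "v : cV K"
 then consider "v : cV C" | p where "p : Ix" "v = cd p" by (auto simp: K_simps)
 thus "UT a K rt uu kk mm (kk v) {v} = d' v"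
 proof cases
  case 1
  thus ?thesis using UT_old by (simp add: d'_def)
 next
  case 2
  thus ?thesis using UT_new cd_new by (cases p) (auto simp: d'_def kk_simps zz_def)
 qed
next
 fix v c assume v: "v : cV K" and c: "c : W" "c ~= rt" "pa c = kk v"
 then consider "v : cV C" | p where "p : Ix" "v = cd p" by (auto simp: K_simps)
 thus "DD K uu kk mm c {v} = d' v"
 proof cases
  case 1
  thus ?thesis using DD_old c by (simp add: d'_def kk_simps)
 next
  case 2
  thus ?thesis using DD_new c cd_new by (cases p) (auto simp: d'_def kk_simps zz_def)
 qed
next
 fix v assume v: "v : cV K" and w: "kk v = om"
 then consider "v : cV C" | p where "p : Ix" "v = cd p" by (auto simp: K_simps)
 thus "NLs a K {v} = d' v"
 proof cases
  case 1
  have "NLs a K {v} = NLs a C {v}" by (simp add: NLs_def K_simps)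
  thus ?thesis using bal[OF 1] w 1 by (simp add: tbal_def d'_def dd_def kk_simps)
 next
  case 2
  obtain v' c i z where p: "p = (v', c, i, z)" by (cases p)
  note P = IxD[OF 2(1)[unfolded p]]
  have "z = om" using w 2 by (simp add: p kk_simps zz_def)
  hence "c : LL" using P desc_line by simp
  hence "del v' c = 0" using DD_le(2) P by blast
  thus ?thesis using P by simp
 qed
next
 fix v assume v: "v : cV K"
 then consider "v : cV C" | p where "p : Ix" "v = cd p" by (auto simp: K_simps)
 thus "0 <= int (d' v) * vchi (tree_curve W pa rt om el) (kk v) - vchi K v"
 proof cases
  case 1
  thus ?thesis using eff_old by (simp add: d'_def kk_simps)
 next
  case 2
  obtain v' c i z where p: "p = (v', c, i, z)" by (cases p)
  note P = IxD[OF 2(1)[unfolded p]]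
  have zw: "z ~= om"
  proof
   assume "z = om"
   hence "c : LL" using P desc_line by simp
   hence "del v' c = 0" using DD_le(2) P by blast
   thus False using P by simp
  qed
  have vT: "vchi (tree_curve W pa rt om el) z = 1 - int (card {c:W - {rt}. pa c = z})"
   unfolding vchi_def gval_tree[OF t P(7)] using zw by simp
  show ?thesis using 2 vchiK_new[OF 2(1)[unfolded p]] cd_new vT by (simp add: p d'_def kk_simps zz_def)
 qed
qed

theorem realize_DR:
 assumes L: "cL C = {1..n}"
 shows "DR n a C"
proof -
 interpret g: graph_cover a K W pa rt om LL el kk mm uu d' by (rule cover)
 have LK: "cL K = {1..n}" using L K_simps by simp
 show ?thesis unfolding DR_def by (intro exI[of _ K] exI[of _ g.T] exI[of _ g.tau] conjI modif g.T g.tau_eff ballI) (use g.tau_legs LK in \<open>auto\<close>)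
qed

end

section \<open>Edge lengths as linear functions of the tree lengths\<close>

definition typelen :: "tcurve => tcurve => (nat => seg) => (nat => nat) => (nat => nat) => (nat => bool) => (nat => real) => nat => real" where
 "typelen G H lab ka m up el = pushl G H lab (%f. el (ka (lo H up f)) / real (m f))"

lemma typelen_curve:
 assumes wf: "wf_graph G" and sd: "subdiv G H lab vl" and tc: "tcov a H W pa rt om LL ka m up"
  and el: "ALL w:W - {rt}. 0 < el w" and nz: "ALL l:cL G. a l ~= 0"
 shows "EX bt D C. isom (curve_of G (typelen G H lab ka m up el)) C bt D & realize a C W pa rt om LL el ka m up & cL C = cL G"
proof -
 \<comment> \<open>Division by 0 yields 0, so the edges of slope 0 are exactly those of length
   0.\<close>
 define ll where "ll f = el (ka (lo H up f)) / real (m f)" for f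
 note inv = subdiv_inv[OF sd wf]
 have wfH: "wf_graph H" using inv by blast
 have tm: "tmap a H W pa rt om ka m up" using tc by (simp add: tcov_def)
 have lV: "lo H up e : cV H" if "e : cE H" for e using wf_ends[OF wfH that] by (simp add: lo_def)
 have pos: "0 < el (ka (lo H up e))" if "e : cE H" "0 < m e" for e
  using tm that el lV[OF that(1)] by (auto simp: tmap_def)
 have nn: "ALL e:cE H. 0 <= ll e"
 proof
  fix e assume e: "e : cE H"
  show "0 <= ll e" using pos[OF e] by (cases "m e = 0") (auto simp: ll_def)
 qed
 have z: "ALL e:cE H. m e = 0 <-> ll e = 0"
 proof
  fix e assume e: "e : cE H"
  show "m e = 0 <-> ll e = 0" using pos[OF e] by (cases "m e = 0") (auto simp: ll_def)
 qed
 interpret c: contracted H ll m by unfold_locales (use wfH nn z in auto)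
 have path: "ka x = ka y" if "(x, y) : (erel (cends H) (zset H ll))^*" for x y
  using that
 proof induction
  case (step y w)
  then obtain e where "e : zset H ll" "cends H e = (y, w) | cends H e = (w, y)" by (auto simp: erel_def)
  hence "ka y = ka w" using tm z by (auto simp: tmap_def zset_def)
  thus ?case using step by simp
 qed simp
 have kar: "ALL v:cV H. ka v = ka (zrep H ll v)"
  using zrep_in[OF wfH] path by (auto simp: zcls_def)
 have tC: "tcov a c.C W pa rt om LL ka m up" using c.tcov_contracted[OF kar] tc by blast
 obtain bt D where i: "isom (curve_of G (pushl G H lab ll)) (curve_of H ll) bt D" using subdiv_isom[OF sd wf nn] by blast
 have L: "cL c.C = cL G" using inv by (simp add: curve_of_simps)
 have r: "realize a c.C W pa rt om LL el ka m up"
 proof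
  show "is_curve c.C" by (rule is_curve_of[OF wfH nn])
  show "tcov a c.C W pa rt om LL ka m up" by (rule tC)
  show "ALL w:W - {rt}. 0 < el w" by (rule el)
  show "a l ~= 0" if "l : cL c.C" for l using that nz L by simp
 next
  fix e assume e: "e : cE c.C"
  hence eH: "e : cE H" "m e ~= 0" using c.cE_C by auto
  have "ka (lo c.C up e) = ka (lo H up e)" using c.lo_C[OF eH(1)] kar lV[OF eH(1)] by metis
  thus "0 < m e & clen c.C e = el (ka (lo c.C up e)) / real (m e)"
   using eH by (simp add: curve_of_simps(6)) (simp add: ll_def)
 qed
 have tl: "typelen G H lab ka m up el = pushl G H lab ll"
  unfolding typelen_def by (rule arg_cong[of _ _ "pushl G H lab"]) (simp add: ll_def fun_eq_iff)
 show ?thesis unfolding tl using i r L by blast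
qed

lemma type_DR:
 assumes wf: "wf_graph G" and L: "cL G = {1..n}" and sd: "subdiv G H lab vl" and tc: "tcov a H W pa rt om LL ka m up"
  and el: "ALL w:W - {rt}. 0 < el w" and nz: "ALL i:{1..n}. a i ~= 0"
 shows "DR n a (curve_of G (typelen G H lab ka m up el))"
proof -
 have "ALL l:cL G. a l ~= 0" using nz L by simp
 then obtain bt D C where c: "isom (curve_of G (typelen G H lab ka m up el)) C bt D"
  "realize a C W pa rt om LL el ka m up" "cL C = cL G"
  using typelen_curve[OF wf sd tc el] by blast
 have "DR n a C" using realize.realize_DR[OF c(2)] c(3) L by simp
 thus ?thesis by (rule DR_isom[OF c(1)])
qed

section \<open>The harmonic function of a cover\<close>

context realize
begin

text \<open>The distance from the root to the foot of \<open>w\<close> on the path from 0 to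
  \<infinity>. The harmonic function is the morphism followed by the projection of the tree onto
  this line.\<close>

definition bet :: "nat => real" where "bet w = (SUM x:{x:LL - {rt}. (w, x) : Tr^*}. el x)"

lemma bet_step: assumes w: "w : W" "w ~= rt" shows "bet w = bet (pa w) + (if w : LL then el w else 0)"
proof -
 have st: "(w, x) : Tr^* <-> x = w | (pa w, x) : Tr^*" for x
 proof
  assume "(w, x) : Tr^*"
  thus "x = w | (pa w, x) : Tr^*" by (cases rule: converse_rtranclE) (auto simp: Tr_def)
 next
  have "(w, pa w) : Tr" using w by (auto simp: Tr_def)
  thus "x = w | (pa w, x) : Tr^* ==> (w, x) : Tr^*" by auto
 qed
 have nw: "(pa w, w) ~: Tr^*" using parent_notin[OF w] rtree_pi[OF t w] by (auto simp: desc_def)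
 have fL: "finite LL" using t finite_subset by (auto simp: rtree_def)
 show ?thesis
 proof (cases "w : LL")
  case True
  have "{x:LL - {rt}. (w, x) : Tr^*} = insert w {x:LL - {rt}. (pa w, x) : Tr^*}" using st True w by auto
  thus ?thesis unfolding bet_def using nw fL True by simp
 next
  case False
  have "{x:LL - {rt}. (w, x) : Tr^*} = {x:LL - {rt}. (pa w, x) : Tr^*}" using st False by auto
  thus ?thesis unfolding bet_def using False by simp
 qed
qed

definition se :: "nat => int" where "se e = (if ka (lo C up e) : LL then int (m e) else 0)"
definition gsl :: "seg => int" where "gsl s = (case s of SE e => if up e then - se e else se e | SL l => - a l)"
definition gst :: "seg => real" where "gst s = bet (ka (segstart C s))"

definition ff :: "pt => real" where
 "ff x = (case x of PV v => bet (ka v) | PE e u => gst (SE e) + of_int (gsl (SE e)) * u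
   | PLg l u => gst (SL l) + of_int (gsl (SL l)) * u)"

lemma ff_ipt: "ff (ipt s u) = gst s + of_int (gsl s) * u" by (cases s) (auto simp: ff_def)

lemma edge_tm: assumes "e : cE C"
 shows "ka (lo C up e) : W" "ka (lo C up e) ~= rt" "ka (hi C up e) = pa (ka (lo C up e))" "real (m e) * clen C e = el (ka (lo C up e))"
proof -
 have "lo C up e : cV C" using wf_ends[OF wf assms] by (simp add: lo_def)
 thus "ka (lo C up e) : W" "ka (lo C up e) ~= rt" "ka (hi C up e) = pa (ka (lo C up e))" "real (m e) * clen C e = el (ka (lo C up e))"
  using tm mE[OF assms] assms by (auto simp: tmap_def)
qed

lemma ff_pos: assumes s: "s : segs C" and u: "seg_dom C s u" shows "ff (pos C s u) = gst s + of_int (gsl s) * u"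
proof (cases "sint C s u")
 case True
 thus ?thesis by (simp add: pos_sint ff_ipt)
next
 case False
 show ?thesis
 proof (cases s)
  case (SL l)
  hence "u = 0" using False u by (auto simp: sint_def seg_dom_def)
  thus ?thesis by (simp add: SL pos_def ff_def gst_def segstart_def)
 next
  case (SE e)
  hence e: "e : cE C" using s by simp
  note E = edge_tm[OF e]
  have b: "bet (ka (lo C up e)) = bet (ka (hi C up e)) + of_int (se e) * clen C e"
   using bet_step[OF E(1,2)] E(3,4) by (simp add: se_def)
  have lp: "0 < clen C e" using is_curve_len[OF C e] .
  have "u = 0 | u = clen C e" using False u by (auto simp: SE sint_def seg_dom_def)
  thus ?thesis
  proof
   assume "u = clen C e"
   thus ?thesis using b by (auto simp: SE pos_def ff_def gst_def gsl_def segstart_def lo_def hi_def)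
  qed (simp add: SE pos_def ff_def gst_def segstart_def)
 qed
qed

definition dsl :: "dir => int" where "dsl h = (if snd (snd h) then gsl (fst h) else - gsl (fst h))"

lemma ff_germ: assumes h: "h : dirs C" shows "fgerm C ff h (dsl h)"
proof -
 obtain s u sn where hh: "h = (s, u, sn)" by (cases h)
 have s: "s : segs C" using h hh dirs_segs by blast
 obtain ep where e: "0 < ep" "!!dl. 0 < dl ==> dl <= ep ==> sint C s (mv sn u dl)"
  using dirs_small[OF h] by (auto simp: hh)
 have dom: "seg_dom C s (mv sn u dl)" if "0 <= dl" "dl <= ep" for dl
  using that e(2)[of dl] sint_seg_dom h by (cases "dl = 0") (auto simp: hh dirs_def)
 show ?thesis unfolding fgerm_def hh prod.case
 proof (intro exI[of _ ep] conjI allI impI)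
  fix dl assume d: "0 <= dl & dl <= ep"
  thus "seg_dom C s (mv sn u dl)" using dom by blast
  have "ff (pos C s (mv sn u dl)) = gst s + of_int (gsl s) * mv sn u dl" "ff (pos C s u) = gst s + of_int (gsl s) * u"
   using ff_pos[OF s dom[of dl]] ff_pos[OF s dom[of 0]] d by auto
  thus "ff (pos C s (mv sn u dl)) = ff (pos C s u) + of_int (dsl (s, u, sn)) * dl"
   by (auto simp: dsl_def mv_def algebra_simps)
 qed (use e in simp)
qed

text \<open>Over a tree vertex off the path all slopes vanish. On the path, equality in
  \<open>tbal\<close> says that the slopes towards 0 and towards \<infinity> have the same sum, with
  legs replacing the edges at the two ends.\<close>

lemma ff_harm_vertex: assumes v: "v : cV C" shows "(SUM h:dir_at C (PV v). dsl h) = 0"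
proof -
 let ?y = "ka v"
 have yW: "?y : W" using tm v by (auto simp: tmap_def)
 have L: "rt : LL" "om : LL" "bij_betw pa (LL - {rt}) (LL - {om})" "LL <= W" using t by (auto simp: rtree_def)
 have legs: "(SUM l:{l:cL C. clegv C l = v}. dsl (SL l, 0, True)) = int (NLs a C {v}) - int (PLs a C {v})"
 proof -
  have "int (NLs a C {v}) = (SUM l:{l:cL C. clegv C l = v}. if a l < 0 then - a l else 0)"
   unfolding NLs_def using fin by (subst sum.inter_filter[symmetric]) (auto intro!: sum.cong)
  moreover have "int (PLs a C {v}) = (SUM l:{l:cL C. clegv C l = v}. if 0 < a l then a l else 0)"
   unfolding PLs_def using fin by (subst sum.inter_filter[symmetric]) (auto intro!: sum.cong)
  ultimately have "int (NLs a C {v}) - int (PLs a C {v}) = (SUM l:{l:cL C. clegv C l = v}. (if a l < 0 then - a l else 0) - (if 0 < a l then a l else 0))"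
   by (simp add: sum_subtractf)
  also have "... = (SUM l:{l:cL C. clegv C l = v}. dsl (SL l, 0, True))"
   by (rule sum.cong) (auto simp: dsl_def gsl_def)
  finally show ?thesis by simp
 qed
 have S: "(SUM h:dir_at C (PV v). dsl h) = (SUM e:{e:cE C. hi C up e = v}. se e) - (SUM e:{e:cE C. lo C up e = v}. se e)
   + (int (NLs a C {v}) - int (PLs a C {v}))"
  unfolding sum_dir_lohi[OF C, of _ v up] legs by (simp add: dirl_def dirh_def dsl_def gsl_def sum_negf if_distrib cong: if_cong)
 have P0: "PLs a C {v} = 0" if "?y ~= rt" unfolding PLs_def using that tm by (intro sum.neutral) (auto simp: tmap_def)
 have N0: "NLs a C {v} = 0" if "?y ~= om" unfolding NLs_def using that tm by (intro sum.neutral) (auto simp: tmap_def)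
 have lo: "(SUM e:{e:cE C. lo C up e = v}. se e) = (if ?y : LL then int (UU C up ka m ?y {v}) else 0)"
  unfolding UU_def se_def by (auto intro!: sum.cong)
 have hi: "(SUM e:{e:cE C. hi C up e = v}. se e) = (SUM c:{c:LL - {rt}. pa c = ?y}. int (DD C up ka m c {v}))"
 proof -
  have fL: "finite LL" using L(4) fin(4) finite_subset by blast
  have "(SUM e:{e:cE C. hi C up e = v}. se e) = (SUM e:{e:{e:cE C. hi C up e = v}. ka (lo C up e) : LL}. int (m e))"
   unfolding se_def using fin by (subst sum.inter_filter) auto
  also have "... = (SUM c:{c:LL - {rt}. pa c = ?y}. SUM e:{e:{e:{e:cE C. hi C up e = v}. ka (lo C up e) : LL}. ka (lo C up e) = c}. int (m e))"
   by (rule sum.group[symmetric]) (use fin fL edge_tm in auto)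
  also have "... = (SUM c:{c:LL - {rt}. pa c = ?y}. int (DD C up ka m c {v}))"
   unfolding DD_def of_nat_sum by (intro sum.cong) auto
  finally show ?thesis .
 qed
 have B: "DD C up ka m c {v} = UT a C rt up ka m ?y {v}" if "c : LL - {rt}" "pa c = ?y" for c
  using bal[OF v] that L(4) unfolding tbal_def by auto
 have pL: "pa c : LL & pa c ~= om" if "c : LL" "c ~= rt" for c using bij_betwE[OF L(3)] that by blast
 have Nw: "NLs a C {v} = UT a C rt up ka m om {v}" using bal[OF v] by (simp add: tbal_def)
 show ?thesis
 proof (cases "?y : LL")
  case False
  have emp: "{c:LL - {rt}. pa c = ?y} = {}" using pL False by force
  have "?y ~= rt" "?y ~= om" using False L(1,2) by auto
  thus ?thesis unfolding S lo hi emp using False P0 N0 by simp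
 next
  case True
  have UTy: "int (UT a C rt up ka m ?y {v}) = int (UU C up ka m ?y {v}) + int (PLs a C {v})"
   using P0 by (auto simp: UT_def)
  show ?thesis
  proof (cases "?y = om")
   case yw: True
   hence emp: "{c:LL - {rt}. pa c = ?y} = {}" using pL by force
   show ?thesis unfolding S lo hi emp using True UTy Nw yw by simp
  next
   case False
   hence "?y : pa ` (LL - {rt})" using L(3) True by (simp add: bij_betw_def)
   then obtain c where c0: "?y = pa c" "c : LL - {rt}" by (rule imageE)
   have c: "c : LL - {rt}" "pa c = ?y" using c0 by auto
   have one: "{c:LL - {rt}. pa c = ?y} = {c}" using c L(3) by (auto simp: bij_betw_def inj_on_def)
   show ?thesis unfolding S lo hi one using True UTy N0[OF False] B[OF c] by simp
  qed
 qed
qed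

theorem realize_PD:
 assumes Ln: "cL C = {1..n}"
 shows "PD n a C"
proof -
 have "(SUM h:dir_at C x. dsl h) = 0" if x: "x : pts C" for x
 proof -
  consider v where "x = PV v" "v : cV C" | s u where "x = ipt s u" "s : segs C" "sint C s u" using x by (auto simp: pts_alt)
  thus ?thesis
  proof cases
   case 1
   thus ?thesis using ff_harm_vertex by simp
  next
   case 2
   thus ?thesis using dir_at_ipt[OF 2(2,3)] by (simp add: dsl_def)
  qed
 qed
 moreover have lin: "fun_eventually_lin C ff l (- a l)" for l
  by (rule fun_eventually_linI[of 1 _ _ _ "gst (SL l)"]) (auto simp: ff_def gsl_def)
 ultimately have "harmonic_fun C ff" unfolding harmonic_fun_def using ff_germ by (intro exI[of _ dsl]) auto
 thus ?thesis unfolding PD_def using lin by blast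
qed

end

lemma type_PD:
 assumes wf: "wf_graph G" and L: "cL G = {1..n}" and sd: "subdiv G H lab vl" and tc: "tcov a H W pa rt om LL ka m up"
  and el: "ALL w:W - {rt}. 0 < el w" and nz: "ALL i:{1..n}. a i ~= 0"
 shows "PD n a (curve_of G (typelen G H lab ka m up el))"
proof -
 have "ALL l:cL G. a l ~= 0" using nz L by simp
 then obtain bt D C where c: "isom (curve_of G (typelen G H lab ka m up el)) C bt D"
  "realize a C W pa rt om LL el ka m up" "cL C = cL G"
  using typelen_curve[OF wf sd tc el] by blast
 have "PD n a C" using realize.realize_PD[OF c(2)] c(3) L by simp
 from PD_isom[OF c(1) wf_curve_of[OF wf] _ this] show ?thesis by (simp add: curve_of_simps L)
qed

section \<open>Contraction of tree edges\<close>

text \<open>The tree vertex \<open>j\<close> is merged into its parent. The edges over it get slope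
  0 but stay in \<open>H\<close>, so the subdivision and its labels are not touched.\<close>

definition cpi :: "(nat => nat) => nat => nat => nat" where "cpi pa j c = (if pa c = j then pa j else pa c)"
definition cka :: "(nat => nat) => (nat => nat) => nat => nat => nat" where "cka pa ka j v = (if ka v = j then pa j else ka v)"
definition csl :: "tcurve => (nat => bool) => (nat => nat) => (nat => nat) => nat => nat => nat" where
 "csl H up ka m j e = (if ka (lo H up e) = j then 0 else m e)"

lemma rtree_contract:
 assumes t: "rtree W pa rt om LL" and j: "j : W" "j ~= rt"
 shows "rtree (W - {j}) (cpi pa j) rt (if om = j then pa j else om) (LL - {j})"
proof -
 obtain lev :: "nat => nat" where lev: "ALL w:W - {rt}. pa w : W & lev (pa w) < lev w" using t by (auto simp: rtree_def)
 have W: "finite W" "rt : W" "om : W" "LL <= W" "rt : LL" "om : LL" and b: "bij_betw pa (LL - {rt}) (LL - {om})"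
  using t by (auto simp: rtree_def)
 let ?w = "if om = j then pa j else om"
 have pj: "pa j : W" "pa j ~= j" "lev (pa j) < lev j" using lev j by force+
 have 1: "ALL w:(W - {j}) - {rt}. cpi pa j w : W - {j} & lev (cpi pa j w) < lev w"
 proof
  fix w assume w: "w : (W - {j}) - {rt}"
  hence "pa w : W" "lev (pa w) < lev w" using lev by auto
  thus "cpi pa j w : W - {j} & lev (cpi pa j w) < lev w" using pj by (auto simp: cpi_def)
 qed
 have inL: "pa c : LL" "pa c ~= om" if "c : LL" "c ~= rt" for c using bij_betwE[OF b] that by auto
 have 2: "bij_betw (cpi pa j) (LL - {j} - {rt}) (LL - {j} - {?w})"
 proof (cases "j : LL")
  case False
  hence e: "LL - {j} = LL" "?w = om" using W by auto
  have "bij_betw (cpi pa j) (LL - {rt}) (LL - {om}) <-> bij_betw pa (LL - {rt}) (LL - {om})"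
   by (rule bij_betw_cong) (use inL False in \<open>auto simp: cpi_def\<close>)
  thus ?thesis using b unfolding e by simp
 next
  case True
  show ?thesis
  proof (cases "j = om")
   case jw: True
   have "bij_betw pa ((LL - {rt}) - {j}) ((LL - {om}) - {pa j})"
    by (rule bij_betw_DiffI[OF b]) (use True j inL in auto)
   moreover have "bij_betw (cpi pa j) ((LL - {rt}) - {j}) ((LL - {om}) - {pa j}) <-> bij_betw pa ((LL - {rt}) - {j}) ((LL - {om}) - {pa j})"
    by (rule bij_betw_cong) (use inL jw in \<open>auto simp: cpi_def\<close>)
   moreover have "LL - {j} - {rt} = (LL - {rt}) - {j}" "LL - {j} - {?w} = (LL - {om}) - {pa j}" using jw by auto
   ultimately show ?thesis by simp
  next
   case jw: False
   hence "j : pa ` (LL - {rt})" using b True by (simp add: bij_betw_def)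
   then obtain c0 where c0: "c0 : LL" "c0 ~= rt" "pa c0 = j" by auto
   have c0j: "c0 ~= j" using c0(3) pj(2) by auto
   have b2: "bij_betw pa ((LL - {rt}) - {c0}) ((LL - {om}) - {j})"
    by (rule bij_betw_DiffI[OF b]) (use c0 inL[of c0] in auto)
   \<comment> \<open>The child \<open>c0\<close> of \<open>j\<close> on the path inherits the parent
     of \<open>j\<close>, so the new bijection is the old one with \<open>c0\<close> sent to where
     \<open>j\<close> went.\<close>
   define g where "g c = (if c = c0 then j else c)" for c
   have b1: "bij_betw g ((LL - {rt}) - {j}) ((LL - {rt}) - {c0})"
    by (rule bij_betw_byWitness[where f' = "%c. if c = j then c0 else c"]) (use c0 j True in \<open>auto simp: g_def\<close>)
   have "bij_betw (pa o g) ((LL - {rt}) - {j}) ((LL - {om}) - {j})" by (rule bij_betw_trans[OF b1 b2])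
   moreover have "bij_betw (cpi pa j) ((LL - {rt}) - {j}) ((LL - {om}) - {j}) <-> bij_betw (pa o g) ((LL - {rt}) - {j}) ((LL - {om}) - {j})"
   proof (rule bij_betw_cong)
    fix c assume c: "c : (LL - {rt}) - {j}"
    show "cpi pa j c = (pa o g) c"
    proof (cases "c = c0")
     case False
     hence "pa c ~= j" using b c c0 by (auto simp: bij_betw_def inj_on_def)
     thus ?thesis using False by (simp add: cpi_def g_def)
    qed (simp add: cpi_def g_def c0)
   qed
   moreover have "LL - {j} - {rt} = (LL - {rt}) - {j}" "LL - {j} - {?w} = (LL - {om}) - {j}" using jw by auto
   ultimately show ?thesis by simp
  qed
 qed
 have pjL: "pa j : LL" if "j : LL" using inL that j by blast
 show ?thesis unfolding rtree_def using W pj 1 2 pjL j by auto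
qed

text \<open>On a set saturated after the contraction, the edges over \<open>j\<close> have both ends
  inside or both outside, so \<open>UT\<close> at \<open>j\<close> equals \<open>DD\<close> at
  \<open>j\<close>. The conditions at \<open>j\<close> and above it then chain, and in the defect
  the slopes over \<open>j\<close> cancel.\<close>

lemma tcov_contract:
 assumes wf: "wf_graph H" and tc: "tcov a H W pa rt om LL ka m up" and j: "j : W" "j ~= rt"
 shows "tcov a H (W - {j}) (cpi pa j) rt (if om = j then pa j else om) (LL - {j}) (cka pa ka j) (csl H up ka m j) up"
proof -
 let ?w = "if om = j then pa j else om" and ?k = "cka pa ka j" and ?m = "csl H up ka m j" and ?p = "cpi pa j"
 have t: "rtree W pa rt om LL" and tm: "tmap a H W pa rt om ka m up" using tc by (auto simp: tcov_def)
 have bal: "tbal a H W pa rt om LL ka m up A" if "satur H m A" for A using tc that by (auto simp: tcov_def)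
 have fin: "finite (cE H)" using wf_fin[OF wf] by simp
 have pj: "pa j : W" "pa j ~= j" using rtree_pi[OF t j] by auto
 have L: "LL <= W" "om : LL" "bij_betw pa (LL - {rt}) (LL - {om})" using t by (auto simp: rtree_def)
 have E0: "ka (fst (cends H e)) = ka (snd (cends H e))" if "e : cE H" "m e = 0" for e using tm that by (auto simp: tmap_def)
 have E1: "ka (lo H up e) ~= rt" "ka (hi H up e) = pa (ka (lo H up e))" if "e : cE H" "0 < m e" for e
  using tm that by (auto simp: tmap_def)
 have tm': "tmap a H (W - {j}) ?p rt ?w ?k ?m up"
  unfolding tmap_def
 proof (intro conjI ballI impI)
  show "?k ` cV H <= W - {j}" using tm pj by (auto simp: tmap_def cka_def)
 next
  fix e assume e: "e : cE H" "?m e = 0"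
  show "?k (fst (cends H e)) = ?k (snd (cends H e))"
  proof (cases "m e = 0")
   case True
   thus ?thesis using E0[OF e(1)] by (simp add: cka_def)
  next
   case False
   hence "ka (lo H up e) = j" using e(2) by (auto simp: csl_def split: if_splits)
   moreover from this have "ka (hi H up e) = pa j" using E1(2)[OF e(1)] False by simp
   ultimately show ?thesis by (auto simp: cka_def lo_def hi_def split: if_splits)
  qed
 next
  fix e assume e: "e : cE H" "0 < ?m e"
  hence m: "ka (lo H up e) ~= j" "0 < m e" by (auto simp: csl_def split: if_splits)
  show "?k (lo H up e) ~= rt" using E1(1)[OF e(1) m(2)] m(1) by (simp add: cka_def)
  show "?k (hi H up e) = ?p (?k (lo H up e))" using E1(2)[OF e(1) m(2)] m(1) by (simp add: cka_def cpi_def)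
 next
  fix l assume l: "l : cL H"
  show "0 < a l ==> ?k (clegv H l) = rt" using tm l j by (auto simp: tmap_def cka_def)
  show "a l < 0 ==> ?k (clegv H l) = ?w" using tm l by (auto simp: tmap_def cka_def)
 qed
 have sums: "(SUM e:{e:cE H. ?k (lo H up e) = c & P e}. ?m e) = (SUM e:{e:cE H. ka (lo H up e) = c & P e}. m e)" if "c ~= j" for c P
 proof -
  have "(SUM e:{e:cE H. ka (lo H up e) = c & P e}. m e) = (SUM e:{e:cE H. ka (lo H up e) = c & P e}. ?m e)"
   by (rule sum.cong) (use that in \<open>auto simp: csl_def\<close>)
  also have "... = (SUM e:{e:cE H. ?k (lo H up e) = c & P e}. ?m e)"
   by (rule sum.mono_neutral_left) (use fin that in \<open>auto simp: cka_def csl_def\<close>)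
  finally show ?thesis by simp
 qed
 have D': "DD H up ?k ?m c A = DD H up ka m c A" if "c ~= j" for c A unfolding DD_def by (rule sums[OF that])
 have U': "UT a H rt up ?k ?m c A = UT a H rt up ka m c A" if "c ~= j" for c A
  unfolding UT_def UU_def sums[OF that] ..
 have "tbal a H (W - {j}) ?p rt ?w (LL - {j}) ?k ?m up A" if A': "satur H ?m A" for A
 proof -
  have A: "satur H m A" using A' by (auto simp: satur_def csl_def)
  note B = bal[OF A]
  have lh: "lo H up e : A <-> hi H up e : A" if "e : cE H" "ka (lo H up e) = j" for e
   using A' that by (auto simp: satur_def csl_def lo_def hi_def)
  have "UU H up ka m j A = DD H up ka m j A"
   unfolding UU_def DD_def by (rule arg_cong[of _ _ "sum m"]) (use lh in auto)
  hence UD: "UT a H rt up ka m j A = DD H up ka m j A" using j by (simp add: UT_def)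
  have B1: "DD H up ka m c A <= UT a H rt up ka m (pa c) A" if "c : W" "c ~= rt" for c using B that by (auto simp: tbal_def)
  have B2: "DD H up ka m c A = UT a H rt up ka m (pa c) A" if "c : LL" "c ~= rt" for c using B that L(1) by (auto simp: tbal_def)
  show ?thesis unfolding tbal_def
  proof (intro conjI ballI impI)
   fix c assume c: "c : W - {j} - {rt}"
   have cp: "?p c ~= j" using pj by (simp add: cpi_def)
   show "DD H up ?k ?m c A <= UT a H rt up ?k ?m (?p c) A"
   proof (cases "pa c = j")
    case True
    have "DD H up ka m c A <= UT a H rt up ka m (pa j) A" using B1[of c] B1[OF j] c True UD by simp
    thus ?thesis using D'[of c] U'[OF cp] c True by (simp add: cpi_def)
   next
    case False
    thus ?thesis using B1[of c] D'[of c] U'[OF cp] c by (simp add: cpi_def)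
   qed
   assume cL: "c : LL - {j}"
   show "DD H up ?k ?m c A = UT a H rt up ?k ?m (?p c) A"
   proof (cases "pa c = j")
    case True
    hence jL: "j : LL" using bij_betwE[OF L(3)] cL c by auto
    have "DD H up ka m c A = UT a H rt up ka m (pa j) A" using B2[of c] B2[OF jL j(2)] cL c True UD by simp
    thus ?thesis using D'[of c] U'[OF cp] c True by (simp add: cpi_def)
   next
    case False
    thus ?thesis using B2[of c] D'[of c] U'[OF cp] c cL by (simp add: cpi_def)
   qed
  next
   have N: "NLs a H A = UT a H rt up ka m om A" using B by (simp add: tbal_def)
   show "NLs a H A = UT a H rt up ?k ?m ?w A"
   proof (cases "om = j")
    case True
    hence "NLs a H A = UT a H rt up ka m (pa j) A" using N UD B2[of j] L(2) j by simp
    thus ?thesis using True U' pj by simp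
   next
    case False
    thus ?thesis using N U' by simp
   qed
   have 1: "int (SUM e:{e:cE H. P e}. m e) = int (SUM e:{e:cE H. P e}. ?m e) + int (SUM e:{e:cE H. ka (lo H up e) = j & P e}. m e)" for P
   proof -
    have "(SUM e:{e:cE H. P e}. m e) = (SUM e:{e:cE H. P e}. ?m e + (if ka (lo H up e) = j then m e else 0))"
     by (rule sum.cong) (auto simp: csl_def)
    also have "... = (SUM e:{e:cE H. P e}. ?m e) + (SUM e:{e:{e:cE H. P e}. ka (lo H up e) = j}. m e)"
     using fin by (simp add: sum.distrib flip: sum.inter_filter)
    also have "{e:{e:cE H. P e}. ka (lo H up e) = j} = {e:cE H. ka (lo H up e) = j & P e}" by auto
    finally show ?thesis by simp
   qed
   have 2: "(SUM e:{e:cE H. ka (lo H up e) = j & lo H up e : A}. m e) = (SUM e:{e:cE H. ka (lo H up e) = j & hi H up e : A}. m e)"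
    by (rule arg_cong[of _ _ "sum m"]) (use lh in auto)
   have "0 <= RR a H up m A" using B by (simp add: tbal_def)
   thus "0 <= RR a H up ?m A"
    unfolding RR_def using 1[of "%e. lo H up e : A"] 1[of "%e. hi H up e : A"] 2 by simp
  qed
 qed
 thus ?thesis unfolding tcov_def using rtree_contract[OF t j] tm' by blast
qed

text \<open>The lengths on \<open>G\<close> produced by length 1 on the tree edge \<open>j\<close>
  alone: the generators of the cone of a type.\<close>

definition col :: "tcurve => tcurve => (nat => seg) => (nat => nat) => (nat => nat) => (nat => bool) => nat => nat => real" where
 "col G H lab ka m up j e = (if e : cE G then (SUM f:{f:cE H. lab f = SE e & ka (lo H up f) = j}. 1 / real (m f)) else 0)"

lemma typelen_col:
 assumes wf: "wf_graph H" and tc: "tcov a H W pa rt om LL ka m up"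
 shows "typelen G H lab ka m up el e = (SUM j:W - {rt}. el j * col G H lab ka m up j e)"
proof (cases "e : cE G")
 case False
 thus ?thesis by (simp add: typelen_def pushl_def col_def)
next
 case True
 have fin: "finite (cE H)" "finite W" using wf_fin[OF wf] tc by (auto simp: tcov_def rtree_def)
 let ?F = "{f:cE H. lab f = SE e}"
 let ?P = "{f:?F. 0 < m f}"
 have lV: "lo H up f : cV H" if "f : cE H" for f using wf_ends[OF wf that] by (simp add: lo_def)
 have W: "ka (lo H up f) : W - {rt}" if "f : ?P" for f
  using that tc lV by (auto simp: tcov_def tmap_def)
 have "typelen G H lab ka m up el e = (SUM f:?F. el (ka (lo H up f)) / real (m f))" using True by (simp add: typelen_def pushl_def)
 also have "... = (SUM f:?P. el (ka (lo H up f)) / real (m f))"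
  by (rule sum.mono_neutral_right) (use fin in auto)
 also have "... = (SUM j:W - {rt}. SUM f:{f:?P. ka (lo H up f) = j}. el (ka (lo H up f)) / real (m f))"
  by (rule sum.group[symmetric]) (use fin W in auto)
 also have "... = (SUM j:W - {rt}. el j * col G H lab ka m up j e)"
 proof (rule sum.cong[OF refl])
  fix j
  have "col G H lab ka m up j e = (SUM f:{f:?P. ka (lo H up f) = j}. 1 / real (m f))"
   unfolding col_def using True fin by (auto intro!: sum.mono_neutral_right)
  thus "(SUM f:{f:?P. ka (lo H up f) = j}. el (ka (lo H up f)) / real (m f)) = el j * col G H lab ka m up j e"
   by (simp add: sum_distrib_left)
 qed
 finally show ?thesis .
qed

lemma col_contract:
 assumes wf: "wf_graph H" and c: "c ~= j"
 shows "col G H lab (cka pa ka j) (csl H up ka m j) up c = col G H lab ka m up c"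
proof -
 have fin: "finite (cE H)" using wf_fin[OF wf] by simp
 have "(SUM f:{f:cE H. lab f = SE e & cka pa ka j (lo H up f) = c}. 1 / real (csl H up ka m j f))
   = (SUM f:{f:cE H. lab f = SE e & ka (lo H up f) = c}. 1 / real (m f))" for e
 proof -
  have "(SUM f:{f:cE H. lab f = SE e & ka (lo H up f) = c}. 1 / real (m f)) = (SUM f:{f:cE H. lab f = SE e & ka (lo H up f) = c}. 1 / real (csl H up ka m j f))"
   by (rule sum.cong) (use c in \<open>auto simp: csl_def\<close>)
  also have "... = (SUM f:{f:cE H. lab f = SE e & cka pa ka j (lo H up f) = c}. 1 / real (csl H up ka m j f))"
   by (rule sum.mono_neutral_left) (use fin c in \<open>auto simp: cka_def csl_def\<close>)
  finally show ?thesis by simp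
 qed
 thus ?thesis unfolding col_def by presburger
qed

lemma typelen_contract:
 assumes wf: "wf_graph H" and tc: "tcov a H W pa rt om LL ka m up" and j: "j : W" "j ~= rt" and z: "el j = 0"
 shows "typelen G H lab (cka pa ka j) (csl H up ka m j) up el = typelen G H lab ka m up el"
proof
 fix e
 have fin: "finite W" using tc by (auto simp: tcov_def rtree_def)
 have "typelen G H lab ka m up el e = (SUM i:W - {rt}. el i * col G H lab ka m up i e)" by (rule typelen_col[OF wf tc])
 also have "... = (SUM i:W - {j} - {rt}. el i * col G H lab ka m up i e)"
  by (rule sum.mono_neutral_right) (use fin z in auto)
 also have "... = (SUM i:W - {j} - {rt}. el i * col G H lab (cka pa ka j) (csl H up ka m j) up i e)"
  by (rule sum.cong) (use col_contract[OF wf] in auto)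
 also have "... = typelen G H lab (cka pa ka j) (csl H up ka m j) up el e"
  by (rule typelen_col[OF wf tcov_contract[OF wf tc j], symmetric])
 finally show "typelen G H lab (cka pa ka j) (csl H up ka m j) up el e = typelen G H lab ka m up el e" by simp
qed

text \<open>A tree edge of length 0 is contracted, which gives a smaller type with the same lengths
  on \<open>G\<close>. Hence the closed cone of every type lies in both loci.\<close>

lemma type_DR_closed:
 assumes wf: "wf_graph G" and L: "cL G = {1..n}" and sd: "subdiv G H lab vl" and nz: "ALL i:{1..n}. a i ~= 0"
 shows "tcov a H W pa rt om LL ka m up ==> ALL w:W - {rt}. 0 <= el w ==> DR n a (curve_of G (typelen G H lab ka m up el))
   & PD n a (curve_of G (typelen G H lab ka m up el))"
proof (induction "card W" arbitrary: W pa om LL ka m rule: less_induct)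
 case less
 have wfH: "wf_graph H" using subdiv_inv[OF sd wf] by blast
 show ?case
 proof (cases "ALL w:W - {rt}. 0 < el w")
  case True
  thus ?thesis using type_DR[OF wf L sd less.prems(1) True nz] type_PD[OF wf L sd less.prems(1) True nz] by blast
 next
  case False
  then obtain j where j: "j : W" "j ~= rt" "el j = 0" using less.prems(2) by force
  have fin: "finite W" using less.prems(1) by (auto simp: tcov_def rtree_def)
  have "card (W - {j}) < card W" using j fin by (intro psubset_card_mono) auto
  from less.hyps[OF this tcov_contract[OF wfH less.prems(1) j(1,2)]] less.prems(2)
  show ?thesis unfolding typelen_contract[where el = el, OF wfH less.prems(1) j] by blast
 qed
qed

section \<open>Bounding the number of tree edges\<close>

locale covtype =
 fixes a :: "nat => int" and G H :: tcurve and lab :: "nat => seg" and vl :: "nat => seg option"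
  and W pa rt om LL ka m up
 assumes wf: "wf_graph G" and stab: "ALL v:cV G. 3 <= 2 * cwt G v + gval G v" and sd: "subdiv G H lab vl"
  and tc: "tcov a H W pa rt om LL ka m up" and nz: "ALL l:cL G. a l ~= 0"
begin

abbreviation "A y == {v:cV H. ka v = y}"
abbreviation "ch y == {c:W - {rt}. pa c = y}"
abbreviation "Lo K == {f:cE H. 0 < m f & lo H up f : K}"
abbreviation "Hi K == {f:cE H. 0 < m f & hi H up f : K}"
abbreviation "cl == col G H lab ka m up"

lemma wfH: "wf_graph H" using subdiv_inv[OF sd wf] by blast

lemma fin: "finite (cE H)" "finite (cV H)" "finite (cL H)" "finite W"
 using wf_fin[OF wfH] tc by (auto simp: tcov_def rtree_def)

lemma t: "rtree W pa rt om LL" using tc by (simp add: tcov_def)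

lemma vl_None: "v : cV H ==> vl v = None ==> vchi H v <= - 1"
 using subdiv_inv[OF sd wf] stab by (fastforce simp: vchi_def)

lemma vl_Some:
 assumes "v : cV H" "vl v = Some s"
 shows "cwt H v = 0" "gval H v = 2" "vchi H v = 0"
  "f : cE H ==> fst (cends H f) = v | snd (cends H f) = v ==> lab f = s"
  "l : cL H ==> clegv H l = v ==> SL l = s"
proof -
 have *: "cwt H v = 0 & gval H v = 2 &
    (ALL f:cE H. fst (cends H f) = v | snd (cends H f) = v --> lab f = s) & (ALL l:cL H. clegv H l = v --> SL l = s)"
  using subdiv_inv[OF sd wf] assms by blast
 show "cwt H v = 0" "gval H v = 2" "vchi H v = 0" using * by (auto simp: vchi_def)
 show "f : cE H ==> fst (cends H f) = v | snd (cends H f) = v ==> lab f = s"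
  "l : cL H ==> clegv H l = v ==> SL l = s" using * by blast+
qed

lemma vchi_le: "v : cV H ==> vchi H v <= 0"
 by (cases "vl v") (use vl_None vl_Some(3) in force)+

lemma lhV: "f : cE H ==> lo H up f : cV H" "f : cE H ==> hi H up f : cV H"
 using wf_ends[OF wfH] by (auto simp: lo_def hi_def)

lemma tm0: "f : cE H ==> m f = 0 ==> ka (fst (cends H f)) = ka (snd (cends H f))"
 and tm1: "f : cE H ==> 0 < m f ==> ka (lo H up f) : W - {rt} & ka (hi H up f) = pa (ka (lo H up f))"
 and tmP: "l : cL H ==> 0 < a l ==> ka (clegv H l) = rt"
 and tmN: "l : cL H ==> a l < 0 ==> ka (clegv H l) = om"
 and tmW: "v : cV H ==> ka v : W"
 using tc lhV by (auto simp: tcov_def tmap_def)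

lemma satur_A: "satur H m (A y)"
 using tm0 wf_ends[OF wfH] by (auto simp: satur_def)

lemma bal: "satur H m K ==> tbal a H W pa rt om LL ka m up K"
 using tc by (simp add: tcov_def)

lemma RR_alt: "RR a H up m K = int (SUM f:Lo K. m f) + int (PLs a H K) - int (SUM f:Hi K. m f) - int (NLs a H K) - (SUM v:K. vchi H v)"
proof -
 have 1: "(SUM e:{e:cE H. lo H up e : K}. m e) = (SUM f:Lo K. m f)"
  by (rule sum.mono_neutral_right) (use fin in auto)
 have 2: "(SUM e:{e:cE H. hi H up e : K}. m e) = (SUM f:Hi K. m f)"
  by (rule sum.mono_neutral_right) (use fin in auto)
 show ?thesis unfolding RR_def 1 2 ..
qed

lemma UU_alt: "K <= A y ==> UU H up ka m y K = (SUM f:Lo K. m f)"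
 unfolding UU_def by (rule sum.mono_neutral_right) (use fin in auto)

lemma Hi_ch: "K <= A y ==> f : Hi K ==> ka (lo H up f) : ch y"
 using tm1[of f] by auto

lemma DD_alt: "K <= A y ==> ch y = {c} ==> DD H up ka m c K = (SUM f:Hi K. m f)"
proof -
 assume K: "K <= A y" and c: "ch y = {c}"
 have "ka (lo H up f) = c" if "f : Hi K" for f using Hi_ch[OF K that] unfolding c by simp
 thus ?thesis unfolding DD_def by (intro sum.mono_neutral_right) (use fin in auto)
qed

lemma PLs_0: "K <= A y ==> y ~= rt ==> PLs a H K = 0"
proof -
 assume "K <= A y" "y ~= rt"
 hence emp: "{l:cL H. 0 < a l & clegv H l : K} = {}" using tmP by auto
 show ?thesis unfolding PLs_def emp by simp
qed

lemma NLs_0: "K <= A y ==> y ~= om ==> NLs a H K = 0"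
proof -
 assume "K <= A y" "y ~= om"
 hence emp: "{l:cL H. a l < 0 & clegv H l : K} = {}" using tmN by auto
 show ?thesis unfolding NLs_def emp by simp
qed

lemma halfedges:
 assumes K: "satur H m K"
 shows "card {e:cE H. fst (cends H e) : K} + card {e:cE H. snd (cends H e) : K}
  = 2 * card {e:cE H. m e = 0 & fst (cends H e) : K} + card (Lo K) + card (Hi K)"
proof -
 let ?z = "{e:cE H. m e = 0 & fst (cends H e) : K}"
 let ?F = "{e:cE H. 0 < m e & fst (cends H e) : K}" and ?S = "{e:cE H. 0 < m e & snd (cends H e) : K}"
 have 1: "card {e:cE H. fst (cends H e) : K} = card ?z + card ?F"
  by (subst card_Un_disjoint[symmetric]) (use fin in \<open>auto intro!: arg_cong[of _ _ card]\<close>)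
 have 2: "card {e:cE H. snd (cends H e) : K} = card ?z + card ?S"
  by (subst card_Un_disjoint[symmetric]) (use fin K in \<open>auto simp: satur_def intro!: arg_cong[of _ _ card]\<close>)
 have c: "card X = (SUM e:cE H. if e : X then 1 else 0)" if "X <= cE H" for X
  using that fin by (simp add: Int_absorb1 flip: sum.inter_restrict)
 have "card ?F + card ?S = card (Lo K) + card (Hi K)"
  unfolding c[of ?F, simplified] c[of ?S, simplified] c[of "Lo K", simplified] c[of "Hi K", simplified] sum.distrib[symmetric] by (rule sum.cong) (auto simp: lo_def hi_def)
 thus ?thesis using 1 2 by simp
qed

text \<open>Stability makes the Euler characteristic of old vertices negative, while it is 0 at
  inserted ones; a vanishing sum leaves inserted vertices only.\<close>

lemma all_Some:
 assumes K: "K <= cV H" and z: "(SUM v:K. vchi H v) = 0" and v: "v : K"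
 shows "EX s. vl v = Some s"
proof (rule ccontr)
 assume "\<nexists>s. vl v = Some s"
 hence "vchi H v <= - 1" using vl_None v K by auto
 moreover have "finite K" using K fin finite_subset by blast
 moreover have "(SUM v:K - {v}. vchi H v) <= 0" using vchi_le K by (intro sum_nonpos) auto
 ultimately show False using z v sum.remove[of K v "vchi H"] by simp
qed

lemma vchi_sum_le: "K <= cV H ==> (SUM v:K. vchi H v) <= 0"
 using vchi_le by (intro sum_nonpos) auto

text \<open>Handshake count: inserted vertices are 2-valent, and a slope-0 edge that meets
  \<open>K\<close> lies inside \<open>K\<close> and is counted twice.\<close>

lemma Some_count:
 assumes K: "satur H m K" and z: "ALL v:K. EX s. vl v = Some s" and nl: "ALL l:cL H. clegv H l ~: K"
 shows "2 * card K = 2 * card {e:cE H. m e = 0 & fst (cends H e) : K} + card (Lo K) + card (Hi K)"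
proof -
 have KV: "K <= cV H" using K by (simp add: satur_def)
 have fK: "finite K" using KV fin finite_subset by blast
 have 1: "(SUM v:K. vchi H v) = 0" using z KV vl_Some(3) by (intro sum.neutral) blast
 have 2: "(SUM v:K. int (cwt H v)) = 0" using z KV vl_Some(1) by (intro sum.neutral ballI) force
 have e: "{l:cL H. clegv H l : K} = {}" using nl by auto
 show ?thesis using vchi_sum[OF wfH fK] halfedges[OF K] unfolding 1 2 e by simp
qed

lemma col_edge:
 assumes "j : W - {rt}" "cl j ~= (%_. 0)"
 obtains e f where "f : cE H" "0 < m f" "lab f = SE e" "ka (lo H up f) = j"
proof -
 obtain e where e: "cl j e ~= 0" using assms(2) by auto
 hence "e : cE G" "(SUM f:{f:cE H. lab f = SE e & ka (lo H up f) = j}. 1 / real (m f)) ~= 0"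
  by (auto simp: col_def split: if_splits)
 then obtain f where "f : {f:cE H. lab f = SE e & ka (lo H up f) = j}" "1 / real (m f) ~= 0"
  by (meson sum.neutral)
 thus ?thesis using that[of f e] by auto
qed

text \<open>Slope-0 edges between inserted vertices stay on one segment of \<open>G\<close>. So
  \<open>tbal\<close> applies to the part of a fibre on a single edge of \<open>G\<close>, and such
  a part has no legs.\<close>

lemma satur_lab:
 assumes z: "ALL v:A y. EX s. vl v = Some s"
 shows "satur H m {v:A y. vl v = Some s}"
 unfolding satur_def
proof (intro conjI ballI impI)
 fix f assume f: "f : cE H" "m f = 0"
 let ?u = "fst (cends H f)" and ?w = "snd (cends H f)"
 have V: "?u : cV H" "?w : cV H" using wf_ends[OF wfH f(1)] by auto
 have k: "ka ?u = ka ?w" using tm0[OF f] .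
 show "?u : {v:A y. vl v = Some s} <-> ?w : {v:A y. vl v = Some s}"
 proof (cases "ka ?u = y")
  case True
  hence "?u : A y" "?w : A y" using V k by auto
  then obtain s1 s2 where s: "vl ?u = Some s1" "vl ?w = Some s2" using z by blast
  have "lab f = s1" "lab f = s2" using vl_Some(4)[OF V(1) s(1) f(1)] vl_Some(4)[OF V(2) s(2) f(1)] by auto
  thus ?thesis using s V k by simp
 qed (use k in simp)
qed auto

lemma no_legs_lab: "K <= {v:A y. vl v = Some (SE e)} ==> l : cL H ==> clegv H l ~: K"
 using vl_Some(5) by blast

lemma ch_root: "card W >= 2 ==> ch y = {} ==> y ~= rt"
proof
 assume W: "card W >= 2" and c: "ch y = {}" and y: "y = rt"
 have "w = rt" if "w : W" for w
  by (rule rtree_root[OF t _ _ that]) (use c y in auto)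
 hence "W <= {rt}" by auto
 hence "card W <= 1" using card_mono[of "{rt}" W] by simp
 thus False using W by simp
qed

lemma col_Lo: "e : cE G ==> cl y e = (SUM f:{f:Lo (A y). lab f = SE e}. 1 / real (m f))"
 unfolding col_def using fin lhV by (auto intro!: sum.mono_neutral_right)

lemma col_Hi:
 assumes e: "e : cE G" and c: "ch y = {c}"
 shows "cl c e = (SUM f:{f:Hi (A y). lab f = SE e}. 1 / real (m f))"
proof -
 have "c : ch y" unfolding c by simp
 hence cy: "pa c = y" by simp
 have "ka (lo H up f) = c" if "f : Hi (A y)" for f using Hi_ch[OF subset_refl that] unfolding c by simp
 moreover have "f : Hi (A y)" if "f : cE H" "ka (lo H up f) = c" "0 < m f" for f using tm1[of f] lhV that cy by auto
 ultimately have eq: "{f:Hi (A y). lab f = SE e} = {f:{f:cE H. lab f = SE e & ka (lo H up f) = c}. 0 < m f}" by blast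
 have "(SUM f:{f:cE H. lab f = SE e & ka (lo H up f) = c}. 1 / real (m f))
  = (SUM f:{f:{f:cE H. lab f = SE e & ka (lo H up f) = c}. 0 < m f}. 1 / real (m f))"
  by (rule sum.mono_neutral_right) (use fin in auto)
 thus ?thesis unfolding col_def eq using e by simp
qed

text \<open>With at most two edges in all and equal sums of positive slopes, either both sides are
  empty or each consists of one edge, with the same slope.\<close>

lemma slope_count:
 assumes F: "finite X" "finite Y" "ALL f:X. 0 < m f" "ALL f:Y. 0 < m f" and s: "sum m X = sum m Y" and c: "card X + card Y <= 2"
  and l: "ALL f:X Un Y. lab f = s"
 shows "(SUM f:{f:X. lab f = u}. 1 / real (m f)) = (SUM f:{f:Y. lab f = u}. 1 / real (m f))"
proof -
 have e: "Z = {}" if "sum m Z = 0" "finite Z" "ALL f:Z. 0 < m f" for Z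
  using that by (metis all_not_in_conv not_less_zero sum_eq_0_iff)
 have *: "(SUM f:X. 1 / real (m f)) = (SUM f:Y. 1 / real (m f))"
 proof (cases "X = {} | Y = {}")
  case True
  hence "sum m X = 0 & sum m Y = 0" using s by (metis sum.empty)
  hence "X = {}" "Y = {}" using e F by blast+
  thus ?thesis by simp
 next
  case False
  hence "card X > 0" "card Y > 0" using F(1,2) by (simp_all add: card_gt_0_iff)
  hence "card X = 1" "card Y = 1" using c by linarith+
  then obtain x y where xy: "X = {x}" "Y = {y}" by (metis card_1_singletonE)
  hence "m x = m y" using s by simp
  thus ?thesis unfolding xy by simp
 qed
 show ?thesis
 proof (cases "u = s")
  case True
  hence e: "{f:X. lab f = u} = X" "{f:Y. lab f = u} = Y" using l by blast+
  show ?thesis unfolding e by (rule *)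
 next
  case False
  hence "{f:X. lab f = u} = {}" "{f:Y. lab f = u} = {}" using l by blast+
  thus ?thesis by metis
 qed
qed

text \<open>A slope-0 component of 2-valent vertices is connected, so a spanning tree leaves it at
  most two outer edges. Its defect is 0, which makes the slopes above and below have the same sum:
  one edge of \<open>G\<close> passes straight through, or nothing does.\<close>

lemma class_cols:
 assumes c: "ch y = {c}" and y: "y ~= rt" "y ~= om" and R: "RR a H up m (A y) = 0" and z: "ALL v:A y. EX s. vl v = Some s"
  and v: "v : A y" and K: "K = zcls H (%e. real (m e)) v"
 shows "(SUM f:{f:Lo K. lab f = u}. 1 / real (m f)) = (SUM f:{f:Hi K. lab f = u}. 1 / real (m f))"
proof -
 \<comment> \<open>With the slopes taken as lengths, \<open>zcls\<close> yields the components of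
   the slope-0 part.\<close>
 let ?ml = "%e. real (m e)"
 have zs: "zset H ?ml = {e:cE H. m e = 0}" by (auto simp: zset_def)
 obtain s where s: "vl v = Some s" using z v by blast
 have sat: "satur H m K"
  unfolding satur_def
 proof (intro conjI ballI impI)
  show "K <= cV H" unfolding K by (rule zcls_sub)
  fix f assume f: "f : cE H" "m f = 0"
  hence "zrep H ?ml (fst (cends H f)) = zrep H ?ml (snd (cends H f))" by (intro zedge_rep) (simp add: zs)
  thus "fst (cends H f) : K <-> snd (cends H f) : K"
   using zrep_eq_iff[OF wfH, of v "fst (cends H f)" ?ml] zrep_eq_iff[OF wfH, of v "snd (cends H f)" ?ml] wf_ends[OF wfH f(1)] v unfolding K by simp
 qed
 have KA: "K <= {v:A y. vl v = Some s}"
 proof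
  fix w assume "w : K"
  hence w: "(v, w) : (erel (cends H) (zset H ?ml))^*" by (simp add: K zcls_def)
  thus "w : {v:A y. vl v = Some s}"
  proof induction
   case base
   thus ?case using v s by simp
  next
   case (step p q)
   then obtain f where f: "f : cE H" "m f = 0" "cends H f = (p, q) | cends H f = (q, p)" by (auto simp: erel_def zs)
   have eq: "fst (cends H f) : {v:A y. vl v = Some s} <-> snd (cends H f) : {v:A y. vl v = Some s}"
    using satur_lab[OF z, of s] f(1,2) unfolding satur_def by blast
   from f(3) show ?case
   proof
    assume "cends H f = (p, q)"
    thus ?thesis using eq step(3) by (simp only: fst_conv snd_conv)
   next
    assume "cends H f = (q, p)"
    thus ?thesis using eq step(3) by (simp only: fst_conv snd_conv)
   qed
  qed
 qed
 hence KAy: "K <= A y" by blast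
 have nl: "ALL l:cL H. clegv H l ~: A y"
 proof
  fix l assume l: "l : cL H"
  hence "a l ~= 0" using nz subdiv_inv[OF sd wf] by simp
  thus "clegv H l ~: A y" using tmP[OF l] tmN[OF l] y by (cases "0 < a l") auto
 qed
 have fK: "finite K" unfolding K by (rule zcls_finite[OF wfH])
 have sat': "satur H m (A y - K)" using sat satur_A[of y] unfolding satur_def by blast
 \<comment> \<open>Both parts of the fibre have nonnegative defect, so the defect 0 of the whole
   passes to the component.\<close>
 have "RR a H up m (A y) = RR a H up m (A y - K) + RR a H up m K"
  using sum_points(5)[OF wfH, of "A y"] sum_points(5)[OF wfH, of "A y - K"] sum_points(5)[OF wfH fK] fin KAy sum.subset_diff[of K "A y" "%v. RR a H up m {v}"] by simp
 moreover have "0 <= RR a H up m K" "0 <= RR a H up m (A y - K)" using bal[OF sat] bal[OF sat'] by (auto simp: tbal_def)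
 ultimately have R0: "RR a H up m K = 0" using R by simp
 have zK: "ALL v:K. EX s. vl v = Some s" using KA by blast
 have ch0: "(SUM v:K. vchi H v) = 0" using zK KAy vl_Some(3) by (intro sum.neutral) blast
 have eq: "(SUM f:Lo K. m f) = (SUM f:Hi K. m f)"
  using R0 RR_alt[of K] PLs_0[OF KAy y(1)] NLs_0[OF KAy y(2)] ch0 by linarith
 have cnt: "2 * card K = 2 * card {e:cE H. m e = 0 & fst (cends H e) : K} + card (Lo K) + card (Hi K)"
  by (rule Some_count[OF sat zK]) (use nl KAy in blast)
 have "card K <= card {e:zset H ?ml. fst (cends H e) : K} + 1" unfolding K by (rule zcls_card[OF wfH]) (use v in simp)
 also have "{e:zset H ?ml. fst (cends H e) : K} = {e:cE H. m e = 0 & fst (cends H e) : K}" by (auto simp: zs)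
 finally have c2: "card (Lo K) + card (Hi K) <= 2" using cnt by linarith
 have lb: "lab f = s" if "f : Lo K Un Hi K" for f
 proof -
  have f: "f : cE H" "lo H up f : K | hi H up f : K" using that by auto
  then obtain w where w: "w : K" "fst (cends H f) = w | snd (cends H f) = w" by (auto simp: lo_def hi_def)
  hence "w : cV H" "vl w = Some s" using KA by auto
  thus ?thesis using vl_Some(4) f(1) w(2) by blast
 qed
 show ?thesis by (rule slope_count[OF _ _ _ _ eq c2, of s]) (use fin lb in auto)
qed

text \<open>Summed over the slope-0 components of the fibre: just above and just below
  \<open>y\<close> each edge of \<open>G\<close> has the same sum of reciprocal slopes.\<close>

lemma single_child_cols:
 assumes c: "ch y = {c}" and y: "y ~= rt" "y ~= om" and R: "RR a H up m (A y) = 0" and z: "ALL v:A y. EX s. vl v = Some s"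
 shows "cl y = cl c"
proof
 fix e
 let ?r = "zrep H (%e. real (m e))"
 show "cl y e = cl c e"
 proof (cases "e : cE G")
  case True
  have grp: "(SUM f:{f:{f:cE H. 0 < m f & P f : A y}. lab f = SE e}. 1 / real (m f))
    = (SUM r:?r ` A y. SUM f:{f:{f:cE H. 0 < m f & P f : zcls H (%e. real (m e)) r}. lab f = SE e}. 1 / real (m f))"
   if P: "ALL f:cE H. P f : cV H" for P
  proof -
   have "(SUM f:{f:{f:cE H. 0 < m f & P f : A y}. lab f = SE e}. 1 / real (m f))
    = (SUM r:?r ` A y. SUM f:{f:{f:{f:cE H. 0 < m f & P f : A y}. lab f = SE e}. ?r (P f) = r}. 1 / real (m f))"
    by (rule sum.group[symmetric]) (use fin in auto)
   also have "... = (SUM r:?r ` A y. SUM f:{f:{f:cE H. 0 < m f & P f : zcls H (%e. real (m e)) r}. lab f = SE e}. 1 / real (m f))"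
   proof (rule sum.cong[OF refl])
    fix r assume "r : ?r ` A y"
    then obtain v where v: "r = ?r v" "v : A y" by (rule imageE)
    have r: "r : ?r ` cV H" using v by auto
    have inA: "w : A y" if "w : cV H" "?r w = r" for w
    proof -
     have "w : zcls H (%e. real (m e)) v" using zrep_eq_iff[OF wfH _ that(1), of v "%e. real (m e)"] v that(2) by simp
     hence "(v, w) : (erel (cends H) (zset H (%e. real (m e))))^*" by (simp add: zcls_def)
     hence "ka v = ka w"
     proof induction
      case (step p q)
      then obtain f where f: "f : cE H" "m f = 0" "cends H f = (p, q) | cends H f = (q, p)" by (auto simp: erel_def zset_def)
      thus ?case using tm0[OF f(1,2)] step(3) by auto
     qed simp
     thus ?thesis using v that by simp
    qed
    have "{f:{f:{f:cE H. 0 < m f & P f : A y}. lab f = SE e}. ?r (P f) = r}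
     = {f:{f:cE H. 0 < m f & P f : zcls H (%e. real (m e)) r}. lab f = SE e}"
     unfolding zcls_rep[OF wfH r] using inA by auto
    thus "(SUM f:{f:{f:{f:cE H. 0 < m f & P f : A y}. lab f = SE e}. ?r (P f) = r}. 1 / real (m f))
     = (SUM f:{f:{f:cE H. 0 < m f & P f : zcls H (%e. real (m e)) r}. lab f = SE e}. 1 / real (m f))" by simp
   qed
   finally show ?thesis .
  qed
  have "cl y e = (SUM r:?r ` A y. SUM f:{f:Lo (zcls H (%e. real (m e)) r). lab f = SE e}. 1 / real (m f))"
   unfolding col_Lo[OF True] by (rule grp) (use lhV in auto)
  also have "... = (SUM r:?r ` A y. SUM f:{f:Hi (zcls H (%e. real (m e)) r). lab f = SE e}. 1 / real (m f))"
  proof (rule sum.cong[OF refl])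
   fix r assume "r : ?r ` A y"
   then obtain v where v: "r = ?r v" "v : A y" by (rule imageE)
   have "zcls H (%e. real (m e)) r = zcls H (%e. real (m e)) v" using zcls_zrep[OF wfH] v by simp
   thus "(SUM f:{f:Lo (zcls H (%e. real (m e)) r). lab f = SE e}. 1 / real (m f)) = (SUM f:{f:Hi (zcls H (%e. real (m e)) r). lab f = SE e}. 1 / real (m f))"
    using class_cols[OF c y R z v(2)] by simp
  qed
  also have "... = cl c e"
   unfolding col_Hi[OF True c] by (rule grp[symmetric]) (use lhV in auto)
  finally show ?thesis .
 qed (simp add: col_def)
qed

text \<open>If the bound failed, the fibre over \<open>y\<close> would consist of inserted vertices.
  A leaf other than \<open>om\<close> would then have an even, nonzero number of edges above it,
  hence defect at least 2 after all. At the leaf \<open>om\<close>, or at a root with one child, a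
  part of the fibre on one edge of \<open>G\<close> would need a leg. At any other vertex with one
  child two generators would coincide.\<close>

lemma vertex_bound:
 assumes W: "2 <= card W" and y: "y : W" and cnz: "ALL j:W - {rt}. cl j ~= (%_. 0)" and cinj: "inj_on cl (W - {rt})"
 shows "2 <= int (card (ch y)) + (if y = om then 1 else 0) + RR a H up m (A y)"
proof -
 have bA: "tbal a H W pa rt om LL ka m up (A y)" by (rule bal[OF satur_A])
 hence R0: "0 <= RR a H up m (A y)" and NA: "NLs a H (A y) = UT a H rt up ka m om (A y)" by (auto simp: tbal_def)
 have fch: "finite (ch y)" using fin by simp
 have vs: "(SUM v:A y. vchi H v) <= 0" by (rule vchi_sum_le) auto
 note RA = RR_alt[of "A y"]
 have UA: "UU H up ka m y (A y) = (SUM f:Lo (A y). m f)" by (rule UU_alt) simp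
 have Lopos: "0 < (SUM f:Lo K. m f)" if "f : Lo K" for f K using that fin by (intro sum_pos2[of _ f]) auto
 have Hipos: "0 < (SUM f:Hi K. m f)" if "f : Hi K" for f K using that fin by (intro sum_pos2[of _ f]) auto
 show ?thesis
 proof (cases "ch y = {}")
  case ch0: True
  have yr: "y ~= rt" by (rule ch_root[OF W ch0])
  obtain e f where f: "f : cE H" "0 < m f" "lab f = SE e" "ka (lo H up f) = y"
   by (rule col_edge[of y]) (use cnz y yr in auto)
  have fL: "f : Lo (A y)" using f lhV by auto
  have Hi0: "Hi (A y) = {}" using Hi_ch[of "A y" y] ch0 by blast
  have Hs: "(SUM f:Hi (A y). m f) = 0" unfolding Hi0 by simp
  have P0: "PLs a H (A y) = 0" by (rule PLs_0[of _ y]) (use yr in auto)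
  show ?thesis
  proof (cases "y = om")
   case yw: False
   have N0: "NLs a H (A y) = 0" by (rule NLs_0[of _ y]) (use yw in auto)
   have R: "RR a H up m (A y) = int (SUM f:Lo (A y). m f) - (SUM v:A y. vchi H v)" using RA Hs P0 N0 by linarith
   show ?thesis
   proof (cases "(SUM v:A y. vchi H v) = 0")
    case True
    have nl: "ALL l:cL H. clegv H l ~: A y"
    proof
     fix l assume l: "l : cL H"
     hence "a l ~= 0" using nz subdiv_inv[OF sd wf] by simp
     thus "clegv H l ~: A y" using tmP[OF l] tmN[OF l] yr yw by (cases "0 < a l") auto
    qed
    have "ALL v:A y. EX s. vl v = Some s" using all_Some[of "A y"] True by auto
    hence cnt: "2 * card (A y) = 2 * card {e:cE H. m e = 0 & fst (cends H e) : A y} + card (Lo (A y)) + card (Hi (A y))"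
     by (rule Some_count[OF satur_A _ nl])
    have hc: "card (Hi (A y)) = 0" unfolding Hi0 by simp
    have fLo: "finite (Lo (A y))" using fin(1) by simp
    have lc: "card (Lo (A y)) ~= 0" unfolding card_eq_0_iff using fL fLo by blast
    have parity: "2 * x = 2 * z + b + c ==> c = 0 ==> b ~= 0 ==> 2 <= b" for x z b c :: nat by presburger
    have "2 <= card (Lo (A y))" by (rule parity[OF cnt hc lc])
    moreover have "card (Lo (A y)) <= (SUM f:Lo (A y). m f)" using sum_mono[of "Lo (A y)" "%_. 1" m] by simp
    ultimately show ?thesis unfolding if_not_P[OF yw] using R True by linarith
   next
    case F: False
    thus ?thesis unfolding if_not_P[OF yw] using R vs Lopos[OF fL] by linarith
   qed
  next
   case yw: True
   have "RR a H up m (A y) ~= 0"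
   proof
    assume 0: "RR a H up m (A y) = 0"
    have "UT a H rt up ka m om (A y) = (SUM f:Lo (A y). m f)" using UA yw yr by (simp add: UT_def)
    hence "(SUM v:A y. vchi H v) = 0" using 0 RA Hs P0 NA by linarith
    hence z: "ALL v:A y. EX s. vl v = Some s" using all_Some[of "A y"] by auto
    \<comment> \<open>The part of the fibre on the edge \<open>e\<close> of \<open>G\<close> has
      positive slope upwards, but no leg of negative degree to balance it.\<close>
    let ?K = "{v:A y. vl v = Some (SE e)}"
    have "lo H up f : A y" using fL by simp
    then obtain s where s: "vl (lo H up f) = Some s" using z by blast
    have "lab f = s" by (rule vl_Some(4)[OF _ s]) (use f lhV in \<open>auto simp: lo_def\<close>)
    hence fK: "f : Lo ?K" using s f fL by simp
    have "NLs a H ?K = UT a H rt up ka m om ?K" using bal[OF satur_lab[OF z]] by (simp add: tbal_def)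
    moreover have "UU H up ka m y ?K = (SUM f:Lo ?K. m f)" by (rule UU_alt) auto
    ultimately have "0 < NLs a H ?K" using Lopos[OF fK] yw by (simp add: UT_def)
    moreover have emp: "{l:cL H. a l < 0 & clegv H l : ?K} = {}" using no_legs_lab[of ?K y e] by auto
    have "NLs a H ?K = 0" unfolding NLs_def emp by simp
    ultimately show False by simp
   qed
   thus ?thesis unfolding if_P[OF yw] using R0 by linarith
  qed
 next
  case False
  hence "0 < card (ch y)" unfolding card_gt_0_iff using fch by blast
  hence c1: "1 <= card (ch y)" by linarith
  show ?thesis
  proof (cases "card (ch y) = 1 & y ~= om")
   case nk: False
   show ?thesis
   proof (cases "y = om")
    case yw: True
    show ?thesis unfolding if_P[OF yw] using c1 R0 by linarith
   next
    case yw: False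
    hence "card (ch y) ~= 1" using nk by blast
    thus ?thesis unfolding if_not_P[OF yw] using c1 R0 by linarith
   qed
  next
   case True
   hence k: "card (ch y) = 1" by (rule conjunct1)
   obtain c where c: "ch y = {c}" by (rule card_1_singletonE[OF k])
   have "c : ch y" unfolding c by (rule singletonI)
   hence cW: "c : W - {rt}" "pa c = y" by simp_all
   have yw: "y ~= om" using True by simp
   have N0: "NLs a H K = 0" if "K <= A y" for K by (rule NLs_0[OF that yw])
   have "RR a H up m (A y) ~= 0"
   proof
    assume 0: "RR a H up m (A y) = 0"
    have DA: "DD H up ka m c (A y) = (SUM f:Hi (A y). m f)" by (rule DD_alt[OF _ c]) simp
    have le: "DD H up ka m c K <= UT a H rt up ka m y K" if "satur H m K" for K
     using bal[OF that] cW by (auto simp: tbal_def)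
    have "UT a H rt up ka m y (A y) = (SUM f:Lo (A y). m f) + PLs a H (A y)"
     using UA PLs_0[of "A y" y] by (auto simp: UT_def)
    hence "(SUM v:A y. vchi H v) = 0" using 0 RA N0[OF subset_refl] le[OF satur_A[of y]] DA vs by linarith
    hence z: "ALL v:A y. EX s. vl v = Some s" using all_Some[of "A y"] by auto
    show False
    proof (cases "y = rt")
     case yr: True
     obtain e f where f: "f : cE H" "0 < m f" "lab f = SE e" "ka (lo H up f) = c"
      by (rule col_edge[of c]) (use cnz cW in auto)
     have fH: "f : Hi (A y)" using f lhV tm1 cW by auto
     \<comment> \<open>Here the part on \<open>e\<close> has positive slope downwards, but no leg of
       positive degree over the root to feed it.\<close>
     let ?K = "{v:A y. vl v = Some (SE e)}"
     have "hi H up f : A y" using fH by simp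
     then obtain s where s: "vl (hi H up f) = Some s" using z by blast
     have "lab f = s" by (rule vl_Some(4)[OF _ s]) (use f lhV in \<open>auto simp: hi_def\<close>)
     hence fK: "f : Hi ?K" using s f fH by simp
     have "DD H up ka m c ?K = (SUM f:Hi ?K. m f)" by (rule DD_alt[OF _ c]) auto
     hence "0 < UT a H rt up ka m y ?K" using le[OF satur_lab[OF z], of "SE e"] Hipos[OF fK] by linarith
     moreover have emp: "{l:cL H. 0 < a l & clegv H l : ?K} = {}" using no_legs_lab[of ?K y e] by auto
     have "PLs a H ?K = 0" unfolding PLs_def emp by simp
     moreover have "UU H up ka m y ?K = 0"
     proof -
      have "m f = 0" if "f : cE H" "ka (lo H up f) = y" for f using tm1[OF that(1)] that(2) yr by (cases "m f = 0") auto
      thus ?thesis unfolding UU_def by (intro sum.neutral) blast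
     qed
     ultimately show False unfolding UT_def by (simp split: if_splits)
    next
     case yr: False
     have "cl y = cl c" by (rule single_child_cols[OF c yr yw 0 z])
     hence "y = c" using inj_onD[OF cinj] y yr cW(1) by blast
     thus False using rtree_pi[OF t, of c] cW by auto
    qed
   qed
   thus ?thesis unfolding if_not_P[OF yw] using R0 c1 by linarith
  qed
 qed
qed

text \<open>Summing \<open>vertex_bound\<close> over the tree: the children are the edges,
  \<open>om\<close> adds 1, and the total defect is minus the total Euler characteristic, because
  slopes cancel edge by edge and the legs have total degree 0.\<close>

lemma edge_bound:
 assumes L: "PLs a H (cV H) = NLs a H (cV H)" and g: "tgenus G = g" "1 <= g" and n: "card (cL G) = n" "2 <= n"
  and cnz: "ALL j:W - {rt}. cl j ~= (%_. 0)" and cinj: "inj_on cl (W - {rt})"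
 shows "int (card (W - {rt})) <= 2 * g + int n - 3"
proof (cases "2 <= card W")
 case False
 have "card (W - {rt}) = card W - 1" using t by (simp add: rtree_def)
 thus ?thesis using False g n by simp
next
 case True
 have inv: "tgenus H = g" "cL H = cL G" using subdiv_inv[OF sd wf] g by auto
 have r: "rt : W" "om : W" using t by (auto simp: rtree_def)
 have "2 * int (card W) = (SUM y:W. 2)" by simp
 also have "... <= (SUM y:W. int (card (ch y)) + (if y = om then 1 else 0) + RR a H up m (A y))"
  by (rule sum_mono) (use vertex_bound[OF True _ cnz cinj] in auto)
 also have "... = (SUM y:W. int (card (ch y))) + 1 + (SUM y:W. RR a H up m (A y))"
  using r fin by (simp add: sum.distrib)
 also have "(SUM y:W. int (card (ch y))) = int (card (W - {rt}))"
 proof -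
  have "(SUM y:W. card (ch y)) = card {c:W - {rt}. pa c : W}" by (rule card_fibers) (use fin in auto)
  also have "{c:W - {rt}. pa c : W} = W - {rt}" using rtree_pi[OF t] by auto
  finally have e: "(SUM y:W. card (ch y)) = card (W - {rt})" .
  show ?thesis unfolding e[symmetric] by (rule of_nat_sum[symmetric])
 qed
 also have "(SUM y:W. RR a H up m (A y)) = RR a H up m (cV H)"
 proof -
  have "RR a H up m (cV H) = (SUM v:cV H. RR a H up m {v})" using sum_points(5)[OF wfH fin(2)] .
  also have "... = (SUM y:W. SUM v:A y. RR a H up m {v})"
   by (rule sum.group[symmetric]) (use fin tmW in auto)
  also have "... = (SUM y:W. RR a H up m (A y))"
   by (rule sum.cong[OF refl], rule sum_points(5)[OF wfH, symmetric]) (use fin in auto)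
  finally show ?thesis by (rule sym)
 qed
 also have "RR a H up m (cV H) = 2 * g - 2 + int n"
 proof -
  have "Lo (cV H) = Hi (cV H)" using lhV by blast
  hence "(SUM f:Lo (cV H). m f) = (SUM f:Hi (cV H). m f)" by (rule arg_cong)
  hence R: "RR a H up m (cV H) = - (SUM v:cV H. vchi H v)" using RR_alt[of "cV H"] L by linarith
  have e: "{e:cE H. fst (cends H e) : cV H} = cE H" "{e:cE H. snd (cends H e) : cV H} = cE H" "{l:cL H. clegv H l : cV H} = cL H"
   using wf_ends[OF wfH] wf_legv[OF wfH] by auto
  show ?thesis unfolding R vchi_sum[OF wfH fin(2)] e using inv n by (simp add: tgenus_def)
 qed
 finally have "2 * int (card W) <= int (card (W - {rt})) + 1 + (2 * g - 2 + int n)" .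
 moreover have "int (card W) = int (card (W - {rt})) + 1" using card.remove[OF fin(4) r(1)] by simp
 ultimately show ?thesis by linarith
qed

text \<open>The total slope over a tree edge never grows on the way down from the root, where it is
  the total positive degree.\<close>

lemma degree_bound:
 assumes "w : W"
 shows "UT a H rt up ka m w (cV H) <= PLs a H (cV H)"
proof (rule rtree_root[OF t _ _ assms])
 have "m f = 0" if "f : cE H" "ka (lo H up f) = rt" for f using tm1[of f] that by auto
 hence "UU H up ka m rt (cV H) = 0" unfolding UU_def by simp
 thus "UT a H rt up ka m rt (cV H) <= PLs a H (cV H)" by (simp add: UT_def)
next
 fix w assume w: "w : W" "w ~= rt" and IH: "UT a H rt up ka m (pa w) (cV H) <= PLs a H (cV H)"
 have "{e:cE H. ka (lo H up e) = w & lo H up e : cV H} = {e:cE H. ka (lo H up e) = w & hi H up e : cV H}" using lhV by blast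
 hence "UT a H rt up ka m w (cV H) = DD H up ka m w (cV H)"
  using w unfolding UT_def UU_def DD_def by presburger
 also have "... <= UT a H rt up ka m (pa w) (cV H)"
 proof -
  have "satur H m (cV H)" using wf_ends[OF wfH] by (auto simp: satur_def)
  thus ?thesis using bal[of "cV H"] w by (auto simp: tbal_def)
 qed
 finally show "UT a H rt up ka m w (cV H) <= PLs a H (cV H)" using IH by simp
qed

text \<open>At most \<open>d\<close> edges lie over a tree edge and their slopes are at most
  \<open>d\<close>, so each reciprocal is a multiple of \<open>1 / fact d\<close>. This leaves
  finitely many generators, whatever the subdivision.\<close>

lemma col_values:
 assumes j: "j : W - {rt}" and d: "PLs a H (cV H) <= d"
 shows "EX p<=d * fact d. cl j e = real p / real (fact d)"
proof (cases "e : cE G")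
 case False
 thus ?thesis by (intro exI[of _ 0]) (simp add: col_def)
next
 case True
 let ?X = "{f:Lo (A j). lab f = SE e}"
 have fX: "finite ?X" using fin by simp
 have "UU H up ka m j (cV H) = (SUM f:Lo (A j). m f)"
  unfolding UU_def by (rule sum.mono_neutral_right) (use fin in auto)
 hence s: "(SUM f:Lo (A j). m f) <= d" using degree_bound[of j] j d by (simp add: UT_def)
 have md: "m f <= d" if "f : ?X" for f
  using member_le_sum[of f "Lo (A j)" m] that s fin by simp
 have "card (Lo (A j)) <= (SUM f:Lo (A j). m f)" using sum_mono[of "Lo (A j)" "%_. 1" m] by simp
 moreover have "card ?X <= card (Lo (A j))" using fin by (intro card_mono) auto
 ultimately have cX: "card ?X <= d" using s by linarith
 have q: "1 / real (m f) = real (fact d div m f) / real (fact d)" if "f : ?X" for f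
 proof -
  have dv: "m f dvd fact d" by (rule dvd_fact) (use that md[OF that] in auto)
  have "m f > 0" using that by simp
  thus ?thesis using dv by (simp add: real_of_nat_div)
 qed
 have "cl j e = (SUM f:?X. 1 / real (m f))" by (rule col_Lo[OF True])
 also have "... = (SUM f:?X. real (fact d div m f) / real (fact d))" by (rule sum.cong[OF refl]) (rule q)
 also have "... = real (SUM f:?X. fact d div m f) / real (fact d)" by (simp add: sum_divide_distrib)
 finally have "cl j e = real (SUM f:?X. fact d div m f) / real (fact d)" .
 moreover have "(SUM f:?X. fact d div m f) <= card ?X * fact d"
  using sum_bounded_above[of ?X "%f. fact d div m f" "fact d"] by simp
 hence "(SUM f:?X. fact d div m f) <= d * fact d" using cX by (meson dual_order.trans mult_le_mono1)
 ultimately show ?thesis by blast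
qed

end

text \<open>A tree edge with zero vector may be given length 0, and of two edges with equal vectors
  one can hand its length to the other. Either way some edge gets length 0 and is contracted,
  without changing the lengths on \<open>G\<close>.\<close>

lemma reduced_type:
 assumes wf: "wf_graph H"
 shows "tcov a H W pa rt om LL ka m up ==> ALL w:W - {rt}. 0 <= el w ==>
  EX W' pa' om' LL' ka' m' el'. tcov a H W' pa' rt om' LL' ka' m' up & (ALL w:W' - {rt}. 0 <= el' w) &
   typelen G H lab ka' m' up el' = typelen G H lab ka m up el &
   (ALL j:W' - {rt}. col G H lab ka' m' up j ~= (%_. 0)) & inj_on (col G H lab ka' m' up) (W' - {rt})"
proof (induction "card W" arbitrary: W pa om LL ka m el rule: less_induct)
 case less
 let ?c = "col G H lab ka m up"
 have fin: "finite W" using less.prems(1) by (auto simp: tcov_def rtree_def)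
 note tl = typelen_col[OF wf less.prems(1)]
 have red: ?case if j: "j : W" "j ~= rt" and el': "el' j = 0" "ALL w:W - {rt}. 0 <= el' w"
  and eq: "typelen G H lab ka m up el' = typelen G H lab ka m up el" for j el'
 proof -
  have "card (W - {j}) < card W" using j fin by (intro psubset_card_mono) auto
  from less.hyps[OF this tcov_contract[OF wf less.prems(1) j], of el'] el'
  show ?thesis unfolding typelen_contract[where el = el', OF wf less.prems(1) j el'(1)] eq by blast
 qed
 consider j where "j : W - {rt}" "?c j = (%_. 0)" | i j where "i : W - {rt}" "j : W - {rt}" "i ~= j" "?c i = ?c j"
  | "(ALL j:W - {rt}. ?c j ~= (%_. 0)) & inj_on ?c (W - {rt})" unfolding inj_on_def by blast
 thus ?case
 proof cases
  case 1
  show ?thesis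
  proof (rule red[of j "el(j := 0)"])
   show "typelen G H lab ka m up (el(j := 0)) = typelen G H lab ka m up el"
    unfolding tl fun_eq_iff
   proof (intro allI sum.cong[OF refl])
    fix e k
    show "(el(j := 0)) k * ?c k e = el k * ?c k e" using 1 by (cases "k = j") auto
   qed
  qed (use 1 less.prems(2) in auto)
 next
  case 2
  let ?e = "el(i := el i + el j, j := 0)"
  show ?thesis
  proof (rule red[of j ?e])
   have f: "finite (W - {rt} - {j})" using fin by simp
   have i: "i : W - {rt} - {j}" using 2 by auto
   have "(SUM k:W - {rt}. ?e k * ?c k e) = (SUM k:W - {rt}. el k * ?c k e)" for e
   proof -
    have s: "(SUM k:W - {rt}. F k) = F j + (F i + (SUM k:W - {rt} - {j} - {i}. F k))" for F :: "nat => real"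
     using sum.remove[of "W - {rt}" j F] sum.remove[OF f i, of F] fin 2 by simp
    have "(SUM k:W - {rt} - {j} - {i}. ?e k * ?c k e) = (SUM k:W - {rt} - {j} - {i}. el k * ?c k e)" by (rule sum.cong) auto
    thus ?thesis unfolding s using 2 by (simp add: algebra_simps)
   qed
   thus "typelen G H lab ka m up ?e = typelen G H lab ka m up el"
    unfolding tl by simp
  qed (use 2 less.prems(2) in auto)
 next
  case 3
  thus ?thesis using less.prems by blast
 qed
qed

definition gcone :: "(nat => real) set => (nat => real) set" where
 "gcone M = {%e. SUM q:M. c q * q e | c. ALL q:M. 0 <= c q}"

definition gens :: "nat set => nat => (nat => real) set" where
 "gens E d = {q. ALL e. if e : E then EX p<=d * fact d. q e = real p / real (fact d) else q e = 0}"

lemma typelen_cone: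
 assumes "ALL w:W - {rt}. 0 <= (el w::real)" and wf: "wf_graph H" and tc: "tcov a H W pa rt om LL ka m up"
 shows "typelen G H lab ka m up el : cone G"
proof -
 have "0 <= col G H lab ka m up j e" for j e unfolding col_def by (auto intro!: sum_nonneg)
 hence "0 <= typelen G H lab ka m up el e" for e
  unfolding typelen_col[OF wf tc] using assms(1) by (intro sum_nonneg) auto
 moreover have "typelen G H lab ka m up el e = 0" if "e ~: cE G" for e using that by (simp add: typelen_def pushl_def)
 ultimately show ?thesis unfolding cone_def by blast
qed

text \<open>Stated point by point: each point of the locus lies in a cone inside the locus with few
  generators from \<open>gens\<close>. Finiteness of the union comes from that of
  \<open>gens\<close>, not from a count of types.\<close>

theorem DR_generators:
 assumes st: "stable_graph g n G" and g: "1 <= g" and n: "2 <= n" and nz0: "ALL i:{1..n}. a i ~= 0" and s0: "(SUM i=1..n. a i) = 0"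
  and ll: "ll : preimage_in G (DR n a)"
 shows "ll : preimage_in G (PD n a) & (EX M. M <= gens (cE G) (SUM i:{i:{1..n}. 0 < a i}. nat (a i)) & card M <= 2 * g + n - 3 & ll : gcone M &
   gcone M <= preimage_in G (DR n a))"
proof -
 have wf: "wf_graph G" and L: "cL G = {1..n}" and tg: "tgenus G = int g" and stv: "ALL v:cV G. 3 <= 2 * cwt G v + gval G v"
  using st by (auto simp: stable_graph_def)
 have cn: "ALL e:cE G. 0 <= ll e" "ALL e. e ~: cE G --> ll e = 0" and dr: "DR n a (curve_of G ll)"
  using ll by (auto simp: preimage_in_def cone_def)
 obtain H lab vl W0 pa0 rt om0 LL0 ka0 m0 up el0 where sd: "subdiv G H lab vl" and tc0: "tcov a H W0 pa0 rt om0 LL0 ka0 m0 up"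
  and el0: "ALL w:W0 - {rt}. 0 < (el0 w::real)"
  and l0: "ALL e:cE G. ll e = (SUM f:{f:cE H. lab f = SE e}. el0 (ka0 (lo H up f)) / real (m0 f))"
  using DR_imp_type[OF wf L nz0 cn(1) dr] by (elim exE conjE) (rule that)
 have wfH: "wf_graph H" and LH: "cL H = {1..n}" using subdiv_inv[OF sd wf] L by auto
 have ll0: "ll = typelen G H lab ka0 m0 up el0"
  using l0 cn(2) by (auto simp: typelen_def pushl_def)
 have el0': "ALL w:W0 - {rt}. 0 <= el0 w" using el0 by (auto intro: less_imp_le)
 have pd: "ll : preimage_in G (PD n a)"
  using type_DR_closed[OF wf L sd nz0 tc0 el0'] ll unfolding ll0 by (simp add: preimage_in_def)
 obtain W pa om LL ka m el where tc: "tcov a H W pa rt om LL ka m up" and el: "ALL w:W - {rt}. 0 <= el w"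
  and le: "typelen G H lab ka m up el = typelen G H lab ka0 m0 up el0"
  and cnz: "ALL j:W - {rt}. col G H lab ka m up j ~= (%_. 0)" and cinj: "inj_on (col G H lab ka m up) (W - {rt})"
  using reduced_type[OF wfH tc0 el0', of G lab] by (elim exE conjE) (rule that)
 interpret covtype a G H lab vl W pa rt om LL ka m up by unfold_locales (use wf stv sd tc nz0 L in auto)
 let ?M = "cl ` (W - {rt})" and ?d = "SUM i:{i:{1..n}. 0 < a i}. nat (a i)"
 have P: "PLs a H (cV H) = ?d"
  unfolding PLs_def using wf_legv[OF wfH] LH by (intro sum.cong) auto
 have N: "NLs a H (cV H) = (SUM i:{i:{1..n}. a i < 0}. nat (- a i))"
  unfolding NLs_def using wf_legv[OF wfH] LH by (intro sum.cong) auto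
 have "int ?d - int (SUM i:{i:{1..n}. a i < 0}. nat (- a i)) = (SUM i=1..n. a i)"
 proof -
  have "int ?d = (SUM i=1..n. if 0 < a i then a i else 0)"
   unfolding sum.inter_filter[OF finite_atLeastAtMost, symmetric] by simp
  moreover have "int (SUM i:{i:{1..n}. a i < 0}. nat (- a i)) = (SUM i=1..n. if a i < 0 then - a i else 0)"
   unfolding sum.inter_filter[OF finite_atLeastAtMost, symmetric] by simp
  ultimately show ?thesis by (auto simp flip: sum_subtractf intro!: sum.cong)
 qed
 hence PN: "PLs a H (cV H) = NLs a H (cV H)" using s0 P N by linarith
 have cL: "card (cL G) = n" using L by simp
 have "int (card (W - {rt})) <= 2 * int g + int n - 3"
  by (rule edge_bound[OF PN tg _ cL n cnz cinj]) (use g in simp)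
 moreover have "card ?M <= card (W - {rt})" using fin by (intro card_image_le) auto
 ultimately have cM: "card ?M <= 2 * g + n - 3" by linarith
 have Q: "?M <= gens (cE G) ?d"
 proof
  fix q assume "q : ?M"
  then obtain j where j: "q = cl j" "j : W - {rt}" by (rule imageE)
  show "q : gens (cE G) ?d" unfolding gens_def
  proof (clarify)
   fix e
   show "if e : cE G then EX p<=?d * fact ?d. q e = real p / real (fact ?d) else q e = 0"
    using col_values[OF j(2) eq_refl[OF P], of e] unfolding j(1) by (auto simp: col_def)
  qed
 qed
 have re: "(SUM q:?M. c q * q e) = typelen G H lab ka m up (%j. c (cl j)) e" for c e
  unfolding typelen_col[OF wfH tc] sum.reindex[OF cinj] by simp
 have gm: "ll : gcone ?M"
 proof -
  \<comment> \<open>The coefficients of \<open>gcone\<close> are indexed by vectors; injectivity of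
    \<open>cl\<close> translates the tree lengths.\<close>
  define c where "c q = el (the_inv_into (W - {rt}) cl q)" for q
  have cc: "c (cl j) = el j" if "j : W - {rt}" for j using the_inv_into_f_f[OF cinj that] by (simp add: c_def)
  have "ll e = (SUM q:?M. c q * q e)" for e
   unfolding re ll0 le[symmetric] typelen_col[OF wfH tc] by (rule sum.cong) (use cc in auto)
  moreover have "ALL q:?M. 0 <= c q" using cc el by auto
  ultimately show ?thesis unfolding gcone_def by blast
 qed
 have "gcone ?M <= preimage_in G (DR n a)"
 proof
  fix l assume "l : gcone ?M"
  then obtain c where c: "l = (%e. SUM q:?M. c q * q e)" "ALL q:?M. 0 <= c q" unfolding gcone_def by blast
  have l: "l = typelen G H lab ka m up (%j. c (cl j))" using c(1) re by auto
  have nn: "ALL w:W - {rt}. 0 <= c (cl w)" using c(2) by auto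
  show "l : preimage_in G (DR n a)"
   unfolding l preimage_in_def using type_DR_closed[OF wf L sd nz0 tc nn] typelen_cone[OF nn wfH tc] by blast
 qed
 thus ?thesis using pd Q cM gm by blast
qed

section \<open>Finitely generated cones\<close>

lemma gcone_empty: "gcone {} = {%_. 0}"
 by (auto simp: gcone_def)

lemma gcone_insert:
 assumes "finite M" "q ~: M"
 shows "y : gcone (insert q M) <-> (EX t>=0. (%e. y e - t * q e) : gcone M)"
proof
 assume "y : gcone (insert q M)"
 then obtain c where c: "y = (%e. SUM p:insert q M. c p * p e)" "ALL p:insert q M. 0 <= c p" by (auto simp: gcone_def)
 have "(%e. y e - c q * q e) = (%e. SUM p:M. c p * p e)" using c(1) assms by auto
 thus "EX t>=0. (%e. y e - t * q e) : gcone M" using c(2) by (intro exI[of _ "c q"]) (auto simp: gcone_def)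
next
 assume "EX t>=0. (%e. y e - t * q e) : gcone M"
 then obtain t c where t: "0 <= t" and c: "(%e. y e - t * q e) = (%e. SUM p:M. c p * p e)" "ALL p:M. 0 <= c p"
  by (auto simp: gcone_def)
 have "y e = (SUM p:insert q M. (c(q := t)) p * p e)" for e
 proof -
  have "(SUM p:M. (c(q := t)) p * p e) = (SUM p:M. c p * p e)" using assms(2) by (intro sum.cong) auto
  thus ?thesis using fun_cong[OF c(1), of e] assms by simp
 qed
 thus "y : gcone (insert q M)" unfolding gcone_def using t c(2) by (intro CollectI exI[of _ "c(q := t)"]) auto
qed

text \<open>Eliminates a single unknown \<open>t\<close>. Its lower bound 0 pairs with the upper
  bounds to give the conditions on one constraint alone; the other lower bounds give those on
  pairs.\<close>

lemma fourier_motzkin: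
 fixes k b :: "'a => real"
 assumes A: "finite A"
 shows "(EX t>=0. ALL ap:A. t * k ap <= b ap) <->
  (ALL ap:A. 0 <= k ap --> 0 <= b ap) & (ALL ap:A. ALL bt:A. 0 < k ap & k bt < 0 --> 0 <= - k bt * b ap + k ap * b bt)"
  (is "?L <-> ?R")
proof
 assume ?L
 then obtain t where t: "0 <= t" "ALL ap:A. t * k ap <= b ap" by blast
 have "0 <= b ap" if "ap : A" "0 <= k ap" for ap     using order_trans[OF mult_nonneg_nonneg[OF t(1) that(2)]] t(2) that(1) by blast
 moreover have "0 <= - k bt * b ap + k ap * b bt" if "ap : A" "bt : A" "0 < k ap" "k bt < 0" for ap bt
 proof -
  have "- k bt * (t * k ap) <= - k bt * b ap" by (rule mult_left_mono) (use t that in auto)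
  moreover have "k ap * (t * k bt) <= k ap * b bt" by (rule mult_left_mono) (use t that in auto)
  ultimately show ?thesis by (simp add: algebra_simps)
 qed
 ultimately show ?R by blast
next
 assume R: ?R
 let ?T = "insert 0 ((%bt. b bt / k bt) ` {bt:A. k bt < 0})"
 \<comment> \<open>The least admissible value: the largest of 0 and the lower bounds from negative
   coefficients.\<close>
 define t where "t = Max ?T"
 have fT: "finite ?T" using A by simp
 have t0: "0 <= t" unfolding t_def by (rule Max_ge[OF fT]) simp
 have tT: "t : ?T" unfolding t_def by (rule Max_in[OF fT]) simp
 have "t * k ap <= b ap" if a: "ap : A" for ap
 proof -
  consider "k ap < 0" | "k ap = 0" | "0 < k ap" by linarith
  thus ?thesis
  proof cases
   case 1
   have "b ap / k ap <= t" unfolding t_def by (rule Max_ge[OF fT]) (use a 1 in auto)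
   thus ?thesis using 1 by (simp add: neg_divide_le_eq)
  next
   case 2
   thus ?thesis using R a by simp
  next
   case 3
   from tT consider "t = 0" | bt where "bt : A" "k bt < 0" "t = b bt / k bt" by auto
   thus ?thesis
   proof cases
    case 1
    thus ?thesis using R a 3 by auto
   next
    case 2
    hence "0 <= - k bt * b ap + k ap * b bt" using R a 3 by blast
    hence "b bt * k ap / k bt <= b ap" using 2(2) by (simp add: neg_divide_le_eq algebra_simps)
    thus ?thesis using 2(3) by simp
   qed
  qed
 qed
 thus ?L using t0 by blast
qed

abbreviation dotp :: "nat set => (nat => int) => (nat => real) => real" where
 "dotp E ap x == SUM e:E. of_int (ap e) * x e"

text \<open>One generator is added at a time and its coefficient eliminated. The common denominator
  \<open>D\<close> keeps all constraints integral.\<close>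

lemma gcone_polyhedral:
 assumes E: "finite E" and D: "0 < D" and M: "finite M"
  and q: "ALL q:M. (ALL e. e ~: E --> q e = 0) & (EX p::nat => int. ALL e:E. q e = of_int (p e) / real D)"
 shows "EX A. finite A & gcone M = {x. (ALL e. e ~: E --> x e = 0) & (ALL ap:A. 0 <= dotp E ap x)}"
 using M q
proof (induction M)
 case empty
 let ?u = "%e e'. if e' = e then 1 else 0 :: int" and ?w = "%e e'. if e' = e then - 1 else 0 :: int"
 have d: "dotp E (?u e) x = x e" "dotp E (?w e) x = - x e" if "e : E" for e x
 proof -
  have "dotp E (?u e) x = (SUM e':E. if e' = e then x e' else 0)" by (rule sum.cong) auto
  thus "dotp E (?u e) x = x e" using E that by simp
  have "dotp E (?w e) x = (SUM e':E. if e' = e then - x e' else 0)" by (rule sum.cong) auto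
  thus "dotp E (?w e) x = - x e" using E that by simp
 qed
 have "x = (%_. 0)" if x: "ALL e. e ~: E --> x e = 0" "ALL ap:?u ` E Un ?w ` E. 0 <= dotp E ap x" for x
 proof
  fix e
  show "x e = 0"
  proof (cases "e : E")
   case True
   have "0 <= dotp E (?u e) x" by (rule bspec[OF x(2)]) (rule UnI1, rule imageI[OF True])
   moreover have "0 <= dotp E (?w e) x" by (rule bspec[OF x(2)]) (rule UnI2, rule imageI[OF True])
   ultimately have "0 <= x e" "0 <= - x e" unfolding d[OF True] .
   thus ?thesis by simp
  qed (use x(1) in simp)
 qed
 moreover have "0 <= dotp E ap (%_. 0)" for ap by simp
 ultimately have "gcone {} = {x. (ALL e. e ~: E --> x e = 0) & (ALL ap:?u ` E Un ?w ` E. 0 <= dotp E ap x)}"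
  unfolding gcone_empty by (intro set_eqI iffI) auto
 thus ?case using E by (intro exI[of _ "?u ` E Un ?w ` E"]) simp
next
 case (insert q M)
 then obtain A where A: "finite A" "gcone M = {x. (ALL e. e ~: E --> x e = 0) & (ALL ap:A. 0 <= dotp E ap x)}" by auto
 obtain p :: "nat => int" where q0: "ALL e. e ~: E --> q e = 0" and p: "ALL e:E. q e = of_int (p e) / real D"
  using insert.prems by auto
 define k where "k ap = (SUM e:E. ap e * p e)" for ap
 have kq: "dotp E ap q = of_int (k ap) / real D" for ap
  unfolding k_def using p by (simp add: sum_divide_distrib)
 have lin: "dotp E ap (%e. y e - t * q e) = dotp E ap y - t * dotp E ap q" for ap y t
  by (simp add: sum_subtractf sum_distrib_left algebra_simps)
 \<comment> \<open>The multipliers are the integers \<open>k\<close>; the true values at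
   \<open>q\<close> differ from them only by the positive factor \<open>1 / D\<close>.\<close>
 define cmb where "cmb ap bt e = - k bt * ap e + k ap * bt e" for ap bt e
 have cmb: "dotp E (cmb ap bt) y = - of_int (k bt) * dotp E ap y + of_int (k ap) * dotp E bt y" for ap bt y
  unfolding cmb_def by (simp add: sum_subtractf sum_negf sum_distrib_left algebra_simps)
 let ?B = "{ap:A. 0 <= k ap} Un (%(ap, bt). cmb ap bt) ` {(ap, bt). ap : A & bt : A & 0 < k ap & k bt < 0}"
 have "{(ap, bt). ap : A & bt : A & 0 < k ap & k bt < 0} <= A \<times> A" by auto
 hence "finite {(ap, bt). ap : A & bt : A & 0 < k ap & k bt < 0}" by (rule finite_subset) (use A(1) in simp)
 hence fB: "finite ?B" using A(1) by simp
 have "y : gcone (insert q M) <-> (ALL e. e ~: E --> y e = 0) & (ALL ap:?B. 0 <= dotp E ap y)" for y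
 proof -
  have "y : gcone (insert q M) <-> (EX t>=0. (%e. y e - t * q e) : gcone M)"
   by (rule gcone_insert[OF insert.hyps])
  also have "... <-> (ALL e. e ~: E --> y e = 0) & (EX t>=0. ALL ap:A. t * dotp E ap q <= dotp E ap y)"
   unfolding A(2) mem_Collect_eq lin using q0 by auto
  also have "(EX t>=0. ALL ap:A. t * dotp E ap q <= dotp E ap y) <->
    (ALL ap:A. 0 <= dotp E ap q --> 0 <= dotp E ap y) &
    (ALL ap:A. ALL bt:A. 0 < dotp E ap q & dotp E bt q < 0 --> 0 <= - dotp E bt q * dotp E ap y + dotp E ap q * dotp E bt y)"
   by (rule fourier_motzkin[OF A(1)])
  also have "... <-> (ALL ap:A. 0 <= k ap --> 0 <= dotp E ap y) &
    (ALL ap:A. ALL bt:A. 0 < k ap & k bt < 0 --> 0 <= dotp E (cmb ap bt) y)"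
  proof -
   have 1: "0 <= dotp E ap q <-> 0 <= k ap" "0 < dotp E ap q <-> 0 < k ap" "dotp E ap q < 0 <-> k ap < 0" for ap
    unfolding kq using D by (simp_all add: zero_le_divide_iff zero_less_divide_iff divide_less_0_iff)
   have 2: "0 <= - dotp E bt q * dotp E ap y + dotp E ap q * dotp E bt y <-> 0 <= dotp E (cmb ap bt) y" for ap bt
   proof -
    have "- dotp E bt q * dotp E ap y + dotp E ap q * dotp E bt y = dotp E (cmb ap bt) y / real D"
     unfolding kq cmb by (simp add: diff_divide_distrib)
    thus ?thesis using D by (simp add: zero_le_divide_iff)
   qed
   show ?thesis unfolding 1 2 ..
  qed
  also have "... <-> (ALL ap:?B. 0 <= dotp E ap y)"
  proof -
   have "((ALL ap:A. Q ap --> P ap) & (ALL ap:A. ALL bt:A. R ap bt --> P (cmb ap bt))) <->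
    (ALL ap:{ap:A. Q ap} Un (%(ap, bt). cmb ap bt) ` {(ap, bt). ap : A & bt : A & R ap bt}. P ap)" for P Q R by auto
   thus ?thesis .
  qed
  finally show ?thesis .
 qed
 thus ?case using fB by (intro exI[of _ ?B]) blast
qed

section \<open>Dimension of a finite union of finitely generated cones\<close>

lemma homogeneous_solution:
 fixes a :: "'i => 'j => real"
 assumes "finite J"
 shows "finite I ==> card J < card I ==> EX c. (EX i:I. c i ~= 0) & (ALL j:J. (SUM i:I. c i * a i j) = 0)"
 using assms
proof (induction J arbitrary: I a)
 case empty
 then obtain i where "i : I" by fastforce
 thus ?case by (intro exI[of _ "%_. 1"]) auto
next
 case (insert j J)
 have cI: "Suc (card J) < card I" using insert by simp
 show ?case
 proof (cases "ALL i:I. a i j = 0")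
  case True
  obtain c where "EX i:I. c i ~= 0" "ALL j:J. (SUM i:I. c i * a i j) = 0" using insert.IH[of I a] insert.prems cI by auto
  thus ?thesis using True by (intro exI[of _ c]) auto
 next
  case False
  then obtain i0 where i0: "i0 : I" "a i0 j ~= 0" by blast
  let ?I = "I - {i0}"
  have "finite ?I" "card J < card ?I" using insert.prems(1) cI i0 by auto
  from insert.IH[OF this, of "%i j'. a i j' - a i j / a i0 j * a i0 j'"]
  obtain c where c: "EX i:?I. c i ~= 0" "ALL j':J. (SUM i:?I. c i * (a i j' - a i j / a i0 j * a i0 j')) = 0" by auto
  define s where "s = (SUM i:?I. c i * a i j) / a i0 j"
  define c' where "c' = c(i0 := - s)"
  have sum': "(SUM i:I. c' i * a i j') = - s * a i0 j' + (SUM i:?I. c i * a i j')" for j'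
  proof -
   have "(SUM i:?I. c' i * a i j') = (SUM i:?I. c i * a i j')" by (rule sum.cong) (auto simp: c'_def)
   thus ?thesis using sum.remove[OF insert.prems(1) i0(1), of "%i. c' i * a i j'"] by (simp add: c'_def)
  qed
  have "(SUM i:I. c' i * a i j') = 0" if "j' : J" for j'
  proof -
   have "(SUM i:?I. c i * (a i j' - a i j / a i0 j * a i0 j')) = (SUM i:?I. c i * a i j') - (SUM i:?I. c i * a i j / a i0 j * a i0 j')"
    by (simp add: sum_subtractf right_diff_distrib mult.assoc)
   also have "(SUM i:?I. c i * a i j / a i0 j * a i0 j') = s * a i0 j'"
    unfolding s_def by (simp add: sum_divide_distrib sum_distrib_right)
   finally show ?thesis using c(2) that unfolding sum' by simp
  qed
  moreover have "(SUM i:I. c' i * a i j) = 0" unfolding sum' using i0 by (simp add: s_def)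
  moreover have "EX i:I. c' i ~= 0" using c(1) by (auto simp: c'_def)
  ultimately show ?thesis by blast
 qed
qed

lemma prod_expand:
 fixes B :: "nat set"
 assumes "finite B"
 shows "EX r. ALL x::real. (PROD b:B. x - real b) = (SUM i<=card B. r i * x ^ i)"
 using assms
proof induction
 case empty
 thus ?case by (intro exI[of _ "%_. 1"]) simp
next
 case (insert b B)
 then obtain r where r: "ALL x::real. (PROD b:B. x - real b) = (SUM i<=card B. r i * x ^ i)" by blast
 let ?n = "card B"
 define r' where "r' i = (if i = 0 then 0 else r (i - 1)) - real b * (if i <= ?n then r i else 0)" for i
 have "(PROD b:insert b B. x - real b) = (SUM i<=Suc ?n. r' i * x ^ i)" for x :: real
 proof -
  have "(PROD b:insert b B. x - real b) = x * (SUM i<=?n. r i * x ^ i) - real b * (SUM i<=?n. r i * x ^ i)"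
   using insert r by (simp add: algebra_simps)
  also have "x * (SUM i<=?n. r i * x ^ i) = (SUM i<=Suc ?n. (if i = 0 then 0 else r (i - 1)) * x ^ i)"
   by (subst sum.atMost_Suc_shift) (simp add: sum_distrib_left mult_ac)
  also have "real b * (SUM i<=?n. r i * x ^ i) = (SUM i<=Suc ?n. real b * (if i <= ?n then r i else 0) * x ^ i)"
   by (simp add: sum_distrib_left mult_ac)
  finally show ?thesis unfolding r'_def by (simp only: left_diff_distrib sum_subtractf)
 qed
 thus ?case using insert by auto
qed

text \<open>Points on the moment curve of a simplex: infinitely many of them lie in one of the cones, and
  \<open>N + 2\<close> of these satisfy an affine relation with at most \<open>N + 1\<close> conditions.\<close>

lemma not_dim_ge_gcones:
 assumes F: "finite F" "ALL M:F. finite M & card M <= N" and S: "S <= (UN M:F. gcone M)"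
 shows "~  dim_ge S (Suc N)"
proof
 let ?k = "Suc N"
 assume "dim_ge S ?k"
 then obtain p :: "nat => nat => real" where
  ind: "!!c::nat => real. (ALL e. (SUM i:{1..?k}. c i * (p i e - p 0 e)) = 0) ==> (ALL i:{1..?k}. c i = 0)" and
  cv: "!!w::nat => real. (ALL i<=?k. 0 <= w i) ==> (SUM i<=?k. w i) = 1 ==> (%e. SUM i<=?k. w i * p i e) : S"
  unfolding dim_ge_def by blast
 \<comment> \<open>Dividing by \<open>Z s\<close> turns the powers of \<open>s\<close> into
   barycentric weights of a point of the simplex.\<close>
 define Z where "Z s = (SUM i<=?k. real s ^ i)" for s :: nat
 have Z: "0 < Z s" for s
 proof -
  have "real s ^ 0 <= Z s" unfolding Z_def by (rule member_le_sum) auto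
  thus ?thesis by simp
 qed
 have ex: "EX M:F. (%e. SUM i<=?k. (real s ^ i / Z s) * p i e) : gcone M" for s
 proof -
  have "(SUM i<=?k. real s ^ i / Z s) = 1"
   unfolding sum_divide_distrib[symmetric] Z_def[symmetric] using Z[of s] by simp
  hence "(%e. SUM i<=?k. (real s ^ i / Z s) * p i e) : S" using Z[of s] by (intro cv) auto
  thus ?thesis using S by blast
 qed
 hence "ALL s. EX M. M : F & (%e. SUM i<=?k. (real s ^ i / Z s) * p i e) : gcone M" by blast
 from choice[OF this] obtain fM where fM: "!!s. fM s : F" "!!s. (%e. SUM i<=?k. (real s ^ i / Z s) * p i e) : gcone (fM s)"
  by blast
 have "fM ` UNIV <= F" using fM(1) by blast
 hence "finite (fM ` UNIV)" using F(1) by (rule finite_subset)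
 from pigeonhole_infinite[OF infinite_UNIV_nat this] obtain s0 where inf: "infinite {s : UNIV. fM s = fM s0}" by blast
 obtain T where T: "finite T" "card T = Suc (Suc N)" "T <= {s : UNIV. fM s = fM s0}"
  using infinite_arbitrarily_large[OF inf, of "Suc (Suc N)"] by blast
 let ?M = "fM s0"
 have M: "finite ?M" "card ?M <= N" using F(2) fM(1) by auto
 have "EX b. ALL e. (SUM i<=?k. real s ^ i * p i e) = (SUM q:?M. b q * q e)" if s: "s : T" for s
 proof -
  have "fM s = ?M" using T(3) s by blast
  hence "(%e. SUM i<=?k. (real s ^ i / Z s) * p i e) : gcone ?M" using fM(2)[of s] by (rule subst)
  then obtain c where c: "(%e. SUM i<=?k. (real s ^ i / Z s) * p i e) = (%e. SUM q:?M. c q * q e)" unfolding gcone_def by blast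
  have "(SUM i<=?k. real s ^ i * p i e) = (SUM q:?M. (Z s * c q) * q e)" for e
  proof -
   have "(SUM i<=?k. real s ^ i * p i e) = Z s * (SUM i<=?k. (real s ^ i / Z s) * p i e)"
    unfolding sum_distrib_left by (rule sum.cong[OF refl]) (use Z[of s] in simp)
   also have "... = (SUM q:?M. (Z s * c q) * q e)" unfolding fun_cong[OF c, of e] by (simp add: sum_distrib_left mult.assoc)
   finally show ?thesis .
  qed
  thus ?thesis by (intro exI[of _ "%q. Z s * c q"] allI)
 qed
 hence "ALL s:T. EX b. ALL e. (SUM i<=?k. real s ^ i * p i e) = (SUM q:?M. b q * q e)" by blast
 from bchoice[OF this] obtain b where b: "!!s e. s : T ==> (SUM i<=?k. real s ^ i * p i e) = (SUM q:?M. b s q * q e)" by blast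
 \<comment> \<open>One condition for each generator and, as \<open>None\<close>, one for the sum of
   the weights: at most \<open>N + 1\<close> conditions on \<open>N + 2\<close> unknowns.\<close>
 let ?J = "insert None (Some ` ?M)"
 have "card ?J <= Suc N" using M by (simp add: card_image)
 hence "card ?J < card T" using T by simp
 from homogeneous_solution[OF _ T(1) this, of "%s j. case j of None => Z s | Some q => b s q"] M
 obtain c where c: "EX s:T. c s ~= 0" and cz: "ALL j:?J. (SUM s:T. c s * (case j of None => Z s | Some q => b s q)) = 0" by auto
 have c0: "(SUM s:T. c s * Z s) = 0" using cz by auto
 have c1: "(SUM s:T. c s * b s q) = 0" if "q : ?M" for q using bspec[OF cz, of "Some q"] that by simp
 \<comment> \<open>The moments of the relation. They are the coefficients of an affine relation
   between the affinely independent corners, so all of them vanish up to degree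
   \<open>N + 1\<close>.\<close>
 define d where "d i = (SUM s:T. c s * real s ^ i)" for i
 have dsum: "(SUM i<=?k. d i) = 0"
 proof -
  have "(SUM i<=?k. d i) = (SUM s:T. SUM i<=?k. c s * real s ^ i)" unfolding d_def by (rule sum.swap)
  also have "... = (SUM s:T. c s * Z s)" unfolding Z_def sum_distrib_left ..
  finally show ?thesis using c0 by simp
 qed
 have dp: "(SUM i<=?k. d i * p i e) = 0" for e
 proof -
  have "(SUM i<=?k. d i * p i e) = (SUM i<=?k. SUM s:T. c s * real s ^ i * p i e)" unfolding d_def sum_distrib_right ..
  also have "... = (SUM s:T. SUM i<=?k. c s * real s ^ i * p i e)" by (rule sum.swap)
  also have "... = (SUM s:T. c s * (SUM i<=?k. real s ^ i * p i e))" by (simp only: sum_distrib_left mult.assoc)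
  also have "... = (SUM s:T. c s * (SUM q:?M. b s q * q e))" by (rule sum.cong) (use b in auto)
  also have "... = (SUM s:T. SUM q:?M. c s * b s q * q e)" by (simp only: sum_distrib_left mult.assoc)
  also have "... = (SUM q:?M. SUM s:T. c s * b s q * q e)" by (rule sum.swap)
  also have "... = (SUM q:?M. (SUM s:T. c s * b s q) * q e)" by (simp only: sum_distrib_right)
  also have "... = 0" using c1 by simp
  finally show ?thesis .
 qed
 have split: "(SUM i<=?k. f i) = f 0 + (SUM i:{1..?k}. f i)" for f :: "nat => real"
 proof -
  have "{..?k} = insert 0 {1..?k}" by auto
  thus ?thesis by simp
 qed
 have d1: "ALL i:{1..?k}. d i = 0"
 proof (rule ind, rule allI)
  fix e
  have "(SUM i:{1..?k}. d i * (p i e - p 0 e)) = (SUM i:{1..?k}. d i * p i e) - (SUM i:{1..?k}. d i) * p 0 e"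
   by (simp only: right_diff_distrib sum_subtractf sum_distrib_right)
  also have "... = 0"
  proof -
   have "(SUM i:{1..?k}. d i) = - d 0" "(SUM i:{1..?k}. d i * p i e) = - (d 0 * p 0 e)"
    using dp[of e] dsum unfolding split[of d] split[of "%i. d i * p i e"] by linarith+
   thus ?thesis by (simp only: mult_minus_left diff_self)
  qed
  finally show "(SUM i:{1..?k}. d i * (p i e - p 0 e)) = 0" .
 qed
 have d0: "d i = 0" if "i <= ?k" for i
 proof (cases "i = 0")
  case True
  have "(SUM i:{1..?k}. d i) = 0" using d1 by (intro sum.neutral) blast
  thus ?thesis using True dsum unfolding split[of d] by simp
 qed (use d1 that in auto)
 obtain s1 where s1: "s1 : T" "c s1 ~= 0" using c by blast
 \<comment> \<open>The polynomial that vanishes at the other points has degree \<open>N + 1\<close>.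
   Vanishing moments make its weighted sum 0, and only the term at \<open>s1\<close> survives
   there.\<close>
 obtain r where r: "!!x::real. (PROD b:T - {s1}. x - real b) = (SUM i<=card (T - {s1}). r i * x ^ i)"
  using prod_expand[of "T - {s1}"] T(1) by auto
 have cT: "card (T - {s1}) = ?k" using T s1 by simp
 let ?P = "%x. PROD b:T - {s1}. x - real b"
 have "(SUM s:T. c s * ?P (real s)) = (SUM s:T. SUM i<=?k. r i * (c s * real s ^ i))"
  unfolding r cT sum_distrib_left by (simp only: mult_ac)
 also have "... = (SUM i<=?k. SUM s:T. r i * (c s * real s ^ i))" by (rule sum.swap)
 also have "... = (SUM i<=?k. r i * d i)" unfolding d_def by (simp only: sum_distrib_left)
 also have "... = 0" using d0 by (intro sum.neutral) auto
 finally have z: "(SUM s:T. c s * ?P (real s)) = 0" .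
 have "?P (real s) = 0" if "s : T - {s1}" for s
  using that T(1) by (intro prod_zero) auto
 hence "(SUM s:T. c s * ?P (real s)) = c s1 * ?P (real s1)"
  using sum.remove[OF T(1) s1(1), of "%s. c s * ?P (real s)"] by simp
 moreover have "?P (real s1) ~= 0" using T(1) by simp
 ultimately show False using z s1 by simp
qed

lemma gens_finite: "finite E ==> finite (gens E d)"
proof -
 assume E: "finite E"
 let ?V = "(%p. real p / real (fact d)) ` {..d * fact d}"
 have "gens E d <= {f. ALL x. (x : E --> f x : ?V) & (x ~: E --> f x = 0)}"
  unfolding gens_def by auto
 moreover have "finite {f. ALL x. (x : E --> f x : ?V) & (x ~: E --> f x = 0)}" by (rule finite_set_of_finite_funs) (use E in auto)
 ultimately show ?thesis by (rule finite_subset)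
qed

text \<open>\<open>S\<close> is the union over all small sets of generators whose cone lies in
  \<open>S\<close>, a family that is finite and does not depend on the points.\<close>

theorem semilinear_dim_upper:
 assumes E: "finite (cE G)" and S: "S <= cone G"
  and c: "!!x. x : S ==> EX M. M <= gens (cE G) d & card M <= N & x : gcone M & gcone M <= S"
 shows "semilinear_in G S" "~  dim_ge S (Suc N)"
proof -
 let ?F = "{M. M <= gens (cE G) d & card M <= N & gcone M <= S}"
 have fQ: "finite (gens (cE G) d)" by (rule gens_finite[OF E])
 have fM: "finite M" if "M : ?F" for M using that fQ finite_subset by blast
 have fF: "finite ?F" by (rule finite_subset[of _ "Pow (gens (cE G) d)"]) (use fQ in auto)
 have U: "S = (UN M:?F. gcone M)" using c by blast
 show "~  dim_ge S (Suc N)"   proof (rule not_dim_ge_gcones[OF fF])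
  show "ALL M:?F. finite M & card M <= N" using fM by blast
  show "S <= (UN M:?F. gcone M)" using U by (rule equalityD1)
 qed
 have "EX A. finite A & gcone M = {x:cone G. ALL ap:A. 0 <= dotp (cE G) ap x}" if M: "M : ?F" for M
 proof -
  have "EX A. finite A & gcone M = {x. (ALL e. e ~: cE G --> x e = 0) & (ALL ap:A. 0 <= dotp (cE G) ap x)}"
  proof (rule gcone_polyhedral[OF E _ fM[OF M], of "fact d"])
   show "ALL q:M. (ALL e. e ~: cE G --> q e = 0) & (EX p::nat => int. ALL e:cE G. q e = of_int (p e) / real (fact d))"
   proof
    fix q assume "q : M"
    hence q: "ALL e. if e : cE G then EX p<=d * fact d. q e = real p / real (fact d) else q e = 0" using M unfolding gens_def by blast
    hence "ALL e:cE G. EX p. q e = real p / real (fact d)" by meson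
    from bchoice[OF this] obtain p where "ALL e:cE G. q e = real (p e) / real (fact d)" by blast
    hence "ALL e:cE G. q e = of_int (int (p e)) / real (fact d)" by simp
    moreover have "ALL e. e ~: cE G --> q e = 0" using q by meson
    ultimately show "(ALL e. e ~: cE G --> q e = 0) & (EX p::nat => int. ALL e:cE G. q e = of_int (p e) / real (fact d))"
     by (intro conjI exI[of _ "%e. int (p e)"])
   qed
  qed simp
  then obtain A where A: "finite A" "gcone M = {x. (ALL e. e ~: cE G --> x e = 0) & (ALL ap:A. 0 <= dotp (cE G) ap x)}" by blast
  have sub: "gcone M <= cone G" using M S by blast
  have "gcone M = {x:cone G. ALL ap:A. 0 <= dotp (cE G) ap x}"
  proof (rule set_eqI, rule iffI)
   fix x assume "x : gcone M"
   thus "x : {x:cone G. ALL ap:A. 0 <= dotp (cE G) ap x}" using sub unfolding A(2) by blast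
  next
   fix x assume "x : {x:cone G. ALL ap:A. 0 <= dotp (cE G) ap x}"
   thus "x : gcone M" unfolding A(2) cone_def by blast
  qed
  thus ?thesis using A(1) by (intro exI[of _ A] conjI)
 qed
 hence "ALL M:?F. EX A. finite A & gcone M = {x:cone G. ALL ap:A. 0 <= dotp (cE G) ap x}" by blast
 from bchoice[OF this] obtain fA where fA: "ALL M:?F. finite (fA M) & gcone M = {x:cone G. ALL ap:fA M. 0 <= dotp (cE G) ap x}" ..
 have "(UN M:?F. gcone M) = (UN M:?F. {x:cone G. ALL ap:fA M. 0 <= dotp (cE G) ap x})"
  by (rule SUP_cong[OF refl]) (rule conjunct2[OF bspec[OF fA]])
 hence "S = (UN A:fA ` ?F. {x:cone G. ALL ap:A. 0 <= dotp (cE G) ap x})" using U by (simp only: image_image)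
 moreover have "finite (fA ` ?F)" using fF by (rule finite_imageI)
 moreover have "ALL A:fA ` ?F. finite A" using fA by blast
 ultimately show "semilinear_in G S" unfolding semilinear_in_def by (intro exI[of _ "fA ` ?F"] conjI)
qed

section \<open>Chains\<close>

text \<open>A cover of the path with vertices \<open>1..r\<close> before the legs are in place:
  every edge crosses one level, and the slopes obey Kirchhoff's law with the legs as sources and
  sinks. The legs may still sit at any level.\<close>

definition chainflow :: "(nat => int) => tcurve => nat => (nat => nat) => (nat => nat) => (nat => bool) => bool" where
 "chainflow a H r ka m up <-> (ALL v:cV H. ka v : {1..r}) & (ALL e:cE H. 0 < m e & ka (lo H up e) = Suc (ka (hi H up e))) &
   (ALL v:cV H. (SUM e:{e:cE H. lo H up e = v}. m e) + PLs a H {v} = (SUM e:{e:cE H. hi H up e = v}. m e) + NLs a H {v})"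

lemma rtree_chain:
 assumes "1 <= r"
 shows "rtree {1..r} (%w. w - 1) 1 r {1..r}"
proof -
 have "bij_betw (%w. w - 1) ({1..r} - {1}) ({1..r} - {r})"
  by (rule bij_betw_byWitness[where f' = Suc]) auto
 moreover have "ALL w:{1..r} - {1}. w - 1 : {1..r} & id (w - 1) < id w" by auto
 ultimately show ?thesis unfolding rtree_def using assms by (intro conjI exI[of _ id]) auto
qed

text \<open>All slopes are positive, so single vertices suffice. By the flow law the slopes cancel
  in the defect and leave \<open>- vchi\<close>.\<close>

lemma chainflow_tcov:
 assumes wf: "wf_graph H" and f: "chainflow a H r ka m up" and r: "1 <= r" and vc: "ALL v:cV H. vchi H v <= 0"
  and L: "ALL l:cL H. (0 < a l --> ka (clegv H l) = 1) & (a l < 0 --> ka (clegv H l) = r)"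
 shows "tcov a H {1..r} (%w. w - 1) 1 r {1..r} ka m up"
proof -
 have fin: "finite (cE H)" "finite (cV H)" using wf_fin[OF wf] by auto
 have kV: "ka v : {1..r}" if "v : cV H" for v using f that unfolding chainflow_def by blast
 have ke: "0 < m e" "ka (lo H up e) = Suc (ka (hi H up e))" if "e : cE H" for e using f that unfolding chainflow_def by blast+
 have kb: "(SUM e:{e:cE H. lo H up e = v}. m e) + PLs a H {v} = (SUM e:{e:cE H. hi H up e = v}. m e) + NLs a H {v}"
  if "v : cV H" for v using f that unfolding chainflow_def by blast
 have lV: "hi H up e : cV H" if "e : cE H" for e using wf_ends[OF wf that] by (simp add: hi_def)
 have tm: "tmap a H {1..r} (%w. w - 1) 1 r ka m up"
  unfolding tmap_def
 proof (intro conjI ballI impI)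
  show "ka ` cV H <= {1..r}" using kV by blast
  show "ka (fst (cends H e)) = ka (snd (cends H e))" if "e : cE H" "m e = 0" for e using ke(1)[OF that(1)] that(2) by simp
  show "ka (lo H up e) ~= 1" "ka (hi H up e) = ka (lo H up e) - 1" if "e : cE H" for e
   using ke(2)[OF that] kV[OF lV[OF that]] by auto
  show "ka (clegv H l) = 1" if "l : cL H" "0 < a l" for l using L that by blast
  show "ka (clegv H l) = r" if "l : cL H" "a l < 0" for l using L that by blast
 qed
 have tb: "tbal a H {1..r} (%w. w - 1) 1 r {1..r} ka m up {v}" if v: "v : cV H" for v
 proof -
  define y where "y = ka v"
  define lov where "lov = (SUM e:{e:cE H. lo H up e = v}. m e)"
  define hiv where "hiv = (SUM e:{e:cE H. hi H up e = v}. m e)"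
  have y: "1 <= y" "y <= r" using kV[OF v] by (auto simp: y_def)
  have U: "UU H up ka m c {v} = (if c = y then lov else 0)" for c
  proof (cases "c = y")
   case True
   have "{e:cE H. ka (lo H up e) = c & lo H up e : {v}} = {e:cE H. lo H up e = v}" using True y_def by blast
   thus ?thesis using True unfolding UU_def lov_def by simp
  next
   case False
   have emp: "{e:cE H. ka (lo H up e) = c & lo H up e : {v}} = {}" using False y_def by blast
   show ?thesis using False unfolding UU_def emp by simp
  qed
  have D: "DD H up ka m c {v} = (if c = Suc y then hiv else 0)" for c
  proof (cases "c = Suc y")
   case True
   have "{e:cE H. ka (lo H up e) = c & hi H up e : {v}} = {e:cE H. hi H up e = v}" using True ke(2) y_def by auto
   thus ?thesis using True unfolding DD_def hiv_def by simp
  next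
   case False
   have emp: "{e:cE H. ka (lo H up e) = c & hi H up e : {v}} = {}" using False ke(2) y_def by auto
   show ?thesis using False unfolding DD_def emp by simp
  qed
  have P: "PLs a H {v} = 0" if "y ~= 1"
  proof -
   have emp: "{l:cL H. 0 < a l & clegv H l : {v}} = {}" using L that y_def by auto
   show ?thesis unfolding PLs_def emp by simp
  qed
  have N: "NLs a H {v} = 0" if "y ~= r"
  proof -
   have emp: "{l:cL H. a l < 0 & clegv H l : {v}} = {}" using L that y_def by auto
   show ?thesis unfolding NLs_def emp by simp
  qed
  have hr: "hiv = 0" if "y = r"
  proof -
   have "ka (lo H up e) <= r" if "e : cE H" for e using kV wf_ends[OF wf that] by (auto simp: lo_def)
   hence emp: "{e:cE H. hi H up e = v} = {}" using ke(2) that y_def by fastforce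
   show ?thesis unfolding hiv_def emp by simp
  qed
  have B: "lov + PLs a H {v} = hiv + NLs a H {v}" using kb[OF v] unfolding lov_def hiv_def .
  have eq: "DD H up ka m c {v} = UT a H 1 up ka m (c - 1) {v}" if c: "c : {1..r} - {1}" for c
  proof (cases "c = Suc y")
   case True
   hence "y ~= r" using c by auto
   thus ?thesis using True B N P unfolding UT_def U D by auto
  next
   case False
   hence "c - 1 ~= y" using c by auto
   thus ?thesis using P unfolding UT_def U D by auto
  qed
  have Nr: "NLs a H {v} = UT a H 1 up ka m r {v}"
  proof (cases "y = r")
   case True
   thus ?thesis using B hr P unfolding UT_def U by auto
  next
   case False
   thus ?thesis using N y unfolding UT_def U by auto
  qed
  have "RR a H up m {v} = int lov + int (PLs a H {v}) - int hiv - int (NLs a H {v}) - vchi H v"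
   unfolding RR_def lov_def hiv_def by simp
  hence R: "0 <= RR a H up m {v}" using B vc v by (smt (verit) of_nat_add)
  show ?thesis unfolding tbal_def using eq Nr R by auto
 qed
 have "tbal a H {1..r} (%w. w - 1) 1 r {1..r} ka m up A" if A: "satur H m A" for A
 proof -
  have sub: "A <= cV H" using A by (simp add: satur_def)
  show ?thesis by (rule tbal_points[OF wf]) (use sub fin(2) finite_subset tb in blast)+
 qed
 thus ?thesis unfolding tcov_def using rtree_chain[OF r] tm by blast
qed

lemma PLs_point: "finite (cL H) ==> PLs a H {w} = (SUM l:cL H. if 0 < a l & clegv H l = w then nat (a l) else 0)"
 unfolding PLs_def by (simp add: sum.inter_filter)

lemma NLs_point: "finite (cL H) ==> NLs a H {w} = (SUM l:cL H. if a l < 0 & clegv H l = w then nat (- a l) else 0)"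
 unfolding NLs_def by (simp add: sum.inter_filter)

text \<open>Legs of positive degree belong over vertex 1 and those of negative degree over
  \<open>r\<close>. Cutting off an initial piece, with the degree as its slope, moves the leg one
  level closer.\<close>

lemma chainflow_step:
 assumes wf: "wf_graph H" and f: "chainflow a H r ka m up" and l: "l : cL H" "a l ~= 0"
  and ok: "if 0 < a l then ka (clegv H l) ~= 1 else ka (clegv H l) ~= r"
  and v: "ALL w:cV H. w < v" and e1: "e1 ~: cE H"
 defines "ka' == ka(v := if 0 < a l then ka (clegv H l) - 1 else Suc (ka (clegv H l)))"
  and "m' == m(e1 := nat \<bar>a l\<bar>)" and "up' == up(e1 := 0 < a l)" and "H' == subdivide H (SL l) v e1"
 shows "chainflow a H' r ka' m' up'"
  "e : cE H ==> ka' (lo H' up' e) = ka (lo H up e) & m' e = m e"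
proof -
 interpret subdiv_graph H "SL l" v e1 by unfold_locales (use wf l v e1 in auto)
 let ?u = "clegv H l"
 have fin: "finite (cE H)" "finite (cL H)" using wf_fin[OF wf] by auto
 have uV: "?u : cV H" using wf_legv[OF wf l(1)] .
 have vn: "v ~: cV H" using v by blast
 have kV: "ka w : {1..r}" if "w : cV H" for w using f that unfolding chainflow_def by blast
 have ke: "0 < m e" "ka (lo H up e) = Suc (ka (hi H up e))" if "e : cE H" for e using f that unfolding chainflow_def by blast+
 have kb: "(SUM e:{e:cE H. lo H up e = w}. m e) + PLs a H {w} = (SUM e:{e:cE H. hi H up e = w}. m e) + NLs a H {w}"
  if "w : cV H" for w using f that unfolding chainflow_def by blast
 have HV: "cV H' = insert v (cV H)" "cE H' = insert e1 (cE H)" "cL H' = cL H" unfolding H'_def by (rule H1_simps)+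
 have ends: "cends H' e = cends H e" if "e : cE H" for e unfolding H'_def by (rule ends_other) (use that in auto)
 have ends1: "cends H' e1 = (?u, v)" unfolding H'_def H1_simps(4) by (simp add: segstart_def)
 have ne: "e ~= e1" if "e : cE H" for e using that e1 by blast
 have loe: "lo H' up' e = lo H up e" "hi H' up' e = hi H up e" if "e : cE H" for e
  using ends[OF that] ne[OF that] by (simp_all add: lo_def hi_def up'_def)
 have lo1: "lo H' up' e1 = (if 0 < a l then ?u else v)" "hi H' up' e1 = (if 0 < a l then v else ?u)"
  using ends1 by (simp_all add: lo_def hi_def up'_def)
 have lhV: "lo H up e : cV H" "hi H up e : cV H" if "e : cE H" for e using wf_ends[OF wf that] by (simp_all add: lo_def hi_def)
 have kk: "ka' w = ka w" if "w : cV H" for w using that vn by (auto simp: ka'_def)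
 have me: "m' e = m e" if "e : cE H" for e using ne[OF that] by (simp add: m'_def)
 show "e : cE H ==> ka' (lo H' up' e) = ka (lo H up e) & m' e = m e" using loe kk lhV me by simp
 have legv: "clegv H' l = v" "l' ~= l ==> clegv H' l' = clegv H l'" for l'
  unfolding H'_def by (auto simp: subdivide_def)
 have los: "(SUM e:{e:cE H'. lo H' up' e = w}. m' e) = (SUM e:{e:cE H. lo H up e = w}. m e) + (if lo H' up' e1 = w then m' e1 else 0)" for w
 proof -
  have s: "{e:cE H'. lo H' up' e = w} = {e:cE H. lo H up e = w} Un (if lo H' up' e1 = w then {e1} else {})"
   unfolding HV(2) using loe by auto
  have "(SUM e:{e:cE H. lo H up e = w}. m' e) = (SUM e:{e:cE H. lo H up e = w}. m e)" by (rule sum.cong) (use me in auto)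
  thus ?thesis unfolding s using fin(1) e1 by (subst sum.union_disjoint) auto
 qed
 have his: "(SUM e:{e:cE H'. hi H' up' e = w}. m' e) = (SUM e:{e:cE H. hi H up e = w}. m e) + (if hi H' up' e1 = w then m' e1 else 0)" for w
 proof -
  have s: "{e:cE H'. hi H' up' e = w} = {e:cE H. hi H up e = w} Un (if hi H' up' e1 = w then {e1} else {})"
   unfolding HV(2) using loe by auto
  have "(SUM e:{e:cE H. hi H up e = w}. m' e) = (SUM e:{e:cE H. hi H up e = w}. m e)" by (rule sum.cong) (use me in auto)
  thus ?thesis unfolding s using fin(1) e1 by (subst sum.union_disjoint) auto
 qed
 have PL: "PLs a H' {w} + (if 0 < a l & ?u = w then nat (a l) else 0) = PLs a H {w} + (if 0 < a l & v = w then nat (a l) else 0)" for w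
 proof -
  have fL': "finite (cL H')" using HV(3) fin(2) by simp
  have "(SUM k:cL H - {l}. if 0 < a k & clegv H' k = w then nat (a k) else 0) = (SUM k:cL H - {l}. if 0 < a k & clegv H k = w then nat (a k) else 0)"
   by (rule sum.cong) (use legv(2) in auto)
  thus ?thesis unfolding PLs_point[OF fL'] PLs_point[OF fin(2)] HV(3) using sum.remove[OF fin(2) l(1), of "%k. if 0 < a k & clegv H' k = w then nat (a k) else 0"] sum.remove[OF fin(2) l(1), of "%k. if 0 < a k & clegv H k = w then nat (a k) else 0"] legv(1) by simp
 qed
 have NL: "NLs a H' {w} + (if a l < 0 & ?u = w then nat (- a l) else 0) = NLs a H {w} + (if a l < 0 & v = w then nat (- a l) else 0)" for w
 proof -
  have fL': "finite (cL H')" using HV(3) fin(2) by simp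
  have "(SUM k:cL H - {l}. if a k < 0 & clegv H' k = w then nat (- a k) else 0) = (SUM k:cL H - {l}. if a k < 0 & clegv H k = w then nat (- a k) else 0)"
   by (rule sum.cong) (use legv(2) in auto)
  thus ?thesis unfolding NLs_point[OF fL'] NLs_point[OF fin(2)] HV(3) using sum.remove[OF fin(2) l(1), of "%k. if a k < 0 & clegv H' k = w then nat (- a k) else 0"] sum.remove[OF fin(2) l(1), of "%k. if a k < 0 & clegv H k = w then nat (- a k) else 0"] legv(1) by simp
 qed
 have m1: "m' e1 = (if 0 < a l then nat (a l) else nat (- a l))" by (simp add: m'_def)
 have emp: "(SUM e:{e:cE H. lo H up e = v}. m e) = 0" "(SUM e:{e:cE H. hi H up e = v}. m e) = 0" "PLs a H {v} = 0" "NLs a H {v} = 0"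
 proof -
  have s: "{e:cE H. lo H up e = v} = {}" "{e:cE H. hi H up e = v} = {}" using lhV vn by blast+
  have t: "{l:cL H. 0 < a l & clegv H l : {v}} = {}" "{l:cL H. a l < 0 & clegv H l : {v}} = {}" using wf_legv[OF wf] vn by blast+
  show "(SUM e:{e:cE H. lo H up e = v}. m e) = 0" "(SUM e:{e:cE H. hi H up e = v}. m e) = 0" unfolding s by simp_all
  show "PLs a H {v} = 0" "NLs a H {v} = 0" unfolding PLs_def NLs_def t by simp_all
 qed
 have uv: "?u ~= v" using uV vn by blast
 show "chainflow a H' r ka' m' up'"
  unfolding chainflow_def
 proof (intro conjI ballI)
  fix w assume "w : cV H'"
  then consider "w = v" | "w : cV H" unfolding HV by blast
  thus "ka' w : {1..r}"
  proof cases
   case 1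
   thus ?thesis using kV[OF uV] ok by (auto simp: ka'_def)
  next
   case 2
   thus ?thesis using kV kk by simp
  qed
 next
  fix e assume e: "e : cE H'"
  show "0 < m' e"
  proof (cases "e = e1")
   case True
   thus ?thesis using l(2) m1 by auto
  next
   case False
   hence "e : cE H" using e HV by blast
   thus ?thesis using ke me by simp
  qed
  show "ka' (lo H' up' e) = Suc (ka' (hi H' up' e))"
  proof (cases "e = e1")
   case True
   have "ka' v = (if 0 < a l then ka ?u - 1 else Suc (ka ?u))" by (simp add: ka'_def)
   thus ?thesis unfolding True lo1 using kk[OF uV] kV[OF uV] by (auto split: if_splits)
  next
   case False
   hence "e : cE H" using e HV by blast
   thus ?thesis using ke kk lhV loe by simp
  qed
 next
  fix w assume w: "w : cV H'"
  show "(SUM e:{e:cE H'. lo H' up' e = w}. m' e) + PLs a H' {w} = (SUM e:{e:cE H'. hi H' up' e = w}. m' e) + NLs a H' {w}"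
  proof (cases "w = v")
   case True
   show ?thesis
   proof (cases "0 < a l")
    case pos: True
    thus ?thesis using PL[of v] NL[of v] emp m1 unfolding True los his lo1 by auto
   next
    case False
    hence "a l < 0" using l(2) by linarith
    thus ?thesis using PL[of v] NL[of v] emp m1 unfolding True los his lo1 by auto
   qed
  next
   case False
   hence wV: "w : cV H" using w HV by blast
   show ?thesis
   proof (cases "0 < a l")
    case pos: True
    show ?thesis
    proof (cases "?u = w")
     case True
     thus ?thesis using pos PL[of w] NL[of w] kb[OF wV] m1 unfolding los his lo1 by auto
    next
     case nu: False
     thus ?thesis using PL[of w] NL[of w] kb[OF wV] m1 unfolding los his lo1 by auto
    qed
   next
    case neg: False
    hence neg': "a l < 0" using l(2) by linarith
    show ?thesis
    proof (cases "?u = w")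
     case True
     thus ?thesis using neg' PL[of w] NL[of w] kb[OF wV] False m1 unfolding los his lo1 by auto
    next
     case nu: False
     thus ?thesis using PL[of w] NL[of w] kb[OF wV] False m1 unfolding los his lo1 by auto
    qed
   qed
  qed
 qed
qed

text \<open>Only legs are cut, so every edge of \<open>G\<close> remains alone on itself with its
  level and slope. The measure is the total distance of the legs from their destinations.\<close>

lemma extend_legs:
 assumes wf: "wf_graph G" and nz: "ALL l:cL G. a l ~= 0"
 shows "subdiv G H lab vl ==> chainflow a H r ka m up ==> ALL e:cE G. {f:cE H. lab f = SE e} = {e} & ka (lo H up e) = K e & m e = D e ==>
  EX H lab vl ka m up. subdiv G H lab vl & chainflow a H r ka m up &
   (ALL e:cE G. {f:cE H. lab f = SE e} = {e} & ka (lo H up e) = K e & m e = D e) &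
   (ALL l:cL H. (0 < a l --> ka (clegv H l) = 1) & (a l < 0 --> ka (clegv H l) = r))"
proof (induction "SUM l:cL H. if 0 < a l then ka (clegv H l) - 1 else r - ka (clegv H l)" arbitrary: H lab vl ka m up rule: less_induct)
 case less
 note sd = less.prems(1) and cf = less.prems(2) and eG = less.prems(3)
 have wfH: "wf_graph H" and LH: "cL H = cL G" using subdiv_inv[OF sd wf] by auto
 have fin: "finite (cV H)" "finite (cE H)" "finite (cL H)" using wf_fin[OF wfH] by auto
 show ?case
 proof (cases "ALL l:cL H. (0 < a l --> ka (clegv H l) = 1) & (a l < 0 --> ka (clegv H l) = r)")
  case True
  thus ?thesis using sd cf eG by blast
 next
  case False
  then obtain l where l: "l : cL H" "if 0 < a l then ka (clegv H l) ~= 1 else ka (clegv H l) ~= r" by auto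
  have al: "a l ~= 0" using nz l LH by blast
  define v where "v = Suc (Max (cV H))"
  have v: "ALL w:cV H. w < v" using fin(1) by (auto simp: v_def less_Suc_eq_le)
  obtain e1 where e1: "e1 ~: cE H" using ex_new_if_finite[OF infinite_UNIV_nat fin(2)] by blast
  let ?H = "subdivide H (SL l) v e1" and ?k = "ka(v := if 0 < a l then ka (clegv H l) - 1 else Suc (ka (clegv H l)))"
   and ?m = "m(e1 := nat \<bar>a l\<bar>)" and ?u = "up(e1 := 0 < a l)" and ?lab = "lab(e1 := SL l)" and ?vl = "vl(v := Some (SL l))"
  note st = chainflow_step[OF wfH cf l(1) al l(2) v e1]
  have sd': "subdiv G ?H ?lab ?vl" by (rule subdiv_step[OF sd]) (use l v e1 in auto)
  have HL: "cL ?H = cL H" by (simp add: subdivide_def)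
  have kV: "ka (clegv H l) : {1..r}" using cf wf_legv[OF wfH l(1)] unfolding chainflow_def by blast
  have dec: "(SUM l:cL ?H. if 0 < a l then ?k (clegv ?H l) - 1 else r - ?k (clegv ?H l)) < (SUM l:cL H. if 0 < a l then ka (clegv H l) - 1 else r - ka (clegv H l))"
   unfolding HL
  proof (rule sum_strict_mono_ex1[OF fin(3)])
   have old: "?k (clegv ?H l') = ka (clegv H l')" if "l' : cL H" "l' ~= l" for l'
    using wf_legv[OF wfH that(1)] v that(2) by (auto simp: subdivide_def)
   have new: "?k (clegv ?H l) = (if 0 < a l then ka (clegv H l) - 1 else Suc (ka (clegv H l)))" by (simp add: subdivide_def)
   show "ALL l':cL H. (if 0 < a l' then ?k (clegv ?H l') - 1 else r - ?k (clegv ?H l')) <= (if 0 < a l' then ka (clegv H l') - 1 else r - ka (clegv H l'))"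
   proof
    fix l' assume l': "l' : cL H"
    show "(if 0 < a l' then ?k (clegv ?H l') - 1 else r - ?k (clegv ?H l')) <= (if 0 < a l' then ka (clegv H l') - 1 else r - ka (clegv H l'))"
    proof (cases "l' = l")
     case True
     show ?thesis unfolding True new by auto
    next
     case False
     show ?thesis unfolding old[OF l' False] by simp
    qed
   qed
   show "EX l':cL H. (if 0 < a l' then ?k (clegv ?H l') - 1 else r - ?k (clegv ?H l')) < (if 0 < a l' then ka (clegv H l') - 1 else r - ka (clegv H l'))"
   proof (rule bexI[OF _ l(1)])
    show "(if 0 < a l then ?k (clegv ?H l) - 1 else r - ?k (clegv ?H l)) < (if 0 < a l then ka (clegv H l) - 1 else r - ka (clegv H l))"
     unfolding new using l(2) kV by auto
   qed
  qed
  have eG': "ALL e:cE G. {f:cE ?H. ?lab f = SE e} = {e} & ?k (lo ?H ?u e) = K e & ?m e = D e"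
  proof
   fix e assume e: "e : cE G"
   hence eq: "{f:cE H. lab f = SE e} = {e}" and kd: "ka (lo H up e) = K e" "m e = D e" using eG by blast+
   have eH: "e : cE H" using eq by blast
   have "{f:cE ?H. ?lab f = SE e} = {f:cE H. lab f = SE e}" using e1 by (auto simp: subdivide_def)
   thus "{f:cE ?H. ?lab f = SE e} = {e} & ?k (lo ?H ?u e) = K e & ?m e = D e"
    unfolding eq using st(2)[OF eH] kd by simp
  qed
  show ?thesis by (rule less.hyps[OF dec sd' st(1) eG'])
 qed
qed

text \<open>The pieces cut from legs add no length to an edge of \<open>G\<close>, so the lengths
  are read off from the flow on \<open>G\<close> itself.\<close>

theorem chainflow_DR:
 assumes wf: "wf_graph G" and L: "cL G = {1..n}" and nz: "ALL i:{1..n}. a i ~= 0" and cf: "chainflow a G r ka m up" and r: "1 <= r"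
  and vc: "ALL v:cV G. vchi G v <= 0" and el: "ALL w:{2..r}. 0 < el w"
 shows "DR n a (curve_of G (%e. if e : cE G then el (ka (lo G up e)) / real (m e) else 0))"
proof -
 have nz': "ALL l:cL G. a l ~= 0" using nz L by simp
 have e0: "ALL e:cE G. {f:cE G. SE f = SE e} = {e} & ka (lo G up e) = ka (lo G up e) & m e = m e" by auto
 obtain H lab vl ka' m' up' where sd: "subdiv G H lab vl" and cf': "chainflow a H r ka' m' up'"
  and eG: "ALL e:cE G. {f:cE H. lab f = SE e} = {e} & ka' (lo H up' e) = ka (lo G up e) & m' e = m e"
  and L': "ALL l:cL H. (0 < a l --> ka' (clegv H l) = 1) & (a l < 0 --> ka' (clegv H l) = r)"
  using extend_legs[OF wf nz' subdiv_refl cf e0] by (elim exE conjE) (rule that)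
 have inv: "wf_graph H" using subdiv_inv[OF sd wf] by blast
 have "ALL v:cV H. vchi H v <= 0"
 proof
  fix v assume v: "v : cV H"
  show "vchi H v <= 0"
  proof (cases "vl v")
   case None
   hence "v : cV G" "vchi H v = vchi G v" using subdiv_inv[OF sd wf] v by (auto simp: vchi_def)
   thus ?thesis using vc by simp
  next
   case (Some s)
   hence "cwt H v = 0 & gval H v = 2" using subdiv_inv[OF sd wf] v by blast
   thus ?thesis by (simp add: vchi_def)
  qed
 qed
 from chainflow_tcov[OF inv cf' r this L']
 have tc: "tcov a H {1..r} (%w. w - 1) 1 r {1..r} ka' m' up'" .
 have "typelen G H lab ka' m' up' el = (%e. if e : cE G then el (ka (lo G up e)) / real (m e) else 0)"
 proof
  fix e
  show "typelen G H lab ka' m' up' el e = (if e : cE G then el (ka (lo G up e)) / real (m e) else 0)"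
  proof (cases "e : cE G")
   case True
   hence s: "{f:cE H. lab f = SE e} = {e}" and k: "ka' (lo H up' e) = ka (lo G up e)" "m' e = m e" using eG by blast+
   show ?thesis unfolding typelen_def pushl_def s by (simp add: k)
  qed (simp add: typelen_def pushl_def)
 qed
 moreover have "ALL w:{1..r} - {1}. 0 < el w" using el by auto
 ultimately show ?thesis using type_DR[OF wf L sd tc _ nz, of el] by simp
qed

section \<open>A cone of maximal dimension\<close>

text \<open>A chain of vertices \<open>1, \<dots>, r\<close>: the even edge \<open>2 * v\<close> joins \<open>v\<close> to \<open>v + 1\<close>, and for \<open>v \<in> C\<close> the odd edge
  \<open>2 * v + 1\<close> closes a cycle. The leg \<open>l\<close> sits at \<open>x l\<close>.\<close>

definition chainG :: "nat => nat => nat set => (nat => nat) => tcurve" where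
 "chainG n r C x = \<lparr>cV = {1..r}, cE = (%v. 2 * v) ` {1..<r} Un (%v. 2 * v + 1) ` C, cends = (%e. (e div 2, Suc (e div 2))),
   cL = {1..n}, clegv = x, cwt = (%_. 0), clen = (%_. 1)\<rparr>"

text \<open>The partial sums of degrees are the total slope between \<open>v\<close> and
  \<open>v + 1\<close>, forced by the flow law. Over a cycle this splits into two positive slopes,
  whence the bound 2 on \<open>C\<close>; \<open>valence\<close> is stability with all weights
  0.\<close>

locale chain =
 fixes n r :: nat and C :: "nat set" and x :: "nat => nat" and a :: "nat => int"
 assumes r: "1 <= r" and C: "C <= {1..<r}" and x: "!!l. l : {1..n} ==> x l : {1..r}"
  and Fpos: "!!v. v : {1..<r} ==> 0 < (SUM l:{l:{1..n}. x l <= v}. a l)"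
  and FC: "!!v. v : C ==> 2 <= (SUM l:{l:{1..n}. x l <= v}. a l)"
  and total: "(SUM l:{1..n}. a l) = 0" and nz: "ALL l:{1..n}. a l ~= 0"
  and valence: "!!v. v : {1..r} ==> 3 <= card {l:{1..n}. x l = v}
   + card ({v - 1, v} Int {1..<r}) + card ({v - 1, v} Int C)"
begin

abbreviation "G == chainG n r C x"
abbreviation "F v == SUM l:{l:{1..n}. x l <= v}. a l"
text \<open>On a cycle the closing edge has slope 1 and the even edge takes the rest of the
  flow.\<close>

definition "mm e = (if odd e then 1 else nat (F (e div 2)) - (if e div 2 : C then 1 else 0))"
abbreviation "EE v == {e:cE G. e div 2 = v}"

lemma G_simps: "cV G = {1..r}" "cE G = (%v. 2 * v) ` {1..<r} Un (%v. 2 * v + 1) ` C" "cends G e = (e div 2, Suc (e div 2))"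
 "cL G = {1..n}" "clegv G = x" "cwt G v = 0"
 by (simp_all add: chainG_def)

lemma finC: "finite C" using C finite_subset by blast

lemma EE_eq: "EE v = (if v : {1..<r} then {2 * v} else {}) Un (if v : C then {2 * v + 1} else {})"
proof -
 have c0: "1 <= w" if "w : C" for w using C that by auto
 show ?thesis unfolding G_simps(2) by (auto dest: c0)
qed

lemma card_EE: "card (EE v) = (if v : {1..<r} then 1 else 0) + (if v : C then 1 else 0)"
proof -
 have "2 * v ~= 2 * v + 1" by simp
 thus ?thesis unfolding EE_eq by auto
qed

lemma finE: "finite (cE G)" unfolding G_simps using finC by simp

lemma lohi: "lo G (%_. False) e = Suc (e div 2)" "hi G (%_. False) e = e div 2"
 by (simp_all add: lo_def hi_def G_simps)

lemma F0: "F 0 = 0"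
proof -
 have emp: "{l:{1..n}. x l <= 0} = {}" using x by force
 show ?thesis unfolding emp by simp
qed

lemma Fr: "F r = 0"
proof -
 have "{l:{1..n}. x l <= r} = {1..n}" using x by auto
 thus ?thesis using total by simp
qed

lemma sum_EE: "v <= r ==> int (SUM e:EE v. mm e) = F v"
proof -
 assume v: "v <= r"
 show ?thesis
 proof (cases "v : {1..<r}")
  case False
  hence "v = 0 | v = r" using v by auto
  hence "F v = 0" using F0 Fr by auto
  moreover have emp: "EE v = {}" unfolding EE_eq using False C by auto
  ultimately show ?thesis unfolding emp by simp
 next
  case True
  show ?thesis
  proof (cases "v : C")
   case vC: True
   have "EE v = {2 * v, 2 * v + 1}" unfolding EE_eq using True vC by auto
   hence "(SUM e:EE v. mm e) = mm (2 * v) + mm (2 * v + 1)" by simp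
   also have "... = (nat (F v) - 1) + 1" using vC by (simp add: mm_def)
   finally show ?thesis using FC[OF vC] by simp
  next
   case vC: False
   have "EE v = {2 * v}" unfolding EE_eq using True vC by auto
   hence "(SUM e:EE v. mm e) = nat (F v)" using vC by (simp add: mm_def)
   thus ?thesis using Fpos[OF True] by simp
  qed
 qed
qed

lemma F_step: "1 <= v ==> F v = F (v - 1) + int (PLs a G {v}) - int (NLs a G {v})"
proof -
 assume v: "1 <= v"
 have s: "{l:{1..n}. x l <= v} = {l:{1..n}. x l <= v - 1} Un {l:{1..n}. x l = v}" by auto
 have "F v = F (v - 1) + (SUM l:{l:{1..n}. x l = v}. a l)"
  unfolding s by (rule sum.union_disjoint) (use v in auto)
 moreover have "{l:{1..n}. x l = v} = {l:{1..n}. 0 < a l & x l = v} Un {l:{1..n}. a l < 0 & x l = v}" using nz by force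
 hence "(SUM l:{l:{1..n}. x l = v}. a l) = (SUM l:{l:{1..n}. 0 < a l & x l = v}. a l) + (SUM l:{l:{1..n}. a l < 0 & x l = v}. a l)"
  by (simp only:) (rule sum.union_disjoint, auto)
 moreover have "int (PLs a G {v}) = (SUM l:{l:{1..n}. 0 < a l & x l = v}. a l)"
  unfolding PLs_def G_simps by simp
 moreover have "int (NLs a G {v}) = - (SUM l:{l:{1..n}. a l < 0 & x l = v}. a l)"
  unfolding NLs_def G_simps by (simp add: sum_negf)
 ultimately show ?thesis by linarith
qed

lemma flow: "chainflow a G r (%v. v) mm (%_. False)"
 unfolding chainflow_def lohi
proof (intro conjI ballI)
 show "v : {1..r}" if "v : cV G" for v using that by (simp add: G_simps)
 show "Suc (e div 2) = Suc (e div 2)" for e :: nat by simp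
 show "0 < mm e" if e: "e : cE G" for e
 proof (cases "odd e")
  case False
  then obtain v where v: "v : {1..<r}" "e = 2 * v" using e by (auto simp: G_simps)
  show ?thesis using Fpos[OF v(1)] FC[of v] unfolding v(2) mm_def by auto
 qed (simp add: mm_def)
next
 fix v assume "v : cV G"
 hence v: "1 <= v" "v <= r" by (auto simp: G_simps)
 have s: "{e:cE G. Suc (e div 2) = v} = EE (v - 1)" using v by auto
 have "int (SUM e:EE (v - 1). mm e) = F (v - 1)" "int (SUM e:EE v. mm e) = F v" using sum_EE v by auto
 thus "(SUM e:{e:cE G. Suc (e div 2) = v}. mm e) + PLs a G {v} = (SUM e:EE v. mm e) + NLs a G {v}"
  unfolding s using F_step[OF v(1)] by linarith
qed

lemma edge_div: "e : cE G ==> e div 2 : {1..<r}"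
proof -
 assume "e : cE G"
 then consider v where "v : {1..<r}" "e = 2 * v" | v where "v : C" "e = 2 * v + 1" unfolding G_simps(2) by blast
 thus ?thesis
 proof cases
  case 1
  thus ?thesis by simp
 next
  case 2
  hence "v : {1..<r}" using C by blast
  thus ?thesis using 2 by simp
 qed
qed

lemma wfG: "wf_graph G"
proof -
 have ad: "(v, Suc v) : adj G" if "1 <= v" "Suc v <= r" for v
 proof -
  have "2 * v : cE G" "cends G (2 * v) = (v, Suc v)" using that by (auto simp: G_simps)
  thus ?thesis unfolding adj_def by blast
 qed
 have p: "v <= r --> (1, v) : (adj G)^*" if "1 <= v" for v
  using that
 proof (induction v rule: dec_induct)
  case (step v)
  show ?case
  proof
   assume v: "Suc v <= r"
   hence "(1, v) : (adj G)^*" using step(3) by simp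
   thus "(1, Suc v) : (adj G)^*" using ad[OF step(1) v] by (rule rtrancl.rtrancl_into_rtrancl)
  qed
 qed simp
 have sy: "(w, v) : (adj G)^*" if "(v, w) : (adj G)^*" for v w
  using that unfolding adj_erel by (rule erel_rtrancl_sym)
 have "(v, w) : (adj G)^*" if "v : cV G" "w : cV G" for v w
 proof -
  have "(1, v) : (adj G)^*" "(1, w) : (adj G)^*" using that p by (simp_all add: G_simps)
  thus ?thesis using rtrancl_trans[OF sy] by blast
 qed
 moreover have "fst (cends G e) : cV G & snd (cends G e) : cV G" if "e : cE G" for e
  using edge_div[OF that] unfolding G_simps(1,3) by simp
 moreover have "clegv G l : cV G" if "l : cL G" for l using x that unfolding G_simps(1,4,5) by blast
 moreover have "finite (cV G)" "finite (cL G)" "cV G ~= {}" using r by (simp_all add: G_simps)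
 ultimately show ?thesis unfolding wf_graph_def using finE by blast
qed

lemma gvalG: "v : {1..r} ==> 3 <= gval G v"
proof -
 assume v: "v : {1..r}"
 have s: "{e:cE G. Suc (e div 2) = v} = EE (v - 1)" using v by auto
 have two: "card ({v - 1, v} Int X) = (if v - 1 : X then 1 else 0) + (if v : X then 1 else 0)" for X
 proof -
  have "v - 1 ~= v" using v by auto
  thus ?thesis by auto
 qed
 have "gval G v = card (EE v) + card (EE (v - 1)) + card {l:{1..n}. x l = v}"
  unfolding gval_def G_simps(3,4,5) fst_conv snd_conv s ..
 thus ?thesis using valence[OF v] unfolding card_EE two by simp
qed

lemma genusG: "tgenus G = int (card C)"
proof -
 have "card (cE G) = card ((%v. 2 * v) ` {1..<r}) + card ((%v. 2 * v + 1) ` C)"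
  unfolding G_simps by (rule card_Un_disjoint) (use finC in \<open>auto, presburger\<close>)
 also have "card ((%v. 2 * v) ` {1..<r}) = r - 1" by (subst card_image) (auto simp: inj_on_def)
 also have "card ((%v. 2 * v + 1) ` C) = card C" by (rule card_image) (auto simp: inj_on_def)
 finally show ?thesis using r by (simp add: tgenus_def G_simps)
qed

lemma stable: "stable_graph (card C) n G"
 unfolding stable_graph_def using wfG genusG gvalG by (auto simp: G_simps)

text \<open>The length of an edge is the tree length at its level divided by its slope, so the
  \<open>r - 1\<close> tree lengths are free and can be recovered from the even edges.\<close>

lemma dimG: "dim_ge (preimage_in G (DR n a)) (r - 1)"
proof -
 define pt where "pt el e = (if e : cE G then el (Suc (e div 2)) / real (mm e) else 0)" for el :: "nat => real" and e
 have mpos: "0 < mm e" if "e : cE G" for e using flow that unfolding chainflow_def by blast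
 have inS: "pt el : preimage_in G (DR n a)" if el: "ALL w:{2..r}. 0 < el w" for el
 proof -
  have "ALL v:cV G. vchi G v <= 0" using gvalG by (fastforce simp: vchi_def G_simps)
  hence "DR n a (curve_of G (%e. if e : cE G then el (lo G (%_. False) e) / real (mm e) else 0))"
   using chainflow_DR[OF wfG _ nz flow r _ el] by (simp add: G_simps)
  hence "DR n a (curve_of G (pt el))" unfolding lohi pt_def .
  moreover have "pt el : cone G"
  proof -
   have "0 <= pt el e" if e: "e : cE G" for e
   proof -
    have "e div 2 : {1..<r}" by (rule edge_div[OF e])
    hence "0 < el (Suc (e div 2))" using el by auto
    thus ?thesis by (simp add: pt_def)
   qed
   moreover have "pt el e = 0" if "e ~: cE G" for e using that by (simp add: pt_def)
   ultimately show ?thesis unfolding cone_def by blast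
  qed
  ultimately show ?thesis by (simp add: preimage_in_def)
 qed
 \<comment> \<open>The corners of the simplex: all tree lengths 1, or one of them raised to 2.
   Convex combinations keep every tree length positive.\<close>
 define eli where "eli i w = (if 0 < i & w = Suc i then 2 else 1 :: real)" for i w :: nat
 let ?k = "r - 1"
 have comb: "(%e. SUM i<=?k. w i * pt (eli i) e) = pt (%j. SUM i<=?k. w i * eli i j)" for w :: "nat => real"
  unfolding pt_def by (auto simp: sum_divide_distrib)
 show ?thesis unfolding dim_ge_def
 proof (intro exI[of _ "%i. pt (eli i)"] conjI allI impI)
  fix w :: "nat => real" assume w: "(ALL i<=?k. 0 <= w i) & (SUM i<=?k. w i) = 1"
  have "0 < (SUM i<=?k. w i * eli i j)" for j
  proof -
   have "(SUM i<=?k. w i) <= (SUM i<=?k. w i * eli i j)" using w by (intro sum_mono) (auto simp: eli_def)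
   thus ?thesis using w by linarith
  qed
  thus "(%e. SUM i<=?k. w i * pt (eli i) e) : preimage_in G (DR n a)" unfolding comb by (intro inS) blast
 next
  fix c :: "nat => real" assume c: "ALL e. (SUM i:{1..?k}. c i * (pt (eli i) e - pt (eli 0) e)) = 0"
  show "ALL i:{1..?k}. c i = 0"
  proof
   fix j assume j: "j : {1..?k}"
   have e: "2 * j : cE G" using j by (auto simp: G_simps)
   have t: "pt (eli i) (2 * j) - pt (eli 0) (2 * j) = (if i = j then 1 / real (mm (2 * j)) else 0)" if "i : {1..?k}" for i
    using e that by (auto simp: pt_def eli_def)
   have "0 = (SUM i:{1..?k}. c i * (pt (eli i) (2 * j) - pt (eli 0) (2 * j)))" using c by simp
   also have "... = (SUM i:{1..?k}. if i = j then c i / real (mm (2 * j)) else 0)"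
    by (rule sum.cong[OF refl]) (simp add: t)
   also have "... = c j / real (mm (2 * j))" using j by simp
   finally show "c j = 0" using mpos[OF e] by simp
  qed
 qed
qed

end

text \<open>Positive legs come first, negative legs last and the cycles in between. The flow over
  the cycles is then the full degree, which is at least 2, and it stays positive along the whole
  chain.\<close>

lemma chain_exists:
 fixes a :: "nat => int"
 assumes g: "1 <= g" and n: "2 <= n" and nz: "ALL i:{1..n}. a i ~= 0" and total: "(SUM i=1..n. a i) = 0"
  and d: "2 <= (SUM i:{i:{1..n}. 0 < a i}. a i)"
 shows "EX C x. chain n (2 * g + n - 2) C x a & card C = g"
proof -
 let ?P = "{i:{1..n}. 0 < a i}" and ?N = "{i:{1..n}. a i < 0}"
 define p where "p = card ?P"
 define q where "q = card ?N"
 have PN: "{1..n} = ?P Un ?N" using nz by force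
 have "card {1..n} = card ?P + card ?N" by (subst PN, rule card_Un_disjoint) auto
 hence npq: "n = p + q" by (simp add: p_def q_def)
 have "sum a {1..n} = sum a ?P + sum a ?N" by (subst PN, rule sum.union_disjoint) auto
 hence sN: "sum a ?N <= - 2" using total d by simp
 have p1: "1 <= p"
 proof -
  have "?P ~= {}" using d by (metis not_numeral_le_zero sum.empty)
  thus ?thesis unfolding p_def by (simp add: Suc_leI card_gt_0_iff)
 qed
 have q1: "1 <= q"
 proof -
  have "?N ~= {}" using sN by (metis neg_0_le_iff_le not_numeral_le_zero sum.empty)
  thus ?thesis unfolding q_def by (simp add: Suc_leI card_gt_0_iff)
 qed
 obtain hp where hp: "bij_betw hp {1..p} ?P" using ex_bij_betw_nat_finite_1[of ?P] unfolding p_def by auto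
 obtain hq where hq: "bij_betw hq {1..q} ?N" using ex_bij_betw_nat_finite_1[of ?N] unfolding q_def by auto
 define r where "r = 2 * g + n - 2"
 have rr: "r = 2 * g + p + q - 2" using npq by (simp add: r_def)
 define ip where "ip = the_inv_into {1..p} hp"
 define iq where "iq = the_inv_into {1..q} hq"
 have ip: "ip (hp i) = i" if "i : {1..p}" for i unfolding ip_def using hp that by (simp add: bij_betw_def the_inv_into_f_f)
 have iq: "iq (hq i) = i" if "i : {1..q}" for i unfolding iq_def using hq that by (simp add: bij_betw_def the_inv_into_f_f)
 have hpP: "hp i : ?P" if "i : {1..p}" for i using bij_betwE[OF hp] that by blast
 have hqN: "hq i : ?N" if "i : {1..q}" for i using bij_betwE[OF hq] that by blast
 have Pi: "EX i:{1..p}. l = hp i" if "l : ?P" for l using hp that unfolding bij_betw_def by blast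
 have Ni: "EX i:{1..q}. l = hq i" if "l : ?N" for l using hq that unfolding bij_betw_def by blast
 \<comment> \<open>Positive legs sit at \<open>1, 1, 2, ..., p - 1\<close> and negative ones at
   \<open>p + 2 * g, ..., r, r\<close>, the doublings giving the end vertices a third half-edge. If
   there is only one leg of a sign, its end vertex lies on a cycle instead.\<close>
 define x where "x l = (if 0 < a l then max 1 (ip l - 1) else min r (p - 1 + 2 * g + iq l))" for l
 have xp: "x (hp i) = max 1 (i - 1)" if "i : {1..p}" for i using hpP[OF that] ip[OF that] by (simp add: x_def)
 have xq: "x (hq i) = min r (p - 1 + 2 * g + i)" if "i : {1..q}" for i using hqN[OF that] iq[OF that] by (simp add: x_def)
 have xP: "1 <= x l & x l <= max 1 (p - 1)" if l: "l : ?P" for l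
 proof -
  obtain i where i: "i : {1..p}" "l = hp i" using Pi[OF l] by blast
  show ?thesis unfolding i(2) xp[OF i(1)] using i(1) by auto
 qed
 have xN: "p + 2 * g - 1 <= x l & x l <= r & (x l = r | p + 2 * g <= x l)" if l: "l : ?N" for l
 proof -
  obtain i where i: "i : {1..q}" "l = hq i" using Ni[OF l] by blast
  show ?thesis unfolding i(2) xq[OF i(1)] using i(1) rr p1 q1 by auto
 qed
 \<comment> \<open>The cycles occupy the disjoint pairs \<open>p + 2 * i\<close>,
   \<open>p + 2 * i + 1\<close>, just after the positive legs.\<close>
 define C where "C = (%i. p + 2 * i) ` {..<g}"
 have Cv: "p <= v & v <= p + 2 * g - 2" if "v : C" for v using that by (auto simp: C_def)
 have cC: "card C = g" unfolding C_def by (subst card_image) (auto simp: inj_on_def)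
 let ?F = "%v. SUM l:{l:{1..n}. x l <= v}. a l"
 have h1: "hp 1 : ?P" "x (hp 1) = 1" using hpP[of 1] xp[of 1] p1 by auto
 have hqr: "hq q : ?N" "x (hq q) = r" using hqN[of q] xq[of q] q1 rr by auto
 have F1: "?F v = (SUM l:{l:?P. x l <= v}. a l)" if "v < r" "v < p + 2 * g" for v
 proof -
  have "{l:{1..n}. x l <= v} = {l:?P. x l <= v}"
  proof (rule set_eqI, rule iffI)
   fix l assume l: "l : {l:{1..n}. x l <= v}"
   have "l ~: ?N"
   proof
    assume "l : ?N"
    from xN[OF this] show False using l that by auto
   qed
   thus "l : {l:?P. x l <= v}" using l PN by blast
  qed blast
  thus ?thesis by (rule arg_cong)
 qed
 have Fpos: "0 < ?F v" if v: "v : {1..<r}" for v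
 proof (cases "v < p + 2 * g")
  case True
  have "0 < (SUM l:{l:?P. x l <= v}. a l)" by (rule sum_pos2[of _ "hp 1"]) (use h1 v in auto)
  thus ?thesis using F1[of v] True v by simp
 next
  case False
  \<comment> \<open>Past the cycles the flow is what the negative legs farther on still take out;
    the last of them sits at \<open>r\<close>.\<close>
  have sp: "{1..n} = {l:{1..n}. x l <= v} Un {l:?N. v < x l}"
  proof (rule set_eqI, rule iffI)
   fix l assume l: "l : {1..n}"
   show "l : {l:{1..n}. x l <= v} Un {l:?N. v < x l}"
   proof (cases "l : ?P")
    case True
    from xP[OF True] have "x l <= v" using False p1 by auto
    thus ?thesis using l by blast
   next
    case nP: False
    hence "l : ?N" using l PN by blast
    thus ?thesis by (cases "x l <= v") auto
   qed
  qed blast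
  have "sum a {1..n} = ?F v + (SUM l:{l:?N. v < x l}. a l)"
   by (subst sp, rule sum.union_disjoint) auto
  moreover have "0 < (SUM l:{l:?N. v < x l}. - a l)" by (rule sum_pos2[of _ "hq q"]) (use hqr v in auto)
  ultimately show ?thesis using total by (simp add: sum_negf)
 qed
 have Csub: "C <= {1..<r}"
 proof
  fix v assume "v : C"
  from Cv[OF this] show "v : {1..<r}" using p1 q1 rr by auto
 qed
 have FC: "2 <= ?F v" if v: "v : C" for v
 proof -
  have vr: "v < r" "v < p + 2 * g" using Csub v Cv[OF v] g by auto
  have "{l:?P. x l <= v} = ?P"
  proof (rule set_eqI, rule iffI)
   fix l assume l: "l : ?P"
   from xP[OF l] have "x l <= v" using Cv[OF v] p1 by auto
   thus "l : {l:?P. x l <= v}" using l by blast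
  qed blast
  hence "?F v = sum a ?P" using F1[OF vr] by simp
  thus ?thesis using d by simp
 qed
 have val: "3 <= card {l:{1..n}. x l = v} + card ({v - 1, v} Int {1..<r}) + card ({v - 1, v} Int C)" if v: "v : {1..r}" for v
 proof -
  have two: "card ({v - 1, v} Int X) = (if v - 1 : X then 1 else 0) + (if v : X then 1 else 0)" for X
  proof -
   have "v - 1 ~= v" using v by auto
   thus ?thesis by auto
  qed
  have c1: "1 <= card {l:{1..n}. x l = v}" if "l : {1..n}" "x l = v" for l
  proof -
   have "card {l} <= card {l:{1..n}. x l = v}" by (rule card_mono) (use that in auto)
   thus ?thesis by simp
  qed
  have c2: "2 <= card {l:{1..n}. x l = v}" if "l : {1..n}" "l' : {1..n}" "x l = v" "x l' = v" "l ~= l'" for l l'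
  proof -
   have "card {l, l'} <= card {l:{1..n}. x l = v}" by (rule card_mono) (use that in auto)
   thus ?thesis using that by simp
  qed
  have r2: "2 <= r" using rr g p1 q1 by simp
  consider "v < p" | "p <= v" "v < p + 2 * g" | "p + 2 * g <= v" by linarith
  thus ?thesis
  proof cases
   case 1
   hence vr: "v : {1..<r}" using v rr g by auto
   show ?thesis
   proof (cases "v = 1")
    case True
    have i2: "2 : {1..p}" "1 : {1..p}" using 1 True by auto
    have "hp 1 ~= hp 2" using hp i2 unfolding bij_betw_def inj_on_def by (metis one_eq_numeral_iff semiring_norm(85))
    hence "2 <= card {l:{1..n}. x l = v}" using c2[of "hp 1" "hp 2"] hpP[OF i2(1)] hpP[OF i2(2)] xp[OF i2(1)] xp[OF i2(2)] True by simp
    thus ?thesis unfolding two using vr by simp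
   next
    case False
    have i: "Suc v : {1..p}" using 1 by auto
    have "1 <= card {l:{1..n}. x l = v}" using c1[of "hp (Suc v)"] hpP[OF i] xp[OF i] v by auto
    moreover have "v - 1 : {1..<r}" using vr False by auto
    ultimately show ?thesis unfolding two using vr by simp
   qed
  next
   case 2
   have Cc: "1 <= card ({v - 1, v} Int C)"
   proof -
    define i where "i = (v - p) div 2"
    have "v = p + 2 * i | v = p + 2 * i + 1" using 2 unfolding i_def by presburger
    moreover have "i < g" using 2 unfolding i_def by auto
    ultimately have "v : C | v - 1 : C" unfolding C_def by auto
    thus ?thesis unfolding two by auto
   qed
   consider "v = 1" | "v = r" | "v ~= 1" "v ~= r" by blast
   thus ?thesis
   proof cases
    case 1
    have "1 <= card {l:{1..n}. x l = v}" using c1[of "hp 1"] h1 1 by auto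
    moreover have "v : {1..<r}" using 1 r2 by auto
    hence "1 <= card ({v - 1, v} Int {1..<r})" unfolding two by simp
    ultimately show ?thesis using Cc by linarith
   next
    case 2
    have "1 <= card {l:{1..n}. x l = v}" using c1[of "hq q"] hqr 2 by auto
    moreover have "v - 1 : {1..<r}" using 2 r2 by auto
    hence "1 <= card ({v - 1, v} Int {1..<r})" unfolding two by simp
    ultimately show ?thesis using Cc by linarith
   next
    case 3
    hence "v - 1 : {1..<r}" "v : {1..<r}" using v by auto
    hence "2 <= card ({v - 1, v} Int {1..<r})" unfolding two by simp
    thus ?thesis using Cc by linarith
   qed
  next
   case 3
   have v1: "v - 1 : {1..<r}" using 3 v g by auto
   show ?thesis
   proof (cases "v = r")
    case True
    have i2: "q : {1..q}" "q - 1 : {1..q}" using 3 True rr p1 by auto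
    have "hq q ~= hq (q - 1)"
    proof
     assume "hq q = hq (q - 1)"
     hence "q = q - 1" using iq[OF i2(1)] iq[OF i2(2)] by simp
     thus False using q1 by simp
    qed
    moreover have "x (hq (q - 1)) = r" unfolding xq[OF i2(2)] using rr by auto
    ultimately have "2 <= card {l:{1..n}. x l = v}" using c2[of "hq q" "hq (q - 1)"] hqN[OF i2(2)] hqr True by simp
    thus ?thesis unfolding two using v1 by simp
   next
    case False
    have i: "v - (p - 1 + 2 * g) : {1..q}" using 3 v rr p1 False by auto
    have "x (hq (v - (p - 1 + 2 * g))) = v" unfolding xq[OF i] using 3 v by auto
    hence "1 <= card {l:{1..n}. x l = v}" using c1 hqN[OF i] by blast
    moreover have "v : {1..<r}" using v False by auto
    ultimately show ?thesis unfolding two using v1 by simp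
   qed
  qed
 qed
 have "chain n r C x a"
 proof
  show "1 <= r" using rr g q1 by simp
  show "x l : {1..r}" if "l : {1..n}" for l
  proof (cases "l : ?P")
   case True
   from xP[OF True] show ?thesis using rr g q1 by auto
  next
   case False
   hence "l : ?N" using that PN by blast
   from xN[OF this] show ?thesis using g by auto
  qed
 qed (use Csub Fpos FC total nz val in blast)+
 thus ?thesis using cC unfolding r_def by blast
qed

theorem theorem5p2:
  fixes g n :: nat and a :: "nat => int"
  assumes "1 \<le> g" and "2 \<le> n"
    and "\<forall>i\<in>{1..n}. a i \<noteq> 0"
    and "(\<Sum>i=1..n. a i) = 0"
    and "2 \<le> (\<Sum>i\<in>{i\<in>{1..n}. 0 < a i}. a i)"
  shows "semilinear_M g n (DR n a)
    \<and> (\<forall>G. stable_graph g n G --> preimage_in G (DR n a) \<subseteq> preimage_in G (PD n a))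
    \<and> trop_dim_eq g n (DR n a) (2 * g + n - 3)"
proof -
 let ?d = "SUM i:{i:{1..n}. 0 < a i}. nat (a i)" and ?N = "2 * g + n - 3"
 note gen = DR_generators[OF _ assms(1-4)]
 have fin: "finite (cE G)" if "stable_graph g n G" for G using that by (simp add: stable_graph_def wf_graph_def)
 have sub: "preimage_in G (DR n a) <= cone G" for G by (auto simp: preimage_in_def)
 have up: "semilinear_in G (preimage_in G (DR n a))" "~  dim_ge (preimage_in G (DR n a)) (Suc ?N)" if G: "stable_graph g n G" for G
  using semilinear_dim_upper[OF fin[OF G] sub conjunct2[OF gen[OF G]]] by blast+
 obtain C x where CC: "chain n (2 * g + n - 2) C x a" "card C = g" using chain_exists[OF assms] by blast
 interpret chain n "2 * g + n - 2" C x a by (rule CC(1))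
 \<comment> \<open>The path has \<open>2 * g + n - 2\<close> vertices, hence one edge less: the
   upper bound for tree edges is attained.\<close>
 have "2 * g + n - 2 - 1 = ?N" by simp
 hence "stable_graph g n G" "dim_ge (preimage_in G (DR n a)) ?N" using stable dimG CC(2) by simp_all
 thus ?thesis unfolding semilinear_M_def trop_dim_eq_def using up gen by blast
qed

end
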